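(* Suppose that $\beta_\ast$ is random with $\mathbb{E}[\beta_\ast]=0$ and $\mathbb{E}[\beta_\ast\beta_\ast^\top]=\frac{\alpha^2}{p}I_p$ for some $\alpha>0$ and is independent of $X_n,\tilde x,\varepsilon_n,\tilde\varepsilon$; that there exists $\delta>0$ with $\mathbb{E}[|Z_{ij}|^{4+\delta}],\mathbb{E}[|\tilde z_j|^{4+\delta}]<+\infty$ for all $i,j$; and that there exists $\gamma_{\max}>0$ with $\sup_{n\ge1}\max_{1\le i\le n,\,1\le j\le p}\{|\gamma_{ij}^{(n)}|,|\tilde\gamma_j^{(n)}|\}<\gamma_{\max}$. For $\lambda>0$ define the deterministic quantities $$r_\lambda^{test}(X_n)=\sigma^2+\frac{\sigma^2}{n}\operatorname{Tr}[\widetilde S_pT_p(-\lambda)]+\lambda\Bigl(\frac{\lambda\alpha^2}{p}-\frac{\sigma^2}{n}\Bigr)\operatorname{Tr}[\widetilde S_pT_p'(-\lambda)],$$ $$r_\lambda^{train}(X_n)=\frac{\lambda^2\alpha^2}{p}\operatorname{Tr}\bigl[\widetilde T_n(-\lambda)-\lambda\widetilde T_n'(-\lambda)\bigr]+\frac{\lambda^2\sigma^2}{n}\operatorname{Tr}[\widetilde T_n'(-\lambda)],$$ where $T_p'$ and $\widetilde T_n'$ denote the derivatives of $T_p$ and $\widetilde T_n$ with respect to $z$. Then for every $\lambda>0$, almost surely, $$\lim_{n\to\infty,\ p/n\to c}\bigl|\hat r_\lambda^{test}(X_n)-r_\lambda^{test}(X_n)\bigr|=0\quad\text{and}\quad\lim_{n\to\infty,\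 p/n\to c}\bigl|\hat r_\lambda^{train}(X_n)-r_\lambda^{train}(X_n)\bigr|=0 .$$
   Context: Asymptotic regime: $p=p(n)$, $n\to\infty$ and $p/n\to c$ for some $c\in(0,\infty)$. Design: $X_n=\Upsilon_n\circ Z_n\in\mathbb{R}^{n\times p}$, where $\circ$ is the entrywise product, $\Upsilon_n=(\gamma_{ij}^{(n)})$ is a deterministic real $n\times p$ matrix, and $Z_n=(Z_{ij})$ is a real random matrix with i.i.d. centered entries of variance one (common law not depending on $n$). Write $\gamma_{ij}=\gamma_{ij}^{(n)}$. Model: $Y_n=X_n\beta_\ast+\varepsilon_n\in\mathbb{R}^n$, where $\varepsilon_n$ has i.i.d. entries with mean $0$ and variance $\sigma^2>0$ and is independent of $X_n$. Ridge estimator: $\hat\theta_\lambda=(X_n^\top X_n+n\lambda I_p)^{-1}X_n^\top Y_n$, $\lambda>0$. Test point: $\tilde y=\tilde x^\top\beta_\ast+\tilde\varepsilon$ with $\mathbb{E}[\tilde\varepsilon]=0$, $\mathbb{E}[\tilde\varepsilon^2]=\sigma^2$, and $\tilde x=\widetilde S_p^{1/2}\tilde z$, where $\tilde z=(\tilde z_j)\in\mathbb{R}^p$ has i.i.d. centered entries of variance one and $\widetilde S_p=\operatorname{diag}(\tilde\gamma_1^2,\dots,\tilde\gamma_p^2)$ is deterministic ($\tilde\gamma_j=\tilde\gamma_j^{(n)}$). The variables $\beta_\ast,X_n,\varepsilon_n,\tilde x,\tilde\varepsilon$ are mutually independent. Risks: $$\hat r_\lambda^{test}(X_n)=\mathbb{E}[(\tilde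 y-\tilde x^\top\hat\theta_\lambda)^2\mid X_n],\qquad \hat r_\lambda^{train}(X_n)=\tfrac1n\mathbb{E}[\|Y_n-X_n\hat\theta_\lambda\|^2\mid X_n].$$ Let $D_i=\operatorname{diag}(\gamma_{i1}^2,\dots,\gamma_{ip}^2)$ and $\widetilde D_j=\operatorname{diag}(\gamma_{1j}^2,\dots,\gamma_{nj}^2)$. For $z\in\mathbb{C}\setminus\mathbb{R}^+$ ($\mathbb{R}^+=[0,\infty)$), the diagonal matrices $T_p(z)=\operatorname{diag}(T_p^{(j)}(z))_{1\le j\le p}$ and $\widetilde T_n(z)=\operatorname{diag}(\widetilde T_n^{(i)}(z))_{1\le i\le n}$ are the unique solution of $$T_p^{(j)}(z)=\frac{-1}{z\bigl(1+\frac1n\operatorname{Tr}[\widetilde D_j\widetilde T_n(z)]\bigr)},\qquad \widetilde T_n^{(i)}(z)=\frac{-1}{z\bigl(1+\frac1n\operatorname{Tr}[D_iT_p(z)]\bigr)},$$ in the class where every entry is the Stieltjes transform $z\mapsto\int\frac{\mu(dt)}{t-z}$ of a probability measure $\mu$ on $[0,\infty)$. *)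

theory Defs
  imports
    "HOL-Probability.Probability"
    "Jordan_Normal_Form.Gauss_Jordan_Elimination"
begin

unbundle no vec_syntax

text \<open>Indices run over \<open>0..<n\<close> (rows) and \<open>0..<p\<close> (columns); values of index families
  outside these ranges are never used.\<close>

definition mat_trace :: "'a :: comm_monoid_add mat \<Rightarrow> 'a" where
  "mat_trace A = (\<Sum>i<dim_row A. A $$ (i, i))"


subsection \<open>Design, ridge estimator and conditional risks\<close>

definition design_matrix ::
  "nat \<Rightarrow> nat \<Rightarrow> (nat \<Rightarrow> nat \<Rightarrow> real) \<Rightarrow> (nat \<Rightarrow> nat \<Rightarrow> 'a \<Rightarrow> real) \<Rightarrow> 'a \<Rightarrow> real mat" where
  "design_matrix n p \<gamma> Z \<omega> = Matrix.mat n p (\<lambda>(i, j). \<gamma> i j * Z i j \<omega>)"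

definition test_point ::
  "nat \<Rightarrow> (nat \<Rightarrow> real) \<Rightarrow> (nat \<Rightarrow> 'a \<Rightarrow> real) \<Rightarrow> 'a \<Rightarrow> real vec" where
  "test_point p \<gamma>t zt \<omega> = mat_diag p (\<lambda>j. sqrt ((\<gamma>t j)\<^sup>2)) *\<^sub>v Matrix.vec p (\<lambda>j. zt j \<omega>)"

text \<open>For \<open>lam > 0\<close> the matrix below is positive definite, so \<open>mat_inverse\<close> is not \<open>None\<close>.\<close>

definition ridge_estimator :: "real \<Rightarrow> real mat \<Rightarrow> real vec \<Rightarrow> real vec" where
  "ridge_estimator lam X Y =
     (the (mat_inverse (transpose_mat X * X + (real (dim_row X) * lam) \<cdot>\<^sub>m 1\<^sub>m (dim_col X)))
        * transpose_mat X) *\<^sub>v Y"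

text \<open>The sub-sigma-algebras of \<open>M\<close> generated by a random vector in dimension \<open>d\<close> and by a
  random \<open>n \<times> p\<close> matrix.\<close>

definition sigma_vec :: "'a measure \<Rightarrow> nat \<Rightarrow> ('a \<Rightarrow> real vec) \<Rightarrow> 'a measure" where
  "sigma_vec M d v =
     vimage_algebra (space M) (\<lambda>\<omega>. \<lambda>i\<in>{..<d}. v \<omega> $ i) (Pi\<^sub>M {..<d} (\<lambda>_. borel))"

definition sigma_mat :: "'a measure \<Rightarrow> nat \<Rightarrow> nat \<Rightarrow> ('a \<Rightarrow> real mat) \<Rightarrow> 'a measure" where
  "sigma_mat M n p A =
     vimage_algebra (space M) (\<lambda>\<omega>. \<lambda>ij\<in>{..<n} \<times> {..<p}. A \<omega> $$ ij)
       (Pi\<^sub>M ({..<n} \<times> {..<p}) (\<lambda>_. borel))"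

definition cond_test_risk ::
  "'a measure \<Rightarrow> real \<Rightarrow> nat \<Rightarrow> nat \<Rightarrow> ('a \<Rightarrow> real mat) \<Rightarrow> ('a \<Rightarrow> real vec)
     \<Rightarrow> ('a \<Rightarrow> real vec) \<Rightarrow> ('a \<Rightarrow> real) \<Rightarrow> 'a \<Rightarrow> real" where
  "cond_test_risk M lam n p X Y xt yt =
     real_cond_exp M (sigma_mat M n p X)
       (\<lambda>\<omega>. (yt \<omega> - xt \<omega> \<bullet> ridge_estimator lam (X \<omega>) (Y \<omega>))\<^sup>2)"

definition cond_train_risk ::
  "'a measure \<Rightarrow> real \<Rightarrow> nat \<Rightarrow> nat \<Rightarrow> ('a \<Rightarrow> real mat) \<Rightarrow> ('a \<Rightarrow> real vec) \<Rightarrow> 'a \<Rightarrow> real" where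
  "cond_train_risk M lam n p X Y \<omega> =
     1 / real n *
     real_cond_exp M (sigma_mat M n p X)
       (\<lambda>\<omega>'. let r = Y \<omega>' - X \<omega>' *\<^sub>v ridge_estimator lam (X \<omega>') (Y \<omega>') in r \<bullet> r) \<omega>"

datatype source = Coefficients | Design | Noise | Test_Point | Test_Noise

definition indep_sources ::
  "'a measure \<Rightarrow> nat \<Rightarrow> nat \<Rightarrow> ('a \<Rightarrow> real vec) \<Rightarrow> ('a \<Rightarrow> real mat) \<Rightarrow> ('a \<Rightarrow> real vec)
     \<Rightarrow> ('a \<Rightarrow> real vec) \<Rightarrow> ('a \<Rightarrow> real) \<Rightarrow> bool" where
  "indep_sources M n p \<beta> X \<epsilon> xt \<epsilon>t \<longleftrightarrow>
     prob_space.indep_sets M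
       (\<lambda>s. case s of
              Coefficients \<Rightarrow> sets (sigma_vec M p \<beta>)
            | Design \<Rightarrow> sets (sigma_mat M n p X)
            | Noise \<Rightarrow> sets (sigma_vec M n \<epsilon>)
            | Test_Point \<Rightarrow> sets (sigma_vec M p xt)
            | Test_Noise \<Rightarrow> sets (vimage_algebra (space M) \<epsilon>t borel))
       UNIV"


subsection \<open>The deterministic equivalents\<close>

definition stieltjes_transform_nonneg :: "(complex \<Rightarrow> complex) \<Rightarrow> bool" where
  "stieltjes_transform_nonneg f \<longleftrightarrow>
     (\<exists>\<mu> :: real measure. real_distribution \<mu> \<and> measure \<mu> {0..} = 1 \<and>
        (\<forall>z. z \<notin> \<real>\<^sub>\<ge>\<^sub>0 \<longrightarrow> f z = (\<integral>t. 1 / (complex_of_real t - z) \<partial>\<mu>)))"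

text \<open>\<open>sq_diag p (\<gamma> i)\<close> is \<open>D\<^sub>i\<close>, \<open>sq_diag n (\<lambda>i. \<gamma> i j)\<close> is the matrix \<open>D\<^sub>j\<close> with a tilde, and
  \<open>sq_diag p \<gamma>t\<close> is the covariance of the test point, all with complex entries.\<close>

definition sq_diag :: "nat \<Rightarrow> (nat \<Rightarrow> real) \<Rightarrow> complex mat" where
  "sq_diag m g = mat_diag m (\<lambda>k. complex_of_real ((g k)\<^sup>2))"

definition canonical_solution ::
  "nat \<Rightarrow> nat \<Rightarrow> (nat \<Rightarrow> nat \<Rightarrow> real)
     \<Rightarrow> (nat \<Rightarrow> complex \<Rightarrow> complex) \<times> (nat \<Rightarrow> complex \<Rightarrow> complex) \<Rightarrow> bool" where
  "canonical_solution n p \<gamma> = (\<lambda>(T, Tt).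
     (\<forall>j<p. stieltjes_transform_nonneg (T j)) \<and>
     (\<forall>i<n. stieltjes_transform_nonneg (Tt i)) \<and>
     (\<forall>z. z \<notin> \<real>\<^sub>\<ge>\<^sub>0 \<longrightarrow>
        (\<forall>j<p. T j z =
           -1 / (z * (1 + 1 / of_nat n *
             mat_trace (sq_diag n (\<lambda>i. \<gamma> i j) * mat_diag n (\<lambda>i. Tt i z))))) \<and>
        (\<forall>i<n. Tt i z =
           -1 / (z * (1 + 1 / of_nat n *
             mat_trace (sq_diag p (\<gamma> i) * mat_diag p (\<lambda>j. T j z)))))))"

text \<open>The solution is unique for indices in range and \<open>z\<close> outside \<open>[0, \<infinity>)\<close>; no other values
  are used below, so the choice made by \<open>SOME\<close> is immaterial.\<close>

definition the_canonical_solution ::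
  "nat \<Rightarrow> nat \<Rightarrow> (nat \<Rightarrow> nat \<Rightarrow> real)
     \<Rightarrow> (nat \<Rightarrow> complex \<Rightarrow> complex) \<times> (nat \<Rightarrow> complex \<Rightarrow> complex)" where
  "the_canonical_solution n p \<gamma> = (SOME TT. canonical_solution n p \<gamma> TT)"

definition T_mat :: "nat \<Rightarrow> nat \<Rightarrow> (nat \<Rightarrow> nat \<Rightarrow> real) \<Rightarrow> complex \<Rightarrow> complex mat" where
  "T_mat n p \<gamma> z = mat_diag p (\<lambda>j. fst (the_canonical_solution n p \<gamma>) j z)"

definition T_mat_deriv :: "nat \<Rightarrow> nat \<Rightarrow> (nat \<Rightarrow> nat \<Rightarrow> real) \<Rightarrow> complex \<Rightarrow> complex mat" where
  "T_mat_deriv n p \<gamma> z = mat_diag p (\<lambda>j. deriv (fst (the_canonical_solution n p \<gamma>) j) z)"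

definition Tt_mat :: "nat \<Rightarrow> nat \<Rightarrow> (nat \<Rightarrow> nat \<Rightarrow> real) \<Rightarrow> complex \<Rightarrow> complex mat" where
  "Tt_mat n p \<gamma> z = mat_diag n (\<lambda>i. snd (the_canonical_solution n p \<gamma>) i z)"

definition Tt_mat_deriv :: "nat \<Rightarrow> nat \<Rightarrow> (nat \<Rightarrow> nat \<Rightarrow> real) \<Rightarrow> complex \<Rightarrow> complex mat" where
  "Tt_mat_deriv n p \<gamma> z = mat_diag n (\<lambda>i. deriv (snd (the_canonical_solution n p \<gamma>) i) z)"

text \<open>At \<open>z = -lam < 0\<close> all the traces are real numbers: a Stieltjes transform of a measure on
  \<open>[0, \<infinity>)\<close> and its derivative are real there. \<open>Re\<close> only changes the type.\<close>

definition det_test_risk ::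
  "real \<Rightarrow> real \<Rightarrow> real \<Rightarrow> nat \<Rightarrow> nat \<Rightarrow> (nat \<Rightarrow> nat \<Rightarrow> real) \<Rightarrow> (nat \<Rightarrow> real) \<Rightarrow> real" where
  "det_test_risk lam \<sigma> \<alpha> n p \<gamma> \<gamma>t =
     \<sigma>\<^sup>2
     + \<sigma>\<^sup>2 / real n * Re (mat_trace (sq_diag p \<gamma>t * T_mat n p \<gamma> (- of_real lam)))
     + lam * (lam * \<alpha>\<^sup>2 / real p - \<sigma>\<^sup>2 / real n)
         * Re (mat_trace (sq_diag p \<gamma>t * T_mat_deriv n p \<gamma> (- of_real lam)))"

definition det_train_risk ::
  "real \<Rightarrow> real \<Rightarrow> real \<Rightarrow> nat \<Rightarrow> nat \<Rightarrow> (nat \<Rightarrow> nat \<Rightarrow> real) \<Rightarrow> real" where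
  "det_train_risk lam \<sigma> \<alpha> n p \<gamma> =
     lam\<^sup>2 * \<alpha>\<^sup>2 / real p
         * Re (mat_trace (Tt_mat n p \<gamma> (- of_real lam)
                 - of_real lam \<cdot>\<^sub>m Tt_mat_deriv n p \<gamma> (- of_real lam)))
     + lam\<^sup>2 * \<sigma>\<^sup>2 / real n * Re (mat_trace (Tt_mat_deriv n p \<gamma> (- of_real lam)))"

end

theory Submission
  imports
    Defs
    "Jordan_Normal_Form.Determinant"
    "HOL-Computational_Algebra.Fundamental_Theorem_Algebra"
    "HOL-Complex_Analysis.Conformal_Mappings"
begin

text \<open>Averaging over the coefficients and the noise, both conditional risks become weighted traces of the
  resolvents of the two normalised Gram matrices at \<open>-\<lambda>\<close> and of their derivatives in \<open>\<lambda>\<close>. A weighted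
  trace has bounded differences in the independent rows of the design, so it is within \<open>O(sqrt n)\<close> of its
  mean, with a fourth-moment bound that is summable after division by \<open>n\<close>. By the Schur complement formula
  the expected diagonal entries solve the canonical system at \<open>z = -x\<close> up to a vanishing error, and a
  positive system of this kind is stable because its map contracts ratios. The canonical solution itself
  is the limit of the iterates of the system, which are Stieltjes transforms of finitely supported laws.
  The derivatives converge because all functions of \<open>x\<close> involved have uniformly bounded second
  derivatives, which turns convergence of difference quotients into convergence of derivatives.\<close>

section \<open>Resolvents of Gram matrices\<close>

text \<open>All estimates take place on the negative axis \<open>z = -x\<close>. There the
  resolvents are positive definite with entries at most \<open>1 / x\<close>, and the canonical
  system has nonnegative weights, so its map contracts ratios for every \<open>x > 0\<close>, not
  just for large \<open>x\<close>. Complex arguments enter only because the canonical solution is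
  defined through Stieltjes transforms. As it is picked by \<open>SOME\<close>, its existence has to
  be proved; whichever solution is picked satisfies the positive system on the axis, and stability
  ties it to the resolvents. The entries are unbounded, with little more than four moments. Bounded
  differences survive because removing a row is a rank-one change, whose effect on a weighted trace
  is at most \<open>D / x\<close> whatever the size of the row. Nothing links the models for
  different \<open>n\<close>, so almost sure convergence must come from summability: after division
  by \<open>n\<close> the variances are of order \<open>1 / n\<close>, which is not enough, but the
  fourth moments are of order \<open>1 / n^2\<close>. Squared resolvents are not concentrated
  directly. They are minus derivatives in \<open>x\<close> of diagonal entries and are reached from
  the traces at countably many points.\<close>

definition gram :: "real \<Rightarrow> real \<Rightarrow> nat \<Rightarrow> (nat \<Rightarrow> nat \<Rightarrow> real) \<Rightarrow> nat \<Rightarrow> nat \<Rightarrow> real" where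
  "gram s x a X j k = s * (\<Sum>i<a. X i j * X i k) + (if j = k then x else 0)"

definition gram_mat :: "real \<Rightarrow> real \<Rightarrow> nat \<Rightarrow> nat \<Rightarrow> (nat \<Rightarrow> nat \<Rightarrow> real) \<Rightarrow> real mat" where
  "gram_mat s x a b X = mat b b (\<lambda>(j, k). gram s x a X j k)"

text \<open>With \<open>s = 1 / n\<close> this is the resolvent of the normalised Gram matrix at
  \<open>z = -x\<close>. The data matrix is a function of two indices, so that a row is changed by
  function update and transposition is a swap of arguments; only \<open>gram_mat\<close> passes to
  the matrix library.\<close>

definition res :: "real \<Rightarrow> real \<Rightarrow> nat \<Rightarrow> nat \<Rightarrow> (nat \<Rightarrow> nat \<Rightarrow> real) \<Rightarrow> nat \<Rightarrow> nat \<Rightarrow> real" where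
  "res s x a b X j k = the (mat_inverse (gram_mat s x a b X)) $$ (j, k)"

lemma gram_mat_carrier [simp]: "gram_mat s x a b X \<in> carrier_mat b b"
  by (simp add: gram_mat_def)

lemma gram_commute: "gram s x a X j k = gram s x a X k j"
  by (simp add: gram_def mult.commute)

lemma gram_apply:
  assumes "j < b"
  shows "(\<Sum>k<b. gram s x a X j k * v k) = s * (\<Sum>i<a. X i j * (\<Sum>k<b. X i k * v k)) + x * v j"
proof -
  have "(\<Sum>k<b. gram s x a X j k * v k)
      = (\<Sum>k<b. s * (\<Sum>i<a. X i j * X i k) * v k + (if j = k then x * v k else 0))"
    by (rule sum.cong) (auto simp: gram_def algebra_simps)
  also have "\<dots> = (\<Sum>k<b. s * (\<Sum>i<a. X i j * X i k) * v k) + x * v j"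
    using assms by (simp add: sum.distrib)
  also have "(\<Sum>k<b. s * (\<Sum>i<a. X i j * X i k) * v k) = s * (\<Sum>k<b. \<Sum>i<a. X i j * (X i k * v k))"
    by (simp add: sum_distrib_left sum_distrib_right mult.assoc)
  also have "(\<Sum>k<b. \<Sum>i<a. X i j * (X i k * v k)) = (\<Sum>i<a. X i j * (\<Sum>k<b. X i k * v k))"
    by (subst sum.swap) (simp add: sum_distrib_left)
  finally show ?thesis .
qed

text \<open>Pair the linear system with its own solution. The norm bounds below, and later the noise
  part of the risks, all come from this identity.\<close>

lemma gram_energy:
  assumes "\<And>j. j < b \<Longrightarrow> (\<Sum>k<b. gram s x a X j k * v k) = w j"
  shows "s * (\<Sum>i<a. (\<Sum>k<b. X i k * v k)\<^sup>2) + x * (\<Sum>j<b. (v j)\<^sup>2) = (\<Sum>j<b. v j * w j)"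
proof -
  have "(\<Sum>j<b. v j * w j) = (\<Sum>j<b. v j * (s * (\<Sum>i<a. X i j * (\<Sum>k<b. X i k * v k)) + x * v j))"
    using assms by (intro sum.cong) (simp_all add: gram_apply)
  also have "\<dots> = s * (\<Sum>j<b. \<Sum>i<a. (X i j * v j) * (\<Sum>k<b. X i k * v k)) + x * (\<Sum>j<b. (v j)\<^sup>2)"
    by (simp add: algebra_simps sum.distrib sum_distrib_left power2_eq_square)
  also have "(\<Sum>j<b. \<Sum>i<a. (X i j * v j) * (\<Sum>k<b. X i k * v k)) = (\<Sum>i<a. (\<Sum>k<b. X i k * v k)\<^sup>2)"
    by (subst sum.swap) (simp add: power2_eq_square sum_distrib_right)
  finally show ?thesis by simp
qed

lemma gram_mat_mult_vec:
  assumes "v \<in> carrier_vec b" "j < b"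
  shows "(gram_mat s x a b X *\<^sub>v v) $ j = (\<Sum>k<b. gram s x a X j k * v $ k)"
  using assms by (auto simp: gram_mat_def scalar_prod_def lessThan_atLeast0 intro!: sum.cong)

lemma res_cong:
  assumes "\<And>i j. i < a \<Longrightarrow> j < b \<Longrightarrow> X i j = Y i j"
  shows "res s x a b X j k = res s x a b Y j k"
proof -
  have "gram_mat s x a b X = gram_mat s x a b Y"
    unfolding gram_mat_def gram_def using assms by (intro cong_mat) auto
  then show ?thesis by (simp add: res_def)
qed

context
  fixes s x :: real
  assumes s0: "s \<ge> 0" and x0: "x > 0"
begin

text \<open>Dropping the nonnegative image term leaves the multiple \<open>x\<close> of the identity
  as a lower bound. This is why the constants below are powers of \<open>1 / x\<close> that depend
  neither on the matrix nor on its dimensions.\<close>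

lemma gram_solution_coercive:
  assumes "\<And>j. j < b \<Longrightarrow> (\<Sum>k<b. gram s x a X j k * v k) = w j"
  shows "x * (\<Sum>j<b. (v j)\<^sup>2) \<le> (\<Sum>j<b. v j * w j)"
proof -
  have "0 \<le> s * (\<Sum>i<a. (\<Sum>k<b. X i k * v k)\<^sup>2)"
    using s0 by (intro mult_nonneg_nonneg sum_nonneg) auto
  with gram_energy[OF assms] show ?thesis by linarith
qed

text \<open>A kernel vector solves the system with right-hand side \<open>0\<close>, and coercivity
  makes it vanish. This gives a meaning to \<open>the\<close> in \<open>res\<close>.\<close>

lemma gram_mat_invertible: "\<exists>B. mat_inverse (gram_mat s x a b X) = Some B"
proof (rule ccontr)
  let ?A = "gram_mat s x a b X"
  assume "\<nexists>B. mat_inverse ?A = Some B"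
  then have "mat_inverse ?A = None" by auto
  from mat_inverse(1)[OF gram_mat_carrier this] have nu: "?A \<notin> Units (ring_mat TYPE(real) b ())" .
  have "Determinant.det ?A \<noteq> 0"
  proof
    assume "Determinant.det ?A = 0"
    then obtain v where v: "v \<in> carrier_vec b" "v \<noteq> 0\<^sub>v b" "?A *\<^sub>v v = 0\<^sub>v b"
      using det_0_iff_vec_prod_zero_field[OF gram_mat_carrier[of s x a b X]] by blast
    have "(\<Sum>k<b. gram s x a X j k * v $ k) = 0" if "j < b" for j
      using gram_mat_mult_vec[OF v(1) that, of s x a X] v(3) that by simp
    from gram_solution_coercive[of b a X "($) v" "\<lambda>_. 0", OF this]
    have "x * (\<Sum>j<b. (v $ j)\<^sup>2) \<le> 0" by simp
    then have "(\<Sum>j<b. (v $ j)\<^sup>2) \<le> 0" using x0 by (simp add: mult_le_0_iff)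
    moreover have "(\<Sum>j<b. (v $ j)\<^sup>2) \<ge> 0" by (intro sum_nonneg) auto
    ultimately have "(\<Sum>j<b. (v $ j)\<^sup>2) = 0" by linarith
    then have "\<forall>j<b. v $ j = 0" by (subst (asm) sum_nonneg_eq_0_iff) auto
    then have "v = 0\<^sub>v b" using v(1) by (intro eq_vecI) auto
    with v(2) show False by simp
  qed
  from det_non_zero_imp_unit[OF gram_mat_carrier this, of "()"] nu show False by blast
qed

lemma
  assumes "j < b" "l < b"
  shows gram_res: "(\<Sum>k<b. gram s x a X j k * res s x a b X k l) = (if j = l then 1 else 0)"
    and res_gram: "(\<Sum>k<b. res s x a b X j k * gram s x a X k l) = (if j = l then 1 else 0)"
proof -
  let ?A = "gram_mat s x a b X"
  obtain B where B: "mat_inverse ?A = Some B" using gram_mat_invertible by blast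
  from mat_inverse(2)[OF gram_mat_carrier B]
  have i: "?A * B = 1\<^sub>m b" "B * ?A = 1\<^sub>m b" "B \<in> carrier_mat b b" by auto
  have "(?A * B) $$ (j, l) = (\<Sum>k<b. gram s x a X j k * res s x a b X k l)"
    using assms i(3) unfolding res_def B
    by (auto simp: scalar_prod_def gram_mat_def lessThan_atLeast0 intro!: sum.cong)
  then show "(\<Sum>k<b. gram s x a X j k * res s x a b X k l) = (if j = l then 1 else 0)"
    using assms i(1) by simp
  have "(B * ?A) $$ (j, l) = (\<Sum>k<b. res s x a b X j k * gram s x a X k l)"
    using assms i(3) unfolding res_def B
    by (auto simp: scalar_prod_def gram_mat_def lessThan_atLeast0 intro!: sum.cong)
  then show "(\<Sum>k<b. res s x a b X j k * gram s x a X k l) = (if j = l then 1 else 0)"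
    using assms i(2) by simp
qed

lemma res_solve:
  assumes "\<And>j. j < b \<Longrightarrow> (\<Sum>k<b. gram s x a X j k * v k) = w j" "j < b"
  shows "v j = (\<Sum>k<b. res s x a b X j k * w k)"
proof -
  have "(\<Sum>k<b. res s x a b X j k * w k) = (\<Sum>k<b. \<Sum>l<b. res s x a b X j k * gram s x a X k l * v l)"
    using assms(1) by (intro sum.cong) (simp_all add: sum_distrib_left mult.assoc flip: assms(1))
  also have "\<dots> = (\<Sum>l<b. (\<Sum>k<b. res s x a b X j k * gram s x a X k l) * v l)"
    by (subst sum.swap) (simp add: sum_distrib_right)
  also have "\<dots> = (\<Sum>l<b. if j = l then v l else 0)"
    using assms(2) by (intro sum.cong) (simp_all add: res_gram)
  finally show ?thesis using assms(2) by simp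
qed

text \<open>Identifies a column of the resolvent by checking its linear system. Symmetry, scaling
  and the rank-one formula are all proved by proposing a column and applying this.\<close>

lemma res_unique:
  assumes "\<And>j. j < b \<Longrightarrow> (\<Sum>k<b. gram s x a X j k * v k) = (if j = l then 1 else 0)" "j < b" "l < b"
  shows "v j = res s x a b X j l"
proof -
  have "v j = (\<Sum>k<b. res s x a b X j k * (if k = l then 1 else 0))"
    using assms(1,2) by (rule res_solve)
  also have "\<dots> = (\<Sum>k<b. if l = k then res s x a b X j k else 0)"
    by (rule sum.cong) auto
  finally show ?thesis using assms(3) by simp
qed

lemma res_commute:
  assumes "j < b" "l < b"
  shows "res s x a b X j l = res s x a b X l j"
proof -
  have "(\<Sum>k<b. gram s x a X i k * res s x a b X j k) = (if i = j then 1 else 0)" if "i < b" for i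
  proof -
    have "(\<Sum>k<b. gram s x a X i k * res s x a b X j k) = (\<Sum>k<b. res s x a b X j k * gram s x a X k i)"
      by (rule sum.cong) (simp_all add: gram_commute[of s x a X i])
    then show ?thesis using res_gram[of j b i a X] assms that by auto
  qed
  from res_unique[of b a X "\<lambda>k. res s x a b X j k" j l, OF this] assms show ?thesis by simp
qed

lemma gram_solution_norm:
  assumes "\<And>j. j < b \<Longrightarrow> (\<Sum>k<b. gram s x a X j k * v k) = w j"
  shows "(\<Sum>j<b. (v j)\<^sup>2) \<le> (\<Sum>j<b. (w j)\<^sup>2) / x\<^sup>2"
proof -
  have "x * (\<Sum>j<b. (v j)\<^sup>2) \<le> (\<Sum>j<b. v j * w j)" by (rule gram_solution_coercive[OF assms])
  \<comment> \<open>Young's inequality with weight \<open>x\<close>, chosen so that half of the left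
    side is absorbed.\<close>
  also have "\<dots> \<le> (\<Sum>j<b. x / 2 * (v j)\<^sup>2 + 1 / (2 * x) * (w j)\<^sup>2)"
  proof (rule sum_mono)
    fix j
    have "0 \<le> (x * v j - w j)\<^sup>2 / (2 * x)" using x0 by simp
    also have "(x * v j - w j)\<^sup>2 / (2 * x) = x / 2 * (v j)\<^sup>2 + 1 / (2 * x) * (w j)\<^sup>2 - v j * w j"
      using x0 by (simp add: field_simps power2_eq_square)
    finally show "v j * w j \<le> x / 2 * (v j)\<^sup>2 + 1 / (2 * x) * (w j)\<^sup>2" by simp
  qed
  also have "\<dots> = x / 2 * (\<Sum>j<b. (v j)\<^sup>2) + 1 / (2 * x) * (\<Sum>j<b. (w j)\<^sup>2)"
    by (simp add: sum.distrib sum_distrib_left)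
  finally have "x * (\<Sum>j<b. (v j)\<^sup>2) \<le> 1 / x * (\<Sum>j<b. (w j)\<^sup>2)" by (simp add: field_simps)
  then show ?thesis using x0 by (simp add: field_simps power2_eq_square)
qed

text \<open>The energy identity for a unit vector on the right. Read backwards, it evaluates the
  squared norm of the image of a resolvent column, which is the form in which the noise enters the
  risks.\<close>

lemma res_energy:
  assumes "l < b"
  shows "s * (\<Sum>i<a. (\<Sum>k<b. X i k * res s x a b X k l)\<^sup>2) + x * (\<Sum>j<b. (res s x a b X j l)\<^sup>2)
    = res s x a b X l l"
proof -
  have "(\<Sum>j<b. res s x a b X j l * (if j = l then 1 else 0)) = (\<Sum>j<b. if l = j then res s x a b X j l else 0)"
    by (rule sum.cong) auto
  with gram_energy[of b s x a X "\<lambda>k. res s x a b X k l" "\<lambda>j. if j = l then 1 else 0"] assms gram_res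
  show ?thesis by simp
qed

text \<open>The diagonal entry \<open>r\<close> is one of the entries of its column, so
  \<open>res_energy\<close> gives \<open>x * r^2 \<le> r\<close>, which forces
  \<open>r \<le> 1 / x\<close>. The other bounds follow from the same identity.\<close>

lemma
  assumes "l < b"
  shows res_diag_nonneg: "0 \<le> res s x a b X l l"
    and res_diag_le: "res s x a b X l l \<le> 1 / x"
    and res_col_norm: "(\<Sum>j<b. (res s x a b X j l)\<^sup>2) \<le> 1 / x\<^sup>2"
    and res_image_norm: "s * (\<Sum>i<a. (\<Sum>k<b. X i k * res s x a b X k l)\<^sup>2) \<le> 1 / x"
proof -
  let ?r = "res s x a b X l l" and ?S = "\<Sum>j<b. (res s x a b X j l)\<^sup>2"
  have n0: "0 \<le> s * (\<Sum>i<a. (\<Sum>k<b. X i k * res s x a b X k l)\<^sup>2)"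
    using s0 by (intro mult_nonneg_nonneg sum_nonneg) auto
  with res_energy[OF assms, of X a] have 1: "x * ?S \<le> ?r" by linarith
  have 2: "?r\<^sup>2 \<le> ?S" by (rule member_le_sum) (use assms in auto)
  have S0: "0 \<le> ?S" by (intro sum_nonneg) auto
  then have xS: "0 \<le> x * ?S" using x0 by simp
  with 1 show 3: "0 \<le> ?r" by linarith
  have "x * ?r\<^sup>2 \<le> x * ?S" using 2 x0 by (intro mult_left_mono) auto
  with 1 have "(x * ?r) * ?r \<le> 1 * ?r" by (simp add: power2_eq_square mult.assoc)
  then have "?r = 0 \<or> x * ?r \<le> 1" using 3 mult_right_le_imp_le[of "x * ?r" ?r 1] by linarith
  then show 4: "?r \<le> 1 / x" using x0 by (auto simp: pos_le_divide_eq mult.commute)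
  then have "x * ?S \<le> 1 / x" using 1 by linarith
  then have "?S \<le> 1 / x / x" using x0 by (simp only: pos_le_divide_eq mult.commute)
  then show "?S \<le> 1 / x\<^sup>2" by (simp add: power2_eq_square)
  then show "s * (\<Sum>i<a. (\<Sum>k<b. X i k * res s x a b X k l)\<^sup>2) \<le> 1 / x"
    using 4 xS res_energy[OF assms, of X a] by linarith
qed

lemma res_abs_le:
  assumes "j < b" "l < b"
  shows "\<bar>res s x a b X j l\<bar> \<le> 1 / x"
proof -
  have "(res s x a b X j l)\<^sup>2 \<le> (\<Sum>j<b. (res s x a b X j l)\<^sup>2)"
    by (rule member_le_sum) (use assms in auto)
  also have "\<dots> \<le> (1 / x)\<^sup>2" using res_col_norm[OF assms(2), of a X] by (simp add: power_divide)
  finally show ?thesis using x0 abs_le_square_iff[of "res s x a b X j l" "1 / x"] by simp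
qed

text \<open>Sherman--Morrison, for the removal of row \<open>i0\<close>.\<close>

lemma
  fixes X :: "nat \<Rightarrow> nat \<Rightarrow> real" and i0 a b :: nat
  defines "u \<equiv> \<lambda>j. \<Sum>k<b. res s x a b (X(i0 := (\<lambda>_. 0))) j k * X i0 k"
  defines "\<tau> \<equiv> s * (\<Sum>j<b. X i0 j * u j)"
  assumes "i0 < a"
  shows row_removed_nonneg: "0 \<le> \<tau>"
    and row_removed_norm: "s * x * (\<Sum>j<b. (u j)\<^sup>2) \<le> \<tau>"
    and res_row_removed: "\<And>j l. j < b \<Longrightarrow> l < b \<Longrightarrow>
      res s x a b X j l = res s x a b (X(i0 := (\<lambda>_. 0))) j l - s * u j * u l / (1 + \<tau>)"
proof -
  define X0 where "X0 = X(i0 := (\<lambda>_. 0))"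
  let ?r = "X i0" and ?Q0 = "res s x a b X0"
  have uj: "u j = (\<Sum>k<b. ?Q0 j k * ?r k)" for j by (simp add: u_def X0_def)
  \<comment> \<open>Restoring row \<open>i0\<close> adds the rank-one matrix
    \<open>s r r^T\<close>.\<close>
  have G: "gram s x a X j k = gram s x a X0 j k + s * ?r j * ?r k" for j k
  proof -
    have "(\<Sum>i<a. X i j * X i k) = (\<Sum>i<a. X0 i j * X0 i k) + ?r j * ?r k"
      using \<open>i0 < a\<close> by (simp add: sum.remove[of "{..<a}" i0] X0_def)
    then show ?thesis by (simp add: gram_def algebra_simps)
  qed
  have 1: "(\<Sum>k<b. gram s x a (X(i0 := (\<lambda>_. 0))) j k * u k) = X i0 j" if "j < b" for j
  proof -
    have "(\<Sum>k<b. gram s x a X0 j k * u k) = (\<Sum>k<b. \<Sum>l<b. gram s x a X0 j k * ?Q0 k l * ?r l)"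
      by (simp add: uj sum_distrib_left mult.assoc)
    also have "\<dots> = (\<Sum>l<b. (\<Sum>k<b. gram s x a X0 j k * ?Q0 k l) * ?r l)"
      by (subst sum.swap) (simp add: sum_distrib_right)
    also have "\<dots> = (\<Sum>l<b. if j = l then ?r l else 0)"
      using that by (intro sum.cong) (simp_all add: gram_res)
    finally show ?thesis using that by (simp add: X0_def)
  qed
  have "x * (\<Sum>j<b. (u j)\<^sup>2) \<le> (\<Sum>j<b. u j * ?r j)" by (rule gram_solution_coercive[OF 1])
  then show 2: "s * x * (\<Sum>j<b. (u j)\<^sup>2) \<le> \<tau>"
    using s0 unfolding \<tau>_def by (simp add: mult.commute[of "u _"] mult.assoc mult_left_mono)
  have "0 \<le> s * x * (\<Sum>j<b. (u j)\<^sup>2)" using s0 x0 by (intro mult_nonneg_nonneg sum_nonneg) auto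
  with 2 show tau: "0 \<le> \<tau>" by linarith
  fix j l assume jl: "j < b" "l < b"
  \<comment> \<open>The proposed column of the full resolvent. The denominator
    \<open>1 + \<tau>\<close> is exactly what makes the two multiples of the row cancel when the
    full system is checked.\<close>
  define q where "q = (\<lambda>k. ?Q0 k l - s * u k * u l / (1 + \<tau>))"
  have "(\<Sum>k<b. gram s x a X i k * q k) = (if i = l then 1 else 0)" if "i < b" for i
  proof -
    have 3: "(\<Sum>k<b. gram s x a X0 i k * q k)
        = (\<Sum>k<b. gram s x a X0 i k * ?Q0 k l) - s * u l / (1 + \<tau>) * (\<Sum>k<b. gram s x a X0 i k * u k)"
      by (simp add: q_def algebra_simps sum_subtractf sum_distrib_left)
    have "(\<Sum>k<b. ?r k * ?Q0 k l) = u l"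
      unfolding uj by (rule sum.cong) (use jl res_commute in auto)
    then have 4: "(\<Sum>k<b. ?r k * q k) = u l - s * u l / (1 + \<tau>) * (\<Sum>k<b. ?r k * u k)"
      by (simp add: q_def algebra_simps sum_subtractf sum_distrib_left)
    have "(\<Sum>k<b. gram s x a X i k * q k) = (\<Sum>k<b. gram s x a X0 i k * q k) + s * ?r i * (\<Sum>k<b. ?r k * q k)"
      by (simp add: G algebra_simps sum.distrib sum_distrib_left)
    also have "\<dots> = (if i = l then 1 else 0) - s * u l / (1 + \<tau>) * ?r i
       + s * ?r i * (u l - u l / (1 + \<tau>) * \<tau>)"
      using 1[OF that] that jl by (simp add: 3 4 gram_res X0_def[symmetric] \<tau>_def)
    also have "u l - u l / (1 + \<tau>) * \<tau> = u l / (1 + \<tau>)" using tau by (simp add: field_simps)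
    finally show ?thesis by simp
  qed
  from res_unique[of b a X q l j, OF this] jl
  show "res s x a b X j l = res s x a b (X(i0 := (\<lambda>_. 0))) j l - s * u j * u l / (1 + \<tau>)"
    by (simp add: q_def X0_def)
qed

text \<open>By Sherman--Morrison the trace drops by \<open>s / (1 + \<tau>)\<close> times the
  weighted squared norm of \<open>u\<close>. Coercivity bounds \<open>s * x * |u|^2\<close> by
  \<open>\<tau>\<close>, so the drop is at most \<open>D / x * \<tau> / (1 + \<tau>)\<close>: the
  size of the row has cancelled.\<close>

lemma weighted_trace_row_removed:
  assumes "i0 < a" "\<And>j. j < b \<Longrightarrow> 0 \<le> d j \<and> d j \<le> D" "0 \<le> D"
  shows "(\<Sum>j<b. d j * res s x a b X j j) \<le> (\<Sum>j<b. d j * res s x a b (X(i0 := (\<lambda>_. 0))) j j)"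
    and "(\<Sum>j<b. d j * res s x a b (X(i0 := (\<lambda>_. 0))) j j) - D / x \<le> (\<Sum>j<b. d j * res s x a b X j j)"
proof -
  define u where "u = (\<lambda>j. \<Sum>k<b. res s x a b (X(i0 := (\<lambda>_. 0))) j k * X i0 k)"
  define \<tau> where "\<tau> = s * (\<Sum>j<b. X i0 j * u j)"
  have t: "0 \<le> \<tau>" "s * x * (\<Sum>j<b. (u j)\<^sup>2) \<le> \<tau>"
    unfolding \<tau>_def u_def by (rule row_removed_nonneg[OF assms(1)] row_removed_norm[OF assms(1)])+
  have e: "(\<Sum>j<b. d j * res s x a b X j j) = (\<Sum>j<b. d j * res s x a b (X(i0 := (\<lambda>_. 0))) j j)
     - s / (1 + \<tau>) * (\<Sum>j<b. d j * (u j)\<^sup>2)"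
  proof -
    have "res s x a b X j j = res s x a b (X(i0 := (\<lambda>_. 0))) j j - s * u j * u j / (1 + \<tau>)" if "j < b" for j
      unfolding \<tau>_def u_def by (rule res_row_removed[OF assms(1) that that])
    then have "(\<Sum>j<b. d j * res s x a b X j j)
        = (\<Sum>j<b. d j * res s x a b (X(i0 := (\<lambda>_. 0))) j j - s / (1 + \<tau>) * (d j * (u j)\<^sup>2))"
      by (intro sum.cong) (simp_all add: power2_eq_square right_diff_distrib mult_ac)
    then show ?thesis by (simp add: sum_subtractf sum_distrib_left)
  qed
  have "0 \<le> s / (1 + \<tau>) * (\<Sum>j<b. d j * (u j)\<^sup>2)"
    using s0 t assms by (intro mult_nonneg_nonneg sum_nonneg) auto
  with e show "(\<Sum>j<b. d j * res s x a b X j j) \<le> (\<Sum>j<b. d j * res s x a b (X(i0 := (\<lambda>_. 0))) j j)"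
    by linarith
  have "s / (1 + \<tau>) * (\<Sum>j<b. d j * (u j)\<^sup>2) \<le> s / (1 + \<tau>) * (\<Sum>j<b. D * (u j)\<^sup>2)"
    using s0 t assms by (intro mult_left_mono sum_mono mult_right_mono) auto
  also have "\<dots> = (D / x) * ((s * x * (\<Sum>j<b. (u j)\<^sup>2)) / (1 + \<tau>))"
    using x0 by (simp add: sum_distrib_left[symmetric])
  also have "\<dots> \<le> (D / x) * 1"
    using t x0 assms by (intro mult_left_mono) (auto simp: field_simps)
  finally show "(\<Sum>j<b. d j * res s x a b (X(i0 := (\<lambda>_. 0))) j j) - D / x \<le> (\<Sum>j<b. d j * res s x a b X j j)"
    using e by linarith
qed

text \<open>Both matrices agree once row \<open>i0\<close> is zero, so both traces lie in the same
  interval of length \<open>D / x\<close> below the common value.\<close>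

lemma weighted_trace_row_changed:
  assumes "i0 < a" "\<And>j. j < b \<Longrightarrow> 0 \<le> d j \<and> d j \<le> D" "0 \<le> D"
    and eq: "\<And>i j. i < a \<Longrightarrow> j < b \<Longrightarrow> i \<noteq> i0 \<Longrightarrow> X i j = Y i j"
  shows "\<bar>(\<Sum>j<b. d j * res s x a b X j j) - (\<Sum>j<b. d j * res s x a b Y j j)\<bar> \<le> D / x"
proof -
  have "res s x a b (X(i0 := (\<lambda>_. 0))) j j = res s x a b (Y(i0 := (\<lambda>_. 0))) j j" for j
    by (rule res_cong) (use eq in auto)
  then show ?thesis
    using weighted_trace_row_removed[of i0 a b d D X] weighted_trace_row_removed[of i0 a b d D Y] assms
    by (simp add: abs_le_iff)
qed

text \<open>In matrix form \<open>X (s X^T X + x)^{-1} = (s X X^T + x)^{-1} X\<close>. The left side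
  solves the system of the transposed Gram matrix whose right-hand side is column \<open>k\<close>
  of \<open>X\<close>.\<close>

lemma res_push_through:
  assumes "i < a" "k < b"
  shows "(\<Sum>j<b. X i j * res s x a b X j k) = (\<Sum>l<a. res s x b a (\<lambda>j i. X i j) i l * X l k)"
proof -
  define v where "v = (\<lambda>i. \<Sum>j<b. X i j * res s x a b X j k)"
  have "(\<Sum>l<a. gram s x b (\<lambda>j i. X i j) i l * v l) = X i k" if "i < a" for i
  proof -
    have "(\<Sum>l<a. gram s x b (\<lambda>j i. X i j) i l * v l)
       = s * (\<Sum>j<b. X i j * (\<Sum>l<a. X l j * v l)) + x * v i"
      using gram_apply[OF that, of s x b "\<lambda>j i. X i j" v] by simp
    also have "\<dots> = (\<Sum>j<b. X i j * (s * (\<Sum>l<a. X l j * v l) + x * res s x a b X j k))"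
      by (simp add: v_def algebra_simps sum.distrib sum_distrib_left)
    also have "\<dots> = (\<Sum>j<b. if k = j then X i j else 0)"
    proof (rule sum.cong)
      fix j assume "j \<in> {..<b}"
      then have "s * (\<Sum>l<a. X l j * v l) + x * res s x a b X j k = (if j = k then 1 else 0)"
        using gram_apply[of j b s x a X "\<lambda>j. res s x a b X j k"] gram_res[of j b k a X] assms
        by (simp add: v_def)
      then show "X i j * (s * (\<Sum>l<a. X l j * v l) + x * res s x a b X j k) = (if k = j then X i j else 0)"
        by auto
    qed simp
    finally show ?thesis using assms by simp
  qed
  from res_solve[of a b "\<lambda>j i. X i j" v "\<lambda>i. X i k", OF this assms(1)] show ?thesis
    by (simp add: v_def)
qed

text \<open>A column of \<open>X\<close> is a row of its transpose. Sherman--Morrison for the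
  transposed resolvent and the push-through identity give \<open>X Q e_j = u / (1 + \<tau>)\<close>,
  and equation \<open>j\<close> of the Gram system then yields the entry. In this form
  \<open>Q0\<close> does not involve column \<open>j\<close>, so for independent entries
  \<open>\<tau>\<close> is a quadratic form in variables independent of its matrix.\<close>

lemma res_diag_schur:
  fixes X :: "nat \<Rightarrow> nat \<Rightarrow> real" and j a b :: nat
  assumes "j < b"
  defines "Q0 \<equiv> res s x b a ((\<lambda>j i. X i j)(j := (\<lambda>_. 0)))"
  defines "\<tau> \<equiv> s * (\<Sum>i<a. X i j * (\<Sum>k<a. Q0 i k * X k j))"
  shows "res s x a b X j j = 1 / (x * (1 + \<tau>))" and "0 \<le> \<tau>"
proof -
  define u where "u = (\<lambda>i. \<Sum>k<a. Q0 i k * X k j)"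
  show t: "0 \<le> \<tau>" unfolding \<tau>_def Q0_def
    using row_removed_nonneg[OF assms(1), where b=a and X="\<lambda>j i. X i j"] by simp
  have q: "res s x b a (\<lambda>j i. X i j) i l = Q0 i l - s * u i * u l / (1 + \<tau>)" if "i < a" "l < a" for i l
    unfolding \<tau>_def Q0_def u_def using res_row_removed[OF assms(1) that, where X="\<lambda>j i. X i j"] by simp
  have "(\<Sum>l<a. res s x b a (\<lambda>j i. X i j) i l * X l j) = u i / (1 + \<tau>)" if "i < a" for i
  proof -
    have "(\<Sum>l<a. res s x b a (\<lambda>j i. X i j) i l * X l j)
      = (\<Sum>l<a. Q0 i l * X l j - u i / (1 + \<tau>) * (s * (X l j * u l)))"
      by (rule sum.cong) (simp_all add: q that algebra_simps)
    also have "\<dots> = u i - u i / (1 + \<tau>) * \<tau>"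
      by (simp add: sum_subtractf u_def \<tau>_def sum_distrib_left)
    finally show ?thesis using t by (simp add: field_simps)
  qed
  then have v: "(\<Sum>k<b. X i k * res s x a b X k j) = u i / (1 + \<tau>)" if "i < a" for i
    using res_push_through[OF that assms(1), of X] that by simp
  have "s * (\<Sum>i<a. X i j * (\<Sum>k<b. X i k * res s x a b X k j)) = s * (\<Sum>i<a. X i j * u i) / (1 + \<tau>)"
    using v by (simp add: sum_divide_distrib[symmetric])
  also have "s * (\<Sum>i<a. X i j * u i) = \<tau>" by (simp add: u_def \<tau>_def)
  finally have "s * (\<Sum>i<a. X i j * (\<Sum>k<b. X i k * res s x a b X k j)) = \<tau> / (1 + \<tau>)" .
  moreover have "s * (\<Sum>i<a. X i j * (\<Sum>k<b. X i k * res s x a b X k j)) + x * res s x a b X j j = 1"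
    using gram_apply[OF assms(1), of s x a X "\<lambda>k. res s x a b X k j"] gram_res[of j b j a X] assms(1) by simp
  ultimately have "x * res s x a b X j j = 1 - \<tau> / (1 + \<tau>)" by linarith
  also have "\<dots> = 1 / (1 + \<tau>)" using t by (simp add: field_simps)
  finally have "res s x a b X j j * (x * (1 + \<tau>)) = 1" using t by (simp add: field_simps)
  moreover have "x * (1 + \<tau>) \<noteq> 0" using x0 t by simp
  ultimately show "res s x a b X j j = 1 / (x * (1 + \<tau>))" by (metis nonzero_eq_divide_eq)
qed

text \<open>The negated difference quotient \<open>w\<close> solves the system at
  \<open>x + h\<close> with right-hand side \<open>v\<close>, and using this twice leaves a
  remainder of exactly \<open>h^2\<close> times the inner product of \<open>w\<close> and
  \<open>v\<close>. The bounds \<open>1 / x^2\<close> for the norm of \<open>w\<close> and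
  \<open>1 / x\<close> for that of \<open>v\<close> hold for every matrix, so one constant serves
  all \<open>n\<close>.\<close>

lemma res_taylor:
  assumes "j < b" "h > 0"
  shows "\<bar>res s (x + h) a b X j j - res s x a b X j j + h * (\<Sum>k<b. (res s x a b X k j)\<^sup>2)\<bar> \<le> h\<^sup>2 / x ^ 3"
proof -
  define v where "v = (\<lambda>k. res s x a b X k j)"
  define v' where "v' = (\<lambda>k. res s (x + h) a b X k j)"
  define w where "w = (\<lambda>k. (v k - v' k) / h)"
  have xh: "x + h > 0" using x0 assms by simp
  have gs: "(\<Sum>k<b. gram s (x + h) a X i k * f k) = (\<Sum>k<b. gram s x a X i k * f k) + h * f i" if "i < b" for i f
    by (simp only: gram_apply[OF that]) (simp add: algebra_simps)
  have w: "(\<Sum>k<b. gram s (x + h) a X i k * w k) = v i" if "i < b" for i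
  proof -
    have "(\<Sum>k<b. gram s (x + h) a X i k * w k)
       = ((\<Sum>k<b. gram s (x + h) a X i k * v k) - (\<Sum>k<b. gram s (x + h) a X i k * v' k)) / h"
      by (simp add: w_def sum_subtractf diff_divide_distrib right_diff_distrib sum_divide_distrib)
    also have "(\<Sum>k<b. gram s (x + h) a X i k * v' k) = (\<Sum>k<b. gram s x a X i k * v k)"
      unfolding v_def v'_def
      using gram_res[OF that assms(1), of a X] that assms(1) xh s0
        Submission.gram_res[of s "x + h" i b j a X] by simp
    finally show ?thesis using assms(2) gs[OF that] by simp
  qed
  have "w j = (\<Sum>k<b. res s (x + h) a b X j k * v k)"
    using Submission.res_solve[OF s0 xh, of b a X w v j, OF w assms(1)] .
  also have "\<dots> = (\<Sum>k<b. v' k * v k)"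
    by (rule sum.cong) (use Submission.res_commute[OF s0 xh] assms in \<open>auto simp: v'_def\<close>)
  also have "\<dots> = (\<Sum>k<b. (v k)\<^sup>2 - h * (w k * v k))"
    by (rule sum.cong) (use assms in \<open>simp_all add: w_def field_simps power2_eq_square\<close>)
  finally have wj: "w j = (\<Sum>k<b. (v k)\<^sup>2) - h * (\<Sum>k<b. w k * v k)"
    by (simp add: sum_subtractf sum_distrib_left)
  have "v' j - v j = - h * w j" using assms by (simp add: w_def)
  then have e: "v' j - v j + h * (\<Sum>k<b. (v k)\<^sup>2) = h\<^sup>2 * (\<Sum>k<b. w k * v k)"
    unfolding wj by (simp add: algebra_simps power2_eq_square)
  have vn: "(\<Sum>k<b. (v k)\<^sup>2) \<le> 1 / x\<^sup>2" unfolding v_def by (rule res_col_norm[OF assms(1)])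
  have "(\<Sum>k<b. (w k)\<^sup>2) \<le> (\<Sum>k<b. (v k)\<^sup>2) / (x + h)\<^sup>2"
    using Submission.gram_solution_norm[OF s0 xh, of b a X w v, OF w] .
  also have "\<dots> \<le> (1 / x\<^sup>2) / x\<^sup>2"
    using vn x0 assms by (intro frac_le) (auto intro!: sum_nonneg power_mono)
  finally have wn: "(\<Sum>k<b. (w k)\<^sup>2) \<le> 1 / x ^ 4" by (simp add: power_numeral_reduce)
  have "\<bar>\<Sum>k<b. w k * v k\<bar> \<le> (\<Sum>k<b. x / 2 * (w k)\<^sup>2 + 1 / (2 * x) * (v k)\<^sup>2)"
  proof (rule order_trans[OF sum_abs sum_mono])
    fix k
    have "0 \<le> (x * \<bar>w k\<bar> - \<bar>v k\<bar>)\<^sup>2 / (2 * x)" using x0 by simp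
    also have "(x * \<bar>w k\<bar> - \<bar>v k\<bar>)\<^sup>2 / (2 * x) = x / 2 * (w k)\<^sup>2 + 1 / (2 * x) * (v k)\<^sup>2 - \<bar>w k * v k\<bar>"
      using x0 by (simp add: field_simps power2_eq_square abs_mult)
    finally show "\<bar>w k * v k\<bar> \<le> x / 2 * (w k)\<^sup>2 + 1 / (2 * x) * (v k)\<^sup>2" by simp
  qed
  also have "\<dots> = x / 2 * (\<Sum>k<b. (w k)\<^sup>2) + 1 / (2 * x) * (\<Sum>k<b. (v k)\<^sup>2)"
    by (simp add: sum.distrib sum_distrib_left)
  also have "\<dots> \<le> x / 2 * (1 / x ^ 4) + 1 / (2 * x) * (1 / x\<^sup>2)"
    using x0 by (intro add_mono mult_left_mono wn vn) auto
  also have "\<dots> = 1 / x ^ 3" using x0 by (simp add: field_simps power_numeral_reduce)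
  finally have "\<bar>\<Sum>k<b. w k * v k\<bar> \<le> 1 / x ^ 3" .
  then have "h\<^sup>2 * \<bar>\<Sum>k<b. w k * v k\<bar> \<le> h\<^sup>2 * (1 / x ^ 3)" by (intro mult_left_mono) auto
  then show ?thesis using e by (simp add: v_def v'_def abs_mult)
qed

end

text \<open>Bridges two normalisations: the ridge estimator inverts \<open>X^T X + n * lam\<close>,
  whereas the limit theory concerns \<open>X^T X / n + lam\<close>.\<close>

lemma res_scale:
  assumes "s \<ge> 0" "x > 0" "m > 0" "j < b" "l < b"
  shows "res (m * s) (m * x) a b X j l = res s x a b X j l / m"
proof -
  have "(\<Sum>k<b. gram (m * s) (m * x) a X i k * (res s x a b X k l / m)) = (if i = l then 1 else 0)"
    if "i < b" for i
  proof -
    have "gram (m * s) (m * x) a X i k * (res s x a b X k l / m) = gram s x a X i k * res s x a b X k l" for k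
      using assms by (simp add: gram_def field_simps)
    then show ?thesis using gram_res[of s x i b l a X] assms that by simp
  qed
  from res_unique[of "m * s" "m * x" b a X "\<lambda>k. res s x a b X k l / m" l j, OF _ _ this]
  show ?thesis using assms by simp
qed

section \<open>Measurability of resolvent entries\<close>

lemma det_measurable:
  fixes A :: "'a \<Rightarrow> real mat"
  assumes "\<And>i j. i < n \<Longrightarrow> j < n \<Longrightarrow> (\<lambda>w. A w $$ (i, j)) \<in> borel_measurable N" "\<And>w. A w \<in> carrier_mat n n"
  shows "(\<lambda>w. Determinant.det (A w)) \<in> borel_measurable N"
proof -
  have d: "dim_row (A w) = n" "dim_col (A w) = n" for w using assms(2) by auto
  have "(\<lambda>w. \<Sum>q\<in>{q. q permutes {0..<n}}. signof q * (\<Prod>i = 0..<n. A w $$ (i, q i))) \<in> borel_measurable N"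
    using assms(1) by (intro borel_measurable_sum borel_measurable_times borel_measurable_const
      borel_measurable_prod) (auto dest: permutes_in_image)
  then show ?thesis by (simp add: Determinant.det_def d)
qed

text \<open>\<open>mat_inverse\<close> is an elimination procedure with case distinctions, so
  measurability goes through Cramer's rule: adjugate and determinant are polynomials in the entries,
  and the determinant does not vanish.\<close>

lemma res_measurable:
  assumes "s \<ge> 0" "x > 0" and X: "\<And>i j. i < a \<Longrightarrow> j < b \<Longrightarrow> (\<lambda>w. X w i j) \<in> borel_measurable N"
    and "j < b" "k < b"
  shows "(\<lambda>w. res s x a b (X w) j k) \<in> borel_measurable N"
proof -
  let ?A = "\<lambda>w. gram_mat s x a b (X w)"
  have A: "(\<lambda>w. ?A w $$ (i, j)) \<in> borel_measurable N" if "i < b" "j < b" for i j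
    using that X by (simp add: gram_mat_def gram_def)
  have "res s x a b (X w) j k = adj_mat (?A w) $$ (j, k) / Determinant.det (?A w)" for w
  proof -
    obtain B where B: "mat_inverse (?A w) = Some B" using gram_mat_invertible[OF assms(1,2)] by blast
    from mat_inverse(2)[OF gram_mat_carrier B]
    have i: "?A w * B = 1\<^sub>m b" "B * ?A w = 1\<^sub>m b" "B \<in> carrier_mat b b" by auto
    have "Determinant.det (?A w) * Determinant.det B = 1"
      using Determinant.det_mult[OF gram_mat_carrier i(3), of s x a "X w"] i(1) by simp
    then have d: "Determinant.det (?A w) \<noteq> 0" by auto
    note adj = adj_mat[OF gram_mat_carrier[of s x a b "X w"]]
    have "adj_mat (?A w) = (B * ?A w) * adj_mat (?A w)" using i adj by simp
    also have "\<dots> = B * (?A w * adj_mat (?A w))"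
      using i adj by (intro assoc_mult_mat) auto
    also have "\<dots> = Determinant.det (?A w) \<cdot>\<^sub>m B" using i adj by (simp add: mult_smult_distrib[of B b b _ b])
    finally have "adj_mat (?A w) $$ (j, k) = Determinant.det (?A w) * B $$ (j, k)"
      using i assms by simp
    then show ?thesis using d by (simp add: res_def B)
  qed
  moreover have "(\<lambda>w. adj_mat (?A w) $$ (j, k)) \<in> borel_measurable N"
  proof -
    have "(\<lambda>w. Determinant.det (mat_delete (?A w) k j)) \<in> borel_measurable N"
    proof (rule det_measurable)
      show "mat_delete (?A w) k j \<in> carrier_mat (b - 1) (b - 1)" for w
        using mat_delete_carrier[OF gram_mat_carrier] .
      fix i l assume "i < b - 1" "l < b - 1"
      moreover from this have "mat_delete (?A w) k j $$ (i, l)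
          = ?A w $$ (if i < k then i else Suc i, if l < j then l else Suc l)" for w
        by (simp add: mat_delete_def gram_mat_def)
      ultimately show "(\<lambda>w. mat_delete (?A w) k j $$ (i, l)) \<in> borel_measurable N"
        using A by auto
    qed
    moreover have "adj_mat (?A w) $$ (j, k) = (-1) ^ (k + j) * Determinant.det (mat_delete (?A w) k j)" for w
      using assms by (simp add: adj_mat_def gram_mat_def Determinant.cofactor_def)
    ultimately show ?thesis by simp
  qed
  moreover have "(\<lambda>w. Determinant.det (?A w)) \<in> borel_measurable N"
    by (rule det_measurable[OF A gram_mat_carrier])
  ultimately show ?thesis by simp
qed

section \<open>Moments of functions with bounded differences\<close>

text \<open>A partial sum of a power series with nonnegative terms. It converts bounds on the
  exponential moments at \<open>t\<close> and \<open>-t\<close> into bounds on the second and the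
  fourth moment at once.\<close>

lemma cosh_lower:
  fixes u :: real
  shows "1 + u\<^sup>2 / 2 + u ^ 4 / 24 \<le> (exp u + exp (- u)) / 2"
proof -
  have "(\<Sum>n<5. if even n then u ^ n /\<^sub>R fact n else 0) \<le> cosh u"
    unfolding sums_unique[OF cosh_converges[of u]]
    by (rule sum_le_suminf[OF sums_summable[OF cosh_converges]]) (auto simp: zero_le_even_power)
  then show ?thesis
    by (simp add: cosh_def lessThan_nat_numeral fact_numeral field_simps)
qed

lemma exp_half_le: "exp (1/2 :: real) \<le> 2"
proof -
  have "exp (1/2 :: real) ^ 2 = exp 1" by (simp add: exp_double[symmetric])
  also have "\<dots> \<le> 2 ^ 2" using e_less_272 by simp
  finally show ?thesis by (rule power2_le_imp_le) simp
qed

text \<open>Integrate out one coordinate at a time; each integration is an instance of Hoeffding's lemma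
  and preserves the bounded differences in the remaining coordinates.\<close>

lemma bounded_differences_mgf_PiM:
  fixes N :: "'i \<Rightarrow> 'b measure" and f :: "('i \<Rightarrow> 'b) \<Rightarrow> real"
  assumes N: "\<And>k. prob_space (N k)" and "finite K" and f: "f \<in> borel_measurable (PiM K N)"
    and bd: "\<And>x. x \<in> space (PiM K N) \<Longrightarrow> \<bar>f x\<bar> \<le> B"
    and diff: "\<And>x k y. x \<in> space (PiM K N) \<Longrightarrow> k \<in> K \<Longrightarrow> y \<in> space (N k) \<Longrightarrow> \<bar>f x - f (x(k := y))\<bar> \<le> c"
    and t: "t > 0"
  shows "(\<integral>\<^sup>+x. exp (t * f x) \<partial>PiM K N) \<le> ennreal (exp (t * (\<integral>x. f x \<partial>PiM K N) + t\<^sup>2 * c\<^sup>2 * card K / 2))"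
  using \<open>finite K\<close> f bd diff
proof (induction K arbitrary: f rule: finite_induct)
  case empty
  have "(\<integral>\<^sup>+x. exp (t * f x) \<partial>PiM {} N) = exp (t * f (\<lambda>_. undefined))"
    "(\<integral>x. f x \<partial>PiM {} N) = f (\<lambda>_. undefined)"
    by (simp_all add: PiM_empty nn_integral_count_space_finite lebesgue_integral_count_space_finite)
  then show ?case by simp
next
  case (insert k K)
  interpret product_prob_space N
    using N by (simp add: product_prob_space_def product_prob_space_axioms_def product_sigma_finite_def
        prob_space_imp_sigma_finite)
  interpret K: finite_product_prob_space N K by standard (use insert in auto)
  interpret kK: finite_product_prob_space N "insert k K" by standard (use insert in auto)
  note f[measurable] = insert.prems(1)
  have upd: "x(k := y) \<in> space (PiM (insert k K) N)" if "x \<in> space (PiM K N)" "y \<in> space (N k)" for x y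
    using that by (auto simp: space_PiM PiE_def extensional_def)
  have updm[measurable]: "(\<lambda>(x, y). x(k := y)) \<in> PiM K N \<Otimes>\<^sub>M N k \<rightarrow>\<^sub>M PiM (insert k K) N"
    by (rule measurable_add_dim)
  define g where "g x = (\<integral>y. f (x(k := y)) \<partial>N k)" for x
  have fm: "(\<lambda>y. f (x(k := y))) \<in> borel_measurable (N k)" if "x \<in> space (PiM K N)" for x
    using measurable_compose[OF measurable_Pair1'[OF that] measurable_compose[OF updm f]] by (simp add: fun_upd_def)
  have fi: "integrable (N k) (\<lambda>y. f (x(k := y)))" if "x \<in> space (PiM K N)" for x
    using fm[OF that] insert.prems(2) upd[OF that]
    by (intro finite_measure.integrable_const_bound[OF prob_space.finite_measure[OF N], where B=B]) auto
  have gm: "g \<in> borel_measurable (PiM K N)"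
    unfolding g_def using measurable_compose[OF updm f]
    by (intro sigma_finite_measure.borel_measurable_lebesgue_integral[OF prob_space_imp_sigma_finite[OF N]]) (simp add: case_prod_unfold)
  have gb: "\<bar>g x\<bar> \<le> B" if "x \<in> space (PiM K N)" for x
  proof -
    have "\<bar>g x\<bar> \<le> (\<integral>y. \<bar>f (x(k := y))\<bar> \<partial>N k)" unfolding g_def by (rule integral_abs_bound)
    also have "\<dots> \<le> (\<integral>y. B \<partial>N k)"
      using fi[OF that] insert.prems(2) upd[OF that] by (intro integral_mono) auto
    finally show ?thesis by (simp add: prob_space.prob_space[OF N])
  qed
  have gd: "\<bar>g x - g (x(l := z))\<bar> \<le> c" if x: "x \<in> space (PiM K N)" and l: "l \<in> K" and z: "z \<in> space (N l)" for x l z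
  proof -
    have xl: "x(l := z) \<in> space (PiM K N)" using x l z by (auto simp: space_PiM PiE_def extensional_def)
    have kl: "k \<noteq> l" using l insert by auto
    have "g x - g (x(l := z)) = (\<integral>y. f (x(k := y)) - f (x(l := z, k := y)) \<partial>N k)"
      unfolding g_def using fi[OF x] fi[OF xl] by (simp add: Bochner_Integration.integral_diff)
    also have "\<bar>\<dots>\<bar> \<le> (\<integral>y. \<bar>f (x(k := y)) - f (x(l := z, k := y))\<bar> \<partial>N k)" by (rule integral_abs_bound)
    also have "\<dots> \<le> (\<integral>y. c \<partial>N k)"
    proof (rule integral_mono)
      fix y assume "y \<in> space (N k)"
      then show "\<bar>f (x(k := y)) - f (x(l := z, k := y))\<bar> \<le> c"
        unfolding fun_upd_twist[OF kl[symmetric], of x z y]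
        using insert.prems(3)[OF upd[OF x], of y l z] l z by blast
    qed (use fi[OF x] fi[OF xl] in auto)
    finally show ?thesis by (simp add: prob_space.prob_space[OF N])
  qed
  have inner: "(\<integral>\<^sup>+y. exp (t * f (x(k := y))) \<partial>N k) \<le> ennreal (exp (t * g x) * exp (t\<^sup>2 * c\<^sup>2 / 2))"
    if x: "x \<in> space (PiM K N)" for x
  proof -
    obtain y0 where y0: "y0 \<in> space (N k)" using prob_space.not_empty[OF N] by auto
    let ?F = "\<lambda>y. f (x(k := y))"
    have "\<bar>?F y0 - ?F y\<bar> \<le> c" if "y \<in> space (N k)" for y
      using insert.prems(3)[OF upd[OF x y0], of k y, unfolded fun_upd_upd] that by blast
    \<comment> \<open>All values lie within \<open>c\<close> of the value at one point
      \<open>y0\<close>, that is in an interval of length \<open>2 * c\<close>; Hoeffding's lemma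
      then contributes the exponent \<open>t^2 * (2 * c)^2 / 8\<close>.\<close>
    then have b: "?F y \<in> {?F y0 - c..?F y0 + c}" if "y \<in> space (N k)" for y
      using that unfolding abs_le_iff atLeastAtMost_iff by fastforce
    interpret h: interval_bounded_random_variable "N k" ?F "?F y0 - c" "?F y0 + c"
      by unfold_locales (use fm[OF x] b in auto)
    have "(\<integral>\<^sup>+y. exp (t * ?F y) \<partial>N k) = (\<integral>\<^sup>+y. ennreal (exp (t * g x)) * ennreal (exp (t * (?F y - g x))) \<partial>N k)"
      by (intro nn_integral_cong) (simp add: ennreal_mult[symmetric] exp_add[symmetric] algebra_simps)
    also have "\<dots> = ennreal (exp (t * g x)) * (\<integral>\<^sup>+y. exp (t * (?F y - g x)) \<partial>N k)"
      using fm[OF x] by (intro nn_integral_cmult) simp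
    also have "\<dots> \<le> ennreal (exp (t * g x)) * ennreal (exp (t\<^sup>2 * (?F y0 + c - (?F y0 - c))\<^sup>2 / 8))"
      using h.Hoeffdings_lemma_nn_integral[OF t] unfolding g_def by (intro mult_left_mono) auto
    also have "t\<^sup>2 * (?F y0 + c - (?F y0 - c))\<^sup>2 / 8 = t\<^sup>2 * c\<^sup>2 / 2" by (simp add: power2_eq_square algebra_simps)
    finally show ?thesis by (simp add: ennreal_mult fun_upd_def)
  qed
  have fint: "integrable (PiM (insert k K) N) f"
    using insert.prems(2) by (intro kK.integrable_const_bound[where B=B]) auto
  have "(\<integral>\<^sup>+x. exp (t * f x) \<partial>PiM (insert k K) N) = (\<integral>\<^sup>+x. (\<integral>\<^sup>+y. exp (t * f (x(k := y))) \<partial>N k) \<partial>PiM K N)"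
    using insert.hyps by (intro product_nn_integral_insert) auto
  also have "\<dots> \<le> (\<integral>\<^sup>+x. ennreal (exp (t\<^sup>2 * c\<^sup>2 / 2)) * exp (t * g x) \<partial>PiM K N)"
    using inner by (intro nn_integral_mono) (simp add: ennreal_mult[symmetric] mult.commute)
  also have "\<dots> = ennreal (exp (t\<^sup>2 * c\<^sup>2 / 2)) * (\<integral>\<^sup>+x. exp (t * g x) \<partial>PiM K N)"
    using gm by (intro nn_integral_cmult) simp
  also have "\<dots> \<le> ennreal (exp (t\<^sup>2 * c\<^sup>2 / 2)) * ennreal (exp (t * (\<integral>x. g x \<partial>PiM K N) + t\<^sup>2 * c\<^sup>2 * card K / 2))"
    using insert.IH[OF gm gb gd] by (intro mult_left_mono) auto
  also have "(\<integral>x. g x \<partial>PiM K N) = (\<integral>x. f x \<partial>PiM (insert k K) N)"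
    unfolding g_def using product_integral_insert[OF insert.hyps fint] by simp
  also have "ennreal (exp (t\<^sup>2 * c\<^sup>2 / 2)) *
      ennreal (exp (t * (\<integral>x. f x \<partial>PiM (insert k K) N) + t\<^sup>2 * c\<^sup>2 * card K / 2))
     = ennreal (exp (t * (\<integral>x. f x \<partial>PiM (insert k K) N) + t\<^sup>2 * c\<^sup>2 * card (insert k K) / 2))"
    using insert.hyps by (simp add: ennreal_mult[symmetric] exp_add[symmetric] field_simps)
  finally show ?case .
qed

context prob_space
begin

text \<open>The joint law of independent variables is a product measure, so the bound on the product
  space transfers; the centring is a constant factor inserted at the end.\<close>

lemma bounded_differences_mgf:
  fixes N :: "'i \<Rightarrow> 'b measure" and f :: "('i \<Rightarrow> 'b) \<Rightarrow> real"
  assumes ind: "indep_vars N Y K" and K: "finite K" "K \<noteq> {}" and f: "f \<in> borel_measurable (PiM K N)"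
    and bd: "\<And>x. \<bar>f x\<bar> \<le> B"
    and diff: "\<And>x y k. k \<in> K \<Longrightarrow> (\<And>l. l \<in> K \<Longrightarrow> l \<noteq> k \<Longrightarrow> x l = y l) \<Longrightarrow> \<bar>f x - f y\<bar> \<le> c"
    and t: "t > 0"
  defines "F \<equiv> \<lambda>\<omega>. f (\<lambda>k\<in>K. Y k \<omega>)"
  shows "expectation (\<lambda>\<omega>. exp (t * (F \<omega> - expectation F))) \<le> exp (t\<^sup>2 * c\<^sup>2 * card K / 2)"
    and "random_variable borel F"
proof -
  have rv: "random_variable (N k) (Y k)" if "k \<in> K" for k
    using ind that by (auto simp: indep_vars_def)
  obtain k0 where k0: "k0 \<in> K" using K by auto
  \<comment> \<open>Indices outside \<open>K\<close> receive the law of \<open>k0\<close>, because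
    the product construction asks for a probability measure at every index.\<close>
  define N' where "N' k = (if k \<in> K then distr M (N k) (Y k) else distr M (N k0) (Y k0))" for k
  have N': "prob_space (N' k)" for k
    using rv k0 by (auto simp: N'_def intro!: prob_space_distr)
  have PN: "sets (PiM K N') = sets (PiM K N)" by (rule sets_PiM_cong) (auto simp: N'_def)
  have Ym: "(\<lambda>\<omega>. \<lambda>k\<in>K. Y k \<omega>) \<in> M \<rightarrow>\<^sub>M PiM K N" using rv by (intro measurable_restrict) auto
  have "distr M (PiM K N) (\<lambda>\<omega>. \<lambda>k\<in>K. Y k \<omega>) = PiM K (\<lambda>k. distr M (N k) (Y k))"
    using ind indep_vars_iff_distr_eq_PiM'[OF K(2), where M'=N and X=Y] rv by simp
  also have "\<dots> = PiM K N'" by (rule PiM_cong) (auto simp: N'_def)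
  finally have d: "distr M (PiM K N) (\<lambda>\<omega>. \<lambda>k\<in>K. Y k \<omega>) = PiM K N'" .
  have Fm: "F \<in> borel_measurable M" unfolding F_def by (rule measurable_compose[OF Ym f])
  then show "random_variable borel F" .
  have fm': "f \<in> borel_measurable (PiM K N')" using f PN by (simp cong: measurable_cong_sets)
  have "(\<integral>\<^sup>+x. exp (t * f x) \<partial>PiM K N') \<le> ennreal (exp (t * (\<integral>x. f x \<partial>PiM K N') + t\<^sup>2 * c\<^sup>2 * card K / 2))"
    using bd diff by (intro bounded_differences_mgf_PiM[OF N' K(1) fm' _ _ t]) auto
  also have "(\<integral>x. f x \<partial>PiM K N') = expectation F"
    unfolding d[symmetric] F_def using Ym f by (rule integral_distr)
  also have "(\<integral>\<^sup>+x. exp (t * f x) \<partial>PiM K N') = (\<integral>\<^sup>+\<omega>. exp (t * F \<omega>) \<partial>M)"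
    unfolding d[symmetric] F_def using Ym f by (subst nn_integral_distr) auto
  finally have le: "(\<integral>\<^sup>+\<omega>. exp (t * F \<omega>) \<partial>M) \<le> ennreal (exp (t * expectation F + t\<^sup>2 * c\<^sup>2 * card K / 2))" .
  have i: "integrable M (\<lambda>\<omega>. exp (t * (F \<omega> - expectation F)))"
  proof (rule integrable_const_bound)
    have "F \<omega> \<le> B" for \<omega> using bd[of "\<lambda>k\<in>K. Y k \<omega>"] by (auto simp: F_def abs_le_iff)
    then show "AE \<omega> in M. norm (exp (t * (F \<omega> - expectation F))) \<le> exp (t * (B - expectation F))"
      using t by auto
  qed (use Fm in simp)
  have "ennreal (expectation (\<lambda>\<omega>. exp (t * (F \<omega> - expectation F)))) = (\<integral>\<^sup>+\<omega>. exp (t * (F \<omega> - expectation F)) \<partial>M)"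
    using i by (intro nn_integral_eq_integral[symmetric]) auto
  also have "\<dots> = (\<integral>\<^sup>+\<omega>. ennreal (exp (- t * expectation F)) * exp (t * F \<omega>) \<partial>M)"
    by (intro nn_integral_cong) (simp add: ennreal_mult[symmetric] exp_add[symmetric] algebra_simps)
  also have "\<dots> = ennreal (exp (- t * expectation F)) * (\<integral>\<^sup>+\<omega>. exp (t * F \<omega>) \<partial>M)"
    using Fm by (intro nn_integral_cmult) simp
  also have "\<dots> \<le> ennreal (exp (- t * expectation F)) * ennreal (exp (t * expectation F + t\<^sup>2 * c\<^sup>2 * card K / 2))"
    using le by (intro mult_left_mono) auto
  also have "\<dots> = ennreal (exp (t\<^sup>2 * c\<^sup>2 * card K / 2))"
    by (simp add: ennreal_mult[symmetric] exp_add[symmetric])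
  finally show "expectation (\<lambda>\<omega>. exp (t * (F \<omega> - expectation F))) \<le> exp (t\<^sup>2 * c\<^sup>2 * card K / 2)"
    by simp
qed

text \<open>With \<open>t\<close> chosen so that the exponent is \<open>1 / 2\<close>, the
  exponential moments of the centred variable at \<open>t\<close> and \<open>-t\<close> are at most
  \<open>2\<close>. By \<open>cosh_lower\<close>, \<open>t^2 / 2\<close> times the second plus
  \<open>t^4 / 24\<close> times the fourth moment is then at most \<open>1\<close>. This yields the
  constants \<open>2\<close> and \<open>24\<close>; the stated ones are twice as large.\<close>

lemma bounded_differences_moments:
  fixes N :: "'i \<Rightarrow> 'b measure" and f :: "('i \<Rightarrow> 'b) \<Rightarrow> real"
  assumes ind: "indep_vars N Y K" and K: "finite K" "K \<noteq> {}" and f: "f \<in> borel_measurable (PiM K N)"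
    and bd: "\<And>x. \<bar>f x\<bar> \<le> B"
    and diff: "\<And>x y k. k \<in> K \<Longrightarrow> (\<And>l. l \<in> K \<Longrightarrow> l \<noteq> k \<Longrightarrow> x l = y l) \<Longrightarrow> \<bar>f x - f y\<bar> \<le> c"
    and c: "c > 0"
  defines "F \<equiv> \<lambda>\<omega>. f (\<lambda>k\<in>K. Y k \<omega>)"
  shows "expectation (\<lambda>\<omega>. (F \<omega> - expectation F)\<^sup>2) \<le> 4 * c\<^sup>2 * card K"
    and "expectation (\<lambda>\<omega>. (F \<omega> - expectation F) ^ 4) \<le> 48 * c ^ 4 * (card K)\<^sup>2"
    and "random_variable borel F"
proof -
  define m where "m = real (card K)"
  have m: "m > 0" using K by (simp add: m_def card_gt_0_iff)
  define t where "t = 1 / (c * sqrt m)"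
  have t2: "t\<^sup>2 = 1 / (c\<^sup>2 * m)" using m by (simp add: t_def power_divide power_mult_distrib)
  have t: "t > 0" "t\<^sup>2 * c\<^sup>2 * m = 1" unfolding t2 using c m by (simp_all add: t_def)
  then have half: "t\<^sup>2 * c\<^sup>2 * real (card K) / 2 = 1 / 2" unfolding m_def by argo
  define D where "D = (\<lambda>\<omega>. F \<omega> - expectation F)"
  have Fm: "F \<in> borel_measurable M"
    unfolding F_def by (rule bounded_differences_mgf(2)[OF ind K f bd diff t(1)])
  then show "random_variable borel F" .
  have Dm[measurable]: "D \<in> borel_measurable M" using Fm by (simp add: D_def)
  have Db: "\<bar>D \<omega>\<bar> \<le> B + \<bar>expectation F\<bar>" for \<omega>
    using bd[of "\<lambda>k\<in>K. Y k \<omega>"] by (auto simp: D_def F_def)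
  have integ: "integrable M (\<lambda>\<omega>. h (D \<omega>))" if "continuous_on UNIV h" for h :: "real \<Rightarrow> real"
  proof -
    let ?S = "{- (B + \<bar>expectation F\<bar>)..B + \<bar>expectation F\<bar>}"
    have "compact (h ` ?S)" using that by (intro compact_continuous_image continuous_on_subset[OF that]) auto
    then obtain C where C: "\<And>y. y \<in> ?S \<Longrightarrow> norm (h y) \<le> C"
      by (meson bounded_iff compact_imp_bounded image_eqI)
    show ?thesis
    proof (rule integrable_const_bound)
      have "norm (h (D \<omega>)) \<le> C" for \<omega>
        using Db[of \<omega>] by (intro C) (simp add: abs_le_iff)
      then show "AE \<omega> in M. norm (h (D \<omega>)) \<le> C" by simp
      show "random_variable borel (\<lambda>\<omega>. h (D \<omega>))"
        using that by (intro measurable_compose[OF Dm] borel_measurable_continuous_onI)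
    qed
  qed
  have e1: "expectation (\<lambda>\<omega>. exp (t * D \<omega>)) \<le> 2"
    using order_trans[OF bounded_differences_mgf(1)[OF ind K f bd diff t(1), unfolded half] exp_half_le]
    unfolding D_def F_def .
  \<comment> \<open>The exponential bound is for positive \<open>t\<close>, so the other tail is
    obtained by applying it to \<open>- f\<close>.\<close>
  have e2: "expectation (\<lambda>\<omega>. exp (- (t * D \<omega>))) \<le> 2"
  proof -
    have "expectation (\<lambda>\<omega>. exp (t * ((- F \<omega>) - expectation (\<lambda>\<omega>. - F \<omega>)))) \<le> exp (t\<^sup>2 * c\<^sup>2 * card K / 2)"
      unfolding F_def
    proof (rule bounded_differences_mgf(1)[OF ind K _ _ _ t(1)])
      show "\<bar>- f x - - f y\<bar> \<le> c" if "k \<in> K" "\<And>l. l \<in> K \<Longrightarrow> l \<noteq> k \<Longrightarrow> x l = y l" for x y k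
        using diff[OF that(1), of x y] that(2) by (simp add: abs_minus_commute)
    qed (use f bd in auto)
    moreover have "t * ((- F \<omega>) - expectation (\<lambda>\<omega>. - F \<omega>)) = - (t * D \<omega>)" for \<omega>
      by (simp add: D_def algebra_simps)
    ultimately show ?thesis unfolding half using exp_half_le by simp
  qed
  have "expectation (\<lambda>\<omega>. 1 + (t * D \<omega>)\<^sup>2 / 2 + (t * D \<omega>) ^ 4 / 24)
      \<le> expectation (\<lambda>\<omega>. (exp (t * D \<omega>) + exp (- (t * D \<omega>))) / 2)"
    by (intro integral_mono integ cosh_lower) (auto intro!: continuous_intros)
  also have "\<dots> = (expectation (\<lambda>\<omega>. exp (t * D \<omega>)) + expectation (\<lambda>\<omega>. exp (- (t * D \<omega>)))) / 2"
    by (subst Bochner_Integration.integral_add[symmetric])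
       (auto intro!: integ continuous_intros)
  also have "\<dots> \<le> 2" using e1 e2 by simp
  also have "expectation (\<lambda>\<omega>. 1 + (t * D \<omega>)\<^sup>2 / 2 + (t * D \<omega>) ^ 4 / 24)
     = 1 + t\<^sup>2 / 2 * expectation (\<lambda>\<omega>. (D \<omega>)\<^sup>2) + t ^ 4 / 24 * expectation (\<lambda>\<omega>. (D \<omega>) ^ 4)"
  proof -
    have "integrable M (\<lambda>\<omega>. (D \<omega>)\<^sup>2)" "integrable M (\<lambda>\<omega>. (D \<omega>) ^ 4)"
      by (intro integ continuous_intros)+
    then show ?thesis by (simp add: power_mult_distrib prob_space)
  qed
  finally have le: "t\<^sup>2 / 2 * expectation (\<lambda>\<omega>. (D \<omega>)\<^sup>2) + t ^ 4 / 24 * expectation (\<lambda>\<omega>. (D \<omega>) ^ 4) \<le> 1" by simp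
  have p2: "0 \<le> t\<^sup>2 / 2 * expectation (\<lambda>\<omega>. (D \<omega>)\<^sup>2)" "0 \<le> t ^ 4 / 24 * expectation (\<lambda>\<omega>. (D \<omega>) ^ 4)"
    by (intro mult_nonneg_nonneg integral_nonneg_AE; simp)+
  have "t ^ 4 = (t\<^sup>2)\<^sup>2" by simp
  then have t4: "t ^ 4 = 1 / (c ^ 4 * m\<^sup>2)" unfolding t2 by (simp add: power_divide power_mult_distrib)
  have pos: "c\<^sup>2 * m > 0" "c ^ 4 * m\<^sup>2 > 0" using c m by simp_all
  have "t\<^sup>2 / 2 * expectation (\<lambda>\<omega>. (D \<omega>)\<^sup>2) \<le> 1" using le p2 by linarith
  then have "expectation (\<lambda>\<omega>. (D \<omega>)\<^sup>2) / (c\<^sup>2 * m) \<le> 2" unfolding t2 by simp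
  then have "expectation (\<lambda>\<omega>. (D \<omega>)\<^sup>2) \<le> 2 * (c\<^sup>2 * m)" using pos(1) by (simp only: pos_divide_le_eq)
  also have "\<dots> \<le> 4 * c\<^sup>2 * m" using pos(1) by linarith
  finally show "expectation (\<lambda>\<omega>. (F \<omega> - expectation F)\<^sup>2) \<le> 4 * c\<^sup>2 * card K" by (simp add: D_def m_def)
  have "t ^ 4 / 24 * expectation (\<lambda>\<omega>. (D \<omega>) ^ 4) \<le> 1" using le p2 by linarith
  then have "expectation (\<lambda>\<omega>. (D \<omega>) ^ 4) / (c ^ 4 * m\<^sup>2) \<le> 24" unfolding t4 by simp
  then have "expectation (\<lambda>\<omega>. (D \<omega>) ^ 4) \<le> 24 * (c ^ 4 * m\<^sup>2)" using pos(2) by (simp only: pos_divide_le_eq)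
  also have "\<dots> \<le> 48 * c ^ 4 * m\<^sup>2" using pos(2) by linarith
  finally show "expectation (\<lambda>\<omega>. (F \<omega> - expectation F) ^ 4) \<le> 48 * c ^ 4 * (card K)\<^sup>2" by (simp add: D_def m_def)
qed

end

section \<open>Quadratic forms in independent variables\<close>

context prob_space
begin

text \<open>Pointwise, the absolute value of \<open>f\<close> is at most
  \<open>e / 2 + f^2 / (2 * e)\<close>; with the second moment below \<open>e^2\<close> the two
  halves add up to \<open>e\<close>, and integrability comes along.\<close>

lemma expectation_abs_le:
  fixes f :: "'a \<Rightarrow> real"
  assumes "random_variable borel f" "integrable M (\<lambda>\<omega>. (f \<omega>)\<^sup>2)"
    and "expectation (\<lambda>\<omega>. (f \<omega>)\<^sup>2) \<le> e\<^sup>2" "e > 0"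
  shows "expectation (\<lambda>\<omega>. \<bar>f \<omega>\<bar>) \<le> e" and "integrable M f"
proof -
  have pt: "\<bar>f \<omega>\<bar> \<le> e / 2 + (f \<omega>)\<^sup>2 / (2 * e)" for \<omega>
  proof -
    have "0 \<le> (\<bar>f \<omega>\<bar> - e)\<^sup>2 / (2 * e)" using assms by simp
    also have "\<dots> = e / 2 + (f \<omega>)\<^sup>2 / (2 * e) - \<bar>f \<omega>\<bar>"
      using assms by (simp add: field_simps power2_eq_square)
    finally show ?thesis by simp
  qed
  have i: "integrable M (\<lambda>\<omega>. e / 2 + (f \<omega>)\<^sup>2 / (2 * e))" using assms by simp
  show fi: "integrable M f"
    by (rule Bochner_Integration.integrable_bound[OF i]) (use assms pt in \<open>auto intro: order_trans\<close>)
  have "expectation (\<lambda>\<omega>. \<bar>f \<omega>\<bar>) \<le> expectation (\<lambda>\<omega>. e / 2 + (f \<omega>)\<^sup>2 / (2 * e))"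
    using fi i pt by (intro integral_mono) auto
  also have "\<dots> = e / 2 + expectation (\<lambda>\<omega>. (f \<omega>)\<^sup>2) / (2 * e)" using assms by (simp add: prob_space)
  also have "\<dots> \<le> e / 2 + e\<^sup>2 / (2 * e)" using assms by (intro add_left_mono divide_right_mono) auto
  also have "\<dots> = e" using assms by (simp add: field_simps power2_eq_square)
  finally show "expectation (\<lambda>\<omega>. \<bar>f \<omega>\<bar>) \<le> e" .
qed

lemma integrable_of_square:
  assumes "random_variable borel f" "integrable M (\<lambda>\<omega>. (f \<omega> :: real)\<^sup>2)"
  shows "integrable M f"
proof (rule Bochner_Integration.integrable_bound[of M "\<lambda>\<omega>. 1 + (f \<omega>)\<^sup>2"])
  have "\<bar>x\<bar> \<le> 1 + x\<^sup>2" for x :: real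
  proof -
    have "0 \<le> (\<bar>x\<bar> - 1 / 2)\<^sup>2" by simp
    then show ?thesis by (simp add: power2_eq_square algebra_simps)
  qed
  then show "AE \<omega> in M. norm (f \<omega>) \<le> norm (1 + (f \<omega>)\<^sup>2)" by (simp add: order_trans[OF _ abs_ge_self])
qed (use assms in auto)

lemma integrable_mult_of_squares:
  assumes "random_variable borel f" "integrable M (\<lambda>\<omega>. (f \<omega> :: real)\<^sup>2)"
    "random_variable borel g" "integrable M (\<lambda>\<omega>. (g \<omega> :: real)\<^sup>2)"
  shows "integrable M (\<lambda>\<omega>. f \<omega> * g \<omega>)"
proof (rule Bochner_Integration.integrable_bound[of M "\<lambda>\<omega>. (f \<omega>)\<^sup>2 + (g \<omega>)\<^sup>2"])
  have "\<bar>x * y\<bar> \<le> x\<^sup>2 + y\<^sup>2" for x y :: real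
  proof -
    have "2 * (\<bar>x\<bar> * \<bar>y\<bar>) \<le> x\<^sup>2 + y\<^sup>2" using sum_squares_bound[of "\<bar>x\<bar>" "\<bar>y\<bar>"] by (simp add: mult.assoc)
    moreover have "0 \<le> \<bar>x\<bar> * \<bar>y\<bar>" by simp
    ultimately show ?thesis unfolding abs_mult by linarith
  qed
  then show "AE \<omega> in M. norm (f \<omega> * g \<omega>) \<le> norm ((f \<omega>)\<^sup>2 + (g \<omega>)\<^sup>2)" by (simp add: order_trans[OF _ abs_ge_self])
qed (use assms in auto)

lemma indep_vars_reindex:
  assumes "indep_vars (\<lambda>_. N) X I" "inj_on h L" "h ` L \<subseteq> I"
  shows "indep_vars (\<lambda>_. N) (\<lambda>l. X (h l)) L"
proof -
  have "indep_vars (\<lambda>l. PiM {h l} (\<lambda>_. N)) (\<lambda>l \<omega>. restrict (\<lambda>i. X i \<omega>) {h l}) L"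
    using assms by (intro indep_vars_restrict[OF assms(1)]) (auto simp: disjoint_family_on_def inj_on_def)
  then have "indep_vars (\<lambda>_. N) (\<lambda>l \<omega>. (\<lambda>z. z (h l)) (restrict (\<lambda>i. X i \<omega>) {h l})) L"
    by (rule indep_vars_compose2) auto
  then show ?thesis by simp
qed

text \<open>Tonelli for the product law: a bound that holds for every frozen value of
  \<open>Y1\<close> survives averaging over \<open>Y1\<close>. The nonnegative integral makes
  integrability a consequence instead of a premise.\<close>

lemma indep_nn_integral_bound:
  assumes "indep_var S Y0 T Y1" and \<Phi>: "\<Phi> \<in> borel_measurable (S \<Otimes>\<^sub>M T)"
    and C: "\<And>y. y \<in> space T \<Longrightarrow> (\<integral>\<^sup>+\<omega>. \<Phi> (Y0 \<omega>, y) \<partial>M) \<le> C"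
  shows "(\<integral>\<^sup>+\<omega>. \<Phi> (Y0 \<omega>, Y1 \<omega>) \<partial>M) \<le> C"
proof -
  from assms(1) have rv: "Y0 \<in> M \<rightarrow>\<^sub>M S" "Y1 \<in> M \<rightarrow>\<^sub>M T"
    and d: "distr M S Y0 \<Otimes>\<^sub>M distr M T Y1 = distr M (S \<Otimes>\<^sub>M T) (\<lambda>x. (Y0 x, Y1 x))"
    by (auto simp: indep_var_distribution_eq)
  interpret D0: prob_space "distr M S Y0" by (rule prob_space_distr[OF rv(1)])
  interpret D1: prob_space "distr M T Y1" by (rule prob_space_distr[OF rv(2)])
  interpret D: pair_sigma_finite "distr M S Y0" "distr M T Y1" by standard
  have "(\<integral>\<^sup>+\<omega>. \<Phi> (Y0 \<omega>, Y1 \<omega>) \<partial>M) = (\<integral>\<^sup>+z. \<Phi> z \<partial>distr M (S \<Otimes>\<^sub>M T) (\<lambda>x. (Y0 x, Y1 x)))"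
    using rv \<Phi> by (subst nn_integral_distr) auto
  also have "\<dots> = (\<integral>\<^sup>+y. (\<integral>\<^sup>+x. \<Phi> (x, y) \<partial>distr M S Y0) \<partial>distr M T Y1)"
    unfolding d[symmetric] using \<Phi> by (intro D.nn_integral_snd[symmetric]) simp
  also have "\<dots> \<le> (\<integral>\<^sup>+y. C \<partial>distr M T Y1)"
  proof (rule nn_integral_mono)
    fix y assume "y \<in> space (distr M T Y1)"
    then have y: "y \<in> space T" by simp
    then have "(\<lambda>x. \<Phi> (x, y)) \<in> borel_measurable S"
      using measurable_compose[OF measurable_Pair2'[OF y] \<Phi>] by simp
    then show "(\<integral>\<^sup>+x. \<Phi> (x, y) \<partial>distr M S Y0) \<le> C"
      using C[OF y] rv by (subst nn_integral_distr) auto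
  qed
  also have "\<dots> = C" using D1.emeasure_space_1 by simp
  finally show ?thesis .
qed

text \<open>Separates variable \<open>m\<close> from the earlier ones; it drives the inductions that
  add one variable at a time.\<close>

lemma indep_prefix_factor:
  fixes Z :: "nat \<Rightarrow> 'a \<Rightarrow> real" and h :: "real \<Rightarrow> real" and G :: "(nat \<Rightarrow> real) \<Rightarrow> real"
  assumes ind: "indep_vars (\<lambda>_. borel) Z {..<a}" and m: "m < a"
    and h: "h \<in> borel_measurable borel" "integrable M (\<lambda>\<omega>. h (Z m \<omega>))"
    and G: "G \<in> borel_measurable (PiM {..<m} (\<lambda>_. borel))" "integrable M (\<lambda>\<omega>. G (\<lambda>i\<in>{..<m}. Z i \<omega>))"
  shows "integrable M (\<lambda>\<omega>. h (Z m \<omega>) * G (\<lambda>i\<in>{..<m}. Z i \<omega>))"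
    and "expectation (\<lambda>\<omega>. h (Z m \<omega>) * G (\<lambda>i\<in>{..<m}. Z i \<omega>))
      = expectation (\<lambda>\<omega>. h (Z m \<omega>)) * expectation (\<lambda>\<omega>. G (\<lambda>i\<in>{..<m}. Z i \<omega>))"
proof -
  have "indep_var (PiM {m} (\<lambda>_. borel)) (\<lambda>\<omega>. restrict (\<lambda>i. Z i \<omega>) {m})
      (PiM {..<m} (\<lambda>_. borel)) (\<lambda>\<omega>. restrict (\<lambda>i. Z i \<omega>) {..<m})"
    using m by (intro indep_var_restrict[OF ind]) auto
  moreover have "(\<lambda>z. h (z m)) \<in> borel_measurable (PiM {m} (\<lambda>_. borel))"
    using h(1) by (intro measurable_compose[OF measurable_component_singleton]) auto
  ultimately have "indep_var borel ((\<lambda>z. h (z m)) \<circ> (\<lambda>\<omega>. restrict (\<lambda>i. Z i \<omega>) {m}))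
      borel (G \<circ> (\<lambda>\<omega>. restrict (\<lambda>i. Z i \<omega>) {..<m}))"
    using G(1) by (rule indep_var_compose)
  then have iv: "indep_var borel (\<lambda>\<omega>. h (Z m \<omega>)) borel (\<lambda>\<omega>. G (\<lambda>i\<in>{..<m}. Z i \<omega>))"
    by (simp add: comp_def)
  show "integrable M (\<lambda>\<omega>. h (Z m \<omega>) * G (\<lambda>i\<in>{..<m}. Z i \<omega>))"
    using indep_var_integrable[OF iv h(2) G(2)] .
  show "expectation (\<lambda>\<omega>. h (Z m \<omega>) * G (\<lambda>i\<in>{..<m}. Z i \<omega>))
      = expectation (\<lambda>\<omega>. h (Z m \<omega>)) * expectation (\<lambda>\<omega>. G (\<lambda>i\<in>{..<m}. Z i \<omega>))"
    using indep_var_lebesgue_integral[OF iv h(2) G(2)] .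
qed

context
  fixes Z :: "nat \<Rightarrow> 'a \<Rightarrow> real" and a :: nat and m4 :: real
  assumes ind: "indep_vars (\<lambda>_. borel) Z {..<a}"
    and Z1: "\<And>i. i < a \<Longrightarrow> integrable M (Z i) \<and> expectation (Z i) = 0"
    and Z2: "\<And>i. i < a \<Longrightarrow> integrable M (\<lambda>\<omega>. (Z i \<omega>)\<^sup>2) \<and> expectation (\<lambda>\<omega>. (Z i \<omega>)\<^sup>2) = 1"
    and Z4: "\<And>i. i < a \<Longrightarrow> integrable M (\<lambda>\<omega>. (Z i \<omega>) ^ 4) \<and> expectation (\<lambda>\<omega>. (Z i \<omega>) ^ 4) \<le> m4"
begin

lemma Z_measurable: "i < a \<Longrightarrow> Z i \<in> borel_measurable M"
  using Z1 by blast

lemma linear_form_moments: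
  assumes "m \<le> a"
  shows "integrable M (\<lambda>\<omega>. (\<Sum>k<m. v k * Z k \<omega>)\<^sup>2)"
    and "expectation (\<lambda>\<omega>. (\<Sum>k<m. v k * Z k \<omega>)\<^sup>2) = (\<Sum>k<m. (v k)\<^sup>2)"
    and "integrable M (\<lambda>\<omega>. \<Sum>k<m. v k * Z k \<omega>)"
    and "expectation (\<lambda>\<omega>. \<Sum>k<m. v k * Z k \<omega>) = 0"
proof -
  have l1: "integrable M (\<lambda>\<omega>. \<Sum>k<m. v k * Z k \<omega>)" if "m \<le> a" for m
    using Z1 that by (intro Bochner_Integration.integrable_sum) auto
  show "integrable M (\<lambda>\<omega>. \<Sum>k<m. v k * Z k \<omega>)" by (rule l1[OF assms])
  show "expectation (\<lambda>\<omega>. \<Sum>k<m. v k * Z k \<omega>) = 0"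
    using Z1 assms by (subst Bochner_Integration.integral_sum) auto
  have "integrable M (\<lambda>\<omega>. (\<Sum>k<m. v k * Z k \<omega>)\<^sup>2) \<and>
    expectation (\<lambda>\<omega>. (\<Sum>k<m. v k * Z k \<omega>)\<^sup>2) = (\<Sum>k<m. (v k)\<^sup>2)"
    using assms
  proof (induction m)
    case (Suc m)
    then have m: "m < a" by simp
    have Gm: "(\<lambda>z. \<Sum>k<m. v k * z k) \<in> borel_measurable (PiM {..<m} (\<lambda>_. borel))"
      by (intro borel_measurable_sum borel_measurable_times borel_measurable_const measurable_component_singleton) auto
    have eq: "(\<Sum>k<m. v k * (\<lambda>i\<in>{..<m}. Z i \<omega>) k) = (\<Sum>k<m. v k * Z k \<omega>)" for \<omega>
      by (intro sum.cong) auto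
    have f: "integrable M (\<lambda>\<omega>. Z m \<omega> * (\<Sum>k<m. v k * Z k \<omega>))"
      "expectation (\<lambda>\<omega>. Z m \<omega> * (\<Sum>k<m. v k * Z k \<omega>)) = 0"
      using indep_prefix_factor[OF ind m _ _ Gm, of "\<lambda>x. x"] Z1[OF m] l1[of m] m by (simp_all add: eq)
    have e: "(\<Sum>k<Suc m. v k * Z k \<omega>)\<^sup>2 = (\<Sum>k<m. v k * Z k \<omega>)\<^sup>2
        + 2 * v m * (Z m \<omega> * (\<Sum>k<m. v k * Z k \<omega>)) + (v m)\<^sup>2 * (Z m \<omega>)\<^sup>2" for \<omega>
      by (simp add: power2_eq_square algebra_simps)
    show ?case using Suc f Z2[OF m] by (simp only: e) simp
  qed simp
  then show "integrable M (\<lambda>\<omega>. (\<Sum>k<m. v k * Z k \<omega>)\<^sup>2)"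
    "expectation (\<lambda>\<omega>. (\<Sum>k<m. v k * Z k \<omega>)\<^sup>2) = (\<Sum>k<m. (v k)\<^sup>2)" by auto
qed

text \<open>The squared variable has mean \<open>1\<close> and nonnegative variance. Used to compare
  the constant \<open>4\<close> with \<open>2 * (m4 + 2)\<close> in the variance bound
  below.\<close>

lemma m4_ge_1: "0 < a \<Longrightarrow> 1 \<le> m4"
proof -
  assume "0 < a"
  note z2 = Z2[OF this] and z4 = Z4[OF this]
  have "0 \<le> expectation (\<lambda>\<omega>. ((Z 0 \<omega>)\<^sup>2 - 1)\<^sup>2)" by (intro integral_nonneg_AE) simp
  also have "(\<lambda>\<omega>. ((Z 0 \<omega>)\<^sup>2 - 1)\<^sup>2) = (\<lambda>\<omega>. (Z 0 \<omega>) ^ 4 - 2 * (Z 0 \<omega>)\<^sup>2 + 1)"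
    by (simp add: power2_eq_square power4_eq_xxxx algebra_simps)
  also have "expectation \<dots> = expectation (\<lambda>\<omega>. (Z 0 \<omega>) ^ 4) - 1" using z2 z4 by (simp add: prob_space)
  finally show ?thesis using z4 by linarith
qed

text \<open>Adding index \<open>m\<close> changes the centred form by \<open>2 * Z m * L\<close>
  plus \<open>B m m * ((Z m)^2 - 1)\<close>, where \<open>L\<close> is linear in the earlier
  variables. After squaring, the mixed terms have mean zero, and what is added is \<open>4\<close>
  times the squared norm of the new off-diagonal row and a diagonal term governed by the fourth
  moment.\<close>

lemma quadratic_form_variance:
  assumes sym: "\<And>i k. i < a \<Longrightarrow> k < a \<Longrightarrow> B i k = B k i"
  shows "integrable M (\<lambda>\<omega>. ((\<Sum>i<a. \<Sum>k<a. B i k * Z i \<omega> * Z k \<omega>) - (\<Sum>i<a. B i i))\<^sup>2)"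
    and "expectation (\<lambda>\<omega>. ((\<Sum>i<a. \<Sum>k<a. B i k * Z i \<omega> * Z k \<omega>) - (\<Sum>i<a. B i i))\<^sup>2)
      \<le> (m4 + 2) * (\<Sum>i<a. \<Sum>k<a. (B i k)\<^sup>2)"
proof -
  define q where "q m z = (\<Sum>i<m. \<Sum>k<m. B i k * z i * z k) - (\<Sum>i<m. B i i)" for m :: nat and z :: "nat \<Rightarrow> real"
  define Zf where "Zf \<omega> = (\<lambda>i. Z i \<omega>)" for \<omega>
  have "integrable M (\<lambda>\<omega>. (q m (Zf \<omega>))\<^sup>2) \<and>
    expectation (\<lambda>\<omega>. (q m (Zf \<omega>))\<^sup>2) \<le> (m4 + 2) * (\<Sum>i<m. \<Sum>k<m. (B i k)\<^sup>2)" if "m \<le> a" for m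
    using that
  proof (induction m)
    case (Suc m)
    then have m: "m < a" by simp
    define L where "L z = (\<Sum>k<m. B m k * z k)" for z :: "nat \<Rightarrow> real"
    let ?b = "B m m"
    have Lm: "L \<in> borel_measurable (PiM {..<m} (\<lambda>_. borel))" unfolding L_def
      by (intro borel_measurable_sum borel_measurable_times borel_measurable_const measurable_component_singleton) auto
    have qm: "q m \<in> borel_measurable (PiM {..<m} (\<lambda>_. borel))" unfolding q_def
      by (intro borel_measurable_diff borel_measurable_sum borel_measurable_times borel_measurable_const
          measurable_component_singleton) auto
    have Lr: "L (\<lambda>i\<in>{..<m}. Z i \<omega>) = L (Zf \<omega>)" for \<omega>
      unfolding L_def Zf_def by (intro sum.cong) auto
    have qr: "q m (\<lambda>i\<in>{..<m}. Z i \<omega>) = q m (Zf \<omega>)" for \<omega>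
      unfolding q_def Zf_def by (intro arg_cong2[where f="(-)"] sum.cong) auto
    have rm: "(\<lambda>\<omega>. \<lambda>i\<in>{..<m}. Z i \<omega>) \<in> M \<rightarrow>\<^sub>M PiM {..<m} (\<lambda>_. borel)"
      using m by (intro measurable_restrict Z_measurable) auto
    have LM: "(\<lambda>\<omega>. L (Zf \<omega>)) \<in> borel_measurable M" using measurable_compose[OF rm Lm] by (simp add: Lr)
    have qM: "(\<lambda>\<omega>. q m (Zf \<omega>)) \<in> borel_measurable M" using measurable_compose[OF rm qm] by (simp add: qr)
    have IH: "integrable M (\<lambda>\<omega>. (q m (Zf \<omega>))\<^sup>2)"
      "expectation (\<lambda>\<omega>. (q m (Zf \<omega>))\<^sup>2) \<le> (m4 + 2) * (\<Sum>i<m. \<Sum>k<m. (B i k)\<^sup>2)" using Suc by auto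
    have L: "integrable M (\<lambda>\<omega>. (L (Zf \<omega>))\<^sup>2)" "expectation (\<lambda>\<omega>. (L (Zf \<omega>))\<^sup>2) = (\<Sum>k<m. (B m k)\<^sup>2)"
      "integrable M (\<lambda>\<omega>. L (Zf \<omega>))" "expectation (\<lambda>\<omega>. L (Zf \<omega>)) = 0"
      using linear_form_moments[of m "B m"] m by (auto simp: L_def Zf_def)
    have Lq: "integrable M (\<lambda>\<omega>. L (Zf \<omega>) * q m (Zf \<omega>))"
      by (rule integrable_mult_of_squares[OF LM L(1) qM IH(1)])
    have q1: "integrable M (\<lambda>\<omega>. q m (Zf \<omega>))" by (rule integrable_of_square[OF qM IH(1)])
    note z1 = Z1[OF m] and z2 = Z2[OF m] and z4 = Z4[OF m]
    have z3: "integrable M (\<lambda>\<omega>. (Z m \<omega>) ^ 3)"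
    proof -
      have "integrable M (\<lambda>\<omega>. Z m \<omega> * (Z m \<omega>)\<^sup>2)"
        using z1 z2 z4 by (intro integrable_mult_of_squares) (auto simp flip: power_mult)
      then show ?thesis by (simp add: power3_eq_cube power2_eq_square mult.assoc)
    qed
    have F1: "integrable M (\<lambda>\<omega>. (Z m \<omega>)\<^sup>2 * (L (Zf \<omega>))\<^sup>2)"
      "expectation (\<lambda>\<omega>. (Z m \<omega>)\<^sup>2 * (L (Zf \<omega>))\<^sup>2) = (\<Sum>k<m. (B m k)\<^sup>2)"
      using indep_prefix_factor[OF ind m, of "\<lambda>x. x\<^sup>2" "\<lambda>z. (L z)\<^sup>2"] Lm z2 L by (simp_all add: Lr)
    have F2: "integrable M (\<lambda>\<omega>. Z m \<omega> * (L (Zf \<omega>) * q m (Zf \<omega>)))"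
      "expectation (\<lambda>\<omega>. Z m \<omega> * (L (Zf \<omega>) * q m (Zf \<omega>))) = 0"
      using indep_prefix_factor[OF ind m, of "\<lambda>x. x" "\<lambda>z. L z * q m z"] Lm qm z1 Lq by (simp_all add: Lr qr)
    have F3: "integrable M (\<lambda>\<omega>. ((Z m \<omega>)\<^sup>2 - 1) * q m (Zf \<omega>))"
      "expectation (\<lambda>\<omega>. ((Z m \<omega>)\<^sup>2 - 1) * q m (Zf \<omega>)) = 0"
      using indep_prefix_factor[OF ind m, of "\<lambda>x. x\<^sup>2 - 1" "q m"] qm z2 q1 by (simp_all add: qr prob_space)
    \<comment> \<open>This mean vanishes because \<open>L\<close> is centred; the third moment of
      \<open>Z m\<close> may be anything.\<close>
    have F4: "integrable M (\<lambda>\<omega>. ((Z m \<omega>) ^ 3 - Z m \<omega>) * L (Zf \<omega>))"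
      "expectation (\<lambda>\<omega>. ((Z m \<omega>) ^ 3 - Z m \<omega>) * L (Zf \<omega>)) = 0"
      using indep_prefix_factor[OF ind m, of "\<lambda>x. x ^ 3 - x" L] Lm z3 z1 L by (simp_all add: Lr)
    have e1: "q (Suc m) (Zf \<omega>) = q m (Zf \<omega>) + 2 * (Z m \<omega> * L (Zf \<omega>)) + ?b * ((Z m \<omega>)\<^sup>2 - 1)" for \<omega>
    proof -
      have "(\<Sum>i<m. B i m * Zf \<omega> i * Zf \<omega> m) = (\<Sum>k<m. B m k * Zf \<omega> m * Zf \<omega> k)"
        using sym m by (intro sum.cong) (auto simp: mult_ac)
      also have "\<dots> = Z m \<omega> * L (Zf \<omega>)" by (simp add: L_def Zf_def sum_distrib_left mult_ac)
      finally have *: "(\<Sum>i<m. B i m * Zf \<omega> i * Zf \<omega> m) = Z m \<omega> * L (Zf \<omega>)" .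
      have **: "(\<Sum>k<m. B m k * Zf \<omega> m * Zf \<omega> k) = Z m \<omega> * L (Zf \<omega>)"
        by (simp add: L_def Zf_def sum_distrib_left mult_ac)
      have "q (Suc m) (Zf \<omega>) = q m (Zf \<omega>) + (\<Sum>i<m. B i m * Zf \<omega> i * Zf \<omega> m)
          + (\<Sum>k<m. B m k * Zf \<omega> m * Zf \<omega> k) + (?b * Zf \<omega> m * Zf \<omega> m - ?b)"
        by (simp add: q_def sum.distrib)
      then show ?thesis unfolding * ** by (simp add: Zf_def power2_eq_square algebra_simps)
    qed
    have e: "(q (Suc m) (Zf \<omega>))\<^sup>2 = (q m (Zf \<omega>))\<^sup>2 + 4 * ((Z m \<omega>)\<^sup>2 * (L (Zf \<omega>))\<^sup>2)
        + ?b\<^sup>2 * ((Z m \<omega>) ^ 4 - 2 * (Z m \<omega>)\<^sup>2 + 1) + 4 * (Z m \<omega> * (L (Zf \<omega>) * q m (Zf \<omega>)))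
        + 2 * ?b * (((Z m \<omega>)\<^sup>2 - 1) * q m (Zf \<omega>)) + 4 * ?b * (((Z m \<omega>) ^ 3 - Z m \<omega>) * L (Zf \<omega>))" for \<omega>
      unfolding e1 by (simp add: power2_eq_square power4_eq_xxxx power3_eq_cube algebra_simps)
    have I: "integrable M (\<lambda>\<omega>. (q (Suc m) (Zf \<omega>))\<^sup>2)"
      unfolding e using IH F1 F2 F3 F4 z2 z4 by simp
    have "expectation (\<lambda>\<omega>. (q (Suc m) (Zf \<omega>))\<^sup>2) = expectation (\<lambda>\<omega>. (q m (Zf \<omega>))\<^sup>2)
        + 4 * (\<Sum>k<m. (B m k)\<^sup>2) + ?b\<^sup>2 * (expectation (\<lambda>\<omega>. (Z m \<omega>) ^ 4) - 1)"
      unfolding e using IH F1 F2 F3 F4 z2 z4 by (simp add: prob_space)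
    also have "\<dots> \<le> (m4 + 2) * (\<Sum>i<m. \<Sum>k<m. (B i k)\<^sup>2) + (m4 + 2) * (2 * (\<Sum>k<m. (B m k)\<^sup>2)) + ?b\<^sup>2 * (m4 + 2)"
    proof (intro add_mono IH)
      have "0 \<le> (\<Sum>k<m. (B m k)\<^sup>2)" by (intro sum_nonneg) auto
      then show "4 * (\<Sum>k<m. (B m k)\<^sup>2) \<le> (m4 + 2) * (2 * (\<Sum>k<m. (B m k)\<^sup>2))"
        using m4_ge_1 m mult_right_mono[of 4 "(m4 + 2) * 2" "\<Sum>k<m. (B m k)\<^sup>2"]
        by (simp only: mult.assoc) simp
      show "?b\<^sup>2 * (expectation (\<lambda>\<omega>. (Z m \<omega>) ^ 4) - 1) \<le> ?b\<^sup>2 * (m4 + 2)"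
        using z4 by (intro mult_left_mono) auto
    qed
    also have "\<dots> = (m4 + 2) * (\<Sum>i<Suc m. \<Sum>k<Suc m. (B i k)\<^sup>2)"
    proof -
      have "(\<Sum>i<m. (B i m)\<^sup>2) = (\<Sum>k<m. (B m k)\<^sup>2)" using sym m by (intro sum.cong) auto
      then show ?thesis by (simp add: sum.distrib algebra_simps)
    qed
    finally show ?case using I by blast
  qed (simp add: q_def)
  from this[of a] show "integrable M (\<lambda>\<omega>. ((\<Sum>i<a. \<Sum>k<a. B i k * Z i \<omega> * Z k \<omega>) - (\<Sum>i<a. B i i))\<^sup>2)"
    and "expectation (\<lambda>\<omega>. ((\<Sum>i<a. \<Sum>k<a. B i k * Z i \<omega> * Z k \<omega>) - (\<Sum>i<a. B i i))\<^sup>2)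
      \<le> (m4 + 2) * (\<Sum>i<a. \<Sum>k<a. (B i k)\<^sup>2)"
    by (simp_all add: q_def Zf_def)
qed

end

end

section \<open>Random matrices with a variance profile\<close>

text \<open>Rows and columns play symmetric roles in these assumptions, so an interpretation at the
  transpose turns every estimate for one Gram matrix into an estimate for the other. The entries may
  have different laws; \<open>m4\<close> is a common bound.\<close>

locale random_matrix = prob_space M for M :: "'a measure" +
  fixes Z :: "nat \<times> nat \<Rightarrow> 'a \<Rightarrow> real" and a b :: nat and g :: "nat \<Rightarrow> nat \<Rightarrow> real" and G m4 :: real
  assumes ind: "indep_vars (\<lambda>_. borel) Z ({..<a} \<times> {..<b})"
    and Z1: "\<And>i j. i < a \<Longrightarrow> j < b \<Longrightarrow> integrable M (Z (i, j)) \<and> expectation (Z (i, j)) = 0"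
    and Z2: "\<And>i j. i < a \<Longrightarrow> j < b \<Longrightarrow>
      integrable M (\<lambda>\<omega>. (Z (i, j) \<omega>)\<^sup>2) \<and> expectation (\<lambda>\<omega>. (Z (i, j) \<omega>)\<^sup>2) = 1"
    and Z4: "\<And>i j. i < a \<Longrightarrow> j < b \<Longrightarrow>
      integrable M (\<lambda>\<omega>. (Z (i, j) \<omega>) ^ 4) \<and> expectation (\<lambda>\<omega>. (Z (i, j) \<omega>) ^ 4) \<le> m4"
    and g_le: "\<And>i j. i < a \<Longrightarrow> j < b \<Longrightarrow> \<bar>g i j\<bar> \<le> G"
    and G_pos: "G > 0" and a_pos: "a > 0" and b_pos: "b > 0"
begin

definition X :: "'a \<Rightarrow> nat \<Rightarrow> nat \<Rightarrow> real" where
  "X \<omega> i j = g i j * Z (i, j) \<omega>"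

lemma Z_measurable: "i < a \<Longrightarrow> j < b \<Longrightarrow> Z (i, j) \<in> borel_measurable M"
  using Z1 by blast

lemma X_measurable: "i < a \<Longrightarrow> j < b \<Longrightarrow> (\<lambda>\<omega>. X \<omega> i j) \<in> borel_measurable M"
  using Z_measurable unfolding X_def by simp

lemma transpose: "random_matrix M (\<lambda>(j, i). Z (i, j)) b a (\<lambda>j i. g i j) G m4"
proof -
  have "indep_vars (\<lambda>_. borel) (\<lambda>p. Z (prod.swap p)) ({..<b} \<times> {..<a})"
    by (rule indep_vars_reindex[OF ind]) auto
  moreover have "(\<lambda>p. Z (prod.swap p)) = (\<lambda>(j, i). Z (i, j))" by auto
  ultimately show ?thesis
    using Z1 Z2 Z4 g_le G_pos a_pos b_pos by unfold_locales auto
qed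

lemma X_transpose: "random_matrix.X (\<lambda>(j, i). Z (i, j)) (\<lambda>j i. g i j) \<omega> j i = X \<omega> i j"
  by (simp add: X_def random_matrix.X_def[OF transpose])

lemma g_sq_le: "i < a \<Longrightarrow> j < b \<Longrightarrow> (g i j)\<^sup>2 \<le> G\<^sup>2"
  using g_le[of i j] G_pos by (simp add: abs_le_square_iff[symmetric])

context
  fixes s x :: real
  assumes s0: "s \<ge> 0" and x0: "x > 0"
begin

lemma res_random_measurable:
  "j < b \<Longrightarrow> k < b \<Longrightarrow> (\<lambda>\<omega>. res s x a b (X \<omega>) j k) \<in> borel_measurable M"
  by (rule res_measurable[OF s0 x0 X_measurable])

lemma res_diag_integrable: "j < b \<Longrightarrow> integrable M (\<lambda>\<omega>. res s x a b (X \<omega>) j j)"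
  using res_random_measurable res_abs_le[OF s0 x0] by (intro integrable_const_bound[where B="1 / x"]) auto

text \<open>The weighted traces have bounded differences as functions of the independent rows.\<close>

lemma weighted_trace_concentration:
  assumes d: "\<And>j. j < b \<Longrightarrow> 0 \<le> d j \<and> d j \<le> D" and D: "D > 0"
  defines "F \<equiv> \<lambda>\<omega>. \<Sum>j<b. d j * res s x a b (X \<omega>) j j"
  shows "expectation (\<lambda>\<omega>. (F \<omega> - expectation F)\<^sup>2) \<le> 4 * (D / x)\<^sup>2 * a"
    and "expectation (\<lambda>\<omega>. (F \<omega> - expectation F) ^ 4) \<le> 48 * (D / x) ^ 4 * (real a)\<^sup>2"
    and "F \<in> borel_measurable M"
    and "\<And>\<omega>. \<bar>F \<omega>\<bar> \<le> b * (D / x)"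
proof -
  \<comment> \<open>Each row is one block: the independent coordinates of the bounded difference
    argument are the \<open>a\<close> rows and not the single entries, which have no bounded
    influence bound of their own here.\<close>
  define B where "B i = {i} \<times> {..<b}" for i :: nat
  define N where "N i = (PiM (B i) (\<lambda>_. borel) :: (nat \<times> nat \<Rightarrow> real) measure)" for i
  define Y where "Y i \<omega> = restrict (\<lambda>p. Z p \<omega>) (B i)" for i \<omega>
  define f where "f y = (\<Sum>j<b. d j * res s x a b (\<lambda>i j. g i j * y i (i, j)) j j)" for y :: "nat \<Rightarrow> nat \<times> nat \<Rightarrow> real"
  have indY: "indep_vars N Y {..<a}"
    unfolding N_def Y_def by (rule indep_vars_restrict[OF ind]) (auto simp: B_def disjoint_family_on_def)
  have fm: "f \<in> borel_measurable (PiM {..<a} N)"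
    unfolding f_def
  proof (intro borel_measurable_sum borel_measurable_times borel_measurable_const res_measurable[OF s0 x0])
    fix i j assume "i < a" "j < b"
    then have "(\<lambda>y. y i) \<in> PiM {..<a} N \<rightarrow>\<^sub>M N i" "(\<lambda>z. z (i, j)) \<in> borel_measurable (N i)"
      unfolding N_def B_def by (auto intro: measurable_component_singleton)
    then show "(\<lambda>y. y i (i, j)) \<in> borel_measurable (PiM {..<a} N)" by (rule measurable_compose)
  qed auto
  have sum_bd: "\<bar>\<Sum>j<b. d j * res s x a b W j j\<bar> \<le> b * (D / x)" for W
  proof -
    have "\<bar>\<Sum>j<b. d j * res s x a b W j j\<bar> \<le> (\<Sum>j<b. D * (1 / x))"
    proof (rule order_trans[OF sum_abs sum_mono])
      fix j assume j: "j \<in> {..<b}"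
      have "\<bar>d j\<bar> * \<bar>res s x a b W j j\<bar> \<le> D * (1 / x)"
        using j d[of j] D res_abs_le[OF s0 x0, of j b j a W] by (intro mult_mono) auto
      then show "\<bar>d j * res s x a b W j j\<bar> \<le> D * (1 / x)" by (simp add: abs_mult)
    qed
    then show ?thesis by simp
  qed
  have fb: "\<bar>f y\<bar> \<le> b * (D / x)" for y unfolding f_def by (rule sum_bd)
  have fd: "\<bar>f y - f z\<bar> \<le> D / x" if "i \<in> {..<a}" "\<And>l. l \<in> {..<a} \<Longrightarrow> l \<noteq> i \<Longrightarrow> y l = z l" for y z i
    unfolding f_def using that d D by (intro weighted_trace_row_changed[OF s0 x0, of i]) auto
  have F: "F = (\<lambda>\<omega>. f (\<lambda>i\<in>{..<a}. Y i \<omega>))"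
    unfolding F_def f_def X_def
    by (intro ext sum.cong refl arg_cong2[where f="(*)"] res_cong) (auto simp: Y_def B_def)
  have c: "D / x > 0" using D x0 by simp
  have K: "finite {..<a}" "{..<a} \<noteq> {}" using a_pos by (auto simp: lessThan_empty_iff)
  note m = bounded_differences_moments[OF indY K fm fb fd c, unfolded card_lessThan]
  show "expectation (\<lambda>\<omega>. (F \<omega> - expectation F)\<^sup>2) \<le> 4 * (D / x)\<^sup>2 * a"
    unfolding F by (rule m(1))
  show "expectation (\<lambda>\<omega>. (F \<omega> - expectation F) ^ 4) \<le> 48 * (D / x) ^ 4 * (real a)\<^sup>2"
    unfolding F by (rule m(2)[unfolded of_nat_power])
  show "F \<in> borel_measurable M" unfolding F by (rule m(3))
  show "\<And>\<omega>. \<bar>F \<omega>\<bar> \<le> b * (D / x)" unfolding F_def by (rule sum_bd)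
qed

end

text \<open>In the Schur complement formula the quadratic form in column \<open>j\<close> is replaced successively by the
  trace against the resolvent without that column, by the full trace, and by its expectation.\<close>

lemma expected_resolvent_approx_equation:
  assumes s0: "s > 0" and x0: "x > 0" and j: "j < b"
  defines "u \<equiv> s * (\<Sum>i<a. (g i j)\<^sup>2 * expectation (\<lambda>\<omega>. res s x b a (\<lambda>j i. X \<omega> i j) i i))"
  shows "\<bar>expectation (\<lambda>\<omega>. res s x a b (X \<omega>) j j) - 1 / (x * (1 + u))\<bar>
    \<le> s * G\<^sup>2 / x\<^sup>2 * (sqrt ((m4 + 2) * a) + 1 + 2 * sqrt b)"
proof -
  have s0': "s \<ge> 0" using s0 by simp
  interpret T: random_matrix M "\<lambda>(j, i). Z (i, j)" b a "\<lambda>j i. g i j" G m4 by (rule transpose)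
  have TX: "T.X \<omega> = (\<lambda>j i. X \<omega> i j)" for \<omega> by (intro ext) (rule X_transpose)
  define Q where "Q \<omega> = res s x a b (X \<omega>) j j" for \<omega>
  define Qt where "Qt \<omega> i = res s x b a (\<lambda>j i. X \<omega> i j) i i" for \<omega> i
  define Q0 where "Q0 \<omega> = res s x b a ((\<lambda>j i. X \<omega> i j)(j := (\<lambda>_. 0)))" for \<omega>
  define \<tau> where "\<tau> \<omega> = s * (\<Sum>i<a. X \<omega> i j * (\<Sum>k<a. Q0 \<omega> i k * X \<omega> k j))" for \<omega>
  define V where "V \<omega> = s * (\<Sum>i<a. (g i j)\<^sup>2 * Q0 \<omega> i i)" for \<omega>
  define W where "W \<omega> = (\<Sum>i<a. (g i j)\<^sup>2 * Qt \<omega> i)" for \<omega>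
  define U where "U \<omega> = s * W \<omega>" for \<omega>
  have X0m: "(\<lambda>\<omega>. ((\<lambda>j i. X \<omega> i j)(j := (\<lambda>_. 0))) l i) \<in> borel_measurable M" if "l < b" "i < a" for l i
    using X_measurable[OF that(2,1)] by (cases "l = j") auto
  have Q0m: "(\<lambda>\<omega>. Q0 \<omega> i k) \<in> borel_measurable M" if "i < a" "k < a" for i k
    unfolding Q0_def using res_measurable[OF s0' x0 X0m that] .
  have Qtm: "(\<lambda>\<omega>. Qt \<omega> i) \<in> borel_measurable M" if "i < a" for i
    unfolding Qt_def using T.res_random_measurable[OF s0' x0 that that] by (simp add: TX)
  have [measurable]: "V \<in> borel_measurable M" "U \<in> borel_measurable M" "\<tau> \<in> borel_measurable M"
    unfolding V_def U_def W_def \<tau>_def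
    by (intro borel_measurable_times borel_measurable_const borel_measurable_sum Q0m Qtm X_measurable; use j in auto)+
  have schur: "Q \<omega> = 1 / (x * (1 + \<tau> \<omega>))" "0 \<le> \<tau> \<omega>" for \<omega>
    unfolding Q_def \<tau>_def Q0_def using res_diag_schur[OF s0' x0 j, where a=a and X="X \<omega>"] by auto
  have G2: "0 \<le> (g i j)\<^sup>2 \<and> (g i j)\<^sup>2 \<le> G\<^sup>2" if "i < a" for i using g_sq_le[OF that j] by simp

  \<comment> \<open>\<open>e1\<close> and \<open>e3\<close> are the square roots of the variance
    bounds for the first and the last replacement; the middle one costs \<open>s * G^2 / x\<close>
    deterministically.\<close>
  define e1 where "e1 = s * G\<^sup>2 / x * sqrt ((m4 + 2) * a)"
  define e3 where "e3 = s * G\<^sup>2 / x * (2 * sqrt b)"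
  have m4: "m4 + 2 > 0"
  proof -
    have "0 \<le> expectation (\<lambda>\<omega>. (Z (0, 0) \<omega>) ^ 4)" by (intro integral_nonneg_AE) simp
    then show ?thesis using Z4[OF a_pos b_pos] by linarith
  qed
  have e1: "e1 > 0" and e3: "e3 > 0"
    using s0 x0 G_pos m4 a_pos b_pos by (auto simp: e1_def e3_def)

  \<comment> \<open>With the other columns frozen at \<open>y\<close> the matrix of the quadratic
    form is deterministic, and the variance bound does not depend on \<open>y\<close>. Independence
    of column \<open>j\<close> from the remaining entries then lifts the freezing.\<close>
  have quad: "(\<integral>\<^sup>+\<omega>. ennreal ((\<tau> \<omega> - V \<omega>)\<^sup>2) \<partial>M) \<le> ennreal (e1\<^sup>2)"
  proof -
    define A where "A = {..<a} \<times> {j}"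
    define C where "C = {..<a} \<times> ({..<b} - {j})"
    define q where "q y = res s x b a ((\<lambda>l i. g i l * y (i, l))(j := (\<lambda>_. 0)))" for y :: "nat \<times> nat \<Rightarrow> real"
    define \<Phi> where "\<Phi> = (\<lambda>(z, y). (s * (\<Sum>i<a. g i j * z (i, j) * (\<Sum>k<a. q y i k * (g k j * z (k, j))))
       - s * (\<Sum>i<a. (g i j)\<^sup>2 * q y i i))\<^sup>2)"
    define Y0 where "Y0 \<omega> = restrict (\<lambda>p. Z p \<omega>) A" for \<omega>
    define Y1 where "Y1 \<omega> = restrict (\<lambda>p. Z p \<omega>) C" for \<omega>
    let ?S = "PiM A (\<lambda>_. borel) :: (nat \<times> nat \<Rightarrow> real) measure"
    let ?T = "PiM C (\<lambda>_. borel) :: (nat \<times> nat \<Rightarrow> real) measure"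
    have iv: "indep_var ?S Y0 ?T Y1"
      unfolding Y0_def Y1_def using j by (intro indep_var_restrict[OF ind]) (auto simp: A_def C_def)
    have zm: "(\<lambda>p. fst p (i, j)) \<in> borel_measurable (?S \<Otimes>\<^sub>M ?T)" if "i < a" for i
      using that by (intro measurable_compose[OF measurable_fst measurable_component_singleton]) (auto simp: A_def)
    have qm: "(\<lambda>y. q y i k) \<in> borel_measurable ?T" if "i < a" "k < a" for i k
      unfolding q_def
    proof (rule res_measurable[OF s0' x0 _ that])
      fix l i assume "l < b" "i < a"
      then show "(\<lambda>y. ((\<lambda>l i. g i l * y (i, l))(j := (\<lambda>_. 0))) l i) \<in> borel_measurable ?T"
        by (cases "l = j") (auto simp: C_def intro!: borel_measurable_times measurable_component_singleton)
    qed
    have qm': "(\<lambda>p. q (snd p) i k) \<in> borel_measurable (?S \<Otimes>\<^sub>M ?T)" if "i < a" "k < a" for i k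
      by (rule measurable_compose[OF measurable_snd qm[OF that]])
    have \<Phi>m: "\<Phi> \<in> borel_measurable (?S \<Otimes>\<^sub>M ?T)"
      unfolding \<Phi>_def case_prod_unfold
      by (intro borel_measurable_power borel_measurable_diff borel_measurable_times borel_measurable_const
          borel_measurable_sum zm qm') auto
    have bound: "(\<integral>\<^sup>+\<omega>. ennreal (\<Phi> (Y0 \<omega>, y)) \<partial>M) \<le> ennreal (e1\<^sup>2)" for y
    proof -
      define B where "B i k = s * g i j * g k j * q y i k" for i k
      have sym: "B i k = B k i" if "i < a" "k < a" for i k
        using res_commute[OF s0' x0 that] by (simp add: B_def q_def)
      have ind': "indep_vars (\<lambda>_. borel) (\<lambda>i. Z (i, j)) {..<a}"
        by (rule indep_vars_reindex[OF ind]) (use j in \<open>auto simp: inj_on_def\<close>)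
      have quad: "integrable M (\<lambda>\<omega>. ((\<Sum>i<a. \<Sum>k<a. B i k * Z (i, j) \<omega> * Z (k, j) \<omega>) - (\<Sum>i<a. B i i))\<^sup>2)"
        "expectation (\<lambda>\<omega>. ((\<Sum>i<a. \<Sum>k<a. B i k * Z (i, j) \<omega> * Z (k, j) \<omega>) - (\<Sum>i<a. B i i))\<^sup>2)
          \<le> (m4 + 2) * (\<Sum>i<a. \<Sum>k<a. (B i k)\<^sup>2)"
        by (rule quadratic_form_variance[OF ind', where ?m4.0=m4]; rule Z1[OF _ j] Z2[OF _ j] Z4[OF _ j] sym; assumption)+
      have eq: "\<Phi> (Y0 \<omega>, y) = ((\<Sum>i<a. \<Sum>k<a. B i k * Z (i, j) \<omega> * Z (k, j) \<omega>) - (\<Sum>i<a. B i i))\<^sup>2" for \<omega>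
        by (simp add: \<Phi>_def B_def Y0_def A_def sum_distrib_left power2_eq_square mult_ac)
      \<comment> \<open>Up to bounded factors a row of \<open>B\<close> is a column of a resolvent,
        of norm at most \<open>1 / x\<close>. Hence the sum of all squares grows like
        \<open>a\<close> and not like \<open>a^2\<close>.\<close>
      have "(\<Sum>k<a. (B i k)\<^sup>2) \<le> s\<^sup>2 * G ^ 4 / x\<^sup>2" if i: "i < a" for i
      proof -
        have "(\<Sum>k<a. (B i k)\<^sup>2) \<le> (\<Sum>k<a. s\<^sup>2 * G ^ 4 * (q y k i)\<^sup>2)"
        proof (rule sum_mono)
          fix k assume k: "k \<in> {..<a}"
          have "(g i j)\<^sup>2 * (g k j)\<^sup>2 \<le> G\<^sup>2 * G\<^sup>2" using G2 i k by (intro mult_mono) auto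
          then have "s\<^sup>2 * ((g i j)\<^sup>2 * (g k j)\<^sup>2) * (q y k i)\<^sup>2 \<le> s\<^sup>2 * (G\<^sup>2 * G\<^sup>2) * (q y k i)\<^sup>2"
            by (intro mult_right_mono mult_left_mono) auto
          moreover have "q y k i = q y i k" using res_commute[OF s0' x0] i k by (simp add: q_def)
          ultimately show "(B i k)\<^sup>2 \<le> s\<^sup>2 * G ^ 4 * (q y k i)\<^sup>2"
            by (simp add: B_def power_mult_distrib mult.assoc flip: power_add)
        qed
        also have "\<dots> = s\<^sup>2 * G ^ 4 * (\<Sum>k<a. (q y k i)\<^sup>2)" by (simp add: sum_distrib_left)
        also have "\<dots> \<le> s\<^sup>2 * G ^ 4 * (1 / x\<^sup>2)"
          unfolding q_def using G_pos by (intro mult_left_mono res_col_norm[OF s0' x0 i]) auto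
        finally show ?thesis by simp
      qed
      then have "(\<Sum>i<a. \<Sum>k<a. (B i k)\<^sup>2) \<le> (\<Sum>i<a. s\<^sup>2 * G ^ 4 / x\<^sup>2)" by (intro sum_mono) auto
      then have "(m4 + 2) * (\<Sum>i<a. \<Sum>k<a. (B i k)\<^sup>2) \<le> (m4 + 2) * (a * (s\<^sup>2 * G ^ 4 / x\<^sup>2))"
        using m4 by (intro mult_left_mono) auto
      also have "\<dots> = e1\<^sup>2" using m4 by (simp add: e1_def power_mult_distrib power_divide mult_ac)
      finally have le: "expectation (\<lambda>\<omega>. \<Phi> (Y0 \<omega>, y)) \<le> e1\<^sup>2" using quad(2) unfolding eq by linarith
      have "(\<integral>\<^sup>+\<omega>. ennreal (\<Phi> (Y0 \<omega>, y)) \<partial>M) = ennreal (expectation (\<lambda>\<omega>. \<Phi> (Y0 \<omega>, y)))"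
        using quad(1) unfolding eq by (intro nn_integral_eq_integral) auto
      then show ?thesis using le by (simp add: ennreal_leI)
    qed
    have "q (Y1 \<omega>) = Q0 \<omega>" for \<omega>
      unfolding q_def Q0_def by (intro ext res_cong) (auto simp: X_def Y1_def C_def)
    then have eq: "(\<tau> \<omega> - V \<omega>)\<^sup>2 = \<Phi> (Y0 \<omega>, Y1 \<omega>)" for \<omega>
      by (simp add: \<tau>_def V_def \<Phi>_def X_def Y0_def A_def)
    show ?thesis unfolding eq
      using indep_nn_integral_bound[OF iv, of "\<lambda>p. ennreal (\<Phi> p)"] \<Phi>m bound by simp
  qed
  have i1: "integrable M (\<lambda>\<omega>. (\<tau> \<omega> - V \<omega>)\<^sup>2)"
    using quad by (intro integrableI_bounded) (auto simp: less_top[symmetric] top_unique intro: le_less_trans)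
  have "ennreal (expectation (\<lambda>\<omega>. (\<tau> \<omega> - V \<omega>)\<^sup>2)) \<le> ennreal (e1\<^sup>2)"
    using quad i1 by (subst nn_integral_eq_integral[symmetric]) auto
  then have le1: "expectation (\<lambda>\<omega>. (\<tau> \<omega> - V \<omega>)\<^sup>2) \<le> e1\<^sup>2" by simp
  have m1: "(\<lambda>\<omega>. \<tau> \<omega> - V \<omega>) \<in> borel_measurable M" by simp
  note E1 = expectation_abs_le[OF m1 i1 le1 e1]

  \<comment> \<open>The rank-one bound for the transposed matrix, of which column \<open>j\<close>
    is a row.\<close>
  have E2: "\<bar>V \<omega> - U \<omega>\<bar> \<le> s * G\<^sup>2 / x" for \<omega>
  proof -
    have "\<bar>(\<Sum>i<a. (g i j)\<^sup>2 * Q0 \<omega> i i) - W \<omega>\<bar> \<le> G\<^sup>2 / x"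
      unfolding W_def Qt_def Q0_def using G2
      by (intro weighted_trace_row_changed[OF s0' x0 j]) auto
    then have "s * \<bar>(\<Sum>i<a. (g i j)\<^sup>2 * Q0 \<omega> i i) - W \<omega>\<bar> \<le> s * (G\<^sup>2 / x)"
      using s0' by (intro mult_left_mono)
    then show ?thesis using s0' by (simp add: V_def U_def abs_mult flip: right_diff_distrib)
  qed

  have Wc: "expectation (\<lambda>\<omega>. (W \<omega> - expectation W)\<^sup>2) \<le> 4 * (G\<^sup>2 / x)\<^sup>2 * b" "\<And>\<omega>. \<bar>W \<omega>\<bar> \<le> a * (G\<^sup>2 / x)"
    "W \<in> borel_measurable M"
    using T.weighted_trace_concentration[OF s0' x0, of "\<lambda>i. (g i j)\<^sup>2" "G\<^sup>2"] G2 G_pos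
    by (auto simp: W_def[abs_def] Qt_def TX)
  have Wi: "integrable M W" using Wc by (intro integrable_const_bound[where B="a * (G\<^sup>2 / x)"]) auto
  have EU: "u = s * expectation W"
  proof -
    have "integrable M (\<lambda>\<omega>. Qt \<omega> i)" if "i < a" for i
      using T.res_diag_integrable[OF s0' x0 that] by (simp add: Qt_def TX)
    then have "expectation W = (\<Sum>i<a. (g i j)\<^sup>2 * expectation (\<lambda>\<omega>. Qt \<omega> i))"
      unfolding W_def by (subst Bochner_Integration.integral_sum) auto
    then show ?thesis by (simp add: u_def Qt_def)
  qed
  have i3: "integrable M (\<lambda>\<omega>. (U \<omega> - u)\<^sup>2)"
  proof (rule integrable_const_bound)
    have "\<bar>U \<omega> - u\<bar> \<le> \<bar>s * (a * (G\<^sup>2 / x)) + \<bar>u\<bar>\<bar>" for \<omega>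
    proof -
      have "\<bar>U \<omega>\<bar> \<le> s * (a * (G\<^sup>2 / x))"
        using Wc(2)[of \<omega>] s0' by (simp only: U_def abs_mult abs_of_nonneg mult_left_mono)
      then show ?thesis by linarith
    qed
    then show "AE \<omega> in M. norm ((U \<omega> - u)\<^sup>2) \<le> (s * (a * (G\<^sup>2 / x)) + \<bar>u\<bar>)\<^sup>2"
      by (simp add: abs_le_square_iff)
  qed simp
  have le3: "expectation (\<lambda>\<omega>. (U \<omega> - u)\<^sup>2) \<le> e3\<^sup>2"
  proof -
    have "(U \<omega> - u)\<^sup>2 = s\<^sup>2 * (W \<omega> - expectation W)\<^sup>2" for \<omega>
      by (simp add: U_def EU power_mult_distrib flip: right_diff_distrib)
    then have "expectation (\<lambda>\<omega>. (U \<omega> - u)\<^sup>2) = s\<^sup>2 * expectation (\<lambda>\<omega>. (W \<omega> - expectation W)\<^sup>2)" by simp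
    also have "\<dots> \<le> s\<^sup>2 * (4 * (G\<^sup>2 / x)\<^sup>2 * b)" by (intro mult_left_mono Wc) auto
    also have "\<dots> = e3\<^sup>2" by (simp add: e3_def power_mult_distrib power_divide)
    finally show ?thesis .
  qed
  have m3: "(\<lambda>\<omega>. U \<omega> - u) \<in> borel_measurable M" by simp
  note E3 = expectation_abs_le[OF m3 i3 le3 e3]

  have u0: "u \<ge> 0" unfolding u_def
    using s0' G2 res_diag_nonneg[OF s0' x0]
    by (intro mult_nonneg_nonneg sum_nonneg integral_nonneg_AE) auto
  \<comment> \<open>As a function of a nonnegative \<open>y\<close>,
    \<open>1 / (x * (1 + y))\<close> is Lipschitz with constant \<open>1 / x\<close>, and both
    \<open>\<tau>\<close> and \<open>u\<close> are nonnegative.\<close>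
  have pt: "\<bar>Q \<omega> - 1 / (x * (1 + u))\<bar> \<le> 1 / x * (\<bar>\<tau> \<omega> - V \<omega>\<bar> + s * G\<^sup>2 / x + \<bar>U \<omega> - u\<bar>)" for \<omega>
  proof -
    have p: "1 + \<tau> \<omega> \<ge> 1" "1 + u \<ge> 1" using schur u0 by auto
    then have nz: "1 + \<tau> \<omega> \<noteq> 0" "1 + u \<noteq> 0" by auto
    have "Q \<omega> - 1 / (x * (1 + u)) = (1 / x) * ((u - \<tau> \<omega>) / ((1 + \<tau> \<omega>) * (1 + u)))"
    proof -
      have "1 / (x * (1 + \<tau> \<omega>)) - 1 / (x * (1 + u)) = (1 / x) * (1 / (1 + \<tau> \<omega>) - 1 / (1 + u))"
        by (simp add: right_diff_distrib)
      also have "1 / (1 + \<tau> \<omega>) - 1 / (1 + u) = (u - \<tau> \<omega>) / ((1 + \<tau> \<omega>) * (1 + u))"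
        using nz by (simp add: diff_frac_eq)
      finally show ?thesis by (simp add: schur)
    qed
    then have "\<bar>Q \<omega> - 1 / (x * (1 + u))\<bar> = (1 / x) * (\<bar>u - \<tau> \<omega>\<bar> / ((1 + \<tau> \<omega>) * (1 + u)))"
      using x0 p by (simp add: abs_mult)
    also have "\<dots> \<le> (1 / x) * (\<bar>u - \<tau> \<omega>\<bar> / 1)"
    proof -
      have "1 * 1 \<le> (1 + \<tau> \<omega>) * (1 + u)" using p by (intro mult_mono) auto
      then show ?thesis using x0 by (intro mult_left_mono divide_left_mono) auto
    qed
    also have "\<dots> \<le> (1 / x) * (\<bar>\<tau> \<omega> - V \<omega>\<bar> + s * G\<^sup>2 / x + \<bar>U \<omega> - u\<bar>)"
    proof (intro mult_left_mono)
      show "\<bar>u - \<tau> \<omega>\<bar> / 1 \<le> \<bar>\<tau> \<omega> - V \<omega>\<bar> + s * G\<^sup>2 / x + \<bar>U \<omega> - u\<bar>" unfolding div_by_1 using E2[of \<omega>] by linarith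
    qed (use x0 in simp)
    finally show ?thesis .
  qed
  have Qi: "integrable M Q" unfolding Q_def using res_diag_integrable[OF s0' x0 j] .
  note ia = integrable_abs[OF E1(2)] integrable_abs[OF E3(2)]
  have "\<bar>expectation Q - 1 / (x * (1 + u))\<bar> = \<bar>expectation (\<lambda>\<omega>. Q \<omega> - 1 / (x * (1 + u)))\<bar>"
    using Qi by (simp add: prob_space)
  also have "\<dots> \<le> expectation (\<lambda>\<omega>. \<bar>Q \<omega> - 1 / (x * (1 + u))\<bar>)" by (rule integral_abs_bound)
  also have "\<dots> \<le> expectation (\<lambda>\<omega>. 1 / x * (\<bar>\<tau> \<omega> - V \<omega>\<bar> + s * G\<^sup>2 / x + \<bar>U \<omega> - u\<bar>))"
  proof (rule integral_mono)
    show "integrable M (\<lambda>\<omega>. \<bar>Q \<omega> - 1 / (x * (1 + u))\<bar>)" using Qi by simp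
    show "integrable M (\<lambda>\<omega>. 1 / x * (\<bar>\<tau> \<omega> - V \<omega>\<bar> + s * G\<^sup>2 / x + \<bar>U \<omega> - u\<bar>))" using ia by simp
  qed (rule pt)
  also have "\<dots> = 1 / x * (expectation (\<lambda>\<omega>. \<bar>\<tau> \<omega> - V \<omega>\<bar>) + s * G\<^sup>2 / x + expectation (\<lambda>\<omega>. \<bar>U \<omega> - u\<bar>))"
    using ia by (simp add: prob_space)
  also have "\<dots> \<le> 1 / x * (e1 + s * G\<^sup>2 / x + e3)"
    using x0 by (intro mult_left_mono add_mono E1 E3) auto
  also have "\<dots> = s * G\<^sup>2 / x\<^sup>2 * (sqrt ((m4 + 2) * a) + 1 + 2 * sqrt b)"
  proof -
    have "e1 + s * G\<^sup>2 / x + e3 = s * G\<^sup>2 / x * (sqrt ((m4 + 2) * a) + 1 + 2 * sqrt b)"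
      unfolding e1_def e3_def distrib_left by simp
    then show ?thesis by (simp add: power2_eq_square)
  qed
  finally show ?thesis by (simp add: Q_def[abs_def])
qed

end

section \<open>Stieltjes transforms of finitely supported laws\<close>

definition atomic_stieltjes :: "(complex \<Rightarrow> complex) \<Rightarrow> bool" where
  "atomic_stieltjes f \<longleftrightarrow> (\<exists>F c. finite F \<and> (\<forall>t\<in>F. 0 \<le> t \<and> 0 \<le> c t) \<and> (\<Sum>t\<in>F. c t) = 1 \<and>
     (\<forall>z. z \<notin> \<real>\<^sub>\<ge>\<^sub>0 \<longrightarrow> f z = (\<Sum>t\<in>F. complex_of_real (c t) / (complex_of_real t - z))))"

text \<open>For positive weights the rational function \<open>\<beta> - z - \<Sum>d t / (t - z)\<close> is a Nevanlinna function whose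
  zeros are real and simple, so the residues of its reciprocal are positive.\<close>

lemma partial_fractions_reciprocal:
  fixes F :: "real set" and d :: "real \<Rightarrow> real" and \<beta> :: real
  assumes fin: "finite F" and d_pos: "\<forall>t\<in>F. d t > 0"
  defines "H \<equiv> \<lambda>z :: complex. of_real \<beta> - z - (\<Sum>t\<in>F. of_real (d t) / (of_real t - z))"
  shows "\<exists>\<Lambda> r. finite \<Lambda> \<and> (\<forall>l\<in>\<Lambda>. H (of_real l) = 0 \<and> l \<notin> F \<and> 0 < r l) \<and> (\<Sum>l\<in>\<Lambda>. r l) = (1 :: real) \<and>
    (\<forall>z. z \<notin> of_real ` F \<longrightarrow> z \<notin> of_real ` \<Lambda> \<longrightarrow>
       1 / H z = (\<Sum>l\<in>\<Lambda>. of_real (r l) / (of_real l - z)))"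
proof -
  have d: "d t > 0" if "t \<in> F" for t using d_pos that by blast
  \<comment> \<open>Linear factors are written as \<open>t - z\<close> to match the kernel, at the
    price of leading coefficients \<open>-1\<close>.\<close>
  define L where "L t = [:complex_of_real t, -1:]" for t :: real
  define N where "N = (\<Prod>t\<in>F. L t)"
  define Nt where "Nt t = (\<Prod>s\<in>F - {t}. L s)" for t
  \<comment> \<open>The numerator of \<open>H\<close> over the common denominator \<open>N\<close>,
    of degree one more than the number of poles.\<close>
  define P where "P = L \<beta> * N - (\<Sum>t\<in>F. Polynomial.smult (of_real (d t)) (Nt t))"
  have pL: "poly (L t) z = of_real t - z" for t z by (simp add: L_def)
  have degL: "Polynomial.degree (L t) = 1" and L0: "L t \<noteq> 0" and lcL: "lead_coeff (L t) = -1" for t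
    by (simp_all add: L_def)
  have pN: "poly N z = (\<Prod>t\<in>F. of_real t - z)" for z by (simp add: N_def poly_prod pL)
  have NNt: "poly N z = (of_real t - z) * poly (Nt t) z" if "t \<in> F" for t z
    using that fin by (simp add: N_def Nt_def prod.remove[of F t] pL)
  have N0: "poly N z \<noteq> 0 \<longleftrightarrow> z \<notin> of_real ` F" for z using fin by (auto simp: pN)
  have Nt_at: "poly (Nt s) (of_real t) = 0" if "t \<in> F" "s \<noteq> t" for s t
    using that fin by (auto simp: Nt_def poly_prod pL)
  have Nt0: "poly (Nt t) (of_real t) \<noteq> 0" for t
    using fin by (auto simp: Nt_def poly_prod pL)
  have pP: "poly P z = H z * poly N z" if "z \<notin> of_real ` F" for z
  proof -
    have "(\<Sum>t\<in>F. of_real (d t) / (of_real t - z)) * poly N z = (\<Sum>t\<in>F. of_real (d t) * poly (Nt t) z)"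
      unfolding sum_distrib_right
    proof (rule sum.cong)
      fix t assume t: "t \<in> F"
      then have "of_real t - z \<noteq> 0" using that by auto
      then show "of_real (d t) / (of_real t - z) * poly N z = of_real (d t) * poly (Nt t) z"
        by (simp add: NNt[OF t])
    qed simp
    then show ?thesis by (simp add: P_def H_def pL poly_sum left_diff_distrib)
  qed
  \<comment> \<open>At a pole \<open>t\<close> only the summand containing \<open>Nt t\<close>
    survives, so numerator and denominator share no root.\<close>
  have P_at: "poly P (of_real t) \<noteq> 0" if t: "t \<in> F" for t
  proof -
    have "(\<Sum>s\<in>F. of_real (d s) * poly (Nt s) (of_real t)) = of_real (d t) * poly (Nt t) (of_real t)"
      using fin t Nt_at[OF t] by (subst sum.remove[of F t]) auto
    then have "poly P (of_real t) = - of_real (d t) * poly (Nt t) (of_real t)"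
      using N0[of "of_real t"] t by (simp add: P_def poly_sum)
    then show ?thesis using d[OF t] Nt0 by simp
  qed
  have root: "z \<notin> of_real ` F \<and> H z = 0" if "poly P z = 0" for z
    using that P_at pP N0 by (metis imageE mult_eq_0_iff)
  have real_root: "Im z = 0" if "poly P z = 0" for z
  proof (rule ccontr)
    assume nz: "Im z \<noteq> 0"
    have "Im (H z) = - Im z * (1 + (\<Sum>t\<in>F. d t / (cmod (of_real t - z))\<^sup>2))"
    proof -
      have "Im (of_real (d t) / (of_real t - z)) = Im z * (d t / (cmod (of_real t - z))\<^sup>2)" for t
        by (simp add: Im_divide cmod_power2)
      then show ?thesis by (simp add: H_def Im_sum sum_distrib_left ring_distribs sum_negf)
    qed
    moreover have "(\<Sum>t\<in>F. d t / (cmod (of_real t - z))\<^sup>2) \<ge> 0" by (intro sum_nonneg divide_nonneg_nonneg) (simp_all add: less_imp_le[OF d])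
    ultimately have "Im (H z) \<noteq> 0" using nz by simp
    with root[OF that] show False by simp
  qed
  define \<Lambda> where "\<Lambda> = {l :: real. poly P (of_real l) = 0}"
  have roots: "{z. poly P z = 0} = of_real ` \<Lambda>"
  proof (intro equalityI subsetI)
    fix z assume "z \<in> {z. poly P z = 0}"
    then have "z = of_real (Re z)" "poly P z = 0" using real_root by (auto simp: complex_eq_iff)
    then show "z \<in> of_real ` \<Lambda>" unfolding \<Lambda>_def by (metis (mono_tags, lifting) image_eqI mem_Collect_eq)
  qed (auto simp: \<Lambda>_def)
  have \<Lambda>F: "H (of_real l) = 0 \<and> l \<notin> F" if "l \<in> \<Lambda>" for l
    using root[of "of_real l"] that by (auto simp: \<Lambda>_def)
  \<comment> \<open>The quotient of \<open>P\<close> by \<open>l - z\<close> in explicit form: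
    \<open>H l = 0\<close> expresses \<open>\<beta>\<close> through \<open>l\<close>, after which
    the difference of the two kernels contains the factor \<open>l - z\<close>.\<close>
  define Gl where "Gl l = N + (\<Sum>t\<in>F. Polynomial.smult (of_real (d t / (t - l))) (Nt t))" for l
  have PG: "P = L l * Gl l" if l: "l \<in> \<Lambda>" for l
  proof (rule poly_ext)
    fix z
    have lF: "t \<noteq> l" if "t \<in> F" for t using \<Lambda>F[OF l] that by auto
    have "of_real \<beta> - of_real l - (\<Sum>t\<in>F. complex_of_real (d t) / (of_real t - of_real l)) = 0"
      using \<Lambda>F[OF l] by (simp add: H_def)
    then have b: "complex_of_real \<beta> = of_real l + (\<Sum>t\<in>F. of_real (d t / (t - l)))"
      by (simp add: algebra_simps)
    have "(of_real l - z) * (of_real (d t / (t - l)) * poly (Nt t) z)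
       = of_real (d t / (t - l)) * poly N z - of_real (d t) * poly (Nt t) z" if t: "t \<in> F" for t
    proof -
      have "d t = d t / (t - l) * (t - l)" using lF[OF t] by simp
      then have "complex_of_real (d t) = of_real (d t / (t - l) * (t - l))" by (rule arg_cong)
      then have e: "complex_of_real (d t) = of_real (d t / (t - l)) * (of_real t - of_real l)"
        by (simp only: of_real_mult of_real_diff)
      have "(l' - z) * (q * n) = q * ((t' - z) * n) - q * (t' - l') * n" for l' q n t' :: complex
        by (simp add: algebra_simps)
      from this[of "of_real l" "of_real (d t / (t - l))" "poly (Nt t) z" "of_real t"]
      show ?thesis unfolding NNt[OF t] e .
    qed
    then have "(\<Sum>t\<in>F. (of_real l - z) * (of_real (d t / (t - l)) * poly (Nt t) z))
       = (\<Sum>t\<in>F. of_real (d t / (t - l)) * poly N z - of_real (d t) * poly (Nt t) z)"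
      by (intro sum.cong) auto
    then have S: "(of_real l - z) * (\<Sum>t\<in>F. of_real (d t / (t - l)) * poly (Nt t) z)
       = (\<Sum>t\<in>F. of_real (d t / (t - l))) * poly N z - (\<Sum>t\<in>F. of_real (d t) * poly (Nt t) z)"
      unfolding sum_distrib_left sum_distrib_right sum_subtractf .
    have p1: "poly P z = (of_real \<beta> - z) * poly N z - (\<Sum>t\<in>F. of_real (d t) * poly (Nt t) z)"
      by (simp add: P_def pL poly_sum)
    have p2: "poly (L l * Gl l) z
        = (of_real l - z) * poly N z + (of_real l - z) * (\<Sum>t\<in>F. of_real (d t / (t - l)) * poly (Nt t) z)"
      by (simp add: Gl_def pL poly_sum distrib_left)
    show "poly P z = poly (L l * Gl l) z" unfolding p1 p2 S b by (simp only: ring_distribs) simp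
  qed
  \<comment> \<open>\<open>K l\<close> is minus the derivative of \<open>H\<close> at
    \<open>l\<close>, so \<open>1 / K l\<close> is the coefficient of \<open>1 / (l - z)\<close> in
    the expansion of \<open>1 / H z\<close>.\<close>
  define K where "K l = 1 + (\<Sum>t\<in>F. d t / (t - l)\<^sup>2)" for l
  have K: "K l > 0" for l
    unfolding K_def by (intro add_pos_nonneg sum_nonneg divide_nonneg_nonneg) (simp_all add: less_imp_le[OF d])
  have GK: "poly (Gl l) (of_real l) = of_real (K l) * poly N (of_real l)" if l: "l \<in> \<Lambda>" for l
  proof -
    have "of_real (d t / (t - l)) * poly (Nt t) (of_real l) = of_real (d t / (t - l)\<^sup>2) * poly N (of_real l)"
      if t: "t \<in> F" for t
    proof -
      have "t - l \<noteq> 0" using \<Lambda>F[OF l] t by auto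
      then have "d t / (t - l) = d t / (t - l)\<^sup>2 * (t - l)" by (simp add: power2_eq_square)
      then have "complex_of_real (d t / (t - l)) = of_real (d t / (t - l)\<^sup>2 * (t - l))" by (rule arg_cong)
      then have "complex_of_real (d t / (t - l)) = of_real (d t / (t - l)\<^sup>2) * (of_real t - of_real l)"
        by (simp only: of_real_mult of_real_diff)
      then show ?thesis unfolding NNt[OF t] by (simp only: mult.assoc)
    qed
    then have "(\<Sum>t\<in>F. of_real (d t / (t - l)) * poly (Nt t) (of_real l))
       = (\<Sum>t\<in>F. of_real (d t / (t - l)\<^sup>2)) * poly N (of_real l)"
      unfolding sum_distrib_right by (intro sum.cong) auto
    then show ?thesis by (simp add: Gl_def poly_sum K_def distrib_right)
  qed
  have sq: "rsquarefree P"
    unfolding rsquarefree_roots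
  proof (intro allI notI)
    fix z assume z: "poly P z = 0 \<and> poly (pderiv P) z = 0"
    then obtain l where l: "l \<in> \<Lambda>" "z = of_real l" using roots by blast
    have "poly (pderiv P) z = - poly (Gl l) z"
      unfolding PG[OF l(1)] pderiv_mult using l by (simp add: L_def pderiv_pCons)
    moreover have "poly (Gl l) z \<noteq> 0"
      using GK[OF l(1)] K[of l] N0[of z] \<Lambda>F[OF l(1)] l by auto
    ultimately show False using z by simp
  qed
  have P0: "P \<noteq> 0" using sq by (simp add: rsquarefree_def)
  have fL: "finite \<Lambda>"
  proof -
    have "finite (complex_of_real ` \<Lambda>)" using poly_roots_finite[OF P0] roots by simp
    then show ?thesis by (rule finite_imageD) (auto simp: inj_on_def)
  qed
  define m where "m = card F"
  have degN: "Polynomial.degree N = m" unfolding N_def m_def using L0 by (simp add: degree_prod_sum_eq degL)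
  have lcN: "lead_coeff N = (-1) ^ m" by (simp only: N_def lead_coeff_prod lcL prod_constant m_def)
  have degS: "Polynomial.degree (\<Sum>t\<in>F. Polynomial.smult (of_real (d t)) (Nt t)) \<le> m"
  proof (rule degree_sum_le[OF fin])
    fix t assume "t \<in> F"
    have "Polynomial.degree (Nt t) \<le> m" unfolding Nt_def m_def using L0 fin
      by (simp add: degree_prod_sum_eq degL card_Diff_subset_Int)
    then show "Polynomial.degree (Polynomial.smult (of_real (d t)) (Nt t)) \<le> m" using degree_smult_le le_trans by blast
  qed
  have N_nz: "N \<noteq> 0" unfolding N_def using L0 fin by simp
  have degLN: "Polynomial.degree (L \<beta> * N) = Suc m" using L0 N_nz degL degN by (simp add: degree_mult_eq)
  have degP: "Polynomial.degree P = Suc m"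
    unfolding P_def diff_conv_add_uminus by (subst degree_add_eq_left) (use degLN degS in auto)
  have lcP: "lead_coeff P = (-1) ^ Suc m"
  proof -
    have "Polynomial.coeff (\<Sum>t\<in>F. Polynomial.smult (of_real (d t)) (Nt t)) (Suc m) = 0" using degS by (intro coeff_eq_0) auto
    then have "lead_coeff P = lead_coeff (L \<beta> * N)" unfolding degP degLN by (simp add: P_def)
    also have "\<dots> = -1 * (-1) ^ m" by (simp only: lead_coeff_mult lcL lcN)
    finally show ?thesis by simp
  qed
  have Pfac: "P = Polynomial.smult ((-1) ^ Suc m) (\<Prod>l\<in>\<Lambda>. [:- of_real l, 1:])"
  proof -
    have "P = Polynomial.smult (lead_coeff P) (\<Prod>z\<in>of_real ` \<Lambda>. [:-z, 1:])"
      using complex_poly_decompose_rsquarefree[OF sq] roots by simp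
    also have "(\<Prod>z\<in>of_real ` \<Lambda>. [:-z, 1:]) = (\<Prod>l\<in>\<Lambda>. [:- complex_of_real l, 1:])"
      by (subst prod.reindex) (auto simp: inj_on_def)
    finally show ?thesis using lcP by simp
  qed
  have cL: "card \<Lambda> = Suc m"
  proof -
    have "Polynomial.degree P = Polynomial.degree (\<Prod>l\<in>\<Lambda>. [:- complex_of_real l, 1:])" by (subst Pfac) simp
    also have "\<dots> = card \<Lambda>" by (subst degree_prod_sum_eq) auto
    finally show ?thesis using degP by simp
  qed
  have PD: "P = (\<Prod>l\<in>\<Lambda>. L l)"
  proof -
    have "(\<Prod>l\<in>\<Lambda>. L l) = (\<Prod>l\<in>\<Lambda>. Polynomial.smult (-1) [:- of_real l, 1:])" by (simp add: L_def)
    also have "\<dots> = Polynomial.smult ((-1) ^ card \<Lambda>) (\<Prod>l\<in>\<Lambda>. [:- of_real l, 1:])"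
      by (subst prod_smult) simp
    finally show ?thesis using Pfac cL by simp
  qed
  define r where "r l = 1 / K l" for l
  define D where "D l = (\<Prod>k\<in>\<Lambda> - {l}. L k)" for l
  have GD: "Gl l = D l" if l: "l \<in> \<Lambda>" for l
  proof -
    have "L l * D l = P" unfolding D_def PD using prod.remove[OF fL l, of L] by simp
    then have "L l * Gl l = L l * D l" by (rule trans[OF PG[OF l, symmetric] sym])
    then show ?thesis using L0 by simp
  qed
  have degD: "Polynomial.degree (D l) = m" "lead_coeff (D l) = (-1) ^ m" if l: "l \<in> \<Lambda>" for l
  proof -
    have c: "card (\<Lambda> - {l}) = m" using fL cL l by simp
    then show "Polynomial.degree (D l) = m" unfolding D_def using L0 by (simp add: degree_prod_sum_eq degL)
    show "lead_coeff (D l) = (-1) ^ m" by (simp only: D_def lead_coeff_prod lcL prod_constant c)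
  qed
  define R where "R = (\<Sum>l\<in>\<Lambda>. Polynomial.smult (of_real (r l)) (D l))"
  have degR: "Polynomial.degree R \<le> m" unfolding R_def
    by (rule degree_sum_le[OF fL]) (use degD degree_smult_le in \<open>metis\<close>)
  \<comment> \<open>Lagrange interpolation: both polynomials have degree at most \<open>m\<close>
    and agree at the \<open>m + 1\<close> points of \<open>\<Lambda>\<close>.\<close>
  have NR: "N = R"
  proof (rule poly_eqI_degree)
    fix z assume "z \<in> complex_of_real ` \<Lambda>"
    then obtain l where l: "l \<in> \<Lambda>" "z = of_real l" by auto
    have "poly (D k) z = 0" if "k \<in> \<Lambda>" "k \<noteq> l" for k
      using that l fL by (auto simp: D_def poly_prod pL)
    then have "poly R z = of_real (r l) * poly (D l) z"
      using fL l by (simp add: R_def poly_sum sum.remove[of \<Lambda> l])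
    also have "\<dots> = poly N z"
      using GD[OF l(1)] GK[OF l(1)] K[of l] l(2) by (simp add: r_def)
    finally show "poly N z = poly R z" by simp
  qed (use degN degR cL in \<open>auto simp: card_image inj_on_def\<close>)
  \<comment> \<open>Comparing the coefficients of degree \<open>m\<close> gives the residues total
    mass one.\<close>
  have "Polynomial.coeff R m = (\<Sum>l\<in>\<Lambda>. of_real (r l)) * (-1) ^ m"
  proof -
    have "Polynomial.coeff (D l) m = (-1) ^ m" if "l \<in> \<Lambda>" for l
      using degD(2)[OF that] unfolding degD(1)[OF that] .
    then show ?thesis by (simp add: R_def coeff_sum sum_distrib_right)
  qed
  moreover have "Polynomial.coeff N m = (-1) ^ m" using lcN unfolding degN .
  ultimately have "(\<Sum>l\<in>\<Lambda>. of_real (r l)) = (1 :: complex)" using NR by simp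
  then have r1: "(\<Sum>l\<in>\<Lambda>. r l) = 1" by (metis of_real_eq_1_iff of_real_sum)
  have "1 / H z = (\<Sum>l\<in>\<Lambda>. of_real (r l) / (of_real l - z))"
    if z: "z \<notin> of_real ` F" "z \<notin> of_real ` \<Lambda>" for z
  proof -
    have "1 / H z = poly N z / poly P z" using pP[OF z(1)] N0[of z] z(1) by simp
    also have "\<dots> = (\<Sum>l\<in>\<Lambda>. of_real (r l) * poly (D l) z / poly P z)"
      by (simp add: NR R_def poly_sum sum_divide_distrib)
    also have "\<dots> = (\<Sum>l\<in>\<Lambda>. of_real (r l) / (of_real l - z))"
    proof (rule sum.cong)
      fix l assume l: "l \<in> \<Lambda>"
      have "poly P z \<noteq> 0" using roots z by auto
      moreover have "poly P z = (of_real l - z) * poly (D l) z"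
        using PG[OF l] GD[OF l] pL by simp
      ultimately show "of_real (r l) * poly (D l) z / poly P z = of_real (r l) / (of_real l - z)" by simp
    qed simp
    finally show ?thesis .
  qed
  moreover have "0 < r l" for l using K by (simp add: r_def)
  ultimately show ?thesis using fL \<Lambda>F r1 by blast
qed

lemma nonneg_Reals_eq_image: "z \<in> \<real>\<^sub>\<ge>\<^sub>0 \<longleftrightarrow> (\<exists>t\<ge>0. z = complex_of_real t)"
  by (auto simp: complex_nonneg_Reals_iff complex_eq_iff)

text \<open>Since \<open>z / (t - z) = t / (t - z) - 1\<close>, the denominator is minus a function
  \<open>H\<close> of the kind just decomposed, with \<open>\<beta> = W\<close> and weights
  \<open>c t * t\<close>. Its reciprocal therefore has positive residues of total mass one, and the
  poles are nonnegative because \<open>H\<close> has no zero on the negative axis.\<close>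

lemma atomic_stieltjes_reciprocal:
  fixes F :: "real set" and c :: "real \<Rightarrow> real"
  assumes fin: "finite F" and c: "\<And>t. t \<in> F \<Longrightarrow> 0 \<le> t \<and> 0 \<le> c t"
  shows "atomic_stieltjes (\<lambda>z. -1 / (z * (1 + (\<Sum>t\<in>F. of_real (c t) / (of_real t - z)))))"
proof -
  \<comment> \<open>Atoms with \<open>c t * t = 0\<close> vanish from the rewritten sum and are left
    out because the partial fractions ask for strictly positive weights; their mass is still counted
    in \<open>W\<close>.\<close>
  define F' where "F' = {t \<in> F. t \<noteq> 0 \<and> c t \<noteq> 0}"
  define W where "W = (\<Sum>t\<in>F. c t)"
  define H where "H z = complex_of_real W - z - (\<Sum>t\<in>F'. of_real (c t * t) / (of_real t - z))" for z
  have H: "H z = - (z * (1 + (\<Sum>t\<in>F. of_real (c t) / (of_real t - z))))" if z: "z \<notin> \<real>\<^sub>\<ge>\<^sub>0" for z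
  proof -
    have "(\<Sum>t\<in>F'. of_real (c t * t) / (of_real t - z)) = (\<Sum>t\<in>F. of_real (c t * t) / (of_real t - z))"
      using fin by (intro sum.mono_neutral_left) (auto simp: F'_def)
    also have "\<dots> = (\<Sum>t\<in>F. of_real (c t) + z * (of_real (c t) / (of_real t - z)))"
    proof (rule sum.cong)
      fix t assume "t \<in> F"
      then have nz: "complex_of_real t - z \<noteq> 0" using z c[of t] by (auto simp: nonneg_Reals_eq_image)
      have "of_real (c t) + z * (of_real (c t) / (of_real t - z))
         = (of_real (c t) * (of_real t - z) + z * of_real (c t)) / (of_real t - z)"
        using nz by (simp add: add_divide_distrib)
      then show "of_real (c t * t) / (of_real t - z) = of_real (c t) + z * (of_real (c t) / (of_real t - z))"
        by (simp add: algebra_simps)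
    qed simp
    also have "\<dots> = of_real W + z * (\<Sum>t\<in>F. of_real (c t) / (of_real t - z))"
      by (simp add: sum.distrib W_def sum_distrib_left)
    finally show ?thesis by (simp add: H_def algebra_simps)
  qed
  have "finite F'" "\<forall>t\<in>F'. c t * t > 0" using fin c by (auto simp: F'_def less_le)
  from partial_fractions_reciprocal[of F' "\<lambda>t. c t * t", OF this, of W, folded H_def]
  obtain \<Lambda> r where LL: "finite \<Lambda> \<and> (\<forall>l\<in>\<Lambda>. H (of_real l) = 0 \<and> l \<notin> F' \<and> 0 < r l) \<and> (\<Sum>l\<in>\<Lambda>. r l) = (1 :: real) \<and>
    (\<forall>z. z \<notin> of_real ` F' \<longrightarrow> z \<notin> of_real ` \<Lambda> \<longrightarrow> 1 / H z = (\<Sum>l\<in>\<Lambda>. of_real (r l) / (of_real l - z)))"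
    by (elim exE) (rule that)
  then have L: "finite \<Lambda>" "\<forall>l\<in>\<Lambda>. H (of_real l) = 0 \<and> l \<notin> F' \<and> 0 < r l" "(\<Sum>l\<in>\<Lambda>. r l) = (1 :: real)"
    and eq: "\<forall>z. z \<notin> of_real ` F' \<longrightarrow> z \<notin> of_real ` \<Lambda> \<longrightarrow> 1 / H z = (\<Sum>l\<in>\<Lambda>. of_real (r l) / (of_real l - z))"
    by simp_all
  \<comment> \<open>For \<open>l < 0\<close> all terms of the original sum are nonnegative, so
    \<open>H\<close> is positive there and \<open>l\<close> cannot be a root.\<close>
  have pos: "0 \<le> l" if l: "l \<in> \<Lambda>" for l
  proof (rule ccontr)
    assume "\<not> 0 \<le> l"
    then have l0: "l < 0" by simp
    have "(\<Sum>t\<in>F. c t / (t - l)) \<ge> 0" using c l0 by (intro sum_nonneg divide_nonneg_nonneg) force+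
    then have "- (l * (1 + (\<Sum>t\<in>F. c t / (t - l)))) > 0" using l0 by (simp add: mult_neg_pos)
    moreover have "H (of_real l) = of_real (- (l * (1 + (\<Sum>t\<in>F. c t / (t - l)))))"
      using l0 by (subst H) (auto simp: complex_nonneg_Reals_iff)
    ultimately have "H (of_real l) \<noteq> 0" by (metis less_irrefl of_real_eq_0_iff)
    with L(2) l show False by blast
  qed
  have "-1 / (z * (1 + (\<Sum>t\<in>F. of_real (c t) / (of_real t - z)))) = (\<Sum>l\<in>\<Lambda>. of_real (r l) / (of_real l - z))"
    if z: "z \<notin> \<real>\<^sub>\<ge>\<^sub>0" for z :: complex
  proof -
    have "z \<notin> of_real ` F'" "z \<notin> of_real ` \<Lambda>" using z pos c by (auto simp: nonneg_Reals_eq_image F'_def)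
    then have "1 / H z = (\<Sum>l\<in>\<Lambda>. complex_of_real (r l) / (of_real l - z))" using eq by blast
    then show ?thesis by (simp add: H[OF z])
  qed
  moreover have "\<forall>l\<in>\<Lambda>. 0 \<le> l \<and> 0 \<le> r l" using L(2) pos less_imp_le by blast
  ultimately show ?thesis unfolding atomic_stieltjes_def using L(1,3) by blast
qed

text \<open>The weighted sum of the given transforms is the transform of one finite measure on the
  union of the supports, to which the reciprocal lemma applies. One step of the iteration thus stays
  inside the class.\<close>

lemma atomic_stieltjes_step:
  assumes fin: "finite I" and w: "\<And>l. l \<in> I \<Longrightarrow> w l \<ge> 0" and f: "\<And>l. l \<in> I \<Longrightarrow> atomic_stieltjes (f l)"
  shows "atomic_stieltjes (\<lambda>z. -1 / (z * (1 + (\<Sum>l\<in>I. of_real (w l) * f l z))))"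
proof -
  have "\<forall>l\<in>I. \<exists>Fc. finite (fst Fc) \<and> (\<forall>t\<in>fst Fc. 0 \<le> t \<and> 0 \<le> snd Fc t) \<and>
     (\<forall>z. z \<notin> \<real>\<^sub>\<ge>\<^sub>0 \<longrightarrow> f l z = (\<Sum>t\<in>fst Fc. complex_of_real (snd Fc t) / (complex_of_real t - z)))"
  proof
    fix l assume "l \<in> I"
    from f[OF this] obtain F c where "finite F" "\<forall>t\<in>F. 0 \<le> t \<and> 0 \<le> c t"
      "\<forall>z. z \<notin> \<real>\<^sub>\<ge>\<^sub>0 \<longrightarrow> f l z = (\<Sum>t\<in>F. complex_of_real (c t) / (complex_of_real t - z))"
      unfolding atomic_stieltjes_def by (elim exE conjE) (rule that)
    then show "\<exists>Fc. finite (fst Fc) \<and> (\<forall>t\<in>fst Fc. 0 \<le> t \<and> 0 \<le> snd Fc t) \<and>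
     (\<forall>z. z \<notin> \<real>\<^sub>\<ge>\<^sub>0 \<longrightarrow> f l z = (\<Sum>t\<in>fst Fc. complex_of_real (snd Fc t) / (complex_of_real t - z)))"
      by (intro exI[of _ "(F, c)"]) simp
  qed
  from bchoice[OF this] obtain Fc where Fc0: "\<forall>l\<in>I. finite (fst (Fc l)) \<and> (\<forall>t\<in>fst (Fc l). 0 \<le> t \<and> 0 \<le> snd (Fc l) t) \<and>
     (\<forall>z. z \<notin> \<real>\<^sub>\<ge>\<^sub>0 \<longrightarrow> f l z = (\<Sum>t\<in>fst (Fc l). complex_of_real (snd (Fc l) t) / (complex_of_real t - z)))"
    by (elim exE) (rule that)
  define F where "F l = fst (Fc l)" for l
  define c where "c l = snd (Fc l)" for l
  have Fc: "finite (F l) \<and> (\<forall>t\<in>F l. 0 \<le> t \<and> 0 \<le> c l t) \<and>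
     (\<forall>z. z \<notin> \<real>\<^sub>\<ge>\<^sub>0 \<longrightarrow> f l z = (\<Sum>t\<in>F l. complex_of_real (c l t) / (complex_of_real t - z)))" if "l \<in> I" for l
    using Fc0 that unfolding F_def c_def by (rule bspec)
  define U where "U = (\<Union>l\<in>I. F l)"
  define C where "C t = (\<Sum>l\<in>I. w l * (if t \<in> F l then c l t else 0))" for t
  have fU: "finite U" using fin Fc by (auto simp: U_def)
  have C: "0 \<le> t \<and> 0 \<le> C t" if "t \<in> U" for t
    using that Fc w by (auto simp: U_def C_def intro!: sum_nonneg mult_nonneg_nonneg)
  have eq: "(\<Sum>l\<in>I. of_real (w l) * f l z) = (\<Sum>t\<in>U. of_real (C t) / (of_real t - z))" if z: "z \<notin> \<real>\<^sub>\<ge>\<^sub>0" for z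
  proof -
    have "of_real (w l) * f l z = (\<Sum>t\<in>U. of_real (w l * (if t \<in> F l then c l t else 0)) / (of_real t - z))"
      if l: "l \<in> I" for l
    proof -
      have "f l z = (\<Sum>t\<in>F l. complex_of_real (if t \<in> F l then c l t else 0) / (complex_of_real t - z))"
        using Fc[OF l] z by (simp cong: sum.cong)
      also have "\<dots> = (\<Sum>t\<in>U. complex_of_real (if t \<in> F l then c l t else 0) / (complex_of_real t - z))"
        using fU l by (intro sum.mono_neutral_left) (auto simp: U_def)
      finally show ?thesis by (simp add: sum_distrib_left)
    qed
    then have "(\<Sum>l\<in>I. of_real (w l) * f l z)
       = (\<Sum>l\<in>I. \<Sum>t\<in>U. of_real (w l * (if t \<in> F l then c l t else 0)) / (of_real t - z))" by simp
    also have "\<dots> = (\<Sum>t\<in>U. of_real (C t) / (of_real t - z))"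
      by (subst sum.swap) (simp add: C_def sum_divide_distrib)
    finally show ?thesis .
  qed
  from atomic_stieltjes_reciprocal[OF fU C] show ?thesis
    unfolding atomic_stieltjes_def by (simp add: eq cong: conj_cong imp_cong)
qed

section \<open>Positive systems\<close>

text \<open>The summand \<open>1\<close> is the source of the contraction: it is the same on both
  sides, while the part subject to the ratio \<open>\<rho>\<close> makes up at most the fraction
  \<open>M / (1 + M)\<close> of the total.\<close>

lemma ratio_step:
  fixes w u v :: "'i \<Rightarrow> real"
  assumes "\<And>l. l \<in> I \<Longrightarrow> 0 \<le> w l" "\<And>l. l \<in> I \<Longrightarrow> u l \<le> \<rho> * v l" "\<And>l. l \<in> I \<Longrightarrow> 0 \<le> v l"
    and "(\<Sum>l\<in>I. w l * v l) \<le> M" "\<rho> \<ge> 1"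
  shows "1 + (\<Sum>l\<in>I. w l * u l) \<le> (1 + M / (1 + M) * (\<rho> - 1)) * (1 + (\<Sum>l\<in>I. w l * v l))"
proof -
  define V where "V = (\<Sum>l\<in>I. w l * v l)"
  have V: "0 \<le> V" "V \<le> M" unfolding V_def using assms by (auto intro!: sum_nonneg mult_nonneg_nonneg)
  have "(\<Sum>l\<in>I. w l * u l) \<le> (\<Sum>l\<in>I. \<rho> * (w l * v l))"
  proof (rule sum_mono)
    fix l assume "l \<in> I"
    then have "w l * u l \<le> w l * (\<rho> * v l)" using assms by (intro mult_left_mono) auto
    then show "w l * u l \<le> \<rho> * (w l * v l)" by (simp add: mult_ac)
  qed
  also have "\<dots> = \<rho> * V" by (simp add: V_def sum_distrib_left)
  finally have "1 + (\<Sum>l\<in>I. w l * u l) \<le> (1 + V) + (\<rho> - 1) * V" by (simp add: algebra_simps)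
  also have "V \<le> M / (1 + M) * (1 + V)"
  proof -
    have "V * (1 + M) \<le> M * (1 + V)" using V by (simp add: algebra_simps)
    then show ?thesis using V by (simp add: field_simps)
  qed
  then have "(1 + V) + (\<rho> - 1) * V \<le> (1 + V) + (\<rho> - 1) * (M / (1 + M) * (1 + V))"
    using assms by (intro add_left_mono mult_left_mono) auto
  finally show ?thesis by (simp add: V_def algebra_simps)
qed

lemma one_le_inverse_mult: "0 < u \<Longrightarrow> u \<le> v \<Longrightarrow> 1 \<le> 1 / u * v" for u v :: real
  by (simp add: pos_le_divide_eq)

lemma weighted_sum_le:
  fixes w u :: "'i \<Rightarrow> real"
  assumes "\<And>l. l \<in> I \<Longrightarrow> 0 \<le> w l" "\<And>l. l \<in> I \<Longrightarrow> u l \<le> 1 / x" "(\<Sum>l\<in>I. w l) \<le> S" "x > 0"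
  shows "(\<Sum>l\<in>I. w l * u l) \<le> S / x"
proof -
  have "(\<Sum>l\<in>I. w l * u l) \<le> (\<Sum>l\<in>I. w l * (1 / x))"
    using assms by (intro sum_mono mult_left_mono) auto
  also have "\<dots> = (\<Sum>l\<in>I. w l) / x" by (simp add: sum_divide_distrib)
  also have "\<dots> \<le> S / x" using assms by (simp add: divide_right_mono)
  finally show ?thesis .
qed

text \<open>The map is a contraction with factor \<open>M / (1 + M)\<close> for the largest ratio between two positive vectors,
  uniformly in the size of the index set.\<close>

lemma positive_system_stability:
  fixes w :: "'i \<Rightarrow> 'i \<Rightarrow> real" and a t :: "'i \<Rightarrow> real"
  assumes fin: "finite I" and w: "\<And>k l. k \<in> I \<Longrightarrow> l \<in> I \<Longrightarrow> 0 \<le> w k l"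
    and S: "\<And>k. k \<in> I \<Longrightarrow> (\<Sum>l\<in>I. w k l) \<le> S" "0 \<le> S" and x: "x > 0"
    and t0: "\<And>k. k \<in> I \<Longrightarrow> 0 \<le> t k"
    and t: "\<And>k. k \<in> I \<Longrightarrow> t k = 1 / (x * (1 + (\<Sum>l\<in>I. w k l * t l)))"
    and a: "\<And>k. k \<in> I \<Longrightarrow> 0 \<le> a k \<and> a k \<le> 1 / x"
    and e: "\<And>k. k \<in> I \<Longrightarrow> \<bar>a k - 1 / (x * (1 + (\<Sum>l\<in>I. w k l * a l)))\<bar> \<le> e" and e0: "0 \<le> e"
    and small: "4 * e * x * (1 + S / x)\<^sup>2 \<le> 1" and k: "k \<in> I"
  shows "\<bar>a k - t k\<bar> \<le> 4 * e * (1 + S / x)\<^sup>2"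
proof -
  define M where "M = S / x"
  define \<kappa> where "\<kappa> = M / (1 + M)"
  \<comment> \<open>\<open>b\<close> is the image of \<open>a\<close> under the map. It is at least
    \<open>1 / (x * (1 + M))\<close>, so \<open>\<eta>\<close> is chosen to turn the additive error
    into a relative one: \<open>e\<close> is at most \<open>\<eta> / 2\<close> times
    \<open>b\<close>, with the factor two as room for passing from \<open>b\<close> to
    \<open>a\<close>.\<close>
  define b where "b k = 1 / (x * (1 + (\<Sum>l\<in>I. w k l * a l)))" for k
  define \<eta> where "\<eta> = 2 * e * x * (1 + M)"
  have M: "0 \<le> M" using S x by (simp add: M_def)
  have wt: "0 \<le> (\<Sum>l\<in>I. w k l * t l)" if "k \<in> I" for k using w[OF that] t0 by (intro sum_nonneg) auto
  have wa: "0 \<le> (\<Sum>l\<in>I. w k l * a l)" if "k \<in> I" for k using w[OF that] a by (intro sum_nonneg) auto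
  have t1: "t k \<le> 1 / x" if "k \<in> I" for k
  proof -
    have "x * 1 \<le> x * (1 + (\<Sum>l\<in>I. w k l * t l))" using wt[OF that] x by (intro mult_left_mono) auto
    then show ?thesis unfolding t[OF that] using x by (intro frac_le) auto
  qed
  have tpos: "t k > 0" if "k \<in> I" for k
    unfolding t[OF that] using wt[OF that] x by simp
  have wtM: "(\<Sum>l\<in>I. w k l * t l) \<le> M" if "k \<in> I" for k
    unfolding M_def using w[OF that] t1 S(1)[OF that] x by (intro weighted_sum_le) auto
  have waM: "(\<Sum>l\<in>I. w k l * a l) \<le> M" if "k \<in> I" for k
    unfolding M_def using w[OF that] a S(1)[OF that] x by (intro weighted_sum_le) auto
  have bl: "1 \<le> b k * (x * (1 + M))" if "k \<in> I" for k
  proof -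
    have "x * (1 + (\<Sum>l\<in>I. w k l * a l)) \<le> x * (1 + M)" using waM[OF that] x by simp
    moreover have "0 < x * (1 + (\<Sum>l\<in>I. w k l * a l))" using wa[OF that] x by simp
    ultimately show ?thesis unfolding b_def by (rule one_le_inverse_mult[rotated])
  qed
  have eb: "2 * e \<le> \<eta> * b k" if "k \<in> I" for k
  proof -
    have "2 * e * 1 \<le> 2 * e * (b k * (x * (1 + M)))" using bl[OF that] e0 by (intro mult_left_mono) auto
    then show ?thesis by (simp add: \<eta>_def mult_ac)
  qed
  have "4 * e * x * (1 + M) \<le> 4 * e * x * (1 + M)\<^sup>2"
    using M e0 x by (intro mult_left_mono) (auto simp: power2_eq_square)
  then have eta: "0 \<le> \<eta>" "2 * \<eta> \<le> 1" "2 * \<eta> * (1 + M) \<le> 1"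
    using small e0 x M by (simp_all add: \<eta>_def M_def[symmetric] power2_eq_square mult_ac)
  have bpos: "b k > 0" if "k \<in> I" for k unfolding b_def using wa[OF that] x by simp
  have ab: "a k \<le> (1 + \<eta>) * b k" "b k \<le> (1 + \<eta>) * a k" if "k \<in> I" for k
  proof -
    have ae: "a k \<le> b k + e" "b k \<le> a k + e" using e[OF that] by (auto simp: b_def abs_le_iff)
    have e2: "2 * e \<le> \<eta> * b k" by (rule eb[OF that])
    with ae(1) e0 show "a k \<le> (1 + \<eta>) * b k" by (simp add: algebra_simps)
    have "\<eta> * b k \<le> (1 / 2) * b k" using eta bpos[OF that] by (intro mult_right_mono) auto
    with e2 ae(2) bpos[OF that] have "b k / 2 \<le> a k" by linarith
    have "\<eta> * (b k / 2) \<le> \<eta> * a k" using eta \<open>b k / 2 \<le> a k\<close> by (intro mult_left_mono) auto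
    with e2 have "e \<le> \<eta> * a k" by simp
    with ae(2) show "b k \<le> (1 + \<eta>) * a k" by (simp add: algebra_simps)
  qed
  have apos: "a k > 0" if "k \<in> I" for k
  proof -
    have "0 < (1 + \<eta>) * a k" using ab(2)[OF that] bpos[OF that] by linarith
    then show ?thesis using eta by (simp add: zero_less_mult_iff)
  qed
  \<comment> \<open>Ratios in both directions; inserting \<open>1\<close> ensures
    \<open>\<rho> \<ge> 1\<close>, as \<open>ratio_step\<close> requires.\<close>
  define R where "R = insert 1 ((\<lambda>k. a k / t k) ` I \<union> (\<lambda>k. t k / a k) ` I)"
  define \<rho> where "\<rho> = Max R"
  have finR: "finite R" "R \<noteq> {}" using fin by (auto simp: R_def)
  have \<rho>1: "\<rho> \<ge> 1" unfolding \<rho>_def using finR by (intro Max_ge) (auto simp: R_def)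
  have \<rho>: "a k \<le> \<rho> * t k" "t k \<le> \<rho> * a k" if "k \<in> I" for k
  proof -
    have "a k / t k \<le> \<rho>" "t k / a k \<le> \<rho>" unfolding \<rho>_def using finR that by (auto intro!: Max_ge simp: R_def)
    then show "a k \<le> \<rho> * t k" "t k \<le> \<rho> * a k" using tpos[OF that] apos[OF that] by (simp_all add: pos_divide_le_eq)
  qed
  define c where "c = 1 + \<kappa> * (\<rho> - 1)"
  have k0: "0 \<le> \<kappa>" using M by (simp add: \<kappa>_def)
  have c1: "c \<ge> 1" using k0 \<rho>1 by (simp add: c_def)
  have recip: "1 / (x * u) \<le> q * (1 / (x * v))" if "v \<le> q * u" "0 < u" "0 < v" for u v q :: real
    using that x by (simp add: field_simps)
  have tb: "t k \<le> c * b k" "b k \<le> c * t k" if "k \<in> I" for k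
  proof -
    have "1 + (\<Sum>l\<in>I. w k l * a l) \<le> c * (1 + (\<Sum>l\<in>I. w k l * t l))"
      unfolding c_def \<kappa>_def using w[OF that] \<rho> t0 wtM[OF that] \<rho>1 by (intro ratio_step) auto
    then show "t k \<le> c * b k" unfolding t[OF that] b_def
      using wt[OF that] wa[OF that] by (intro recip) auto
    have "1 + (\<Sum>l\<in>I. w k l * t l) \<le> c * (1 + (\<Sum>l\<in>I. w k l * a l))"
      unfolding c_def \<kappa>_def using w[OF that] \<rho> a waM[OF that] \<rho>1 by (intro ratio_step) auto
    then show "b k \<le> c * t k" unfolding t[OF that] b_def
      using wt[OF that] wa[OF that] by (intro recip) auto
  qed
  have "a k \<le> (1 + \<eta>) * c * t k" "t k \<le> (1 + \<eta>) * c * a k" if "k \<in> I" for k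
  proof -
    have "(1 + \<eta>) * b k \<le> (1 + \<eta>) * (c * t k)" using tb[OF that] eta by (intro mult_left_mono) auto
    then show "a k \<le> (1 + \<eta>) * c * t k" using ab(1)[OF that] by (simp add: mult.assoc)
    have "c * b k \<le> c * ((1 + \<eta>) * a k)" using ab(2)[OF that] c1 by (intro mult_left_mono) auto
    then show "t k \<le> (1 + \<eta>) * c * a k" using tb(1)[OF that] by (simp add: mult_ac)
  qed
  then have "a k / t k \<le> (1 + \<eta>) * c" "t k / a k \<le> (1 + \<eta>) * c" if "k \<in> I" for k
    using that tpos[OF that] apos[OF that] by (simp_all add: pos_divide_le_eq)
  moreover have "1 \<le> (1 + \<eta>) * c"
  proof -
    have "1 * 1 \<le> (1 + \<eta>) * c" using c1 eta by (intro mult_mono) auto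
    then show ?thesis by simp
  qed
  ultimately have "\<rho> \<le> (1 + \<eta>) * c"
    unfolding \<rho>_def using finR by (subst Max_le_iff) (auto simp: R_def)
  \<comment> \<open>The bound now contains \<open>\<rho>\<close> on both sides. Multiplied by
    \<open>1 + M\<close> and rearranged, it has the factor \<open>1 - \<eta> * M\<close> on the
    left, which the smallness assumption keeps at least \<open>1 / 2\<close>.\<close>
  then have "\<rho> - 1 \<le> \<eta> + (1 + \<eta>) * \<kappa> * (\<rho> - 1)" by (simp add: c_def algebra_simps)
  then have "(\<rho> - 1) * (1 + M) \<le> \<eta> * (1 + M) + (1 + \<eta>) * M * (\<rho> - 1)"
  proof -
    assume "\<rho> - 1 \<le> \<eta> + (1 + \<eta>) * \<kappa> * (\<rho> - 1)"
    then have "(\<rho> - 1) * (1 + M) \<le> (\<eta> + (1 + \<eta>) * \<kappa> * (\<rho> - 1)) * (1 + M)" using M by (intro mult_right_mono) auto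
    also have "\<dots> = \<eta> * (1 + M) + (1 + \<eta>) * (\<kappa> * (1 + M)) * (\<rho> - 1)" by (simp add: algebra_simps)
    also have "\<kappa> * (1 + M) = M" using M by (simp add: \<kappa>_def)
    finally show ?thesis .
  qed
  then have "(\<rho> - 1) * (1 - \<eta> * M) \<le> \<eta> * (1 + M)" by (simp add: algebra_simps)
  moreover have "(\<rho> - 1) * (1 / 2) \<le> (\<rho> - 1) * (1 - \<eta> * M)"
    using eta \<rho>1 by (intro mult_left_mono) (auto simp: algebra_simps)
  ultimately have r: "\<rho> - 1 \<le> 2 * \<eta> * (1 + M)" by simp
  have "\<bar>a k - t k\<bar> \<le> (\<rho> - 1) * (1 / x)"
  proof -
    have "(\<rho> - 1) * t k \<le> (\<rho> - 1) * (1 / x)" "(\<rho> - 1) * a k \<le> (\<rho> - 1) * (1 / x)"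
      using \<rho>1 t1[OF k] a[OF k] by (intro mult_left_mono; simp)+
    then show ?thesis using \<rho>[OF k] by (simp add: abs_le_iff left_diff_distrib)
  qed
  also have "\<dots> \<le> 2 * \<eta> * (1 + M) * (1 / x)" using r x by (intro mult_right_mono) auto
  also have "\<dots> = 4 * e * (1 + S / x)\<^sup>2" using x by (simp add: \<eta>_def M_def[symmetric] power2_eq_square)
  finally show ?thesis .
qed

section \<open>Iteration of the positive system\<close>

fun positive_iterate :: "'i set \<Rightarrow> ('i \<Rightarrow> 'i \<Rightarrow> real) \<Rightarrow> nat \<Rightarrow> 'i \<Rightarrow> real \<Rightarrow> real" where
  "positive_iterate I w 0 k x = 1 / x"
| "positive_iterate I w (Suc m) k x = 1 / (x * (1 + (\<Sum>l\<in>I. w k l * positive_iterate I w m l x)))"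

context
  fixes I :: "'i set" and w :: "'i \<Rightarrow> 'i \<Rightarrow> real" and S :: real
  assumes fin: "finite I" and w: "\<And>k l. k \<in> I \<Longrightarrow> l \<in> I \<Longrightarrow> 0 \<le> w k l"
    and S: "\<And>k. k \<in> I \<Longrightarrow> (\<Sum>l\<in>I. w k l) \<le> S" "0 \<le> S"
begin

text \<open>The last bound says that the iterates are at least \<open>1 / (x + S)\<close>. As it is
  uniform in \<open>m\<close>, it later keeps the laws behind the iterates from losing mass at
  infinity.\<close>

lemma positive_iterate_bounds:
  assumes x: "x > 0" and k: "k \<in> I"
  shows "0 < positive_iterate I w m k x" "positive_iterate I w m k x \<le> 1 / x"
    "1 \<le> positive_iterate I w m k x * (x * (1 + S / x))"
proof -
  have *: "0 < positive_iterate I w m k x \<and> positive_iterate I w m k x \<le> 1 / x" if "k \<in> I" for k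
    using that
  proof (induction m arbitrary: k)
    case (Suc m)
    have "0 \<le> (\<Sum>l\<in>I. w k l * positive_iterate I w m l x)"
      using w[OF Suc.prems] Suc.IH by (intro sum_nonneg mult_nonneg_nonneg) (auto intro: less_imp_le)
    then have "x * 1 \<le> x * (1 + (\<Sum>l\<in>I. w k l * positive_iterate I w m l x))" using x by (intro mult_left_mono) auto
    then show ?case using x by (simp add: frac_le)
  qed (use x in auto)
  then show "0 < positive_iterate I w m k x" "positive_iterate I w m k x \<le> 1 / x" using k by blast+
  show "1 \<le> positive_iterate I w m k x * (x * (1 + S / x))"
  proof (cases m)
    case 0 then show ?thesis using S x by simp
  next
    case (Suc m')
    have "(\<Sum>l\<in>I. w k l * positive_iterate I w m' l x) \<le> S / x"
    proof (rule weighted_sum_le)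
      show "positive_iterate I w m' l x \<le> 1 / x" if "l \<in> I" for l
        using that
      proof (induction m' arbitrary: l)
        case (Suc m)
        have "0 < positive_iterate I w m l x" if "l \<in> I" for l using that x w
        proof (induction m arbitrary: l)
          case (Suc m)
          then have "0 \<le> (\<Sum>q\<in>I. w l q * positive_iterate I w m q x)"
            by (intro sum_nonneg mult_nonneg_nonneg) (auto intro: less_imp_le)
          then show ?case using x by simp
        qed simp
        then have "0 \<le> (\<Sum>q\<in>I. w l q * positive_iterate I w m q x)"
          using w[OF Suc.prems] by (intro sum_nonneg mult_nonneg_nonneg) (auto intro: less_imp_le)
        then show ?case using x by (simp add: frac_le)
      qed simp
    qed (use w[OF k] S(1)[OF k] x in auto)
    then have "x * (1 + (\<Sum>l\<in>I. w k l * positive_iterate I w m' l x)) \<le> x * (1 + S / x)" using x by simp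
    moreover have "0 < x * (1 + (\<Sum>l\<in>I. w k l * positive_iterate I w m' l x))"
      using \<open>0 < positive_iterate I w m k x\<close> by (simp add: Suc zero_less_divide_iff)
    ultimately show ?thesis unfolding Suc positive_iterate.simps(2) by (rule one_le_inverse_mult[rotated])
  qed
qed

text \<open>Consecutive iterates differ by a ratio of at most \<open>1 + M * \<kappa>^m\<close>,
  starting from \<open>1 + M\<close> by the two-sided bounds. With all iterates at most
  \<open>1 / x\<close> the increments are dominated by a geometric series.\<close>

lemma positive_iterate_converges:
  assumes x: "x > 0"
  shows "\<exists>t. \<forall>k\<in>I. (\<lambda>m. positive_iterate I w m k x) \<longlonglongrightarrow> t k \<and> 0 \<le> t k \<and>
    t k = 1 / (x * (1 + (\<Sum>l\<in>I. w k l * t l)))"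
proof -
  define M where "M = S / x"
  define \<kappa> where "\<kappa> = M / (1 + M)"
  have M: "0 \<le> M" using S x by (simp add: M_def)
  have \<kappa>: "0 \<le> \<kappa>" "\<kappa> < 1" using M by (auto simp: \<kappa>_def)
  let ?T = "\<lambda>m k. positive_iterate I w m k x"
  note B = positive_iterate_bounds[OF x]
  have TM: "(\<Sum>l\<in>I. w k l * ?T m l) \<le> M" if "k \<in> I" for k m
    unfolding M_def using w[OF that] B(2) S(1)[OF that] x by (intro weighted_sum_le) auto
  have T0: "0 \<le> (\<Sum>l\<in>I. w k l * ?T m l)" if "k \<in> I" for k m
    using w[OF that] B(1) by (intro sum_nonneg mult_nonneg_nonneg) (auto intro: less_imp_le)
  have ratio: "?T (Suc m) k \<le> (1 + M * \<kappa> ^ m) * ?T m k \<and> ?T m k \<le> (1 + M * \<kappa> ^ m) * ?T (Suc m) k" if "k \<in> I" for k m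
    using that
  proof (induction m arbitrary: k)
    case 0
    have "?T (Suc 0) k \<le> (1 + M) * ?T 0 k"
      using B(2)[OF 0, of "Suc 0"] M x by (simp add: divide_right_mono order_trans[of _ "1 / x"] del: positive_iterate.simps(2))
    moreover have "?T 0 k \<le> (1 + M) * ?T (Suc 0) k"
      using B(3)[OF 0, of "Suc 0"] x by (simp add: M_def pos_divide_le_eq mult_ac del: positive_iterate.simps(2))
    ultimately show ?case by simp
  next
    case (Suc m)
    have r: "1 + M * \<kappa> ^ Suc m = 1 + M / (1 + M) * ((1 + M * \<kappa> ^ m) - 1)" by (simp add: \<kappa>_def)
    have recip: "1 / (x * u) \<le> q * (1 / (x * v))" if "v \<le> q * u" "0 < u" "0 < v" for u v q :: real
      using that x by (simp add: field_simps)
    have "1 + (\<Sum>l\<in>I. w k l * ?T m l) \<le> (1 + M * \<kappa> ^ Suc m) * (1 + (\<Sum>l\<in>I. w k l * ?T (Suc m) l))"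
      unfolding r using w[OF Suc.prems] Suc.IH B(1) TM[OF Suc.prems] M \<kappa>
      by (intro ratio_step) (auto intro: less_imp_le simp del: positive_iterate.simps)
    then have "?T (Suc (Suc m)) k \<le> (1 + M * \<kappa> ^ Suc m) * ?T (Suc m) k"
      unfolding positive_iterate.simps(2)[of I w "Suc m"] positive_iterate.simps(2)[of I w m k]
      using T0[OF Suc.prems, of m] T0[OF Suc.prems, of "Suc m"] by (intro recip) linarith+
    moreover have "1 + (\<Sum>l\<in>I. w k l * ?T (Suc m) l) \<le> (1 + M * \<kappa> ^ Suc m) * (1 + (\<Sum>l\<in>I. w k l * ?T m l))"
      unfolding r using w[OF Suc.prems] Suc.IH B(1) TM[OF Suc.prems] M \<kappa>
      by (intro ratio_step) (auto intro: less_imp_le simp del: positive_iterate.simps)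
    then have "?T (Suc m) k \<le> (1 + M * \<kappa> ^ Suc m) * ?T (Suc (Suc m)) k"
      unfolding positive_iterate.simps(2)[of I w "Suc m"] positive_iterate.simps(2)[of I w m k]
      using T0[OF Suc.prems, of m] T0[OF Suc.prems, of "Suc m"] by (intro recip) linarith+
    ultimately show ?case by blast
  qed
  have conv: "convergent (\<lambda>m. ?T m k)" if k: "k \<in> I" for k
  proof -
    have "norm (?T (Suc m) k - ?T m k) \<le> (M / x) * \<kappa> ^ m" for m
    proof -
      have "(M * \<kappa> ^ m) * ?T m k \<le> (M * \<kappa> ^ m) * (1 / x)" "(M * \<kappa> ^ m) * ?T (Suc m) k \<le> (M * \<kappa> ^ m) * (1 / x)"
        using B(2)[OF k] M \<kappa> by (intro mult_left_mono; simp del: positive_iterate.simps)+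
      then show ?thesis using ratio[OF k, of m]
        by (simp add: abs_le_iff distrib_right del: positive_iterate.simps)
    qed
    then have le: "norm (?T (Suc m) k - ?T m k) \<le> (M / x) * \<kappa> ^ m" if "m \<ge> 0" for m .
    have "summable (\<lambda>m. (M / x) * \<kappa> ^ m)" using \<kappa> by (intro summable_mult summable_geometric) simp
    from summable_comparison_test'[OF this le]
    have "convergent (\<lambda>n. \<Sum>m<n. ?T (Suc m) k - ?T m k)" by (simp only: summable_iff_convergent)
    then have "convergent (\<lambda>n. ?T n k - ?T 0 k)"
      unfolding sum_lessThan_telescope[of "\<lambda>m. positive_iterate I w m k x"] .
    then have "convergent (\<lambda>n. (?T n k - ?T 0 k) + ?T 0 k)" by (rule convergent_add) (rule convergent_const)
    then show ?thesis by simp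
  qed
  define t where "t k = lim (\<lambda>m. ?T m k)" for k
  have lim: "(\<lambda>m. ?T m k) \<longlonglongrightarrow> t k" if "k \<in> I" for k
    using conv[OF that] by (simp add: t_def convergent_LIMSEQ_iff)
  have tn: "0 \<le> t k" if "k \<in> I" for k
    by (rule LIMSEQ_le_const[OF lim[OF that]]) (use B(1)[OF that] in \<open>auto intro: less_imp_le\<close>)
  have "t k = 1 / (x * (1 + (\<Sum>l\<in>I. w k l * t l)))" if k: "k \<in> I" for k
  proof (rule LIMSEQ_unique)
    show "(\<lambda>m. ?T (Suc m) k) \<longlonglongrightarrow> t k" by (rule LIMSEQ_Suc[OF lim[OF k]])
    have "0 \<le> (\<Sum>l\<in>I. w k l * t l)" using w[OF k] tn by (intro sum_nonneg) auto
    then have "x * (1 + (\<Sum>l\<in>I. w k l * t l)) \<noteq> 0" using x by auto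
    then show "(\<lambda>m. ?T (Suc m) k) \<longlonglongrightarrow> 1 / (x * (1 + (\<Sum>l\<in>I. w k l * t l)))"
      unfolding positive_iterate.simps(2)
      by (intro tendsto_divide tendsto_mult tendsto_add tendsto_sum tendsto_const lim)
  qed
  then show ?thesis using lim tn by blast
qed

end

section \<open>Existence and uniqueness of the canonical solution\<close>

lemma stieltjes_kernel_bound:
  assumes "z \<notin> \<real>\<^sub>\<ge>\<^sub>0"
  obtains \<delta> where "\<delta> > 0" "\<And>t. 0 \<le> t \<Longrightarrow> \<delta> \<le> cmod (complex_of_real t - z)"
proof -
  have "open (- (\<real>\<^sub>\<ge>\<^sub>0 :: complex set))" by (simp add: closed_nonneg_Reals_complex open_Compl)
  then obtain \<delta> where d: "\<delta> > 0" "ball z \<delta> \<subseteq> - \<real>\<^sub>\<ge>\<^sub>0"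
    using assms by (metis ComplI open_contains_ball)
  have "\<delta> \<le> cmod (complex_of_real t - z)" if "0 \<le> t" for t
  proof (rule ccontr)
    assume "\<not> \<delta> \<le> cmod (complex_of_real t - z)"
    then have "complex_of_real t \<in> ball z \<delta>" by (simp add: dist_norm norm_minus_commute)
    with d that show False by auto
  qed
  with d that show thesis by blast
qed

context
  fixes \<mu> :: "real measure"
  assumes \<mu>: "real_distribution \<mu>" "measure \<mu> {0..} = 1"
begin

interpretation \<mu>: real_distribution \<mu> by (rule \<mu>(1))

lemma AE_nonneg: "AE t in \<mu>. 0 \<le> t"
  using \<mu>.AE_prob_1[OF \<mu>(2)] by simp

text \<open>The difference quotient of the kernel misses its derivative by exactly
  \<open>h / ((t - z - h) * (t - z)^2)\<close>, which has modulus at most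
  \<open>2 / \<delta>^3\<close> times that of \<open>h\<close>, with \<open>\<delta>\<close>
  bounding the distance of \<open>z\<close> to the half-line from below.\<close>

lemma stieltjes_has_derivative:
  assumes z: "z \<notin> \<real>\<^sub>\<ge>\<^sub>0"
  shows "((\<lambda>z. \<integral>t. 1 / (complex_of_real t - z) \<partial>\<mu>) has_field_derivative
    (\<integral>t. 1 / (complex_of_real t - z)\<^sup>2 \<partial>\<mu>)) (at z)"
proof -
  obtain \<delta> where \<delta>: "\<delta> > 0" "\<And>t. 0 \<le> t \<Longrightarrow> \<delta> \<le> cmod (complex_of_real t - z)"
    using stieltjes_kernel_bound[OF z] by blast
  define f where "f z = (\<integral>t. 1 / (complex_of_real t - z) \<partial>\<mu>)" for z
  define D where "D = (\<integral>t. 1 / (complex_of_real t - z)\<^sup>2 \<partial>\<mu>)"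
  have low: "\<delta> / 2 \<le> cmod (complex_of_real t - (z + h))" if "0 \<le> t" "cmod h < \<delta> / 2" for t h
  proof -
    have "cmod (complex_of_real t - z) \<le> cmod (complex_of_real t - (z + h)) + cmod h"
      using norm_triangle_ineq[of "complex_of_real t - (z + h)" h] by simp
    then show ?thesis using \<delta>(2)[OF that(1)] that(2) by linarith
  qed
  have i1: "integrable \<mu> (\<lambda>t. 1 / (complex_of_real t - (z + h)))" if "cmod h < \<delta> / 2" for h
  proof (rule \<mu>.integrable_const_bound)
    show "AE t in \<mu>. cmod (1 / (complex_of_real t - (z + h))) \<le> 1 / (\<delta> / 2)"
      using AE_nonneg
    proof eventually_elim
      case (elim t)
      from low[OF this that] show ?case using \<delta>(1) by (simp add: norm_divide divide_simps)
    qed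
  qed simp
  have i2: "integrable \<mu> (\<lambda>t. 1 / (complex_of_real t - z)\<^sup>2)"
  proof (rule \<mu>.integrable_const_bound)
    show "AE t in \<mu>. cmod (1 / (complex_of_real t - z)\<^sup>2) \<le> 1 / \<delta>\<^sup>2"
      using AE_nonneg
    proof eventually_elim
      case (elim t)
      from \<delta>(2)[OF this] have "\<delta>\<^sup>2 \<le> (cmod (complex_of_real t - z))\<^sup>2" using \<delta>(1) by (intro power_mono) auto
      then show ?case using \<delta>(1) by (simp add: norm_divide norm_power frac_le)
    qed
  qed simp
  have bound: "cmod ((f (z + h) - f z) / h - D) \<le> 2 / \<delta> ^ 3 * cmod h" if h: "h \<noteq> 0" "cmod h < \<delta> / 2" for h
  proof -
    have "(f (z + h) - f z) / h - D
      = (\<integral>t. (1 / (complex_of_real t - (z + h)) - 1 / (complex_of_real t - z)) / h - 1 / (complex_of_real t - z)\<^sup>2 \<partial>\<mu>)"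
      unfolding f_def D_def using i1[OF h(2)] i1[of 0] i2 \<delta>(1) by simp
    also have "cmod \<dots> \<le> (\<integral>t. 2 / \<delta> ^ 3 * cmod h \<partial>\<mu>)"
    proof (rule order_trans[OF integral_norm_bound integral_mono_AE])
      show "integrable \<mu> (\<lambda>t. cmod ((1 / (complex_of_real t - (z + h)) - 1 / (complex_of_real t - z)) / h - 1 / (complex_of_real t - z)\<^sup>2))"
        using i1[OF h(2)] i1[of 0] i2 \<delta>(1) by (intro integrable_norm) simp
      show "AE t in \<mu>. cmod ((1 / (complex_of_real t - (z + h)) - 1 / (complex_of_real t - z)) / h - 1 / (complex_of_real t - z)\<^sup>2)
          \<le> 2 / \<delta> ^ 3 * cmod h"
        using AE_nonneg
      proof eventually_elim
        case (elim t)
        define u where "u = complex_of_real t - z"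
        have u: "\<delta> \<le> cmod u" "\<delta> / 2 \<le> cmod (u - h)"
          using \<delta>(2)[OF elim] low[OF elim h(2)] by (simp_all add: u_def algebra_simps)
        then have nz: "u \<noteq> 0" "u - h \<noteq> 0" using \<delta>(1) by auto
        have "(1 / (u - h) - 1 / u) / h - 1 / u\<^sup>2 = h / ((u - h) * u\<^sup>2)"
          using nz h(1) by (simp add: field_simps power2_eq_square)
        also have "cmod \<dots> = cmod h / (cmod (u - h) * (cmod u)\<^sup>2)" by (simp add: norm_divide norm_mult norm_power)
        also have "\<dots> \<le> cmod h / (\<delta> / 2 * \<delta>\<^sup>2)"
          using u \<delta>(1) by (intro divide_left_mono mult_mono power_mono mult_pos_pos) (auto intro: zero_less_power)
        also have "\<dots> = 2 / \<delta> ^ 3 * cmod h" by (simp add: power3_eq_cube power2_eq_square mult_ac)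
        finally show ?case by (simp add: u_def diff_diff_eq)
      qed
    qed simp
    also have "(\<integral>t. 2 / \<delta> ^ 3 * cmod h \<partial>\<mu>) = 2 / \<delta> ^ 3 * cmod h" using \<mu>.prob_space by simp
    finally show ?thesis .
  qed
  have "((\<lambda>h. (f (z + h) - f z) / h - D) \<longlongrightarrow> 0) (at 0)"
  proof (rule Lim_null_comparison)
    have "eventually (\<lambda>h. h \<in> ball 0 (\<delta> / 2) - {0}) (at (0 :: complex))"
      using \<delta>(1) by (intro eventually_at_in_open) auto
    then show "eventually (\<lambda>h. cmod ((f (z + h) - f z) / h - D) \<le> 2 / \<delta> ^ 3 * cmod h) (at 0)"
      by eventually_elim (intro bound; simp)
    show "((\<lambda>h. 2 / \<delta> ^ 3 * cmod h) \<longlongrightarrow> 0) (at 0)"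
      by (intro tendsto_mult_right_zero tendsto_norm_zero tendsto_ident_at)
  qed
  then have "((\<lambda>h. (f (z + h) - f z) / h) \<longlongrightarrow> D) (at 0)" by (simp add: LIM_zero_cancel)
  then show ?thesis unfolding f_def D_def by (simp add: DERIV_def)
qed

lemma kernel_integrable:
  assumes "x > 0"
  shows "integrable \<mu> (\<lambda>t. 1 / (t + x))" "integrable \<mu> (\<lambda>t. 1 / (t + x)\<^sup>2)"
proof -
  show "integrable \<mu> (\<lambda>t. 1 / (t + x))"
  proof (rule \<mu>.integrable_const_bound)
    show "AE t in \<mu>. norm (1 / (t + x)) \<le> 1 / x"
      using AE_nonneg by eventually_elim (use assms in \<open>simp add: frac_le\<close>)
  qed simp
  show "integrable \<mu> (\<lambda>t. 1 / (t + x)\<^sup>2)"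
  proof (rule \<mu>.integrable_const_bound)
    show "AE t in \<mu>. norm (1 / (t + x)\<^sup>2) \<le> 1 / x\<^sup>2"
      using AE_nonneg by eventually_elim (use assms in \<open>simp add: frac_le power_mono\<close>)
  qed simp
qed

lemma stieltjes_negative_axis:
  assumes "x > 0"
  shows "(\<integral>t. 1 / (complex_of_real t - (- of_real x)) \<partial>\<mu>) = of_real (\<integral>t. 1 / (t + x) \<partial>\<mu>)"
    and "(\<integral>t. 1 / (complex_of_real t - (- of_real x))\<^sup>2 \<partial>\<mu>) = of_real (\<integral>t. 1 / (t + x)\<^sup>2 \<partial>\<mu>)"
    and "0 \<le> (\<integral>t. 1 / (t + x) \<partial>\<mu>)"
proof -
  have "(\<integral>t. 1 / (complex_of_real t - (- of_real x)) \<partial>\<mu>) = (\<integral>t. complex_of_real (1 / (t + x)) \<partial>\<mu>)"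
    by simp
  also have "\<dots> = of_real (\<integral>t. 1 / (t + x) \<partial>\<mu>)"
    by (rule integral_of_real[OF kernel_integrable(1)[OF assms]])
  finally show "(\<integral>t. 1 / (complex_of_real t - (- of_real x)) \<partial>\<mu>) = of_real (\<integral>t. 1 / (t + x) \<partial>\<mu>)" .
  have "(\<integral>t. 1 / (complex_of_real t - (- of_real x))\<^sup>2 \<partial>\<mu>) = (\<integral>t. complex_of_real (1 / (t + x)\<^sup>2) \<partial>\<mu>)"
    by simp
  also have "\<dots> = of_real (\<integral>t. 1 / (t + x)\<^sup>2 \<partial>\<mu>)"
    by (rule integral_of_real[OF kernel_integrable(2)[OF assms]])
  finally show "(\<integral>t. 1 / (complex_of_real t - (- of_real x))\<^sup>2 \<partial>\<mu>) = of_real (\<integral>t. 1 / (t + x)\<^sup>2 \<partial>\<mu>)" .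
  show "0 \<le> (\<integral>t. 1 / (t + x) \<partial>\<mu>)"
    by (rule integral_nonneg_AE) (use AE_nonneg assms in \<open>auto elim: eventually_mono\<close>)
qed

text \<open>Counterpart of \<open>res_taylor\<close> with the same bound: pointwise the remainder
  equals \<open>h^2 / ((u + h) * u^2)\<close> for \<open>u = t + x\<close>.\<close>

lemma stieltjes_taylor:
  assumes x: "x > 0" and h: "h > 0"
  shows "\<bar>(\<integral>t. 1 / (t + (x + h)) \<partial>\<mu>) - (\<integral>t. 1 / (t + x) \<partial>\<mu>) + h * (\<integral>t. 1 / (t + x)\<^sup>2 \<partial>\<mu>)\<bar> \<le> h\<^sup>2 / x ^ 3"
proof -
  have xh: "x + h > 0" using x h by simp
  define A where "A t = 1 / (t + (x + h))" for t
  define B where "B t = 1 / (t + x)" for t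
  define C where "C t = 1 / (t + x)\<^sup>2" for t
  have i: "integrable \<mu> A" "integrable \<mu> B" "integrable \<mu> C"
    using kernel_integrable[OF x] kernel_integrable(1)[OF xh] by (simp_all add: A_def[abs_def] B_def[abs_def] C_def[abs_def])
  have "(\<integral>t. A t \<partial>\<mu>) - (\<integral>t. B t \<partial>\<mu>) + h * (\<integral>t. C t \<partial>\<mu>) = (\<integral>t. A t - B t + h * C t \<partial>\<mu>)"
    using i by simp
  also have "\<bar>\<dots>\<bar> \<le> (\<integral>t. h\<^sup>2 / x ^ 3 \<partial>\<mu>)"
  proof (rule order_trans[OF integral_abs_bound integral_mono_AE])
    show "integrable \<mu> (\<lambda>t. \<bar>A t - B t + h * C t\<bar>)" using i by (intro integrable_abs) simp
    show "AE t in \<mu>. \<bar>A t - B t + h * C t\<bar> \<le> h\<^sup>2 / x ^ 3"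
      using AE_nonneg
    proof eventually_elim
      case (elim t)
      define u where "u = t + x"
      have u: "x \<le> u" "u > 0" "u + h > 0" using elim x h by (auto simp: u_def)
      have "1 / (u + h) - 1 / u = - h / ((u + h) * u)" using u by (simp add: diff_frac_eq)
      also have "\<dots> = - (h * u) / ((u + h) * u\<^sup>2)" using u by (simp add: power2_eq_square)
      finally have 1: "1 / (u + h) - 1 / u = - (h * u) / ((u + h) * u\<^sup>2)" .
      have 2: "h * (1 / u\<^sup>2) = h * (u + h) / ((u + h) * u\<^sup>2)" using u by simp
      have "A t - B t + h * C t = (- (h * u) + h * (u + h)) / ((u + h) * u\<^sup>2)"
        unfolding add_divide_distrib 1[symmetric] 2[symmetric] by (simp add: A_def B_def C_def u_def add.assoc)
      also have "\<dots> = h\<^sup>2 / ((u + h) * u\<^sup>2)" by (simp add: power2_eq_square distrib_left)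
      finally have eq: "A t - B t + h * C t = h\<^sup>2 / ((u + h) * u\<^sup>2)" .
      have "0 \<le> h\<^sup>2 / ((u + h) * u\<^sup>2)" using u by simp
      then have "\<bar>A t - B t + h * C t\<bar> = h\<^sup>2 / ((u + h) * u\<^sup>2)" unfolding eq by (rule abs_of_nonneg)
      also have "\<dots> \<le> h\<^sup>2 / (x * x\<^sup>2)"
        using u x h by (intro divide_left_mono mult_mono power_mono mult_pos_pos) auto
      also have "\<dots> = h\<^sup>2 / x ^ 3" by (simp add: power3_eq_cube power2_eq_square mult.assoc)
      finally show ?case .
    qed
  qed simp
  also have "(\<integral>t. h\<^sup>2 / x ^ 3 \<partial>\<mu>) = h\<^sup>2 / x ^ 3" using \<mu>.prob_space by simp
  finally show ?thesis unfolding A_def B_def C_def .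
qed

end

lemma stieltjes_transform_nonneg_holomorphic:
  assumes "stieltjes_transform_nonneg f"
  shows "f holomorphic_on - \<real>\<^sub>\<ge>\<^sub>0"
proof -
  from assms obtain \<mu> where \<mu>: "real_distribution \<mu>" "measure \<mu> {0..} = 1"
    and f: "\<And>z. z \<notin> \<real>\<^sub>\<ge>\<^sub>0 \<Longrightarrow> f z = (\<integral>t. 1 / (complex_of_real t - z) \<partial>\<mu>)"
    unfolding stieltjes_transform_nonneg_def by blast
  have "(\<lambda>z. \<integral>t. 1 / (complex_of_real t - z) \<partial>\<mu>) holomorphic_on - \<real>\<^sub>\<ge>\<^sub>0"
    unfolding holomorphic_on_def
  proof
    fix z :: complex assume "z \<in> - \<real>\<^sub>\<ge>\<^sub>0"
    then have "z \<notin> \<real>\<^sub>\<ge>\<^sub>0" by simp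
    from stieltjes_has_derivative[OF \<mu> this]
    show "(\<lambda>z. \<integral>t. 1 / (complex_of_real t - z) \<partial>\<mu>) field_differentiable at z within - \<real>\<^sub>\<ge>\<^sub>0"
      unfolding field_differentiable_def by (intro exI) (rule has_field_derivative_at_within)
  qed
  then show ?thesis by (rule holomorphic_transform) (simp add: f)
qed

text \<open>On the negative axis the kernel is \<open>1 / (t + x)\<close>, real and positive. The
  derivative term has a plus sign because \<open>deriv\<close> is taken in \<open>z = -x\<close>,
  against the direction of \<open>x\<close>.\<close>

lemma stieltjes_transform_nonneg_real:
  assumes f: "stieltjes_transform_nonneg f" and x: "x > 0"
  shows "f (- of_real x) = of_real (Re (f (- of_real x)))" "0 \<le> Re (f (- of_real x))"
    and "h > 0 \<Longrightarrow> \<bar>Re (f (- of_real (x + h))) - Re (f (- of_real x)) + h * Re (deriv f (- of_real x))\<bar> \<le> h\<^sup>2 / x ^ 3"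
proof -
  from f obtain \<mu> where \<mu>: "real_distribution \<mu>" "measure \<mu> {0..} = 1"
    and f: "\<And>z. z \<notin> \<real>\<^sub>\<ge>\<^sub>0 \<Longrightarrow> f z = (\<integral>t. 1 / (complex_of_real t - z) \<partial>\<mu>)"
    unfolding stieltjes_transform_nonneg_def by blast
  have out: "- complex_of_real y \<notin> \<real>\<^sub>\<ge>\<^sub>0" if "y > 0" for y
    using that by (simp add: complex_nonneg_Reals_iff)
  have fx: "f (- of_real y) = of_real (\<integral>t. 1 / (t + y) \<partial>\<mu>)" if "y > 0" for y
    using f[OF out[OF that]] stieltjes_negative_axis(1)[OF \<mu> that] by simp
  then show "f (- of_real x) = of_real (Re (f (- of_real x)))" "0 \<le> Re (f (- of_real x))"
    using x stieltjes_negative_axis(3)[OF \<mu> x] by simp_all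
  \<comment> \<open>\<open>f\<close> is known to equal the integral only off the half-line; that set
    is open, so the derivatives agree as well.\<close>
  have "(f has_field_derivative (\<integral>t. 1 / (complex_of_real t - (- of_real x))\<^sup>2 \<partial>\<mu>)) (at (- of_real x))"
  proof (rule has_field_derivative_transform_within_open[OF stieltjes_has_derivative[OF \<mu> out[OF x]]])
    show "open (- (\<real>\<^sub>\<ge>\<^sub>0 :: complex set))" by (simp add: closed_nonneg_Reals_complex open_Compl)
    show "- complex_of_real x \<in> - \<real>\<^sub>\<ge>\<^sub>0" using out[OF x] by simp
  qed (simp add: f)
  then have "deriv f (- of_real x) = of_real (\<integral>t. 1 / (t + x)\<^sup>2 \<partial>\<mu>)"
    using stieltjes_negative_axis(2)[OF \<mu> x] by (simp add: DERIV_imp_deriv)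
  then show "\<bar>Re (f (- of_real (x + h))) - Re (f (- of_real x)) + h * Re (deriv f (- of_real x))\<bar> \<le> h\<^sup>2 / x ^ 3"
    if h: "h > 0"
    using stieltjes_taylor[OF \<mu> x h] fx[OF x] fx[of "x + h"] x h by simp
qed

lemma atomic_stieltjes_imp_stieltjes:
  assumes "atomic_stieltjes f"
  shows "stieltjes_transform_nonneg f"
proof -
  from assms obtain F c where Fc: "finite F" "\<forall>t\<in>F. 0 \<le> t \<and> 0 \<le> c t" "(\<Sum>t\<in>F. c t) = 1"
    and f: "\<forall>z. z \<notin> \<real>\<^sub>\<ge>\<^sub>0 \<longrightarrow> f z = (\<Sum>t\<in>F. complex_of_real (c t) / (complex_of_real t - z))"
    unfolding atomic_stieltjes_def by (elim exE conjE) (rule that)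
  define c' where "c' t = (if t \<in> F then c t else 0)" for t
  define P where "P = embed_pmf c'"
  have pos: "0 \<le> c' t" for t using Fc by (simp add: c'_def)
  have "(\<integral>\<^sup>+t. c' t \<partial>count_space UNIV) = (\<Sum>t\<in>F. ennreal (c' t))"
    using Fc(1) by (intro nn_integral_count_space') (auto simp: c'_def)
  also have "\<dots> = ennreal (\<Sum>t\<in>F. c' t)" using pos by (rule sum_ennreal)
  also have "(\<Sum>t\<in>F. c' t) = 1" using Fc(3) by (simp add: c'_def cong: sum.cong)
  finally have one: "(\<integral>\<^sup>+t. c' t \<partial>count_space UNIV) = 1" by simp
  have pmf: "pmf P t = c' t" for t unfolding P_def using pos one by (rule pmf_embed_pmf)
  have sP: "set_pmf P \<subseteq> F" by (auto simp: set_pmf_eq pmf c'_def)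
  \<comment> \<open>A \<open>pmf\<close> carries the discrete sigma-algebra; the push-forward makes
    it a Borel law on the line.\<close>
  define \<mu> where "\<mu> = distr (measure_pmf P) borel (\<lambda>t. t)"
  have rd: "real_distribution \<mu>"
    unfolding \<mu>_def real_distribution_def real_distribution_axioms_def
    by (auto intro!: measure_pmf.prob_space_distr)
  have "measure \<mu> {0..} = measure (measure_pmf P) {0..}"
    unfolding \<mu>_def by (subst measure_distr) auto
  also have "\<dots> = 1" using sP Fc(2) by (subst measure_pmf.prob_eq_1) (auto simp: AE_measure_pmf_iff)
  finally have m1: "measure \<mu> {0..} = 1" .
  have "f z = (\<integral>t. 1 / (complex_of_real t - z) \<partial>\<mu>)" if z: "z \<notin> \<real>\<^sub>\<ge>\<^sub>0" for z
  proof -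
    have "(\<integral>t. 1 / (complex_of_real t - z) \<partial>\<mu>) = (\<integral>t. 1 / (complex_of_real t - z) \<partial>measure_pmf P)"
      unfolding \<mu>_def by (rule integral_distr) auto
    also have "\<dots> = (\<Sum>t\<in>F. pmf P t *\<^sub>R (1 / (complex_of_real t - z)))"
      using Fc(1) sP by (intro integral_measure_pmf) auto
    also have "\<dots> = (\<Sum>t\<in>F. complex_of_real (c t) / (complex_of_real t - z))"
      by (rule sum.cong) (simp_all add: pmf c'_def scaleR_conv_of_real)
    finally show ?thesis using f z by simp
  qed
  then show ?thesis unfolding stieltjes_transform_nonneg_def using rd m1 by blast
qed

text \<open>Each iterate is the Stieltjes transform of a finitely supported law; the laws are tight and the
  transforms converge on the negative axis, which determines the limit.\<close>

lemma stieltjes_limit_negative_axis: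
  fixes \<mu> :: "nat \<Rightarrow> real measure" and t :: "real \<Rightarrow> real"
  assumes \<mu>: "\<And>m. real_distribution (\<mu> m)" "\<And>m. measure (\<mu> m) {0..} = 1"
    and lim: "\<And>x. x > 0 \<Longrightarrow> (\<lambda>m. \<integral>u. 1 / (u + x) \<partial>\<mu> m) \<longlonglongrightarrow> t x"
    and low: "\<And>x m. x > 0 \<Longrightarrow> 1 \<le> (\<integral>u. 1 / (u + x) \<partial>\<mu> m) * (x * (1 + S / x))" and S: "0 \<le> S"
  shows "\<exists>\<nu>. real_distribution \<nu> \<and> measure \<nu> {0..} = 1 \<and> (\<forall>x>0. (\<integral>u. 1 / (u + x) \<partial>\<nu>) = t x)"
proof -
  \<comment> \<open>Since \<open>b / (u + b)\<close> is at most \<open>1\<close>, and at most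
    \<open>1 / 2\<close> beyond \<open>b\<close>, the tail mass is at most
    \<open>2 * (1 - b * I)\<close>. The lower bound \<open>1 / (b + S)\<close> for \<open>I\<close>
    turns this into \<open>2 * S / b\<close>, uniformly in \<open>m\<close>.\<close>
  have tail: "measure (\<mu> m) {b<..} \<le> 2 * S / b" if b: "b > 0" for m b
  proof -
    interpret real_distribution "\<mu> m" by (rule \<mu>)
    define I where "I = (\<integral>u. 1 / (u + b) \<partial>\<mu> m)"
    have "b * I = (\<integral>u. b * (1 / (u + b)) \<partial>\<mu> m)" unfolding I_def by (rule integral_mult_right_zero[symmetric])
    also have "\<dots> \<le> (\<integral>u. 1 - indicator {b<..} u / 2 \<partial>\<mu> m)"
    proof (rule integral_mono_AE)
      show "integrable (\<mu> m) (\<lambda>u. b * (1 / (u + b)))" using kernel_integrable(1)[OF \<mu> b, of m] by (rule integrable_mult_right)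
      show "integrable (\<mu> m) (\<lambda>u. 1 - indicator {b<..} u / 2 :: real)" by (intro integrable_const_bound[where B=1]) (auto split: split_indicator)
      show "AE u in \<mu> m. b * (1 / (u + b)) \<le> 1 - indicator {b<..} u / 2"
        using AE_nonneg[OF \<mu>]
        by eventually_elim (use b in \<open>auto simp: field_simps split: split_indicator\<close>)
    qed
    also have "\<dots> = 1 - measure (\<mu> m) {b<..} / 2"
      using prob_space by (subst Bochner_Integration.integral_diff) (auto intro!: integrable_const_bound[where B=1] split: split_indicator)
    finally have 1: "measure (\<mu> m) {b<..} \<le> 2 * (1 - b * I)" by simp
    have "1 \<le> I * (b + S)" using low[OF b, of m] b by (simp add: I_def algebra_simps)
    then have I: "1 / (b + S) \<le> I" using b S by (simp add: pos_divide_le_eq)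
    have "1 - b * I \<le> 1 - b * (1 / (b + S))" using mult_left_mono[OF I, of b] b by linarith
    also have "\<dots> = S / (b + S)" using b S by (simp add: field_simps)
    also have "\<dots> \<le> S / b" using b S by (intro divide_left_mono) auto
    finally show ?thesis using 1 by simp
  qed
  have "tight \<mu>"
    unfolding tight_def
  proof (intro conjI allI impI \<mu>)
    fix \<epsilon> :: real assume e: "\<epsilon> > 0"
    define b where "b = 2 * S / \<epsilon> + 1"
    have b: "b > 0" using S e by (simp add: b_def add_nonneg_pos)
    have "2 * S / b < \<epsilon>" using b e by (simp add: b_def field_simps)
    have "measure (\<mu> m) {-1<..b} > 1 - \<epsilon>" for m
    proof -
      interpret real_distribution "\<mu> m" by (rule \<mu>)
      have "1 = measure (\<mu> m) {0..}" using \<mu> by simp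
      also have "\<dots> \<le> measure (\<mu> m) ({-1<..b} \<union> {b<..})" by (intro finite_measure_mono) auto
      also have "\<dots> \<le> measure (\<mu> m) {-1<..b} + measure (\<mu> m) {b<..}"
        by (rule measure_Un_le) auto
      finally show ?thesis using tail[OF b, of m] \<open>2 * S / b < \<epsilon>\<close> by linarith
    qed
    then show "\<exists>a b. a < b \<and> (\<forall>n. 1 - \<epsilon> < measure (\<mu> n) {a<..b})" using b by (intro exI[of _ "-1"] exI[of _ b]) auto
  qed
  from tight_imp_convergent_subsubsequence[OF this strict_mono_id]
  obtain r \<nu> where r: "strict_mono (r :: nat \<Rightarrow> nat)" and \<nu>: "real_distribution \<nu>" and wc: "weak_conv_m (\<mu> \<circ> id \<circ> r) \<nu>"
    by blast
  interpret \<nu>: real_distribution \<nu> by (rule \<nu>)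
  have rd: "real_distribution ((\<mu> \<circ> id \<circ> r) n)" for n using \<mu> by simp
  note conv = weak_conv_imp_integral_bdd_continuous_conv[OF rd \<nu> wc]
  have AEn: "AE u in \<mu> m. 0 \<le> u" for m by (rule AE_nonneg[OF \<mu>])
  have supp: "AE u in \<nu>. 0 \<le> u"
  proof -
    \<comment> \<open>A bounded continuous function whose zeros are exactly the nonnegative numbers
      carries the support condition through weak convergence.\<close>
    define h where "h u = max 0 (min 1 (- u))" for u :: real
    have hc: "isCont h u" for u unfolding h_def by (intro continuous_intros)
    have hb: "norm (h u) \<le> 1" for u by (auto simp: h_def)
    have hm: "h \<in> borel_measurable borel" unfolding h_def by simp
    have "AE u in \<mu> (r n). h u = 0" for n using AEn by eventually_elim (simp add: h_def)
    then have "(\<integral>u. h u \<partial>(\<mu> \<circ> id \<circ> r) n) = 0" for n using integral_eq_zero_AE[where f=h and M="\<mu> (r n)"] by simp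
    then have "(\<integral>u. h u \<partial>\<nu>) = 0" using conv[OF hc hb] by (simp add: LIMSEQ_const_iff)
    moreover have "integrable \<nu> h" using hb hm by (intro \<nu>.integrable_const_bound[where B=1]) auto
    ultimately have "AE u in \<nu>. h u = 0"
      by (subst (asm) integral_nonneg_eq_0_iff_AE) (auto simp: h_def)
    then show ?thesis by eventually_elim (auto simp: h_def max_def min_def split: if_splits)
  qed
  have n1: "measure \<nu> {0..} = 1" using supp \<nu>.AE_in_set_eq_1[of "{0..}"] by simp
  have "(\<integral>u. 1 / (u + x) \<partial>\<nu>) = t x" if x: "x > 0" for x
  proof -
    \<comment> \<open>The kernel continued by a constant to the left of \<open>0\<close>: bounded
      and continuous on the whole line, with the same integrals for laws on the half-line.\<close>
    define g where "g u = 1 / (max 0 u + x)" for u :: real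
    have gc: "isCont g u" for u unfolding g_def using x by (intro continuous_intros) auto
    have gb: "norm (g u) \<le> 1 / x" for u using x by (auto simp: g_def intro!: frac_le)
    have gm: "g \<in> borel_measurable borel" unfolding g_def by simp
    have eq: "(\<integral>u. g u \<partial>\<rho>) = (\<integral>u. 1 / (u + x) \<partial>\<rho>)" if "real_distribution \<rho>" "AE u in \<rho>. 0 \<le> u" for \<rho>
    proof (rule integral_cong_AE)
      interpret real_distribution \<rho> by fact
      show "g \<in> borel_measurable \<rho>" using gm by simp
      show "(\<lambda>u. 1 / (u + x)) \<in> borel_measurable \<rho>" by simp
      show "AE u in \<rho>. g u = 1 / (u + x)" using that(2) by eventually_elim (simp add: g_def)
    qed
    have "(\<lambda>n. \<integral>u. g u \<partial>(\<mu> \<circ> id \<circ> r) n) \<longlonglongrightarrow> (\<integral>u. g u \<partial>\<nu>)" by (rule conv[OF gc gb])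
    then have "(\<lambda>n. \<integral>u. 1 / (u + x) \<partial>\<mu> (r n)) \<longlonglongrightarrow> (\<integral>u. 1 / (u + x) \<partial>\<nu>)"
      using eq[OF \<mu>(1) AEn] eq[OF \<nu> supp] by simp
    moreover have "(\<lambda>n. \<integral>u. 1 / (u + x) \<partial>\<mu> (r n)) \<longlonglongrightarrow> t x"
      using LIMSEQ_subseq_LIMSEQ[OF lim[OF x] r] by (simp add: comp_def)
    ultimately show ?thesis by (rule LIMSEQ_unique)
  qed
  then show ?thesis using \<nu> n1 by blast
qed

text \<open>The start \<open>-1 / z\<close> is the transform of the unit mass at \<open>0\<close>.
  At \<open>z = -x\<close> the recursion becomes that of \<open>positive_iterate\<close>.\<close>

fun stieltjes_iterate :: "'i set \<Rightarrow> ('i \<Rightarrow> 'i \<Rightarrow> real) \<Rightarrow> nat \<Rightarrow> 'i \<Rightarrow> complex \<Rightarrow> complex" where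
  "stieltjes_iterate I w 0 k = (\<lambda>z. -1 / z)"
| "stieltjes_iterate I w (Suc m) k = (\<lambda>z. -1 / (z * (1 + (\<Sum>l\<in>I. of_real (w k l) * stieltjes_iterate I w m l z))))"

text \<open>The mirror image of the plane slit along the nonpositive axis, which is
  starlike.\<close>

lemma connected_slit_plane: "connected (- (\<real>\<^sub>\<ge>\<^sub>0 :: complex set))"
proof -
  have "connected (uminus ` (- (complex_of_real ` {..0})))"
    by (intro connected_continuous_image starlike_imp_connected starlike_slotted_complex_plane_left continuous_intros)
  also have "uminus ` (- (complex_of_real ` {..0})) = - \<real>\<^sub>\<ge>\<^sub>0"
  proof -
    have "uminus ` (- (complex_of_real ` {..0})) = - (uminus ` (complex_of_real ` {..0}))"
      by (rule bij_image_Compl_eq) (simp add: bij_uminus)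
    also have "uminus ` (complex_of_real ` {..0}) = \<real>\<^sub>\<ge>\<^sub>0"
    proof (intro equalityI subsetI)
      fix z :: complex assume "z \<in> \<real>\<^sub>\<ge>\<^sub>0"
      then have "z = - complex_of_real (- Re z)" "- Re z \<le> 0" by (auto simp: complex_nonneg_Reals_iff complex_eq_iff)
      then show "z \<in> uminus ` (complex_of_real ` {..0})" by blast
    qed (auto simp: complex_nonneg_Reals_iff)
    finally show ?thesis .
  qed
  finally show ?thesis .
qed

text \<open>The ratio argument works only where all quantities are positive. So the limit laws are
  identified on the negative axis, and the equations are carried to the slit plane by analytic
  continuation.\<close>

theorem stieltjes_system_solution:
  fixes I :: "'i set" and w :: "'i \<Rightarrow> 'i \<Rightarrow> real"
  assumes fin: "finite I" and w: "\<And>k l. k \<in> I \<Longrightarrow> l \<in> I \<Longrightarrow> 0 \<le> w k l"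
  shows "\<exists>f. (\<forall>k\<in>I. stieltjes_transform_nonneg (f k)) \<and>
    (\<forall>z. z \<notin> \<real>\<^sub>\<ge>\<^sub>0 \<longrightarrow> (\<forall>k\<in>I. f k z = -1 / (z * (1 + (\<Sum>l\<in>I. of_real (w k l) * f l z)))))"
proof -
  \<comment> \<open>The total weight, a crude bound for every row sum; for existence any finite
    bound will do.\<close>
  define S where "S = (\<Sum>k\<in>I. \<Sum>l\<in>I. w k l)"
  have S0: "0 \<le> S" unfolding S_def using w by (intro sum_nonneg) auto
  have S: "(\<Sum>l\<in>I. w k l) \<le> S" if "k \<in> I" for k
    unfolding S_def using fin w that by (intro member_le_sum[of k I "\<lambda>k. \<Sum>l\<in>I. w k l"]) (auto intro: sum_nonneg)
  let ?f = "stieltjes_iterate I w"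
  have atomic: "atomic_stieltjes (?f m k)" if "k \<in> I" for m k
    using that
  proof (induction m arbitrary: k)
    case 0
    show ?case unfolding atomic_stieltjes_def
      by (intro exI[of _ "{0}"] exI[of _ "\<lambda>_. 1"]) (auto simp: field_simps)
  next
    case (Suc m)
    then show ?case unfolding stieltjes_iterate.simps using fin w by (intro atomic_stieltjes_step) blast+
  qed
  have "\<forall>m k. \<exists>\<mu>. k \<in> I \<longrightarrow> real_distribution \<mu> \<and> measure \<mu> {0..} = 1 \<and>
      (\<forall>z. z \<notin> \<real>\<^sub>\<ge>\<^sub>0 \<longrightarrow> ?f m k z = (\<integral>t. 1 / (complex_of_real t - z) \<partial>\<mu>))"
    using atomic_stieltjes_imp_stieltjes[OF atomic] unfolding stieltjes_transform_nonneg_def by blast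
  then obtain \<mu> where \<mu>: "\<And>m k. k \<in> I \<Longrightarrow> real_distribution (\<mu> m k) \<and> measure (\<mu> m k) {0..} = 1 \<and>
      (\<forall>z. z \<notin> \<real>\<^sub>\<ge>\<^sub>0 \<longrightarrow> ?f m k z = (\<integral>t. 1 / (complex_of_real t - z) \<partial>\<mu> m k))"
    by metis
  have out: "- complex_of_real y \<notin> \<real>\<^sub>\<ge>\<^sub>0" if "y > 0" for y
    using that by (simp add: complex_nonneg_Reals_iff)
  have real: "?f m k (- of_real x) = of_real (positive_iterate I w m k x)" for m k x
    by (induction m arbitrary: k) simp_all
  have pos: "(\<integral>u. 1 / (u + x) \<partial>\<mu> m k) = positive_iterate I w m k x" if "k \<in> I" "x > 0" for m k x
    using stieltjes_negative_axis(1)[of "\<mu> m k" x] \<mu>[OF that(1), of m] out[OF that(2)] real[of m k x] that(2)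
    by (metis of_real_eq_iff)
  have "\<forall>x. \<exists>t. x > 0 \<longrightarrow> (\<forall>k\<in>I. (\<lambda>m. positive_iterate I w m k x) \<longlonglongrightarrow> t k \<and> 0 \<le> t k \<and>
    t k = 1 / (x * (1 + (\<Sum>l\<in>I. w k l * t l))))"
  proof
    fix x
    have "\<exists>t. \<forall>k\<in>I. (\<lambda>m. positive_iterate I w m k x) \<longlonglongrightarrow> t k \<and> 0 \<le> t k \<and>
        t k = 1 / (x * (1 + (\<Sum>l\<in>I. w k l * t l)))" if "x > 0"
      by (rule positive_iterate_converges[OF fin]) (use w S S0 that in blast)+
    then show "\<exists>t. x > 0 \<longrightarrow> (\<forall>k\<in>I. (\<lambda>m. positive_iterate I w m k x) \<longlonglongrightarrow> t k \<and> 0 \<le> t k \<and>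
        t k = 1 / (x * (1 + (\<Sum>l\<in>I. w k l * t l))))" by blast
  qed
  from choice[OF this] obtain t where t: "\<forall>x. x > 0 \<longrightarrow> (\<forall>k\<in>I. (\<lambda>m. positive_iterate I w m k x) \<longlonglongrightarrow> t x k \<and>
    0 \<le> t x k \<and> t x k = 1 / (x * (1 + (\<Sum>l\<in>I. w k l * t x l))))"
    by (elim exE) (rule that)
  have t1: "(\<lambda>m. positive_iterate I w m k x) \<longlonglongrightarrow> t x k" and t2: "0 \<le> t x k"
    and t3: "t x k = 1 / (x * (1 + (\<Sum>l\<in>I. w k l * t x l)))" if "x > 0" "k \<in> I" for x k
    using t that by blast+
  have "\<forall>k. \<exists>\<nu>. k \<in> I \<longrightarrow> real_distribution \<nu> \<and> measure \<nu> {0..} = 1 \<and> (\<forall>x>0. (\<integral>u. 1 / (u + x) \<partial>\<nu>) = t x k)"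
  proof
    fix k
    have "k \<in> I \<Longrightarrow> \<exists>\<nu>. real_distribution \<nu> \<and> measure \<nu> {0..} = 1 \<and> (\<forall>x>0. (\<integral>u. 1 / (u + x) \<partial>\<nu>) = t x k)"
    proof (rule stieltjes_limit_negative_axis[OF _ _ _ _ S0])
      assume k: "k \<in> I"
      show "real_distribution (\<mu> m k)" "measure (\<mu> m k) {0..} = 1" for m using \<mu>[OF k] by auto
      show "(\<lambda>m. \<integral>u. 1 / (u + x) \<partial>\<mu> m k) \<longlonglongrightarrow> t x k" if "x > 0" for x
        unfolding pos[OF k that] by (rule t1[OF that k])
      show "1 \<le> (\<integral>u. 1 / (u + x) \<partial>\<mu> m k) * (x * (1 + S / x))" if "x > 0" for x m
        unfolding pos[OF k that] by (rule positive_iterate_bounds(3)[OF fin w S S0 that k])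
    qed
    then show "\<exists>\<nu>. k \<in> I \<longrightarrow> real_distribution \<nu> \<and> measure \<nu> {0..} = 1 \<and> (\<forall>x>0. (\<integral>u. 1 / (u + x) \<partial>\<nu>) = t x k)"
      by blast
  qed
  from choice[OF this] obtain \<nu> where \<nu>': "\<forall>k. k \<in> I \<longrightarrow> real_distribution (\<nu> k) \<and> measure (\<nu> k) {0..} = 1 \<and>
      (\<forall>x>0. (\<integral>u. 1 / (u + x) \<partial>\<nu> k) = t x k)"
    by (elim exE) (rule that)
  have \<nu>: "real_distribution (\<nu> k) \<and> measure (\<nu> k) {0..} = 1 \<and> (\<forall>x>0. (\<integral>u. 1 / (u + x) \<partial>\<nu> k) = t x k)"
    if "k \<in> I" for k using \<nu>' that by blast
  define F where "F k z = (\<integral>t. 1 / (complex_of_real t - z) \<partial>\<nu> k)" for k z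
  have st: "stieltjes_transform_nonneg (F k)" if "k \<in> I" for k
    unfolding stieltjes_transform_nonneg_def F_def using \<nu>[OF that] by blast
  have Fx: "F k (- of_real x) = of_real (t x k)" if "k \<in> I" "x > 0" for k x
    unfolding F_def using stieltjes_negative_axis(1)[of "\<nu> k" x] \<nu>[OF that(1)] that(2) by simp
  have "F k z = -1 / (z * (1 + (\<Sum>l\<in>I. of_real (w k l) * F l z)))" if z: "z \<notin> \<real>\<^sub>\<ge>\<^sub>0" and k: "k \<in> I" for z k
  proof -
    \<comment> \<open>The equation with its denominator cleared, so that holomorphy does not
      presuppose a nonzero denominator. That the denominator is nonzero follows afterwards, as its
      product with \<open>F k z\<close> is \<open>-1\<close>.\<close>
    define \<phi> where "\<phi> z = F k z * (z * (1 + (\<Sum>l\<in>I. of_real (w k l) * F l z))) + 1" for z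
    have "\<phi> z = 0"
    proof (rule analytic_continuation[where S = "- \<real>\<^sub>\<ge>\<^sub>0" and U = "complex_of_real ` {..<0}" and \<xi> = "-1" and f = \<phi>])
      show "\<phi> holomorphic_on - \<real>\<^sub>\<ge>\<^sub>0"
        unfolding \<phi>_def using st k by (intro holomorphic_intros stieltjes_transform_nonneg_holomorphic) auto
      show "open (- (\<real>\<^sub>\<ge>\<^sub>0 :: complex set))" by (simp add: closed_nonneg_Reals_complex open_Compl)
      show "connected (- (\<real>\<^sub>\<ge>\<^sub>0 :: complex set))" by (rule connected_slit_plane)
      show "complex_of_real ` {..<0} \<subseteq> - \<real>\<^sub>\<ge>\<^sub>0" "- 1 \<in> - (\<real>\<^sub>\<ge>\<^sub>0 :: complex set)"
        by (auto simp: complex_nonneg_Reals_iff)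
      show "- 1 islimpt complex_of_real ` {..<0}"
        unfolding islimpt_approachable
      proof (intro allI impI)
        fix e :: real assume e: "e > 0"
        have "complex_of_real (- 1 - e / 2) \<in> complex_of_real ` {..<0}"
          using e by (intro imageI) simp
        moreover have "complex_of_real (- 1 - e / 2) \<noteq> - 1 \<and> dist (complex_of_real (- 1 - e / 2)) (- 1) < e"
          using e by (simp add: dist_norm complex_eq_iff)
        ultimately show "\<exists>x'\<in>complex_of_real ` {..<0}. x' \<noteq> - 1 \<and> dist x' (- 1) < e" by blast
      qed
      show "z \<in> - \<real>\<^sub>\<ge>\<^sub>0" using z by simp
      fix y assume "y \<in> complex_of_real ` {..<0}"
      then obtain x where x: "x > 0" "y = - of_real x" by (auto intro: that[of "- _"])
      have "0 \<le> t x l" if "l \<in> I" for l by (rule t2[OF x(1) that])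
      then have nn: "0 \<le> (\<Sum>l\<in>I. w k l * t x l)" using w[OF k] by (intro sum_nonneg) auto
      have "(\<Sum>l\<in>I. of_real (w k l) * F l y) = complex_of_real (\<Sum>l\<in>I. w k l * t x l)"
        unfolding x(2) using Fx x(1) by simp
      then have "\<phi> y = of_real (1 - t x k * (x * (1 + (\<Sum>l\<in>I. w k l * t x l))))"
        by (simp add: \<phi>_def Fx[OF k x(1)] x(2))
      also have "t x k * (x * (1 + (\<Sum>l\<in>I. w k l * t x l))) = 1"
      proof -
        have "x * (1 + (\<Sum>l\<in>I. w k l * t x l)) \<noteq> 0" using nn x by auto
        from iffD1[OF nonzero_eq_divide_eq[OF this] t3[OF x(1) k]] show ?thesis .
      qed
      finally show "\<phi> y = 0" by simp
    qed
    then have e: "F k z * (z * (1 + (\<Sum>l\<in>I. of_real (w k l) * F l z))) = -1"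
      by (simp add: \<phi>_def add_eq_0_iff2)
    then have "z * (1 + (\<Sum>l\<in>I. of_real (w k l) * F l z)) \<noteq> 0" by auto
    with e show ?thesis by (metis nonzero_eq_divide_eq)
  qed
  with st show ?thesis by blast
qed

section \<open>Conditional risks\<close>

lemma UNIV_source: "UNIV = {Coefficients, Design, Noise, Test_Point, Test_Noise}"
  using source.exhaust by auto

context prob_space
begin

text \<open>With one function per source, independence of the generated sigma-algebras becomes a
  product rule for expectations.\<close>

lemma independent_sources_product:
  fixes h :: "source \<Rightarrow> 'a \<Rightarrow> real"
  assumes ind: "indep_sets (\<lambda>s. sets (F s)) UNIV" and sp: "\<And>s. space (F s) = space M"
    and h: "\<And>s. h s \<in> borel_measurable (F s)" "\<And>s. integrable M (h s)"
  shows "integrable M (\<lambda>\<omega>. \<Prod>s\<in>UNIV. h s \<omega>)"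
    and "expectation (\<lambda>\<omega>. \<Prod>s\<in>UNIV. h s \<omega>) = (\<Prod>s\<in>UNIV. expectation (h s))"
proof -
  have "indep_sets (\<lambda>s. {h s -` A \<inter> space M |A. A \<in> sets borel}) UNIV"
  proof (rule indep_sets_mono_sets[OF ind])
    fix s show "{h s -` A \<inter> space M |A. A \<in> sets borel} \<subseteq> sets (F s)"
      using measurable_sets[OF h(1)[of s]] sp[of s] by auto
  qed
  then have iv: "indep_vars (\<lambda>_. borel) h UNIV"
    unfolding indep_vars_def2 using h(2) by auto
  have fin: "finite (UNIV :: source set)" by (simp add: UNIV_source)
  show "integrable M (\<lambda>\<omega>. \<Prod>s\<in>UNIV. h s \<omega>)" by (rule indep_vars_integrable[OF fin iv h(2)])
  show "expectation (\<lambda>\<omega>. \<Prod>s\<in>UNIV. h s \<omega>) = (\<Prod>s\<in>UNIV. expectation (h s))"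
    by (rule indep_vars_lebesgue_integral[OF fin iv h(2)])
qed

text \<open>Conditionally on the design, a sum of squares of linear combinations of uncorrelated products
  of the other sources is the corresponding weighted sum of variances.\<close>

lemma cond_exp_sum_of_squares:
  fixes D :: "'r \<Rightarrow> 'q \<Rightarrow> 'a \<Rightarrow> real" and b e x t :: "'q \<Rightarrow> 'a \<Rightarrow> real" and v :: "'q \<Rightarrow> real"
  assumes ind: "indep_sets (\<lambda>s. sets (F s)) UNIV" and sp: "\<And>s. space (F s) = space M"
    and fin: "finite R" "finite A"
    and D: "\<And>i q. i \<in> R \<Longrightarrow> q \<in> A \<Longrightarrow> D i q \<in> borel_measurable (F Design)"
      "\<And>i q \<omega>. i \<in> R \<Longrightarrow> q \<in> A \<Longrightarrow> \<bar>D i q \<omega>\<bar> \<le> B"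
    and meas: "\<And>q. q \<in> A \<Longrightarrow> b q \<in> borel_measurable (F Coefficients)" "\<And>q. q \<in> A \<Longrightarrow> e q \<in> borel_measurable (F Noise)"
      "\<And>q. q \<in> A \<Longrightarrow> x q \<in> borel_measurable (F Test_Point)" "\<And>q. q \<in> A \<Longrightarrow> t q \<in> borel_measurable (F Test_Noise)"
    and integ: "\<And>q r. q \<in> A \<Longrightarrow> r \<in> A \<Longrightarrow> integrable M (\<lambda>\<omega>. b q \<omega> * b r \<omega>)"
      "\<And>q r. q \<in> A \<Longrightarrow> r \<in> A \<Longrightarrow> integrable M (\<lambda>\<omega>. e q \<omega> * e r \<omega>)"
      "\<And>q r. q \<in> A \<Longrightarrow> r \<in> A \<Longrightarrow> integrable M (\<lambda>\<omega>. x q \<omega> * x r \<omega>)"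
      "\<And>q r. q \<in> A \<Longrightarrow> r \<in> A \<Longrightarrow> integrable M (\<lambda>\<omega>. t q \<omega> * t r \<omega>)"
    and ortho: "\<And>q r. q \<in> A \<Longrightarrow> r \<in> A \<Longrightarrow>
        expectation (\<lambda>\<omega>. b q \<omega> * b r \<omega>) * expectation (\<lambda>\<omega>. e q \<omega> * e r \<omega>)
        * expectation (\<lambda>\<omega>. x q \<omega> * x r \<omega>) * expectation (\<lambda>\<omega>. t q \<omega> * t r \<omega>) = (if q = r then v q else 0)"
  shows "AE \<omega> in M. real_cond_exp M (F Design)
      (\<lambda>\<omega>. \<Sum>i\<in>R. (\<Sum>q\<in>A. D i q \<omega> * (b q \<omega> * e q \<omega> * x q \<omega> * t q \<omega>))\<^sup>2) \<omega>
    = (\<Sum>i\<in>R. \<Sum>q\<in>A. (D i q \<omega>)\<^sup>2 * v q)"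
proof -
  let ?G = "F Design"
  have subs: "sets (F s) \<subseteq> events" for s using ind by (auto simp: indep_sets_def)
  interpret finite_measure_subalgebra M ?G
    by unfold_locales (simp add: subalgebra_def sp subs)
  have DM: "D i q \<in> borel_measurable M" if "i \<in> R" "q \<in> A" for i q
    using D(1)[OF that] subs[of Design] sp[of Design] by (metis measurable_from_subalg subalg)
  define g where "g q r \<omega> = (b q \<omega> * b r \<omega>) * (e q \<omega> * e r \<omega>) * (x q \<omega> * x r \<omega>) * (t q \<omega> * t r \<omega>)" for q r \<omega>
  have prod_term: "integrable M (\<lambda>\<omega>. c \<omega> * g q r \<omega>) \<and>
      expectation (\<lambda>\<omega>. c \<omega> * g q r \<omega>) = expectation c * (if q = r then v q else 0)"
    if qr: "q \<in> A" "r \<in> A" and c: "c \<in> borel_measurable ?G" "\<And>\<omega>. \<bar>c \<omega>\<bar> \<le> C" for q r c C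
  proof -
    \<comment> \<open>The integrand sorted by source: \<open>c\<close> collects all that depends on
      the design, the other four factors are the pair products whose means are governed by
      \<open>ortho\<close>.\<close>
    define h where "h s = (case s of Coefficients \<Rightarrow> (\<lambda>\<omega>. b q \<omega> * b r \<omega>) | Design \<Rightarrow> c
      | Noise \<Rightarrow> (\<lambda>\<omega>. e q \<omega> * e r \<omega>) | Test_Point \<Rightarrow> (\<lambda>\<omega>. x q \<omega> * x r \<omega>) | Test_Noise \<Rightarrow> (\<lambda>\<omega>. t q \<omega> * t r \<omega>))" for s
    have cM: "c \<in> borel_measurable M" using measurable_from_subalg[OF subalg c(1)] .
    have ci: "integrable M c" by (rule integrable_const_bound[where B=C]) (use c(2) cM in auto)
    have hm: "h s \<in> borel_measurable (F s)" for s
      using meas[OF qr(1)] meas[OF qr(2)] c(1) by (cases s) (simp_all add: h_def)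
    have hi: "integrable M (h s)" for s
      using integ[OF qr] ci by (cases s) (simp_all add: h_def)
    have p: "(\<Prod>s\<in>UNIV. h s \<omega>) = c \<omega> * g q r \<omega>" for \<omega>
      by (simp add: UNIV_source h_def g_def mult_ac)
    have "(\<Prod>s\<in>UNIV. expectation (h s)) = expectation c * (if q = r then v q else 0)"
      unfolding ortho[OF qr, symmetric] by (simp add: UNIV_source h_def mult_ac)
    then show ?thesis using independent_sources_product[OF ind sp hm hi] unfolding p by simp
  qed
  define f where "f \<omega> = (\<Sum>i\<in>R. \<Sum>q\<in>A. \<Sum>r\<in>A. (D i q \<omega> * D i r \<omega>) * g q r \<omega>)" for \<omega>
  define k where "k \<omega> = (\<Sum>i\<in>R. \<Sum>q\<in>A. (D i q \<omega>)\<^sup>2 * v q)" for \<omega>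
  have DD: "(\<lambda>\<omega>. D i q \<omega> * D i r \<omega>) \<in> borel_measurable ?G" "\<bar>D i q \<omega> * D i r \<omega>\<bar> \<le> B * B"
    if "i \<in> R" "q \<in> A" "r \<in> A" for i q r \<omega>
  proof -
    show "(\<lambda>\<omega>. D i q \<omega> * D i r \<omega>) \<in> borel_measurable ?G" using D(1) that by simp
    show "\<bar>D i q \<omega> * D i r \<omega>\<bar> \<le> B * B"
      unfolding abs_mult using D(2)[OF that(1,2), of \<omega>] D(2)[OF that(1,3), of \<omega>] by (intro mult_mono) linarith+
  qed
  have f: "(\<Sum>i\<in>R. (\<Sum>q\<in>A. D i q \<omega> * (b q \<omega> * e q \<omega> * x q \<omega> * t q \<omega>))\<^sup>2) = f \<omega>" for \<omega>
    unfolding f_def power2_eq_square sum_product by (intro sum.cong refl) (simp add: g_def mult_ac)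
  have fi: "integrable M f"
    unfolding f_def using prod_term[OF _ _ DD] by (intro Bochner_Integration.integrable_sum) blast
  have kb: "integrable M k"
    unfolding k_def
  proof (intro Bochner_Integration.integrable_sum integrable_mult_left)
    fix i q assume iq: "i \<in> R" "q \<in> A"
    show "integrable M (\<lambda>\<omega>. (D i q \<omega>)\<^sup>2)"
    proof (rule integrable_const_bound)
      show "AE \<omega> in M. norm ((D i q \<omega>)\<^sup>2) \<le> B * B"
        using DD(2)[OF iq iq(2)] by (simp add: power2_eq_square)
    qed (use DM[OF iq] in simp)
  qed
  have km: "k \<in> borel_measurable ?G"
    unfolding k_def using D(1) by (intro borel_measurable_sum borel_measurable_times borel_measurable_power borel_measurable_const) auto
  \<comment> \<open>Integrating over an event \<open>E\<close> of the design only multiplies the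
    design factor by a bounded indicator, so \<open>prod_term\<close> still applies and all terms
    with \<open>q \<noteq> r\<close> drop out.\<close>
  have "AE \<omega> in M. real_cond_exp M ?G f \<omega> = k \<omega>"
  proof (rule real_cond_exp_charact[OF _ fi kb km])
    fix E assume E: "E \<in> sets ?G"
    have im: "(\<lambda>\<omega>. indicator E \<omega> * (D i q \<omega> * D i r \<omega>)) \<in> borel_measurable ?G"
      "\<bar>indicator E \<omega> * (D i q \<omega> * D i r \<omega>)\<bar> \<le> B * B" if "i \<in> R" "q \<in> A" "r \<in> A" for i q r \<omega>
    proof -
      show "(\<lambda>\<omega>. indicator E \<omega> * (D i q \<omega> * D i r \<omega>)) \<in> borel_measurable ?G"
        by (rule borel_measurable_times[OF borel_measurable_indicator[OF E] DD(1)[OF that]])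
      show "\<bar>indicator E \<omega> * (D i q \<omega> * D i r \<omega>)\<bar> \<le> B * B"
        using DD(2)[OF that, of \<omega>] abs_ge_zero[of "D i q \<omega> * D i r \<omega>"] by (auto split: split_indicator)
    qed
    have t: "integrable M (\<lambda>\<omega>. (indicator E \<omega> * (D i q \<omega> * D i r \<omega>)) * g q r \<omega>)"
      "expectation (\<lambda>\<omega>. (indicator E \<omega> * (D i q \<omega> * D i r \<omega>)) * g q r \<omega>)
         = expectation (\<lambda>\<omega>. indicator E \<omega> * (D i q \<omega> * D i r \<omega>)) * (if q = r then v q else 0)"
      if "i \<in> R" "q \<in> A" "r \<in> A" for i q r
      using prod_term[OF that(2,3) im[OF that]] by auto
    have ii: "integrable M (\<lambda>\<omega>. indicator E \<omega> * (D i q \<omega> * D i r \<omega>))" if "i \<in> R" "q \<in> A" "r \<in> A" for i q r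
      using im(2)[OF that] measurable_from_subalg[OF subalg im(1)[OF that]]
      by (intro integrable_const_bound[where B="B * B"]) auto
    have "(\<integral>\<omega>\<in>E. f \<omega> \<partial>M) = expectation (\<lambda>\<omega>. \<Sum>i\<in>R. \<Sum>q\<in>A. \<Sum>r\<in>A. (indicator E \<omega> * (D i q \<omega> * D i r \<omega>)) * g q r \<omega>)"
      by (simp add: set_lebesgue_integral_def f_def sum_distrib_left mult.assoc)
    also have "\<dots> = (\<Sum>i\<in>R. \<Sum>q\<in>A. \<Sum>r\<in>A. expectation (\<lambda>\<omega>. (indicator E \<omega> * (D i q \<omega> * D i r \<omega>)) * g q r \<omega>))"
      using t(1) by (simp add: Bochner_Integration.integral_sum Bochner_Integration.integrable_sum)
    also have "\<dots> = (\<Sum>i\<in>R. \<Sum>q\<in>A. \<Sum>r\<in>A. if q = r then expectation (\<lambda>\<omega>. indicator E \<omega> * (D i q \<omega> * D i r \<omega>)) * v q else 0)"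
      using t(2) by (intro sum.cong refl) simp
    also have "\<dots> = (\<Sum>i\<in>R. \<Sum>q\<in>A. expectation (\<lambda>\<omega>. indicator E \<omega> * (D i q \<omega> * D i q \<omega>)) * v q)"
      using fin by simp
    also have "\<dots> = expectation (\<lambda>\<omega>. \<Sum>i\<in>R. \<Sum>q\<in>A. (indicator E \<omega> * (D i q \<omega> * D i q \<omega>)) * v q)"
    proof -
      have "integrable M (\<lambda>\<omega>. (indicator E \<omega> * (D i q \<omega> * D i q \<omega>)) * v q)" if "i \<in> R" "q \<in> A" for i q
        using ii[OF that that(2)] by (rule integrable_mult_left)
      then show ?thesis by (simp add: Bochner_Integration.integral_sum Bochner_Integration.integrable_sum)
    qed
    also have "\<dots> = (\<integral>\<omega>\<in>E. k \<omega> \<partial>M)"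
      by (simp add: set_lebesgue_integral_def k_def sum_distrib_left mult.assoc power2_eq_square)
    finally show "(\<integral>\<omega>\<in>E. f \<omega> \<partial>M) = (\<integral>\<omega>\<in>E. k \<omega> \<partial>M)" .
  qed
  then show ?thesis unfolding f k_def .
qed

end

section \<open>The ridge model at one size: exact conditional risks\<close>

locale ridge_model = prob_space M for M :: "'a measure" +
  fixes n p :: nat and \<gamma> :: "nat \<Rightarrow> nat \<Rightarrow> real" and \<gamma>t :: "nat \<Rightarrow> real"
    and Z :: "nat \<Rightarrow> nat \<Rightarrow> 'a \<Rightarrow> real" and zt \<beta> \<epsilon> :: "nat \<Rightarrow> 'a \<Rightarrow> real" and \<epsilon>t :: "'a \<Rightarrow> real"
    and \<sigma> \<alpha> lam :: real
  assumes n: "n \<ge> 1" and lam: "lam > 0"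
    and sources: "indep_sources M n p (\<lambda>\<omega>. Matrix.vec p (\<lambda>j. \<beta> j \<omega>)) (design_matrix n p \<gamma> Z)
      (\<lambda>\<omega>. Matrix.vec n (\<lambda>i. \<epsilon> i \<omega>)) (test_point p \<gamma>t zt) \<epsilon>t"
    and zt_ind: "indep_vars (\<lambda>_. borel) zt {..<p}"
    and zt: "\<And>j. j < p \<Longrightarrow> integrable M (zt j) \<and> expectation (zt j) = 0 \<and>
      integrable M (\<lambda>\<omega>. (zt j \<omega>)\<^sup>2) \<and> expectation (\<lambda>\<omega>. (zt j \<omega>)\<^sup>2) = 1"
    and \<epsilon>_ind: "indep_vars (\<lambda>_. borel) \<epsilon> {..<n}"
    and \<epsilon>: "\<And>i. i < n \<Longrightarrow> integrable M (\<epsilon> i) \<and> expectation (\<epsilon> i) = 0 \<and>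
      integrable M (\<lambda>\<omega>. (\<epsilon> i \<omega>)\<^sup>2) \<and> expectation (\<lambda>\<omega>. (\<epsilon> i \<omega>)\<^sup>2) = \<sigma>\<^sup>2"
    and \<epsilon>t: "integrable M \<epsilon>t \<and> expectation \<epsilon>t = 0 \<and>
      integrable M (\<lambda>\<omega>. (\<epsilon>t \<omega>)\<^sup>2) \<and> expectation (\<lambda>\<omega>. (\<epsilon>t \<omega>)\<^sup>2) = \<sigma>\<^sup>2"
    and \<beta>1: "\<And>j. j < p \<Longrightarrow> integrable M (\<beta> j) \<and> expectation (\<beta> j) = 0"
    and \<beta>2: "\<And>j k. j < p \<Longrightarrow> k < p \<Longrightarrow> integrable M (\<lambda>\<omega>. \<beta> j \<omega> * \<beta> k \<omega>) \<and>
      expectation (\<lambda>\<omega>. \<beta> j \<omega> * \<beta> k \<omega>) = (if j = k then \<alpha>\<^sup>2 / real p else 0)"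
begin

definition X :: "'a \<Rightarrow> nat \<Rightarrow> nat \<Rightarrow> real" where "X \<omega> i j = \<gamma> i j * Z i j \<omega>"

definition Q :: "'a \<Rightarrow> nat \<Rightarrow> nat \<Rightarrow> real" where "Q \<omega> = res (1 / n) lam n p (X \<omega>)"

definition Qt :: "'a \<Rightarrow> nat \<Rightarrow> nat \<Rightarrow> real" where "Qt \<omega> = res (1 / n) lam p n (\<lambda>j i. X \<omega> i j)"

text \<open>The case distinction of \<open>indep_sources\<close> for measures in place of their
  systems of sets, so that measurability with respect to one source can be expressed.\<close>

definition F :: "source \<Rightarrow> 'a measure" where
  "F s = (case s of
     Coefficients \<Rightarrow> sigma_vec M p (\<lambda>\<omega>. Matrix.vec p (\<lambda>j. \<beta> j \<omega>))
   | Design \<Rightarrow> sigma_mat M n p (design_matrix n p \<gamma> Z)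
   | Noise \<Rightarrow> sigma_vec M n (\<lambda>\<omega>. Matrix.vec n (\<lambda>i. \<epsilon> i \<omega>))
   | Test_Point \<Rightarrow> sigma_vec M p (test_point p \<gamma>t zt)
   | Test_Noise \<Rightarrow> vimage_algebra (space M) \<epsilon>t borel)"

lemma F_indep: "indep_sets (\<lambda>s. sets (F s)) UNIV"
proof -
  have "(\<lambda>s. sets (F s)) = (\<lambda>s. case s of
              Coefficients \<Rightarrow> sets (sigma_vec M p (\<lambda>\<omega>. Matrix.vec p (\<lambda>j. \<beta> j \<omega>)))
            | Design \<Rightarrow> sets (sigma_mat M n p (design_matrix n p \<gamma> Z))
            | Noise \<Rightarrow> sets (sigma_vec M n (\<lambda>\<omega>. Matrix.vec n (\<lambda>i. \<epsilon> i \<omega>)))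
            | Test_Point \<Rightarrow> sets (sigma_vec M p (test_point p \<gamma>t zt))
            | Test_Noise \<Rightarrow> sets (vimage_algebra (space M) \<epsilon>t borel))"
    by (rule ext) (simp add: F_def split: source.split)
  then show ?thesis using sources by (simp add: indep_sources_def)
qed

lemma space_F: "space (F s) = space M"
  by (simp add: F_def sigma_vec_def sigma_mat_def split: source.split)

lemma sigma_vec_measurable:
  assumes "i < d"
  shows "(\<lambda>\<omega>. v \<omega> $ i) \<in> borel_measurable (sigma_vec N d v)"
proof -
  have "(\<lambda>\<omega>. \<lambda>i\<in>{..<d}. v \<omega> $ i) \<in> sigma_vec N d v \<rightarrow>\<^sub>M Pi\<^sub>M {..<d} (\<lambda>_. borel)"
    unfolding sigma_vec_def by (rule measurable_vimage_algebra1) (auto simp: space_PiM)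
  from measurable_compose[OF this measurable_component_singleton[of i]] assms show ?thesis by simp
qed

lemma sigma_mat_measurable:
  assumes "i < n'" "j < p'"
  shows "(\<lambda>\<omega>. A \<omega> $$ (i, j)) \<in> borel_measurable (sigma_mat N n' p' A)"
proof -
  have "(\<lambda>\<omega>. \<lambda>ij\<in>{..<n'} \<times> {..<p'}. A \<omega> $$ ij) \<in> sigma_mat N n' p' A \<rightarrow>\<^sub>M Pi\<^sub>M ({..<n'} \<times> {..<p'}) (\<lambda>_. borel)"
    unfolding sigma_mat_def by (rule measurable_vimage_algebra1) (auto simp: space_PiM)
  from measurable_compose[OF this measurable_component_singleton[of "(i, j)"]] assms show ?thesis by simp
qed

text \<open>The square root of a square is an absolute value; it disappears again when second
  moments are taken.\<close>

lemma test_point_nth: "j < p \<Longrightarrow> test_point p \<gamma>t zt \<omega> $ j = \<bar>\<gamma>t j\<bar> * zt j \<omega>"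
  unfolding test_point_def
  by (simp add: mat_diag_def scalar_prod_def if_distrib[of "\<lambda>x. x * _"] cong: if_cong)

lemma source_measurable:
  "j < p \<Longrightarrow> \<beta> j \<in> borel_measurable (F Coefficients)"
  "i < n \<Longrightarrow> \<epsilon> i \<in> borel_measurable (F Noise)"
  "j < p \<Longrightarrow> (\<lambda>\<omega>. \<bar>\<gamma>t j\<bar> * zt j \<omega>) \<in> borel_measurable (F Test_Point)"
  "\<epsilon>t \<in> borel_measurable (F Test_Noise)"
  "i < n \<Longrightarrow> j < p \<Longrightarrow> (\<lambda>\<omega>. X \<omega> i j) \<in> borel_measurable (F Design)"
proof -
  show "j < p \<Longrightarrow> \<beta> j \<in> borel_measurable (F Coefficients)"
    using sigma_vec_measurable[of j p "\<lambda>\<omega>. Matrix.vec p (\<lambda>j. \<beta> j \<omega>)" M] by (simp add: F_def)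
  show "i < n \<Longrightarrow> \<epsilon> i \<in> borel_measurable (F Noise)"
    using sigma_vec_measurable[of i n "\<lambda>\<omega>. Matrix.vec n (\<lambda>j. \<epsilon> j \<omega>)" M] by (simp add: F_def)
  show "j < p \<Longrightarrow> (\<lambda>\<omega>. \<bar>\<gamma>t j\<bar> * zt j \<omega>) \<in> borel_measurable (F Test_Point)"
    using sigma_vec_measurable[of j p "test_point p \<gamma>t zt" M] by (simp add: F_def test_point_nth)
  show "\<epsilon>t \<in> borel_measurable (F Test_Noise)"
    by (simp add: F_def measurable_vimage_algebra1)
  show "i < n \<Longrightarrow> j < p \<Longrightarrow> (\<lambda>\<omega>. X \<omega> i j) \<in> borel_measurable (F Design)"
    using sigma_mat_measurable[of i n j p "design_matrix n p \<gamma> Z" M] by (simp add: F_def X_def design_matrix_def)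
qed

lemma pos: "1 / real n \<ge> 0" "lam > 0" "real n > 0"
  using n lam by auto

lemma res_coeffs:
  assumes "j < p" "k < p"
  shows "(\<lambda>\<omega>. Q \<omega> j k) \<in> borel_measurable (F Design)" "\<bar>Q \<omega> j k\<bar> \<le> 1 / lam"
  unfolding Q_def using res_measurable[OF pos(1,2) source_measurable(5) assms] res_abs_le[OF pos(1,2) assms]
  by auto

lemma rest_coeffs:
  assumes "i < n" "l < n"
  shows "(\<lambda>\<omega>. Qt \<omega> i l) \<in> borel_measurable (F Design)" "\<bar>Qt \<omega> i l\<bar> \<le> 1 / lam"
  unfolding Qt_def using res_measurable[OF pos(1,2) source_measurable(5) assms] res_abs_le[OF pos(1,2) assms]
  by auto

text \<open>The entries of \<open>X\<close> are unbounded, but those of \<open>X Q\<close> are not,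
  because \<open>res_image_norm\<close> controls the norm of every column of \<open>X Q\<close>. A
  bound growing with \<open>n\<close> is sufficient, as it only serves integrability at fixed
  \<open>n\<close>.\<close>

lemma image_coeffs:
  assumes "i < n" "j < p"
  shows "(\<lambda>\<omega>. \<Sum>k<p. X \<omega> i k * Q \<omega> k j) \<in> borel_measurable (F Design)"
    "\<bar>\<Sum>k<p. X \<omega> i k * Q \<omega> k j\<bar> \<le> 1 + n / lam"
proof -
  show "(\<lambda>\<omega>. \<Sum>k<p. X \<omega> i k * Q \<omega> k j) \<in> borel_measurable (F Design)"
    using assms by (intro borel_measurable_sum borel_measurable_times source_measurable res_coeffs) auto
  define y where "y i = (\<Sum>k<p. X \<omega> i k * Q \<omega> k j)" for i
  have "1 / n * (\<Sum>i<n. (y i)\<^sup>2) \<le> 1 / lam" unfolding y_def Q_def by (rule res_image_norm[OF pos(1,2) assms(2)])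
  then have "(\<Sum>i<n. (y i)\<^sup>2) \<le> n / lam" using pos(3) by (simp add: field_simps)
  moreover have "(y i)\<^sup>2 \<le> (\<Sum>i<n. (y i)\<^sup>2)" by (rule member_le_sum) (use assms in auto)
  moreover have "\<bar>y i\<bar> \<le> 1 + (y i)\<^sup>2"
  proof -
    have "0 \<le> (\<bar>y i\<bar> - 1 / 2)\<^sup>2" by simp
    then show ?thesis by (simp add: power2_eq_square algebra_simps)
  qed
  ultimately show "\<bar>\<Sum>k<p. X \<omega> i k * Q \<omega> k j\<bar> \<le> 1 + n / lam" unfolding y_def by linarith
qed

lemma design_nth: "i < n \<Longrightarrow> j < p \<Longrightarrow> design_matrix n p \<gamma> Z \<omega> $$ (i, j) = X \<omega> i j"
  by (simp add: design_matrix_def X_def)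

text \<open>The estimator inverts the Gram matrix with \<open>s = 1\<close> and shift
  \<open>n * lam\<close>; by \<open>res_scale\<close> that inverse is \<open>Q / n\<close>.\<close>

lemma ridge_matrix:
  obtains B where "B \<in> carrier_mat p p" "\<And>j k. j < p \<Longrightarrow> k < p \<Longrightarrow> B $$ (j, k) = Q \<omega> j k / n"
    "\<And>Y. ridge_estimator lam (design_matrix n p \<gamma> Z \<omega>) Y = (B * transpose_mat (design_matrix n p \<gamma> Z \<omega>)) *\<^sub>v Y"
proof -
  define A where "A = design_matrix n p \<gamma> Z \<omega>"
  have A: "A \<in> carrier_mat n p" by (simp add: A_def design_matrix_def)
  have G: "transpose_mat A * A + (real (dim_row A) * lam) \<cdot>\<^sub>m 1\<^sub>m (dim_col A) = gram_mat 1 (n * lam) n p (X \<omega>)"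
    using A by (intro eq_matI)
      (auto simp: gram_mat_def gram_def scalar_prod_def A_def design_nth lessThan_atLeast0 intro!: sum.cong)
  have nl: "real n * lam > 0" using pos by simp
  obtain B where B: "mat_inverse (gram_mat 1 (n * lam) n p (X \<omega>)) = Some B"
    using gram_mat_invertible[OF zero_le_one nl] by blast
  have Bc: "B \<in> carrier_mat p p" using mat_inverse(2)[OF gram_mat_carrier B] by simp
  have Bjk: "B $$ (j, k) = Q \<omega> j k / n" if "j < p" "k < p" for j k
  proof -
    have "res (n * (1 / n)) (n * lam) n p (X \<omega>) j k = res (1 / n) lam n p (X \<omega>) j k / n"
      by (rule res_scale[OF pos that])
    then show ?thesis using pos by (simp add: res_def B Q_def)
  qed
  have r: "ridge_estimator lam A Y = (B * transpose_mat A) *\<^sub>v Y" for Y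
    unfolding ridge_estimator_def G B by simp
  show thesis using that[OF Bc Bjk r[unfolded A_def]] .
qed

lemma ridge_carrier: "dim_vec (ridge_estimator lam (design_matrix n p \<gamma> Z \<omega>) Y) = p"
  by (rule ridge_matrix[of \<omega>]) simp

lemma ridge_nth:
  assumes j: "j < p" and Y: "Y \<in> carrier_vec n"
  shows "ridge_estimator lam (design_matrix n p \<gamma> Z \<omega>) Y $ j
    = 1 / n * (\<Sum>i<n. (\<Sum>k<p. X \<omega> i k * Q \<omega> k j) * Y $ i)"
proof -
  let ?A = "design_matrix n p \<gamma> Z \<omega>"
  have A: "?A \<in> carrier_mat n p" by (simp add: design_matrix_def)
  obtain B where Bc: "B \<in> carrier_mat p p" and Bjk: "\<And>j k. j < p \<Longrightarrow> k < p \<Longrightarrow> B $$ (j, k) = Q \<omega> j k / n"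
    and r: "\<And>Y. ridge_estimator lam ?A Y = (B * transpose_mat ?A) *\<^sub>v Y"
    by (rule ridge_matrix[of \<omega>]) (rule that)
  define C where "C = B * transpose_mat ?A"
  have C: "C \<in> carrier_mat p n" using Bc A by (simp add: C_def)
  have "ridge_estimator lam ?A Y $ j = (\<Sum>i<n. C $$ (j, i) * Y $ i)"
    unfolding r C_def[symmetric] using C Y j by (simp add: scalar_prod_def lessThan_atLeast0)
  also have "\<dots> = (\<Sum>i<n. 1 / n * ((\<Sum>k<p. X \<omega> i k * Q \<omega> k j) * Y $ i))"
  proof (rule sum.cong)
    fix i assume i: "i \<in> {..<n}"
    have "C $$ (j, i) = (\<Sum>k<p. B $$ (j, k) * ?A $$ (i, k))"
      using Bc A j i by (simp add: C_def scalar_prod_def lessThan_atLeast0)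
    also have "\<dots> = (\<Sum>k<p. 1 / n * (X \<omega> i k * Q \<omega> k j))"
    proof (rule sum.cong)
      fix k assume k: "k \<in> {..<p}"
      have "Q \<omega> j k = Q \<omega> k j" unfolding Q_def using j k by (intro res_commute[OF pos(1,2)]) auto
      then show "B $$ (j, k) * ?A $$ (i, k) = 1 / n * (X \<omega> i k * Q \<omega> k j)"
        using i j k by (simp add: Bjk design_nth)
    qed simp
    finally show "C $$ (j, i) * Y $ i = 1 / n * ((\<Sum>k<p. X \<omega> i k * Q \<omega> k j) * Y $ i)"
      by (simp add: sum_divide_distrib[symmetric])
  qed simp
  finally show ?thesis by (simp add: sum_distrib_left)
qed

text \<open>A response with index \<open>Inl k\<close> stands for the coefficient \<open>\<beta> k\<close>, with index \<open>Inr i\<close> for the noise \<open>\<epsilon> i\<close>.\<close>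

definition bc :: "nat + nat \<Rightarrow> 'a \<Rightarrow> real" where "bc m = (case m of Inl k \<Rightarrow> \<beta> k | Inr i \<Rightarrow> (\<lambda>_. 1))"
definition ec :: "nat + nat \<Rightarrow> 'a \<Rightarrow> real" where "ec m = (case m of Inl k \<Rightarrow> (\<lambda>_. 1) | Inr i \<Rightarrow> \<epsilon> i)"
definition vc :: "nat + nat \<Rightarrow> real" where "vc m = (case m of Inl k \<Rightarrow> \<alpha>\<^sup>2 / p | Inr i \<Rightarrow> \<sigma>\<^sup>2)"
definition W :: "(nat + nat) set" where "W = {..<p} <+> {..<n}"

lemma W_cases: "m \<in> W \<longleftrightarrow> (\<exists>k<p. m = Inl k) \<or> (\<exists>i<n. m = Inr i)"
  by (auto simp: W_def)

lemma sum_W: "(\<Sum>m\<in>W. f m) = (\<Sum>k<p. f (Inl k)) + (\<Sum>i<n. f (Inr i))"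
  unfolding W_def by (subst sum.Plus) auto

text \<open>For a mixed pair the two products are a single coefficient and a single noise variable,
  both centred. For a pair of the same kind one product is \<open>1\<close> and the other has the
  prescribed covariance as its mean.\<close>

lemma coefficient_noise_facts:
  assumes "m \<in> W" "m' \<in> W"
  shows "bc m \<in> borel_measurable (F Coefficients)" "ec m \<in> borel_measurable (F Noise)"
    "integrable M (\<lambda>\<omega>. bc m \<omega> * bc m' \<omega>)" "integrable M (\<lambda>\<omega>. ec m \<omega> * ec m' \<omega>)"
    "expectation (\<lambda>\<omega>. bc m \<omega> * bc m' \<omega>) * expectation (\<lambda>\<omega>. ec m \<omega> * ec m' \<omega>) = (if m = m' then vc m else 0)"
proof -
  show "bc m \<in> borel_measurable (F Coefficients)" "ec m \<in> borel_measurable (F Noise)"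
    using assms source_measurable by (auto simp: W_cases bc_def ec_def)
  have ee: "integrable M (\<lambda>\<omega>. \<epsilon> i \<omega> * \<epsilon> k \<omega>) \<and> expectation (\<lambda>\<omega>. \<epsilon> i \<omega> * \<epsilon> k \<omega>) = (if i = k then \<sigma>\<^sup>2 else 0)"
    if "i < n" "k < n" for i k
  proof (cases "i = k")
    case True then show ?thesis using \<epsilon>[OF that(1)] by (simp add: power2_eq_square)
  next
    case False
    have "indep_vars (\<lambda>_. borel) \<epsilon> {i, k}" using \<epsilon>_ind by (rule indep_vars_subset) (use that in auto)
    from indep_vars_lebesgue_integral[OF _ this] indep_vars_integrable[OF _ this] \<epsilon>[OF that(1)] \<epsilon>[OF that(2)] False
    show ?thesis by auto
  qed
  show "integrable M (\<lambda>\<omega>. bc m \<omega> * bc m' \<omega>)" "integrable M (\<lambda>\<omega>. ec m \<omega> * ec m' \<omega>)"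
    using assms \<beta>1 \<beta>2 \<epsilon> ee by (auto simp: W_cases bc_def ec_def)
  show "expectation (\<lambda>\<omega>. bc m \<omega> * bc m' \<omega>) * expectation (\<lambda>\<omega>. ec m \<omega> * ec m' \<omega>) = (if m = m' then vc m else 0)"
    using assms \<beta>1 \<beta>2 \<epsilon> ee by (auto simp: W_cases bc_def ec_def vc_def prob_space)
qed

lemma coefficient_noise_integrable: "m \<in> W \<Longrightarrow> integrable M (bc m) \<and> integrable M (ec m)"
  using \<beta>1 \<epsilon> by (auto simp: W_cases bc_def ec_def)

definition Y :: "'a \<Rightarrow> real vec" where
  "Y \<omega> = design_matrix n p \<gamma> Z \<omega> *\<^sub>v Matrix.vec p (\<lambda>j. \<beta> j \<omega>) + Matrix.vec n (\<lambda>i. \<epsilon> i \<omega>)"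

lemma Y_carrier: "Y \<omega> \<in> carrier_vec n"
  by (rule carrier_vecI) (simp add: Y_def)

lemma Y_nth: "i < n \<Longrightarrow> Y \<omega> $ i = (\<Sum>k<p. X \<omega> i k * \<beta> k \<omega>) + \<epsilon> i \<omega>"
  by (auto simp: Y_def design_matrix_def X_def scalar_prod_def lessThan_atLeast0 intro!: sum.cong)

text \<open>The identity \<open>Q X^T X / n = 1 - lam Q\<close> turns the coefficient part into
  \<open>lam Q \<beta>\<close>; the noise enters through the transpose of
  \<open>X Q\<close>.\<close>

lemma estimation_error:
  assumes j: "j < p"
  shows "\<beta> j \<omega> - ridge_estimator lam (design_matrix n p \<gamma> Z \<omega>) (Y \<omega>) $ j
    = (\<Sum>k<p. lam * Q \<omega> j k * \<beta> k \<omega>) + (\<Sum>i<n. (- 1 / n * (\<Sum>k<p. X \<omega> i k * Q \<omega> k j)) * \<epsilon> i \<omega>)"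
proof -
  define u where "u i = (\<Sum>k<p. X \<omega> i k * Q \<omega> k j)" for i
  have "(1 / n) * (\<Sum>i<n. u i * X \<omega> i k) = (if k = j then 1 else 0) - lam * Q \<omega> j k" if k: "k < p" for k
  proof -
    have "(1 / n) * (\<Sum>i<n. X \<omega> i k * u i) + lam * Q \<omega> k j = (if k = j then 1 else 0)"
      using gram_apply[OF k, of "1 / n" lam n "X \<omega>" "\<lambda>k. Q \<omega> k j"] gram_res[OF pos(1,2) k j, of n "X \<omega>"]
      by (simp add: u_def Q_def)
    moreover have "Q \<omega> k j = Q \<omega> j k" unfolding Q_def by (rule res_commute[OF pos(1,2) k j])
    ultimately show ?thesis by (simp add: mult.commute[of "X \<omega> _ k"])
  qed
  then have "(\<Sum>k<p. (1 / n) * (\<Sum>i<n. u i * X \<omega> i k) * \<beta> k \<omega>)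
      = (\<Sum>k<p. (if j = k then \<beta> k \<omega> else 0) - lam * Q \<omega> j k * \<beta> k \<omega>)"
    by (intro sum.cong) (auto simp: left_diff_distrib)
  also have "\<dots> = \<beta> j \<omega> - (\<Sum>k<p. lam * Q \<omega> j k * \<beta> k \<omega>)" using j by (simp add: sum_subtractf)
  finally have 1: "(\<Sum>k<p. (1 / n) * (\<Sum>i<n. u i * X \<omega> i k) * \<beta> k \<omega>) = \<beta> j \<omega> - (\<Sum>k<p. lam * Q \<omega> j k * \<beta> k \<omega>)" .
  have "ridge_estimator lam (design_matrix n p \<gamma> Z \<omega>) (Y \<omega>) $ j = 1 / n * (\<Sum>i<n. u i * Y \<omega> $ i)"
    unfolding u_def by (rule ridge_nth[OF j Y_carrier])
  also have "(\<Sum>i<n. u i * Y \<omega> $ i) = (\<Sum>i<n. u i * ((\<Sum>k<p. X \<omega> i k * \<beta> k \<omega>) + \<epsilon> i \<omega>))"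
    by (rule sum.cong) (simp_all add: Y_nth)
  also have "\<dots> = (\<Sum>i<n. \<Sum>k<p. u i * X \<omega> i k * \<beta> k \<omega>) + (\<Sum>i<n. u i * \<epsilon> i \<omega>)"
    by (simp add: distrib_left sum.distrib sum_distrib_left mult.assoc)
  also have "(\<Sum>i<n. \<Sum>k<p. u i * X \<omega> i k * \<beta> k \<omega>) = (\<Sum>k<p. (\<Sum>i<n. u i * X \<omega> i k) * \<beta> k \<omega>)"
    by (subst sum.swap) (simp add: sum_distrib_right)
  also have "1 / n * ((\<Sum>k<p. (\<Sum>i<n. u i * X \<omega> i k) * \<beta> k \<omega>) + (\<Sum>i<n. u i * \<epsilon> i \<omega>))
     = (\<Sum>k<p. (1 / n) * (\<Sum>i<n. u i * X \<omega> i k) * \<beta> k \<omega>) + (\<Sum>i<n. 1 / n * u i * \<epsilon> i \<omega>)"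
  proof -
    have "c * ((\<Sum>k<p. T k * \<beta> k \<omega>) + (\<Sum>i<n. u i * \<epsilon> i \<omega>))
      = (\<Sum>k<p. c * T k * \<beta> k \<omega>) + (\<Sum>i<n. c * u i * \<epsilon> i \<omega>)" for c and T :: "nat \<Rightarrow> real"
      by (simp add: distrib_left sum_distrib_left mult.assoc)
    then show ?thesis .
  qed
  finally have "ridge_estimator lam (design_matrix n p \<gamma> Z \<omega>) (Y \<omega>) $ j
     = (\<Sum>k<p. (1 / n) * (\<Sum>i<n. u i * X \<omega> i k) * \<beta> k \<omega>) + (\<Sum>i<n. 1 / n * u i * \<epsilon> i \<omega>)" .
  then show ?thesis unfolding 1 u_def[symmetric] by (simp add: sum_negf)
qed

text \<open>The coefficient part is read off from \<open>estimation_error\<close>. In the noise part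
  the operator \<open>1 - X Q X^T / n\<close> is recognised as \<open>lam Qt\<close> by the
  push-through identity and the defining equation of the transposed resolvent.\<close>

lemma residual:
  assumes i: "i < n"
  shows "(Y \<omega> - design_matrix n p \<gamma> Z \<omega> *\<^sub>v ridge_estimator lam (design_matrix n p \<gamma> Z \<omega>) (Y \<omega>)) $ i
    = (\<Sum>k<p. lam * (\<Sum>j<p. X \<omega> i j * Q \<omega> j k) * \<beta> k \<omega>) + (\<Sum>l<n. lam * Qt \<omega> i l * \<epsilon> l \<omega>)"
proof -
  let ?\<theta> = "ridge_estimator lam (design_matrix n p \<gamma> Z \<omega>) (Y \<omega>)"
  define y where "y l j = (\<Sum>k<p. X \<omega> l k * Q \<omega> k j)" for l j
  have "(Y \<omega> - design_matrix n p \<gamma> Z \<omega> *\<^sub>v ?\<theta>) $ i = Y \<omega> $ i - (\<Sum>j<p. X \<omega> i j * ?\<theta> $ j)"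
    using i Y_carrier[of \<omega>] ridge_carrier[of \<omega> "Y \<omega>"]
    by (auto simp: design_matrix_def X_def scalar_prod_def lessThan_atLeast0 intro!: sum.cong)
  also have "Y \<omega> $ i = (\<Sum>j<p. X \<omega> i j * \<beta> j \<omega>) + \<epsilon> i \<omega>" by (rule Y_nth[OF i])
  also have "\<dots> - (\<Sum>j<p. X \<omega> i j * ?\<theta> $ j) = (\<Sum>j<p. X \<omega> i j * (\<beta> j \<omega> - ?\<theta> $ j)) + \<epsilon> i \<omega>"
    by (simp add: right_diff_distrib sum_subtractf)
  also have "(\<Sum>j<p. X \<omega> i j * (\<beta> j \<omega> - ?\<theta> $ j))
     = (\<Sum>j<p. X \<omega> i j * ((\<Sum>k<p. lam * Q \<omega> j k * \<beta> k \<omega>) + (\<Sum>l<n. (- 1 / n * y l j) * \<epsilon> l \<omega>)))"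
    by (rule sum.cong) (simp_all only: estimation_error y_def lessThan_iff)
  also have "\<dots> = (\<Sum>j<p. \<Sum>k<p. lam * (X \<omega> i j * Q \<omega> j k) * \<beta> k \<omega>)
      - (\<Sum>j<p. \<Sum>l<n. 1 / n * y l j * X \<omega> i j * \<epsilon> l \<omega>)"
    by (simp add: distrib_left right_diff_distrib sum.distrib sum_subtractf sum_distrib_left sum_negf mult_ac)
  also have "(\<Sum>j<p. \<Sum>k<p. lam * (X \<omega> i j * Q \<omega> j k) * \<beta> k \<omega>) = (\<Sum>k<p. lam * (\<Sum>j<p. X \<omega> i j * Q \<omega> j k) * \<beta> k \<omega>)"
    by (subst sum.swap) (simp add: sum_distrib_left sum_distrib_right)
  also have "(\<Sum>j<p. \<Sum>l<n. 1 / n * y l j * X \<omega> i j * \<epsilon> l \<omega>)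
     = (\<Sum>l<n. ((if i = l then 1 else 0) - lam * Qt \<omega> i l) * \<epsilon> l \<omega>)"
  proof (subst sum.swap, rule sum.cong)
    fix l assume l: "l \<in> {..<n}"
    have "y l j = (\<Sum>m<n. Qt \<omega> l m * X \<omega> m j)" if "j < p" for j
      unfolding y_def Q_def Qt_def using l that by (intro res_push_through[OF pos(1,2)]) auto
    then have "(\<Sum>j<p. 1 / n * y l j * X \<omega> i j * \<epsilon> l \<omega>)
       = (\<Sum>j<p. 1 / n * (\<Sum>m<n. Qt \<omega> l m * X \<omega> m j) * X \<omega> i j * \<epsilon> l \<omega>)" by simp
    also have "\<dots> = 1 / n * (\<Sum>j<p. X \<omega> i j * (\<Sum>m<n. X \<omega> m j * Qt \<omega> m l)) * \<epsilon> l \<omega>"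
    proof -
      have "(\<Sum>m<n. Qt \<omega> l m * X \<omega> m j) = (\<Sum>m<n. X \<omega> m j * Qt \<omega> m l)" for j
        unfolding Qt_def using l res_commute[OF pos(1,2)] by (intro sum.cong) auto
      then show ?thesis by (simp add: sum_distrib_left sum_distrib_right mult_ac)
    qed
    also have "1 / n * (\<Sum>j<p. X \<omega> i j * (\<Sum>m<n. X \<omega> m j * Qt \<omega> m l)) = (if i = l then 1 else 0) - lam * Qt \<omega> i l"
      using gram_apply[OF i, of "1 / n" lam p "\<lambda>j i. X \<omega> i j" "\<lambda>m. Qt \<omega> m l"]
        gram_res[OF pos(1,2) i, of l p "\<lambda>j i. X \<omega> i j"] l by (simp add: Qt_def)
    finally show "(\<Sum>j<p. 1 / n * y l j * X \<omega> i j * \<epsilon> l \<omega>)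
      = ((if i = l then 1 else 0) - lam * Qt \<omega> i l) * \<epsilon> l \<omega>" .
  qed simp
  also have "\<dots> = (\<Sum>l<n. (if i = l then \<epsilon> l \<omega> else 0) - lam * Qt \<omega> i l * \<epsilon> l \<omega>)"
    by (rule sum.cong) (auto simp: left_diff_distrib)
  also have "\<dots> = \<epsilon> i \<omega> - (\<Sum>l<n. lam * Qt \<omega> i l * \<epsilon> l \<omega>)" using i by (simp add: sum_subtractf)
  finally show ?thesis by simp
qed

text \<open>The prediction error is one linear combination with design coefficients of products of
  one factor per remaining source, so its conditional second moment is a sum of variances.
  \<open>res_energy\<close> rewrites the noise contribution through \<open>Q j j\<close> and the
  squared norm of its column.\<close>

theorem cond_test_risk_formula:
  "AE \<omega> in M. cond_test_risk M lam n p (design_matrix n p \<gamma> Z) Y (test_point p \<gamma>t zt)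
      (\<lambda>\<omega>. test_point p \<gamma>t zt \<omega> \<bullet> Matrix.vec p (\<lambda>j. \<beta> j \<omega>) + \<epsilon>t \<omega>) \<omega>
    = \<sigma>\<^sup>2 + (\<Sum>j<p. (\<gamma>t j)\<^sup>2 * (\<alpha>\<^sup>2 / p * lam\<^sup>2 * (\<Sum>k<p. (Q \<omega> k j)\<^sup>2)
        + \<sigma>\<^sup>2 / n * (Q \<omega> j j - lam * (\<Sum>k<p. (Q \<omega> k j)\<^sup>2))))"
proof -
  \<comment> \<open>\<open>None\<close> indexes the test noise, \<open>Some (j, m)\<close> the
    coordinate \<open>j\<close> of the test point combined with response \<open>m\<close>. Sources
    absent from a term contribute the constant \<open>1\<close>.\<close>
  define A where "A = insert None (Some ` ({..<p} \<times> W))"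
  define D where "D (i :: unit) q \<omega> = (case q of None \<Rightarrow> 1 | Some (j, m) \<Rightarrow>
     (case m of Inl k \<Rightarrow> lam * Q \<omega> j k | Inr i \<Rightarrow> - 1 / n * (\<Sum>k<p. X \<omega> i k * Q \<omega> k j)))" for i q \<omega>
  define b where "b q = (case q of None \<Rightarrow> (\<lambda>_. 1) | Some (j :: nat, m) \<Rightarrow> bc m)" for q
  define e where "e q = (case q of None \<Rightarrow> (\<lambda>_. 1) | Some (j :: nat, m) \<Rightarrow> ec m)" for q
  define x where "x q = (case q of None \<Rightarrow> (\<lambda>_. 1) | Some (j, m :: nat + nat) \<Rightarrow> (\<lambda>\<omega>. \<bar>\<gamma>t j\<bar> * zt j \<omega>))" for q
  define t where "t q = (case q of None \<Rightarrow> \<epsilon>t | Some (j :: nat, m :: nat + nat) \<Rightarrow> (\<lambda>_. 1))" for q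
  define v where "v q = (case q of None \<Rightarrow> \<sigma>\<^sup>2 | Some (j, m) \<Rightarrow> (\<gamma>t j)\<^sup>2 * vc m)" for q
  have A_cases: "q \<in> A \<longleftrightarrow> q = None \<or> (\<exists>j m. j < p \<and> m \<in> W \<and> q = Some (j, m))" for q by (auto simp: A_def)
  have xx: "integrable M (\<lambda>\<omega>. zt j \<omega> * zt k \<omega>) \<and> expectation (\<lambda>\<omega>. zt j \<omega> * zt k \<omega>) = (if j = k then 1 else 0)"
    if "j < p" "k < p" for j k
  proof (cases "j = k")
    case True then show ?thesis using zt[OF that(1)] by (simp add: power2_eq_square)
  next
    case False
    have "indep_vars (\<lambda>_. borel) zt {j, k}" using zt_ind by (rule indep_vars_subset) (use that in auto)
    from indep_vars_lebesgue_integral[OF _ this] indep_vars_integrable[OF _ this] zt[OF that(1)] zt[OF that(2)] False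
    show ?thesis by auto
  qed
  have xx': "integrable M (\<lambda>\<omega>. (\<bar>\<gamma>t j\<bar> * zt j \<omega>) * (\<bar>\<gamma>t k\<bar> * zt k \<omega>))"
    "expectation (\<lambda>\<omega>. (\<bar>\<gamma>t j\<bar> * zt j \<omega>) * (\<bar>\<gamma>t k\<bar> * zt k \<omega>)) = (if j = k then (\<gamma>t j)\<^sup>2 else 0)"
    if "j < p" "k < p" for j k
  proof -
    have eq: "(\<bar>\<gamma>t j\<bar> * zt j \<omega>) * (\<bar>\<gamma>t k\<bar> * zt k \<omega>) = (\<bar>\<gamma>t j\<bar> * \<bar>\<gamma>t k\<bar>) * (zt j \<omega> * zt k \<omega>)" for \<omega>
      by (simp add: mult_ac)
    show "integrable M (\<lambda>\<omega>. (\<bar>\<gamma>t j\<bar> * zt j \<omega>) * (\<bar>\<gamma>t k\<bar> * zt k \<omega>))"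
      unfolding eq using xx[OF that] by (intro integrable_mult_right) auto
    show "expectation (\<lambda>\<omega>. (\<bar>\<gamma>t j\<bar> * zt j \<omega>) * (\<bar>\<gamma>t k\<bar> * zt k \<omega>)) = (if j = k then (\<gamma>t j)\<^sup>2 else 0)"
      unfolding eq using xx[OF that] by (simp add: power2_eq_square)
  qed
  have AE1: "AE \<omega> in M. real_cond_exp M (F Design)
      (\<lambda>\<omega>. \<Sum>i\<in>{()}. (\<Sum>q\<in>A. D i q \<omega> * (b q \<omega> * e q \<omega> * x q \<omega> * t q \<omega>))\<^sup>2) \<omega>
    = (\<Sum>i\<in>{()}. \<Sum>q\<in>A. (D i q \<omega>)\<^sup>2 * v q)"
  proof (rule cond_exp_sum_of_squares[OF F_indep space_F, where B = "1 + (1 + n / lam)"])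
    show "finite {()}" "finite A" by (simp_all add: A_def W_def)
    show "D i q \<in> borel_measurable (F Design)" if "q \<in> A" for i q
      using that res_coeffs(1) image_coeffs(1) by (auto simp: A_cases D_def[abs_def] W_cases)
    show "\<bar>D i q \<omega>\<bar> \<le> 1 + (1 + n / lam)" if "q \<in> A" for i q \<omega>
    proof -
      have nl: "0 \<le> n / lam" using pos by simp
      have "\<bar>lam * Q \<omega> j k\<bar> \<le> 1" if "j < p" "k < p" for j k
        using res_coeffs(2)[OF that, of \<omega>] lam by (simp add: abs_mult field_simps)
      moreover have "\<bar>- 1 / n * (\<Sum>k<p. X \<omega> i k * Q \<omega> k j)\<bar> \<le> 1 + n / lam" if "i < n" "j < p" for i j
      proof -
        have "\<bar>- 1 / n * (\<Sum>k<p. X \<omega> i k * Q \<omega> k j)\<bar> = 1 / n * \<bar>\<Sum>k<p. X \<omega> i k * Q \<omega> k j\<bar>" by (simp add: abs_mult)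
        also have "\<dots> \<le> 1 * (1 + n / lam)" using image_coeffs(2)[OF that, of \<omega>] n by (intro mult_mono) auto
        finally show ?thesis by simp
      qed
      ultimately show ?thesis using that nl by (fastforce simp: A_cases D_def W_cases)
    qed
    fix q assume q: "q \<in> A"
    show "b q \<in> borel_measurable (F Coefficients)" "e q \<in> borel_measurable (F Noise)"
      "x q \<in> borel_measurable (F Test_Point)" "t q \<in> borel_measurable (F Test_Noise)"
      using q coefficient_noise_facts source_measurable
      by (auto simp: A_cases b_def e_def x_def t_def)
    fix r assume r: "r \<in> A"
    show "integrable M (\<lambda>\<omega>. b q \<omega> * b r \<omega>)" "integrable M (\<lambda>\<omega>. e q \<omega> * e r \<omega>)"
      using q r coefficient_noise_facts(3,4) coefficient_noise_integrable by (auto simp: A_cases b_def e_def)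
    show "integrable M (\<lambda>\<omega>. x q \<omega> * x r \<omega>)"
      using q r xx'(1) zt by (auto simp: A_cases x_def)
    show "integrable M (\<lambda>\<omega>. t q \<omega> * t r \<omega>)"
      using q r \<epsilon>t by (auto simp: A_cases t_def power2_eq_square)
    show "expectation (\<lambda>\<omega>. b q \<omega> * b r \<omega>) * expectation (\<lambda>\<omega>. e q \<omega> * e r \<omega>)
        * expectation (\<lambda>\<omega>. x q \<omega> * x r \<omega>) * expectation (\<lambda>\<omega>. t q \<omega> * t r \<omega>) = (if q = r then v q else 0)"
    proof (cases q)
      case None
      then show ?thesis using r \<epsilon>t
        by (auto simp: A_cases b_def e_def x_def t_def v_def prob_space power2_eq_square)
    next
      case (Some jm)
      then obtain j m where jm: "q = Some (j, m)" "j < p" "m \<in> W" using q by (auto simp: A_cases)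
      show ?thesis
      proof (cases r)
        case None
        then show ?thesis using jm \<epsilon>t by (simp add: t_def)
      next
        case (Some kl)
        then obtain k l where kl: "r = Some (k, l)" "k < p" "l \<in> W" using r by (auto simp: A_cases)
        have "expectation (\<lambda>\<omega>. b q \<omega> * b r \<omega>) * expectation (\<lambda>\<omega>. e q \<omega> * e r \<omega>) = (if m = l then vc m else 0)"
          using coefficient_noise_facts(5)[OF jm(3) kl(3)] by (simp add: b_def e_def jm kl)
        moreover have "expectation (\<lambda>\<omega>. x q \<omega> * x r \<omega>) = (if j = k then (\<gamma>t j)\<^sup>2 else 0)"
          using xx'(2)[OF jm(2) kl(2)] by (simp add: x_def jm kl)
        moreover have "expectation (\<lambda>\<omega>. t q \<omega> * t r \<omega>) = 1" by (simp add: t_def jm kl prob_space)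
        ultimately show ?thesis by (auto simp: jm kl v_def)
      qed
    qed
  qed
  have sumA: "(\<Sum>q\<in>A. f q) = f None + (\<Sum>j<p. \<Sum>m\<in>W. f (Some (j, m)))" for f :: "(nat \<times> (nat + nat)) option \<Rightarrow> real"
  proof -
    have "(\<Sum>q\<in>A. f q) = f None + (\<Sum>q\<in>Some ` ({..<p} \<times> W). f q)"
      unfolding A_def by (subst sum.insert) (auto simp: W_def)
    also have "(\<Sum>q\<in>Some ` ({..<p} \<times> W). f q) = (\<Sum>(j, m)\<in>{..<p} \<times> W. f (Some (j, m)))"
      by (subst sum.reindex) (auto simp: inj_on_def case_prod_unfold)
    finally show ?thesis by (simp add: sum.cartesian_product)
  qed
  have res: "(test_point p \<gamma>t zt \<omega> \<bullet> Matrix.vec p (\<lambda>j. \<beta> j \<omega>) + \<epsilon>t \<omega>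
        - test_point p \<gamma>t zt \<omega> \<bullet> ridge_estimator lam (design_matrix n p \<gamma> Z \<omega>) (Y \<omega>))
      = (\<Sum>q\<in>A. D () q \<omega> * (b q \<omega> * e q \<omega> * x q \<omega> * t q \<omega>))" for \<omega>
  proof -
    let ?\<theta> = "ridge_estimator lam (design_matrix n p \<gamma> Z \<omega>) (Y \<omega>)"
    have \<theta>c: "dim_vec ?\<theta> = p" by (rule ridge_carrier)
    have "test_point p \<gamma>t zt \<omega> \<bullet> Matrix.vec p (\<lambda>j. \<beta> j \<omega>) - test_point p \<gamma>t zt \<omega> \<bullet> ?\<theta>
      = (\<Sum>j<p. (\<bar>\<gamma>t j\<bar> * zt j \<omega>) * (\<beta> j \<omega> - ?\<theta> $ j))"
      using \<theta>c by (simp add: scalar_prod_def lessThan_atLeast0 test_point_nth right_diff_distrib sum_subtractf)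
    also have "\<dots> = (\<Sum>j<p. \<Sum>m\<in>W. D () (Some (j, m)) \<omega> * (bc m \<omega> * ec m \<omega> * (\<bar>\<gamma>t j\<bar> * zt j \<omega>)))"
    proof (rule sum.cong)
      fix j assume j: "j \<in> {..<p}"
      then show "(\<bar>\<gamma>t j\<bar> * zt j \<omega>) * (\<beta> j \<omega> - ?\<theta> $ j)
        = (\<Sum>m\<in>W. D () (Some (j, m)) \<omega> * (bc m \<omega> * ec m \<omega> * (\<bar>\<gamma>t j\<bar> * zt j \<omega>)))"
        using estimation_error[of j \<omega>]
        by (simp add: sum_W D_def bc_def ec_def distrib_left sum_distrib_left mult_ac)
    qed simp
    finally show ?thesis by (simp add: sumA D_def b_def e_def x_def t_def)
  qed
  have val: "(\<Sum>q\<in>A. (D () q \<omega>)\<^sup>2 * v q) = \<sigma>\<^sup>2 + (\<Sum>j<p. (\<gamma>t j)\<^sup>2 * (\<alpha>\<^sup>2 / p * lam\<^sup>2 * (\<Sum>k<p. (Q \<omega> k j)\<^sup>2)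
        + \<sigma>\<^sup>2 / n * (Q \<omega> j j - lam * (\<Sum>k<p. (Q \<omega> k j)\<^sup>2))))" for \<omega>
  proof -
    have "(\<Sum>m\<in>W. (D () (Some (j, m)) \<omega>)\<^sup>2 * v (Some (j, m))) = (\<gamma>t j)\<^sup>2 * (\<alpha>\<^sup>2 / p * lam\<^sup>2 * (\<Sum>k<p. (Q \<omega> k j)\<^sup>2)
        + \<sigma>\<^sup>2 / n * (Q \<omega> j j - lam * (\<Sum>k<p. (Q \<omega> k j)\<^sup>2)))" if j: "j < p" for j
    proof -
      have en: "1 / n * (\<Sum>i<n. (\<Sum>k<p. X \<omega> i k * Q \<omega> k j)\<^sup>2) = Q \<omega> j j - lam * (\<Sum>k<p. (Q \<omega> k j)\<^sup>2)"
        using res_energy[OF pos(1,2) j, where a=n and X="X \<omega>"] by (simp add: Q_def)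
      have "(\<Sum>k<p. (lam * Q \<omega> j k)\<^sup>2 * ((\<gamma>t j)\<^sup>2 * (\<alpha>\<^sup>2 / p))) = (\<gamma>t j)\<^sup>2 * (\<alpha>\<^sup>2 / p * lam\<^sup>2 * (\<Sum>k<p. (Q \<omega> k j)\<^sup>2))"
        using j res_commute[OF pos(1,2)] by (simp add: sum_distrib_left power_mult_distrib mult_ac Q_def)
      moreover have "(\<Sum>i<n. (- 1 / n * (\<Sum>k<p. X \<omega> i k * Q \<omega> k j))\<^sup>2 * ((\<gamma>t j)\<^sup>2 * \<sigma>\<^sup>2))
        = (\<gamma>t j)\<^sup>2 * (\<sigma>\<^sup>2 / n * (1 / n * (\<Sum>i<n. (\<Sum>k<p. X \<omega> i k * Q \<omega> k j)\<^sup>2)))"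
        by (simp add: sum_distrib_left power_divide power2_eq_square mult_ac)
      ultimately show ?thesis unfolding en by (simp add: sum_W D_def v_def vc_def distrib_left)
    qed
    then show ?thesis by (simp add: sumA D_def v_def)
  qed
  have "sigma_mat M n p (design_matrix n p \<gamma> Z) = F Design" by (simp add: F_def)
  then show ?thesis using AE1 unfolding cond_test_risk_def by (simp add: res val)
qed

text \<open>One square per observation, with the constant \<open>1\<close> in place of the two test
  sources. Push-through moves the coefficient part to the transposed resolvent, whose energy
  identity evaluates it.\<close>

theorem cond_train_risk_formula:
  "AE \<omega> in M. cond_train_risk M lam n p (design_matrix n p \<gamma> Z) Y \<omega>
    = lam\<^sup>2 * \<alpha>\<^sup>2 / p * (\<Sum>i<n. Qt \<omega> i i - lam * (\<Sum>l<n. (Qt \<omega> l i)\<^sup>2))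
      + lam\<^sup>2 * \<sigma>\<^sup>2 / n * (\<Sum>i<n. \<Sum>l<n. (Qt \<omega> l i)\<^sup>2)"
proof -
  define D where "D i m \<omega> = (case m of Inl k \<Rightarrow> lam * (\<Sum>j<p. X \<omega> i j * Q \<omega> j k) | Inr l \<Rightarrow> lam * Qt \<omega> i l)" for i m \<omega>
  have AE1: "AE \<omega> in M. real_cond_exp M (F Design)
      (\<lambda>\<omega>. \<Sum>i\<in>{..<n}. (\<Sum>m\<in>W. D i m \<omega> * (bc m \<omega> * ec m \<omega> * 1 * 1))\<^sup>2) \<omega>
    = (\<Sum>i\<in>{..<n}. \<Sum>m\<in>W. (D i m \<omega>)\<^sup>2 * vc m)"
  proof (rule cond_exp_sum_of_squares[OF F_indep space_F, where B = "1 + lam * (1 + n / lam)"])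
    show "finite W" by (simp add: W_def)
    show "D i m \<in> borel_measurable (F Design)" if "i \<in> {..<n}" "m \<in> W" for i m
      using that rest_coeffs(1) image_coeffs(1) by (auto simp: D_def[abs_def] W_cases)
    show "\<bar>D i m \<omega>\<bar> \<le> 1 + lam * (1 + n / lam)" if im: "i \<in> {..<n}" "m \<in> W" for i m \<omega>
    proof -
      have nl: "0 \<le> lam * (1 + n / lam)" using pos by simp
      have "\<bar>lam * Qt \<omega> i k\<bar> \<le> 1" if "k < n" for k
        using rest_coeffs(2)[of i k \<omega>] that im lam by (simp add: abs_mult field_simps)
      moreover have "\<bar>lam * (\<Sum>j<p. X \<omega> i j * Q \<omega> j k)\<bar> \<le> lam * (1 + n / lam)" if "k < p" for k
        unfolding abs_mult using image_coeffs(2)[of i k \<omega>] that im lam by (simp add: mult_left_mono)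
      ultimately show ?thesis using im nl by (fastforce simp: D_def W_cases)
    qed
  qed (use coefficient_noise_facts in \<open>auto simp: prob_space\<close>)
  have rr: "(let r = Y \<omega> - design_matrix n p \<gamma> Z \<omega> *\<^sub>v ridge_estimator lam (design_matrix n p \<gamma> Z \<omega>) (Y \<omega>) in r \<bullet> r)
      = (\<Sum>i\<in>{..<n}. (\<Sum>m\<in>W. D i m \<omega> * (bc m \<omega> * ec m \<omega> * 1 * 1))\<^sup>2)" for \<omega>
  proof -
    let ?r = "Y \<omega> - design_matrix n p \<gamma> Z \<omega> *\<^sub>v ridge_estimator lam (design_matrix n p \<gamma> Z \<omega>) (Y \<omega>)"
    have "dim_vec ?r = n" by (simp add: design_matrix_def)
    then have "?r \<bullet> ?r = (\<Sum>i<n. (?r $ i)\<^sup>2)" by (simp add: scalar_prod_def lessThan_atLeast0 power2_eq_square)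
    also have "\<dots> = (\<Sum>i\<in>{..<n}. (\<Sum>m\<in>W. D i m \<omega> * (bc m \<omega> * ec m \<omega> * 1 * 1))\<^sup>2)"
      by (rule sum.cong) (auto simp: residual sum_W D_def bc_def ec_def simp del: index_minus_vec)
    finally show ?thesis by (simp add: Let_def)
  qed
  have val: "1 / n * (\<Sum>i\<in>{..<n}. \<Sum>m\<in>W. (D i m \<omega>)\<^sup>2 * vc m)
    = lam\<^sup>2 * \<alpha>\<^sup>2 / p * (\<Sum>i<n. Qt \<omega> i i - lam * (\<Sum>l<n. (Qt \<omega> l i)\<^sup>2))
      + lam\<^sup>2 * \<sigma>\<^sup>2 / n * (\<Sum>i<n. \<Sum>l<n. (Qt \<omega> l i)\<^sup>2)" for \<omega>
  proof -
    have "1 / n * (\<Sum>m\<in>W. (D i m \<omega>)\<^sup>2 * vc m) = lam\<^sup>2 * \<alpha>\<^sup>2 / p * (Qt \<omega> i i - lam * (\<Sum>l<n. (Qt \<omega> l i)\<^sup>2))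
      + lam\<^sup>2 * \<sigma>\<^sup>2 / n * (\<Sum>l<n. (Qt \<omega> l i)\<^sup>2)" if i: "i < n" for i
    proof -
      have "(\<Sum>j<p. X \<omega> i j * Q \<omega> j k) = (\<Sum>m<n. X \<omega> m k * Qt \<omega> m i)" if "k < p" for k
      proof -
        have "(\<Sum>j<p. X \<omega> i j * Q \<omega> j k) = (\<Sum>m<n. Qt \<omega> i m * X \<omega> m k)"
          unfolding Q_def Qt_def using i that by (intro res_push_through[OF pos(1,2)]) auto
        also have "\<dots> = (\<Sum>m<n. X \<omega> m k * Qt \<omega> m i)"
          unfolding Qt_def using i res_commute[OF pos(1,2)] by (intro sum.cong) auto
        finally show ?thesis .
      qed
      then have "1 / n * (\<Sum>k<p. (\<Sum>j<p. X \<omega> i j * Q \<omega> j k)\<^sup>2) = Qt \<omega> i i - lam * (\<Sum>l<n. (Qt \<omega> l i)\<^sup>2)"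
        using res_energy[OF pos(1,2) i, where a=p and X="\<lambda>j i. X \<omega> i j"] by (simp add: Qt_def)
      moreover have "1 / n * (\<Sum>k<p. (lam * (\<Sum>j<p. X \<omega> i j * Q \<omega> j k))\<^sup>2 * (\<alpha>\<^sup>2 / p))
         = lam\<^sup>2 * \<alpha>\<^sup>2 / p * (1 / n * (\<Sum>k<p. (\<Sum>j<p. X \<omega> i j * Q \<omega> j k)\<^sup>2))"
      proof -
        have "1 / n * (\<Sum>k<p. (lam * S k)\<^sup>2 * c) = lam\<^sup>2 * c * (1 / n * (\<Sum>k<p. (S k)\<^sup>2))" for S :: "nat \<Rightarrow> real" and c
          by (simp add: sum_distrib_left power_mult_distrib mult_ac)
        from this[of "\<lambda>k. \<Sum>j<p. X \<omega> i j * Q \<omega> j k" "\<alpha>\<^sup>2 / p"] show ?thesis by (simp only: times_divide_eq_right)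
      qed
      moreover have "1 / n * (\<Sum>l<n. (lam * Qt \<omega> i l)\<^sup>2 * \<sigma>\<^sup>2) = lam\<^sup>2 * \<sigma>\<^sup>2 / n * (\<Sum>l<n. (Qt \<omega> l i)\<^sup>2)"
        using i res_commute[OF pos(1,2)] by (simp add: sum_distrib_left power_mult_distrib mult_ac Qt_def)
      ultimately show ?thesis by (simp only: sum_W D_def vc_def sum.case distrib_left)
    qed
    then have "(\<Sum>i<n. 1 / n * (\<Sum>m\<in>W. (D i m \<omega>)\<^sup>2 * vc m)) = (\<Sum>i<n. lam\<^sup>2 * \<alpha>\<^sup>2 / p * (Qt \<omega> i i - lam * (\<Sum>l<n. (Qt \<omega> l i)\<^sup>2))
      + lam\<^sup>2 * \<sigma>\<^sup>2 / n * (\<Sum>l<n. (Qt \<omega> l i)\<^sup>2))" by (intro sum.cong) auto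
    then show ?thesis by (simp only: sum.distrib sum_distrib_left)
  qed
  have FD: "sigma_mat M n p (design_matrix n p \<gamma> Z) = F Design" by (simp add: F_def)
  show ?thesis unfolding cond_train_risk_def rr FD
    using AE1
  proof eventually_elim
    case (elim \<omega>)
    then show ?case unfolding val[symmetric] by simp
  qed
qed

end

section \<open>Deterministic equivalents\<close>

lemma mat_trace_sq_diag_mult:
  "mat_trace (sq_diag m g * mat_diag m f) = (\<Sum>k<m. of_real ((g k)\<^sup>2) * f k)"
  unfolding sq_diag_def by (simp add: mat_diag_diag mat_trace_def) (simp add: mat_diag_def)

lemma mat_trace_diag_lincomb:
  "mat_trace (mat_diag m f - c \<cdot>\<^sub>m mat_diag m h) = (\<Sum>k<m. f k - c * h k)"
  "mat_trace (mat_diag m f) = (\<Sum>k<m. f k)"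
  by (simp_all add: mat_trace_def mat_diag_def)

text \<open>Both families of canonical equations become one positive system on the disjoint union of
  the columns (\<open>Inl\<close>) and the rows (\<open>Inr\<close>). The weights are bipartite:
  zero between two indices of the same kind.\<close>

definition profile_weight :: "nat \<Rightarrow> (nat \<Rightarrow> nat \<Rightarrow> real) \<Rightarrow> nat + nat \<Rightarrow> nat + nat \<Rightarrow> real" where
  "profile_weight n \<gamma> k l = (case (k, l) of (Inl j, Inr i) \<Rightarrow> (\<gamma> i j)\<^sup>2 / n | (Inr i, Inl j) \<Rightarrow> (\<gamma> i j)\<^sup>2 / n | _ \<Rightarrow> 0)"

lemma profile_weight_nonneg: "0 \<le> profile_weight n \<gamma> k l"
  by (auto simp: profile_weight_def split: sum.split)

lemma sum_profile_weight:
  fixes f :: "nat + nat \<Rightarrow> 'b :: real_normed_algebra_1"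
  shows "(\<Sum>l\<in>{..<p} <+> {..<n}. of_real (profile_weight n \<gamma> (Inl j) l) * f l) = (\<Sum>i<n. of_real ((\<gamma> i j)\<^sup>2 / n) * f (Inr i))"
    and "(\<Sum>l\<in>{..<p} <+> {..<n}. of_real (profile_weight n \<gamma> (Inr i) l) * f l) = (\<Sum>j<p. of_real ((\<gamma> i j)\<^sup>2 / n) * f (Inl j))"
  by (simp_all add: sum.Plus profile_weight_def)

text \<open>Existence is what makes the choice by \<open>SOME\<close> meaningful: from here on the
  chosen pair may be used through \<open>canonical_solution\<close>.\<close>

lemma the_canonical_solution:
  "canonical_solution n p \<gamma> (the_canonical_solution n p \<gamma>)"
proof -
  have "\<exists>f. (\<forall>k\<in>{..<p} <+> {..<n}. stieltjes_transform_nonneg (f k)) \<and>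
    (\<forall>z. z \<notin> \<real>\<^sub>\<ge>\<^sub>0 \<longrightarrow> (\<forall>k\<in>{..<p} <+> {..<n}. f k z
        = -1 / (z * (1 + (\<Sum>l\<in>{..<p} <+> {..<n}. of_real (profile_weight n \<gamma> k l) * f l z)))))"
    by (rule stieltjes_system_solution) (auto simp: profile_weight_nonneg)
  then obtain f where st: "\<forall>k\<in>{..<p} <+> {..<n}. stieltjes_transform_nonneg (f k)"
    and eq: "\<forall>z. z \<notin> \<real>\<^sub>\<ge>\<^sub>0 \<longrightarrow> (\<forall>k\<in>{..<p} <+> {..<n}. f k z
        = -1 / (z * (1 + (\<Sum>l\<in>{..<p} <+> {..<n}. of_real (profile_weight n \<gamma> k l) * f l z))))"
    by (elim exE conjE) (rule that)
  have "f (Inl j) z = -1 / (z * (1 + 1 / of_nat n *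
             mat_trace (sq_diag n (\<lambda>i. \<gamma> i j) * mat_diag n (\<lambda>i. f (Inr i) z))))"
    if "z \<notin> \<real>\<^sub>\<ge>\<^sub>0" "j < p" for z j
  proof -
    have "f (Inl j) z = -1 / (z * (1 + (\<Sum>l\<in>{..<p} <+> {..<n}. of_real (profile_weight n \<gamma> (Inl j) l) * f l z)))"
      using eq that by blast
    then show ?thesis unfolding sum_profile_weight(1) mat_trace_sq_diag_mult by (simp add: sum_distrib_left)
  qed
  moreover have "f (Inr i) z = -1 / (z * (1 + 1 / of_nat n *
             mat_trace (sq_diag p (\<gamma> i) * mat_diag p (\<lambda>j. f (Inl j) z))))"
    if "z \<notin> \<real>\<^sub>\<ge>\<^sub>0" "i < n" for z i
  proof -
    have "f (Inr i) z = -1 / (z * (1 + (\<Sum>l\<in>{..<p} <+> {..<n}. of_real (profile_weight n \<gamma> (Inr i) l) * f l z)))"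
      using eq that by blast
    then show ?thesis unfolding sum_profile_weight(2) mat_trace_sq_diag_mult by (simp add: sum_distrib_left)
  qed
  ultimately have "canonical_solution n p \<gamma> (\<lambda>j. f (Inl j), \<lambda>i. f (Inr i))"
    using st by (auto simp: canonical_solution_def)
  then show ?thesis unfolding the_canonical_solution_def by (rule someI)
qed

definition T_real :: "nat \<Rightarrow> nat \<Rightarrow> (nat \<Rightarrow> nat \<Rightarrow> real) \<Rightarrow> real \<Rightarrow> nat + nat \<Rightarrow> real" where
  "T_real n p \<gamma> x k = Re (case_sum (fst (the_canonical_solution n p \<gamma>)) (snd (the_canonical_solution n p \<gamma>)) k (- of_real x))"

lemma canonical_stieltjes:
  "k \<in> {..<p} <+> {..<n} \<Longrightarrow> stieltjes_transform_nonneg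
     (case_sum (fst (the_canonical_solution n p \<gamma>)) (snd (the_canonical_solution n p \<gamma>)) k)"
  using the_canonical_solution[of n p \<gamma>] by (auto simp: canonical_solution_def case_prod_unfold)

text \<open>At \<open>z = -x\<close> the factor \<open>-1 / z\<close> becomes \<open>1 / x\<close>
  and all transforms are real and nonnegative, so the canonical equations turn into the system
  covered by \<open>positive_system_stability\<close>.\<close>

lemma T_real_equation:
  assumes x: "x > 0" and k: "k \<in> {..<p} <+> {..<n}"
  shows "0 \<le> T_real n p \<gamma> x k"
    and "T_real n p \<gamma> x k = 1 / (x * (1 + (\<Sum>l\<in>{..<p} <+> {..<n}. profile_weight n \<gamma> k l * T_real n p \<gamma> x l)))"
proof -
  let ?TT = "the_canonical_solution n p \<gamma>"
  let ?f = "\<lambda>k. case_sum (fst ?TT) (snd ?TT) k (- of_real x)"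
  have re: "?f k = of_real (T_real n p \<gamma> x k)" "0 \<le> T_real n p \<gamma> x k" if "k \<in> {..<p} <+> {..<n}" for k
    using stieltjes_transform_nonneg_real(1,2)[OF canonical_stieltjes[OF that] x] by (simp_all add: T_real_def)
  show "0 \<le> T_real n p \<gamma> x k" by (rule re(2)[OF k])
  have out: "- complex_of_real x \<notin> \<real>\<^sub>\<ge>\<^sub>0" using x by (simp add: complex_nonneg_Reals_iff)
  have "?f k = -1 / (- of_real x * (1 + (\<Sum>l\<in>{..<p} <+> {..<n}. of_real (profile_weight n \<gamma> k l) * ?f l)))"
  proof (cases k)
    case (Inl j)
    then have "fst ?TT j (- of_real x) = -1 / (- of_real x * (1 + 1 / of_nat n *
             mat_trace (sq_diag n (\<lambda>i. \<gamma> i j) * mat_diag n (\<lambda>i. snd ?TT i (- of_real x)))))"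
      using the_canonical_solution[of n p \<gamma>] out k by (auto simp: canonical_solution_def case_prod_unfold)
    then show ?thesis unfolding Inl sum_profile_weight(1) mat_trace_sq_diag_mult by (simp add: sum_distrib_left)
  next
    case (Inr i)
    then have "snd ?TT i (- of_real x) = -1 / (- of_real x * (1 + 1 / of_nat n *
             mat_trace (sq_diag p (\<gamma> i) * mat_diag p (\<lambda>j. fst ?TT j (- of_real x)))))"
      using the_canonical_solution[of n p \<gamma>] out k by (auto simp: canonical_solution_def case_prod_unfold)
    then show ?thesis unfolding Inr sum_profile_weight(2) mat_trace_sq_diag_mult by (simp add: sum_distrib_left)
  qed
  also have "(\<Sum>l\<in>{..<p} <+> {..<n}. of_real (profile_weight n \<gamma> k l) * ?f l)
     = complex_of_real (\<Sum>l\<in>{..<p} <+> {..<n}. profile_weight n \<gamma> k l * T_real n p \<gamma> x l)"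
    unfolding of_real_sum of_real_mult by (intro sum.cong refl) (simp only: re(1))
  finally have "complex_of_real (T_real n p \<gamma> x k)
     = of_real (1 / (x * (1 + (\<Sum>l\<in>{..<p} <+> {..<n}. profile_weight n \<gamma> k l * T_real n p \<gamma> x l))))"
    unfolding re(1)[OF k] by simp
  then show "T_real n p \<gamma> x k = 1 / (x * (1 + (\<Sum>l\<in>{..<p} <+> {..<n}. profile_weight n \<gamma> k l * T_real n p \<gamma> x l)))"
    by (simp only: of_real_eq_iff)
qed

text \<open>Here \<open>f'\<close> and \<open>g'\<close> stand for minus the derivatives. For fixed
  \<open>h\<close> they differ by at most the differences of \<open>f\<close> and \<open>g\<close>
  at \<open>x + h\<close> and at \<open>x\<close>, divided by \<open>h\<close>, plus
  \<open>2 * K * h\<close>. The index tends to infinity before \<open>h\<close> becomes small, and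
  the choice \<open>h = 1 / Suc m\<close> keeps the number of exceptional null sets
  countable.\<close>

lemma derivative_convergence:
  fixes f g f' g' :: "real \<Rightarrow> nat \<Rightarrow> real" and x K :: real
  assumes f: "\<And>h. h > 0 \<Longrightarrow> eventually (\<lambda>n. \<bar>f (x + h) n - f x n + h * f' x n\<bar> \<le> K * h\<^sup>2) sequentially"
    and g: "\<And>h. h > 0 \<Longrightarrow> eventually (\<lambda>n. \<bar>g (x + h) n - g x n + h * g' x n\<bar> \<le> K * h\<^sup>2) sequentially"
    and lim0: "(\<lambda>n. f x n - g x n) \<longlonglongrightarrow> 0"
    and lim: "\<And>m :: nat. (\<lambda>n. f (x + 1 / Suc m) n - g (x + 1 / Suc m) n) \<longlonglongrightarrow> 0" and K: "K \<ge> 0"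
  shows "(\<lambda>n. f' x n - g' x n) \<longlonglongrightarrow> 0"
proof (rule tendstoI)
  fix \<epsilon> :: real assume e: "\<epsilon> > 0"
  \<comment> \<open>Chosen so that the remainders \<open>2 * K * h\<close> use less than half of
    \<open>\<epsilon>\<close>; each of the two differences gets a quarter.\<close>
  obtain m :: nat where m: "4 * K / \<epsilon> < Suc m" using reals_Archimedean2 less_trans of_nat_less_iff lessI by metis
  define h where "h = 1 / real (Suc m)"
  have h: "h > 0" by (simp add: h_def)
  have "4 * K < \<epsilon> * Suc m" using m e by (simp add: pos_divide_less_eq mult.commute)
  then have Kh: "2 * (K * h) < \<epsilon> / 2" by (simp add: h_def field_simps)
  have "eventually (\<lambda>n. \<bar>f (x + h) n - g (x + h) n\<bar> < h * \<epsilon> / 4) sequentially"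
    using tendstoD[OF lim[of m], of "h * \<epsilon> / 4"] e h by (simp add: dist_real_def h_def)
  moreover have "eventually (\<lambda>n. \<bar>f x n - g x n\<bar> < h * \<epsilon> / 4) sequentially"
    using tendstoD[OF lim0, of "h * \<epsilon> / 4"] e h by (simp add: dist_real_def)
  ultimately show "eventually (\<lambda>n. dist (f' x n - g' x n) 0 < \<epsilon>) sequentially"
    using f[OF h] g[OF h]
  proof eventually_elim
    case (elim n)
    have "h * \<bar>f' x n - g' x n\<bar> = \<bar>h * f' x n - h * g' x n\<bar>"
      using h by (simp add: abs_mult flip: right_diff_distrib)
    also have "\<dots> < h * \<epsilon> / 2 + 2 * (K * h\<^sup>2)" using elim by linarith
    also have "2 * (K * h\<^sup>2) = h * (2 * (K * h))" by (simp add: power2_eq_square)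
    also have "\<dots> < h * (\<epsilon> / 2)" using Kh h by (intro mult_strict_left_mono) auto
    finally have "h * \<bar>f' x n - g' x n\<bar> < h * \<epsilon>" by (simp add: mult.commute)
    then show ?case using h by (simp add: dist_real_def)
  qed
qed

text \<open>The fourth moments are summable, so the series of fourth powers is almost surely finite
  and its terms tend to zero, whatever the dependence between different \<open>n\<close>.\<close>

lemma (in prob_space) AE_tendsto_zero_of_fourth_moments:
  fixes D :: "nat \<Rightarrow> 'a \<Rightarrow> real"
  assumes "eventually (\<lambda>n. D n \<in> borel_measurable M \<and> (\<exists>B. \<forall>\<omega>. \<bar>D n \<omega>\<bar> \<le> B) \<and>
    expectation (\<lambda>\<omega>. (D n \<omega>) ^ 4) \<le> C / (real n)\<^sup>2) sequentially" and C: "C \<ge> 0"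
  shows "AE \<omega> in M. (\<lambda>n. D n \<omega>) \<longlonglongrightarrow> 0"
proof -
  obtain n0 where n0: "\<And>n. n \<ge> n0 \<Longrightarrow> D n \<in> borel_measurable M" "\<And>n. n \<ge> n0 \<Longrightarrow> \<exists>B. \<forall>\<omega>. \<bar>D n \<omega>\<bar> \<le> B"
    "\<And>n. n \<ge> n0 \<Longrightarrow> expectation (\<lambda>\<omega>. (D n \<omega>) ^ 4) \<le> C / (real n)\<^sup>2"
    using assms(1) unfolding eventually_sequentially by blast
  \<comment> \<open>The finitely many terms outside the eventual hypothesis are replaced by
    zero.\<close>
  define E where "E n \<omega> = (if n \<ge> n0 then (D n \<omega>) ^ 4 else 0)" for n \<omega>
  have Em: "E n \<in> borel_measurable M" for n using n0(1) by (cases "n \<ge> n0") (simp_all add: E_def[abs_def])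
  have E0: "0 \<le> E n \<omega>" for n \<omega> by (simp add: E_def)
  have le: "(\<integral>\<^sup>+\<omega>. E n \<omega> \<partial>M) \<le> ennreal (C / (real n)\<^sup>2)" for n
  proof (cases "n \<ge> n0")
    case True
    obtain B where B: "\<And>\<omega>. \<bar>D n \<omega>\<bar> \<le> B" using n0(2)[OF True] by blast
    have "integrable M (E n)"
    proof (rule integrable_const_bound)
      have "norm (E n \<omega>) \<le> B ^ 4" for \<omega>
        using power_mono[OF B[of \<omega>], of 4] True by (simp add: E_def)
      then show "AE \<omega> in M. norm (E n \<omega>) \<le> B ^ 4" by simp
    qed (rule Em)
    then have "(\<integral>\<^sup>+\<omega>. E n \<omega> \<partial>M) = ennreal (expectation (E n))" using E0 by (intro nn_integral_eq_integral) auto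
    also have "expectation (E n) \<le> C / (real n)\<^sup>2" using n0(3)[OF True] True by (simp add: E_def[abs_def])
    finally show ?thesis by (simp add: ennreal_leI)
  qed (simp add: E_def)
  have "summable (\<lambda>n. C / (real n)\<^sup>2)" using inverse_power_summable[of 2, where 'a = real] by (simp add: divide_inverse summable_mult)
  then have fin: "(\<Sum>n. ennreal (C / (real n)\<^sup>2)) < \<top>"
    using C by (subst suminf_ennreal2) auto
  have "(\<integral>\<^sup>+\<omega>. (\<Sum>n. ennreal (E n \<omega>)) \<partial>M) = (\<Sum>n. \<integral>\<^sup>+\<omega>. E n \<omega> \<partial>M)"
    using Em by (intro nn_integral_suminf) simp
  also have "\<dots> \<le> (\<Sum>n. ennreal (C / (real n)\<^sup>2))" by (intro suminf_le le) auto
  finally have "(\<integral>\<^sup>+\<omega>. (\<Sum>n. ennreal (E n \<omega>)) \<partial>M) \<noteq> \<infinity>" using fin by (auto simp: top_unique)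
  then have "AE \<omega> in M. (\<Sum>n. ennreal (E n \<omega>)) \<noteq> \<infinity>"
    using Em by (intro nn_integral_PInf_AE) auto
  then show ?thesis
  proof eventually_elim
    case (elim \<omega>)
    then have "summable (\<lambda>n. E n \<omega>)" using E0 by (intro summable_suminf_not_top) auto
    then have "(\<lambda>n. E n \<omega>) \<longlonglongrightarrow> 0" by (rule summable_LIMSEQ_zero)
    moreover have "eventually (\<lambda>n. E n \<omega> = (D n \<omega>) ^ 4) sequentially"
      using eventually_ge_at_top[of n0] by eventually_elim (simp add: E_def)
    ultimately have "(\<lambda>n. (D n \<omega>) ^ 4) \<longlonglongrightarrow> 0" by (rule Lim_transform_eventually)
    then have "(\<lambda>n. sqrt (sqrt ((D n \<omega>) ^ 4))) \<longlonglongrightarrow> sqrt (sqrt 0)" by (intro tendsto_real_sqrt)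
    moreover have "sqrt (sqrt (d ^ 4)) = \<bar>d\<bar>" for d :: real
    proof -
      have "d ^ 4 = (d\<^sup>2)\<^sup>2" by simp
      then show ?thesis by (simp only: real_sqrt_abs abs_power2)
    qed
    ultimately have "(\<lambda>n. \<bar>D n \<omega>\<bar>) \<longlonglongrightarrow> 0" by simp
    then show ?case by (rule tendsto_rabs_zero_cancel)
  qed
qed

section \<open>Almost sure limits of traces and of their derivatives for growing sizes\<close>

locale random_matrix_sequence = prob_space M for M :: "'a measure" +
  fixes p :: "nat \<Rightarrow> nat" and c :: real and \<gamma> :: "nat \<Rightarrow> nat \<Rightarrow> nat \<Rightarrow> real" and G m4 :: real
    and Z :: "nat \<Rightarrow> nat \<Rightarrow> nat \<Rightarrow> 'a \<Rightarrow> real"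
  assumes c: "c > 0" and ratio: "(\<lambda>n. real (p n) / real n) \<longlonglongrightarrow> c"
    and rm: "\<And>n. n \<ge> 1 \<Longrightarrow> p n \<ge> 1 \<Longrightarrow> random_matrix M (\<lambda>(i, j). Z n i j) n (p n) (\<gamma> n) G m4"
begin

definition X :: "nat \<Rightarrow> 'a \<Rightarrow> nat \<Rightarrow> nat \<Rightarrow> real" where
  "X n \<omega> i j = \<gamma> n i j * Z n i j \<omega>"

definition Q :: "nat \<Rightarrow> real \<Rightarrow> 'a \<Rightarrow> nat \<Rightarrow> nat \<Rightarrow> real" where
  "Q n x \<omega> = res (1 / n) x n (p n) (X n \<omega>)"

definition Qt :: "nat \<Rightarrow> real \<Rightarrow> 'a \<Rightarrow> nat \<Rightarrow> nat \<Rightarrow> real" where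
  "Qt n x \<omega> = res (1 / n) x (p n) n (\<lambda>j i. X n \<omega> i j)"

text \<open>Positivity of \<open>c\<close> excludes \<open>p n = 0\<close> for large
  \<open>n\<close>, and \<open>c + 1\<close> is a convenient number above the limit
  \<open>c\<close>; all sizes become comparable with \<open>n\<close>.\<close>

lemma eventually_size: "eventually (\<lambda>n. n \<ge> 1 \<and> p n \<ge> 1 \<and> real (p n) \<le> (c + 1) * n) sequentially"
proof -
  have "eventually (\<lambda>n. real (p n) / real n > 0) sequentially" by (rule order_tendstoD(1)[OF ratio c])
  moreover have "eventually (\<lambda>n. real (p n) / real n < c + 1) sequentially"
    by (rule order_tendstoD(2)[OF ratio]) simp
  ultimately show ?thesis using eventually_ge_at_top[of 1]
  proof eventually_elim
    case (elim n)
    then show ?case by (auto simp: field_simps zero_less_divide_iff)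
  qed
qed

lemma rm_X: "n \<ge> 1 \<Longrightarrow> p n \<ge> 1 \<Longrightarrow> random_matrix.X (\<lambda>(i, j). Z n i j) (\<gamma> n) = X n"
  by (intro ext) (simp add: random_matrix.X_def[OF rm] X_def)

text \<open>The expected diagonal entries of both resolvents together solve the canonical system at
  \<open>-x\<close> up to an error of order \<open>1 / sqrt n\<close>, while the row sums of the
  weights stay below \<open>G^2 * (c + 1)\<close>. Stability passes the same order on to the
  distance from the canonical solution, uniformly over the indices.\<close>

lemma expected_resolvent_limit:
  assumes x: "x > 0"
  shows "\<exists>\<eta>. \<eta> \<longlonglongrightarrow> 0 \<and> eventually (\<lambda>n.
    (\<forall>j<p n. \<bar>expectation (\<lambda>\<omega>. Q n x \<omega> j j) - T_real n (p n) (\<gamma> n) x (Inl j)\<bar> \<le> \<eta> n) \<and>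
    (\<forall>i<n. \<bar>expectation (\<lambda>\<omega>. Qt n x \<omega> i i) - T_real n (p n) (\<gamma> n) x (Inr i)\<bar> \<le> \<eta> n)) sequentially"
proof -
  define S where "S = G\<^sup>2 * (c + 1)"
  have S0: "0 \<le> S" using c by (simp add: S_def)
  \<comment> \<open>Both \<open>n\<close> and \<open>p n\<close> are at most
    \<open>(c + 2) * n\<close>, so one constant serves the matrix and its transpose.\<close>
  define A where "A = sqrt ((m4 + 2) * (c + 2)) + 1 + 2 * sqrt (c + 2)"
  define e where "e n = G\<^sup>2 / x\<^sup>2 * A / sqrt n" for n :: nat
  define \<eta> where "\<eta> n = 4 * e n * (1 + S / x)\<^sup>2" for n
  have isq: "(\<lambda>n. 1 / sqrt (real n)) \<longlonglongrightarrow> 0"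
    by (intro real_tendsto_divide_at_top[OF tendsto_const] filterlim_compose[OF sqrt_at_top filterlim_real_sequentially])
  have e_lim: "e \<longlonglongrightarrow> 0"
    using tendsto_mult_right_zero[OF isq, of "G\<^sup>2 / x\<^sup>2 * A"] by (simp add: e_def[abs_def])
  have \<eta>_lim: "\<eta> \<longlonglongrightarrow> 0"
    unfolding \<eta>_def using e_lim by (intro tendsto_mult_left_zero tendsto_mult_right_zero)
  have "(\<lambda>n. 4 * e n * x * (1 + S / x)\<^sup>2) \<longlonglongrightarrow> 0"
    using e_lim by (intro tendsto_mult_left_zero tendsto_mult_right_zero)
  then have "eventually (\<lambda>n. 4 * e n * x * (1 + S / x)\<^sup>2 < 1) sequentially" by (rule order_tendstoD) simp
  then have "eventually (\<lambda>n.
    (\<forall>j<p n. \<bar>expectation (\<lambda>\<omega>. Q n x \<omega> j j) - T_real n (p n) (\<gamma> n) x (Inl j)\<bar> \<le> \<eta> n) \<and>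
    (\<forall>i<n. \<bar>expectation (\<lambda>\<omega>. Qt n x \<omega> i i) - T_real n (p n) (\<gamma> n) x (Inr i)\<bar> \<le> \<eta> n)) sequentially"
    using eventually_size
  proof eventually_elim
    case (elim n)
    then have n: "n \<ge> 1" "p n \<ge> 1" "real (p n) \<le> (c + 1) * n" by auto
    interpret R: random_matrix M "\<lambda>(i, j). Z n i j" n "p n" "\<gamma> n" G m4 by (rule rm[OF n(1,2)])
    interpret T: random_matrix M "\<lambda>(j, i). Z n i j" "p n" n "\<lambda>j i. \<gamma> n i j" G m4
      using R.transpose by simp
    have RX: "R.X = X n" by (rule rm_X[OF n(1,2)])
    have TX: "T.X \<omega> = (\<lambda>j i. X n \<omega> i j)" for \<omega>
      by (intro ext) (simp add: T.X_def X_def)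
    have s: "1 / real n > 0" using n by simp
    let ?I = "{..<p n} <+> {..<n}"
    let ?w = "profile_weight n (\<gamma> n)"
    define a where "a k = (case k of Inl j \<Rightarrow> expectation (\<lambda>\<omega>. Q n x \<omega> j j) | Inr i \<Rightarrow> expectation (\<lambda>\<omega>. Qt n x \<omega> i i))" for k
    have m40: "m4 + 2 \<ge> 0"
    proof -
      have "0 \<le> expectation (\<lambda>\<omega>. (Z n 0 0 \<omega>) ^ 4)" by (intro integral_nonneg_AE) simp
      moreover have "expectation (\<lambda>\<omega>. (Z n 0 0 \<omega>) ^ 4) \<le> m4" using R.Z4[of 0 0] n by simp
      ultimately show ?thesis by linarith
    qed
    have npn: "real n + real (p n) \<le> (c + 2) * n" using n(3) by (simp add: algebra_simps)
    have err: "1 / n * G\<^sup>2 / x\<^sup>2 * (sqrt ((m4 + 2) * a') + 1 + 2 * sqrt b') \<le> e n"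
      if ab: "0 \<le> a'" "a' \<le> (c + 2) * n" "0 \<le> b'" "b' \<le> (c + 2) * n" for a' b' :: real
    proof -
      have sn: "sqrt n \<ge> 1" using n by simp
      have "sqrt ((m4 + 2) * a') \<le> sqrt ((m4 + 2) * ((c + 2) * n))" using ab m40 by (intro real_sqrt_le_mono mult_left_mono) auto
      also have "\<dots> = sqrt ((m4 + 2) * (c + 2)) * sqrt n" by (simp add: real_sqrt_mult mult.assoc)
      finally have 1: "sqrt ((m4 + 2) * a') \<le> sqrt ((m4 + 2) * (c + 2)) * sqrt n" .
      have "sqrt b' \<le> sqrt ((c + 2) * n)" using ab by simp
      also have "\<dots> = sqrt (c + 2) * sqrt n" by (simp add: real_sqrt_mult)
      finally have 2: "sqrt b' \<le> sqrt (c + 2) * sqrt n" .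
      have "sqrt ((m4 + 2) * a') + 1 + 2 * sqrt b' \<le> A * sqrt n" 
        using 1 2 sn unfolding A_def distrib_right by linarith
      then have "1 / n * G\<^sup>2 / x\<^sup>2 * (sqrt ((m4 + 2) * a') + 1 + 2 * sqrt b') \<le> 1 / n * G\<^sup>2 / x\<^sup>2 * (A * sqrt n)"
        by (intro mult_left_mono) auto
      also have "\<dots> = G\<^sup>2 / x\<^sup>2 * A * (sqrt n / n)" by (simp add: mult_ac)
      also have "sqrt n / n = 1 / sqrt n" using n by (simp add: real_div_sqrt field_simps)
      finally show ?thesis by (simp add: e_def)
    qed
    have e0: "0 \<le> e n" using err[of 0 0] c n by (smt (verit, best) divide_nonneg_nonneg mult_nonneg_nonneg of_nat_0_le_iff real_sqrt_ge_zero zero_le_power2 zero_le_one)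
    have stab: "\<bar>a k - T_real n (p n) (\<gamma> n) x k\<bar> \<le> 4 * e n * (1 + S / x)\<^sup>2" if k: "k \<in> ?I" for k
    proof (rule positive_system_stability[where w = ?w and I = ?I])
      show "finite ?I" by simp
      show "0 \<le> ?w k l" for k l by (rule profile_weight_nonneg)
      show "(\<Sum>l\<in>?I. ?w k l) \<le> S" if k: "k \<in> ?I" for k
      proof (cases k)
        case (Inl j)
        have "(\<Sum>l\<in>?I. ?w k l) = (\<Sum>i<n. (\<gamma> n i j)\<^sup>2 / n)"
          using sum_profile_weight(1)[of n "\<gamma> n" j "\<lambda>_. 1 :: real" "p n"] Inl by simp
        also have "\<dots> \<le> (\<Sum>i<n. G\<^sup>2 / n)" using R.g_sq_le k Inl by (intro sum_mono divide_right_mono) auto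
        also have "\<dots> = G\<^sup>2" using n by simp
        also have "\<dots> \<le> S" using c by (simp add: S_def distrib_left)
        finally show ?thesis .
      next
        case (Inr i)
        have "(\<Sum>l\<in>?I. ?w k l) = (\<Sum>j<p n. (\<gamma> n i j)\<^sup>2 / n)"
          using sum_profile_weight(2)[of n "\<gamma> n" i "\<lambda>_. 1 :: real" "p n"] Inr by simp
        also have "\<dots> \<le> (\<Sum>j<p n. G\<^sup>2 / n)" using R.g_sq_le k Inr by (intro sum_mono divide_right_mono) auto
        also have "\<dots> = G\<^sup>2 * (p n / n)" by simp
        also have "\<dots> \<le> G\<^sup>2 * (c + 1)" using n by (intro mult_left_mono) (auto simp: divide_le_eq)
        finally show ?thesis by (simp add: S_def)
      qed
      show "0 \<le> S" "x > 0" "0 \<le> e n" using S0 x e0 by auto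
      show "0 \<le> T_real n (p n) (\<gamma> n) x k" if "k \<in> ?I" for k by (rule T_real_equation(1)[OF x that])
      show "T_real n (p n) (\<gamma> n) x k = 1 / (x * (1 + (\<Sum>l\<in>?I. ?w k l * T_real n (p n) (\<gamma> n) x l)))" if "k \<in> ?I" for k
        by (rule T_real_equation(2)[OF x that])
      show "4 * e n * x * (1 + S / x)\<^sup>2 \<le> 1" using elim by simp
      show "k \<in> ?I" by (rule k)
      have bd: "0 \<le> expectation f \<and> expectation f \<le> 1 / x" if "integrable M f" "\<And>\<omega>. 0 \<le> f \<omega> \<and> f \<omega> \<le> 1 / x" for f
      proof
        show "0 \<le> expectation f" using that(2) by (intro integral_nonneg_AE) auto
        have "expectation f \<le> expectation (\<lambda>_. 1 / x)" using that by (intro integral_mono) auto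
        then show "expectation f \<le> 1 / x" by (simp add: prob_space)
      qed
      show "0 \<le> a k \<and> a k \<le> 1 / x" if k: "k \<in> ?I" for k
      proof (cases k)
        case (Inl j)
        then have j: "j < p n" using k by auto
        show ?thesis unfolding Inl a_def sum.case Q_def
          using R.res_diag_integrable[OF less_imp_le[OF s] x j] res_diag_nonneg[OF less_imp_le[OF s] x j] res_diag_le[OF less_imp_le[OF s] x j]
          unfolding RX by (intro bd) auto
      next
        case (Inr i)
        then have i: "i < n" using k by auto
        show ?thesis unfolding Inr a_def sum.case Qt_def
          using T.res_diag_integrable[OF less_imp_le[OF s] x i] res_diag_nonneg[OF less_imp_le[OF s] x i] res_diag_le[OF less_imp_le[OF s] x i]
          unfolding TX by (intro bd) auto
      qed
      show "\<bar>a k - 1 / (x * (1 + (\<Sum>l\<in>?I. ?w k l * a l)))\<bar> \<le> e n" if k: "k \<in> ?I" for k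
      proof (cases k)
        case (Inl j)
        then have j: "j < p n" using k by auto
        have "(\<Sum>l\<in>?I. ?w k l * a l) = 1 / n * (\<Sum>i<n. (\<gamma> n i j)\<^sup>2 * expectation (\<lambda>\<omega>. Qt n x \<omega> i i))"
          using sum_profile_weight(1)[of n "\<gamma> n" j a "p n"] Inl by (simp add: a_def sum_distrib_left)
        then have "\<bar>a k - 1 / (x * (1 + (\<Sum>l\<in>?I. ?w k l * a l)))\<bar>
           \<le> 1 / n * G\<^sup>2 / x\<^sup>2 * (sqrt ((m4 + 2) * real n) + 1 + 2 * sqrt (real (p n)))"
          using R.expected_resolvent_approx_equation[OF s x j] by (simp add: Inl a_def Q_def Qt_def RX)
        also have "\<dots> \<le> e n" using npn by (intro err) auto
        finally show ?thesis .
      next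
        case (Inr i)
        then have i: "i < n" using k by auto
        have "(\<Sum>l\<in>?I. ?w k l * a l) = 1 / n * (\<Sum>j<p n. (\<gamma> n i j)\<^sup>2 * expectation (\<lambda>\<omega>. Q n x \<omega> j j))"
          using sum_profile_weight(2)[of n "\<gamma> n" i a "p n"] Inr by (simp add: a_def sum_distrib_left)
        then have "\<bar>a k - 1 / (x * (1 + (\<Sum>l\<in>?I. ?w k l * a l)))\<bar>
           \<le> 1 / n * G\<^sup>2 / x\<^sup>2 * (sqrt ((m4 + 2) * real (p n)) + 1 + 2 * sqrt (real n))"
          using T.expected_resolvent_approx_equation[OF s x i] by (simp add: Inr a_def Q_def Qt_def TX)
        also have "\<dots> \<le> e n" using npn by (intro err) auto
        finally show ?thesis .
      qed
    qed
    show ?case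
    proof (intro conjI allI impI)
      fix j assume "j < p n"
      then show "\<bar>expectation (\<lambda>\<omega>. Q n x \<omega> j j) - T_real n (p n) (\<gamma> n) x (Inl j)\<bar> \<le> \<eta> n"
        using stab[of "Inl j"] by (auto simp: a_def \<eta>_def)
    next
      fix i assume "i < n"
      then show "\<bar>expectation (\<lambda>\<omega>. Qt n x \<omega> i i) - T_real n (p n) (\<gamma> n) x (Inr i)\<bar> \<le> \<eta> n"
        using stab[of "Inr i"] by (auto simp: a_def \<eta>_def)
    qed
  qed
  with \<eta>_lim show ?thesis by blast
qed

end

context random_matrix_sequence
begin

text \<open>The difference splits into the centred trace \<open>E\<close> and the deterministic bias
  \<open>B\<close>. Dividing by \<open>n\<close> turns the fourth moment bound of order
  \<open>n^2\<close> into the summable \<open>C / n^2\<close>. The bias consists of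
  \<open>p n\<close> errors of size at most \<open>D * \<eta> n\<close>, divided by
  \<open>n\<close>.\<close>

lemma weighted_trace_limit_rows:
  assumes x: "x > 0" and d: "\<And>n j. n \<ge> 1 \<Longrightarrow> j < p n \<Longrightarrow> 0 \<le> d n j \<and> d n j \<le> D" and D: "D > 0"
  shows "AE \<omega> in M. (\<lambda>n. 1 / n * (\<Sum>j<p n. d n j * Q n x \<omega> j j)
     - 1 / n * (\<Sum>j<p n. d n j * T_real n (p n) (\<gamma> n) x (Inl j))) \<longlonglongrightarrow> 0"
proof -
  define F where "F n \<omega> = (\<Sum>j<p n. d n j * Q n x \<omega> j j)" for n \<omega>
  define E where "E n \<omega> = 1 / n * (F n \<omega> - expectation (F n))" for n \<omega>
  define C where "C = 48 * (D / x) ^ 4"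
  define B where "B n = 1 / n * expectation (F n) - 1 / n * (\<Sum>j<p n. d n j * T_real n (p n) (\<gamma> n) x (Inl j))" for n
  have C0: "C \<ge> 0" by (simp add: C_def)
  have "AE \<omega> in M. (\<lambda>n. E n \<omega>) \<longlonglongrightarrow> 0"
  proof (rule AE_tendsto_zero_of_fourth_moments[OF _ C0])
    show "eventually (\<lambda>n. E n \<in> borel_measurable M \<and> (\<exists>B. \<forall>\<omega>. \<bar>E n \<omega>\<bar> \<le> B) \<and>
      expectation (\<lambda>\<omega>. (E n \<omega>) ^ 4) \<le> C / (real n)\<^sup>2) sequentially"
      using eventually_size
    proof eventually_elim
      case (elim n)
      then have n: "n \<ge> 1" "p n \<ge> 1" by auto
      interpret R: random_matrix M "\<lambda>(i, j). Z n i j" n "p n" "\<gamma> n" G m4 by (rule rm[OF n])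
      have s: "1 / real n \<ge> 0" by simp
      note conc = R.weighted_trace_concentration[OF s x, of "d n" D, OF d[OF n(1)] D, unfolded rm_X[OF n], folded Q_def, folded F_def]
      have m: "E n \<in> borel_measurable M" unfolding E_def using conc(3) by simp
      have b: "\<bar>E n \<omega>\<bar> \<le> 1 / n * (p n * (D / x) + \<bar>expectation (F n)\<bar>)" for \<omega>
      proof -
        have "\<bar>F n \<omega> - expectation (F n)\<bar> \<le> p n * (D / x) + \<bar>expectation (F n)\<bar>" using conc(4)[of \<omega>] by linarith
        then show ?thesis unfolding E_def abs_mult by (simp add: divide_right_mono)
      qed
      have "expectation (\<lambda>\<omega>. (E n \<omega>) ^ 4) = (1 / n) ^ 4 * expectation (\<lambda>\<omega>. (F n \<omega> - expectation (F n)) ^ 4)"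
        unfolding E_def power_mult_distrib by simp
      also have "\<dots> \<le> (1 / n) ^ 4 * (48 * (D / x) ^ 4 * (real n)\<^sup>2)" by (intro mult_left_mono conc(2)) simp_all
      also have "\<dots> = C / (real n)\<^sup>2" using n by (simp add: C_def power_divide power_numeral_reduce)
      finally show ?case using m b by blast
    qed
  qed
  moreover have "B \<longlonglongrightarrow> 0"
  proof -
    from expected_resolvent_limit[OF x] obtain \<eta> where \<eta>: "\<eta> \<longlonglongrightarrow> 0"
      and ev: "eventually (\<lambda>n.
        (\<forall>j<p n. \<bar>expectation (\<lambda>\<omega>. Q n x \<omega> j j) - T_real n (p n) (\<gamma> n) x (Inl j)\<bar> \<le> \<eta> n) \<and>
        (\<forall>i<n. \<bar>expectation (\<lambda>\<omega>. Qt n x \<omega> i i) - T_real n (p n) (\<gamma> n) x (Inr i)\<bar> \<le> \<eta> n)) sequentially"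
      by (elim exE conjE) (rule that)
    show ?thesis
    proof (rule Lim_null_comparison)
      show "(\<lambda>n. (c + 1) * D * \<eta> n) \<longlonglongrightarrow> 0" using \<eta> by (rule tendsto_mult_right_zero)
      show "eventually (\<lambda>n. norm (B n) \<le> (c + 1) * D * \<eta> n) sequentially"
        using eventually_size ev
      proof eventually_elim
        case (elim n)
        then have n: "n \<ge> 1" "p n \<ge> 1" "real (p n) \<le> (c + 1) * n" by auto
        interpret R: random_matrix M "\<lambda>(i, j). Z n i j" n "p n" "\<gamma> n" G m4 by (rule rm[OF n(1,2)])
        have s: "1 / real n \<ge> 0" by simp
        have qi: "integrable M (\<lambda>\<omega>. Q n x \<omega> j j)" if "j < p n" for j
          using R.res_diag_integrable[OF s x that] unfolding rm_X[OF n(1,2)] Q_def .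
        have eF: "expectation (F n) = (\<Sum>j<p n. d n j * expectation (\<lambda>\<omega>. Q n x \<omega> j j))"
          unfolding F_def using qi by (subst Bochner_Integration.integral_sum) auto
        have e0: "0 \<le> \<eta> n" using elim n by (auto dest: spec[of _ 0])
        have "\<bar>B n\<bar> = 1 / n * \<bar>\<Sum>j<p n. d n j * (expectation (\<lambda>\<omega>. Q n x \<omega> j j) - T_real n (p n) (\<gamma> n) x (Inl j))\<bar>"
          unfolding B_def eF right_diff_distrib[symmetric] abs_mult sum_subtractf[symmetric] by simp
        also have "\<dots> \<le> 1 / n * (\<Sum>j<p n. D * \<eta> n)"
        proof (intro mult_left_mono order_trans[OF sum_abs sum_mono])
          fix j assume j: "j \<in> {..<p n}"
          then show "\<bar>d n j * (expectation (\<lambda>\<omega>. Q n x \<omega> j j) - T_real n (p n) (\<gamma> n) x (Inl j))\<bar> \<le> D * \<eta> n"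
            unfolding abs_mult using d[OF n(1), of j] elim D by (intro mult_mono) auto
        qed simp
        also have "\<dots> = (p n / n) * (D * \<eta> n)" by simp
        also have "\<dots> \<le> (c + 1) * (D * \<eta> n)"
          using n e0 D by (intro mult_right_mono) (auto simp: divide_le_eq)
        finally show ?case by (simp add: mult.assoc)
      qed
    qed
  qed
  ultimately have "AE \<omega> in M. (\<lambda>n. E n \<omega> + B n) \<longlonglongrightarrow> 0"
    by (auto elim!: eventually_mono intro: tendsto_add_zero)
  moreover have "E n \<omega> + B n = 1 / n * (\<Sum>j<p n. d n j * Q n x \<omega> j j)
     - 1 / n * (\<Sum>j<p n. d n j * T_real n (p n) (\<gamma> n) x (Inl j))" for n \<omega>
    by (simp add: E_def B_def F_def right_diff_distrib diff_divide_distrib)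
  ultimately show ?thesis by simp
qed

text \<open>The same argument for the transposed matrix. Its independent rows are \<open>p n\<close>
  in number, whence the factor \<open>(c + 1)^2\<close> in \<open>C\<close>.\<close>

lemma trace_limit_columns:
  assumes x: "x > 0"
  shows "AE \<omega> in M. (\<lambda>n. 1 / n * (\<Sum>i<n. Qt n x \<omega> i i)
     - 1 / n * (\<Sum>i<n. T_real n (p n) (\<gamma> n) x (Inr i))) \<longlonglongrightarrow> 0"
proof -
  define F where "F n \<omega> = (\<Sum>i<n. 1 * Qt n x \<omega> i i)" for n \<omega>
  define E where "E n \<omega> = 1 / n * (F n \<omega> - expectation (F n))" for n \<omega>
  define C where "C = 48 * (1 / x) ^ 4 * (c + 1)\<^sup>2"
  define B where "B n = 1 / n * expectation (F n) - 1 / n * (\<Sum>i<n. T_real n (p n) (\<gamma> n) x (Inr i))" for n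
  have C0: "C \<ge> 0" by (simp add: C_def)
  have trans: "random_matrix M (\<lambda>(j, i). Z n i j) (p n) n (\<lambda>j i. \<gamma> n i j) G m4"
    "random_matrix.X (\<lambda>(j, i). Z n i j) (\<lambda>j i. \<gamma> n i j) \<omega> = (\<lambda>j i. X n \<omega> i j)"
    if "n \<ge> 1" "p n \<ge> 1" for n \<omega>
  proof -
    show t: "random_matrix M (\<lambda>(j, i). Z n i j) (p n) n (\<lambda>j i. \<gamma> n i j) G m4"
      using random_matrix.transpose[OF rm[OF that]] by simp
    show "random_matrix.X (\<lambda>(j, i). Z n i j) (\<lambda>j i. \<gamma> n i j) \<omega> = (\<lambda>j i. X n \<omega> i j)"
      by (intro ext) (simp add: random_matrix.X_def[OF t] X_def)
  qed
  have "AE \<omega> in M. (\<lambda>n. E n \<omega>) \<longlonglongrightarrow> 0"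
  proof (rule AE_tendsto_zero_of_fourth_moments[OF _ C0])
    show "eventually (\<lambda>n. E n \<in> borel_measurable M \<and> (\<exists>B. \<forall>\<omega>. \<bar>E n \<omega>\<bar> \<le> B) \<and>
      expectation (\<lambda>\<omega>. (E n \<omega>) ^ 4) \<le> C / (real n)\<^sup>2) sequentially"
      using eventually_size
    proof eventually_elim
      case (elim n)
      then have n: "n \<ge> 1" "p n \<ge> 1" "real (p n) \<le> (c + 1) * n" by auto
      interpret R: random_matrix M "\<lambda>(j, i). Z n i j" "p n" n "\<lambda>j i. \<gamma> n i j" G m4 by (rule trans(1)[OF n(1,2)])
      have s: "1 / real n \<ge> 0" by simp
      note conc = R.weighted_trace_concentration[OF s x, of "\<lambda>_. 1" 1, unfolded trans(2)[OF n(1,2)], folded Qt_def, folded F_def, simplified]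
      have m: "E n \<in> borel_measurable M" unfolding E_def using conc(3) by simp
      have b: "\<bar>E n \<omega>\<bar> \<le> 1 / n * (n / x + \<bar>expectation (F n)\<bar>)" for \<omega>
      proof -
        have "\<bar>F n \<omega> - expectation (F n)\<bar> \<le> n / x + \<bar>expectation (F n)\<bar>" using conc(4)[of \<omega>] by linarith
        then show ?thesis unfolding E_def abs_mult by (simp add: divide_right_mono)
      qed
      have "expectation (\<lambda>\<omega>. (E n \<omega>) ^ 4) = (1 / n) ^ 4 * expectation (\<lambda>\<omega>. (F n \<omega> - expectation (F n)) ^ 4)"
        unfolding E_def power_mult_distrib by simp
      also have "\<dots> \<le> (1 / n) ^ 4 * (48 * (1 / x) ^ 4 * (real (p n))\<^sup>2)"
        using conc(2) by (intro mult_left_mono) (simp_all add: power_divide)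
      also have "\<dots> \<le> (1 / n) ^ 4 * (48 * (1 / x) ^ 4 * ((c + 1) * n)\<^sup>2)"
        using n(3) by (intro mult_left_mono power_mono) auto
      also have "\<dots> = C / (real n)\<^sup>2" using n by (simp add: C_def power_divide power_numeral_reduce)
      finally show ?case using m b by blast
    qed
  qed
  moreover have "B \<longlonglongrightarrow> 0"
  proof -
    from expected_resolvent_limit[OF x] obtain \<eta> where \<eta>: "\<eta> \<longlonglongrightarrow> 0"
      and ev: "eventually (\<lambda>n.
        (\<forall>j<p n. \<bar>expectation (\<lambda>\<omega>. Q n x \<omega> j j) - T_real n (p n) (\<gamma> n) x (Inl j)\<bar> \<le> \<eta> n) \<and>
        (\<forall>i<n. \<bar>expectation (\<lambda>\<omega>. Qt n x \<omega> i i) - T_real n (p n) (\<gamma> n) x (Inr i)\<bar> \<le> \<eta> n)) sequentially"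
      by (elim exE conjE) (rule that)
    show ?thesis
    proof (rule Lim_null_comparison)
      show "\<eta> \<longlonglongrightarrow> 0" by (rule \<eta>)
      show "eventually (\<lambda>n. norm (B n) \<le> \<eta> n) sequentially"
        using eventually_size ev
      proof eventually_elim
        case (elim n)
        then have n: "n \<ge> 1" "p n \<ge> 1" by auto
        interpret R: random_matrix M "\<lambda>(j, i). Z n i j" "p n" n "\<lambda>j i. \<gamma> n i j" G m4 by (rule trans(1)[OF n])
        have s: "1 / real n \<ge> 0" by simp
        have qi: "integrable M (\<lambda>\<omega>. Qt n x \<omega> i i)" if "i < n" for i
          using R.res_diag_integrable[OF s x that] unfolding trans(2)[OF n] Qt_def .
        have eF: "expectation (F n) = (\<Sum>i<n. expectation (\<lambda>\<omega>. Qt n x \<omega> i i))"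
          unfolding F_def using qi by (subst Bochner_Integration.integral_sum) auto
        have "\<bar>B n\<bar> = 1 / n * \<bar>\<Sum>i<n. expectation (\<lambda>\<omega>. Qt n x \<omega> i i) - T_real n (p n) (\<gamma> n) x (Inr i)\<bar>"
          unfolding B_def eF right_diff_distrib[symmetric] abs_mult sum_subtractf[symmetric] by simp
        also have "\<dots> \<le> 1 / n * (\<Sum>i<n. \<eta> n)"
          using elim by (intro mult_left_mono order_trans[OF sum_abs sum_mono]) auto
        also have "\<dots> = \<eta> n" using n by simp
        finally show ?case by simp
      qed
    qed
  qed
  ultimately have "AE \<omega> in M. (\<lambda>n. E n \<omega> + B n) \<longlonglongrightarrow> 0"
    by (auto elim!: eventually_mono intro: tendsto_add_zero)
  moreover have "E n \<omega> + B n = 1 / n * (\<Sum>i<n. Qt n x \<omega> i i)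
     - 1 / n * (\<Sum>i<n. T_real n (p n) (\<gamma> n) x (Inr i))" for n \<omega>
    by (simp add: E_def B_def F_def right_diff_distrib diff_divide_distrib)
  ultimately show ?thesis by simp
qed

definition T_deriv :: "nat \<Rightarrow> real \<Rightarrow> nat + nat \<Rightarrow> real" where
  "T_deriv n x k = Re (deriv (case_sum (fst (the_canonical_solution n (p n) (\<gamma> n)))
     (snd (the_canonical_solution n (p n) (\<gamma> n))) k) (- of_real x))"

lemma T_real_taylor:
  assumes "x > 0" "h > 0" "k \<in> {..<p n} <+> {..<n}"
  shows "\<bar>T_real n (p n) (\<gamma> n) (x + h) k - T_real n (p n) (\<gamma> n) x k + h * T_deriv n x k\<bar> \<le> h\<^sup>2 / x ^ 3"
  using stieltjes_transform_nonneg_real(3)[OF canonical_stieltjes[OF assms(3)] assms(1,2)]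
  unfolding T_real_def T_deriv_def .

text \<open>Averages an expansion whose remainder is uniform over the indices; \<open>C\<close>
  absorbs the ratio of the number of terms to \<open>n\<close>.\<close>

lemma weighted_sum_taylor:
  assumes "\<And>k. k < m \<Longrightarrow> \<bar>u k - v k + h * w k\<bar> \<le> B" "\<And>k. k < m \<Longrightarrow> 0 \<le> d k \<and> d k \<le> D" "real m \<le> C * n" "n \<ge> 1" "0 \<le> B" "0 \<le> D"
  shows "\<bar>1 / real n * (\<Sum>k<m. d k * u k) - 1 / n * (\<Sum>k<m. d k * v k) + h * (1 / n * (\<Sum>k<m. d k * w k))\<bar> \<le> C * D * B"
proof -
  have "1 / real n * (\<Sum>k<m. d k * u k) - 1 / n * (\<Sum>k<m. d k * v k) + h * (1 / n * (\<Sum>k<m. d k * w k))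
     = 1 / n * (\<Sum>k<m. d k * (u k - v k + h * w k))"
    by (simp add: sum.distrib sum_subtractf sum_distrib_left algebra_simps sum_divide_distrib)
  also have "\<bar>\<dots>\<bar> \<le> 1 / n * (\<Sum>k<m. D * B)"
    unfolding abs_mult
  proof (intro mult_mono order_trans[OF sum_abs sum_mono])
    fix k assume "k \<in> {..<m}"
    then show "\<bar>d k * (u k - v k + h * w k)\<bar> \<le> D * B"
      unfolding abs_mult using assms by (intro mult_mono) auto
  qed auto
  also have "\<dots> = real m / n * (D * B)" by simp
  also have "\<dots> \<le> C * (D * B)" using assms by (intro mult_right_mono) (auto simp: divide_le_eq)
  finally show ?thesis by (simp add: mult.assoc)
qed

text \<open>The squared column norm is minus the derivative of \<open>Q j j\<close> in
  \<open>x\<close>, and \<open>T_deriv\<close> is minus that of \<open>T_real\<close>. Both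
  expansions have remainder \<open>h^2 / x^3\<close>, so \<open>derivative_convergence\<close>
  applies on the event that the traces converge at \<open>x\<close> and at all points
  \<open>x + 1 / Suc m\<close>.\<close>

lemma weighted_trace_limit_derivative:
  assumes x: "x > 0" and d: "\<And>n j. n \<ge> 1 \<Longrightarrow> j < p n \<Longrightarrow> 0 \<le> d n j \<and> d n j \<le> D" and D: "D > 0"
  shows "AE \<omega> in M. (\<lambda>n. 1 / n * (\<Sum>j<p n. d n j * (\<Sum>k<p n. (Q n x \<omega> k j)\<^sup>2))
     - 1 / n * (\<Sum>j<p n. d n j * T_deriv n x (Inl j))) \<longlonglongrightarrow> 0"
proof -
  have "AE \<omega> in M. \<forall>m::nat. (\<lambda>n. 1 / n * (\<Sum>j<p n. d n j * Q n (x + 1 / Suc m) \<omega> j j)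
     - 1 / n * (\<Sum>j<p n. d n j * T_real n (p n) (\<gamma> n) (x + 1 / Suc m) (Inl j))) \<longlonglongrightarrow> 0"
    unfolding AE_all_countable
  proof
    fix m :: nat
    have "x + 1 / Suc m > 0" using x by (intro add_pos_pos) auto
    then show "AE \<omega> in M. (\<lambda>n. 1 / n * (\<Sum>j<p n. d n j * Q n (x + 1 / Suc m) \<omega> j j)
     - 1 / n * (\<Sum>j<p n. d n j * T_real n (p n) (\<gamma> n) (x + 1 / Suc m) (Inl j))) \<longlonglongrightarrow> 0"
      by (rule weighted_trace_limit_rows[OF _ _ D]) (rule d)
  qed
  moreover have "AE \<omega> in M. (\<lambda>n. 1 / n * (\<Sum>j<p n. d n j * Q n x \<omega> j j)
     - 1 / n * (\<Sum>j<p n. d n j * T_real n (p n) (\<gamma> n) x (Inl j))) \<longlonglongrightarrow> 0"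
    by (rule weighted_trace_limit_rows[OF x _ D]) (rule d)
  ultimately show ?thesis
  proof eventually_elim
    case (elim \<omega>)
    have K: "0 \<le> (c + 1) * D / x ^ 3" using c D x by simp
    show ?case
    proof (rule derivative_convergence[where f = "\<lambda>x n. 1 / n * (\<Sum>j<p n. d n j * Q n x \<omega> j j)" and x = x
        and g = "\<lambda>x n. 1 / n * (\<Sum>j<p n. d n j * T_real n (p n) (\<gamma> n) x (Inl j))" and K = "(c + 1) * D / x ^ 3"
        and f' = "\<lambda>x n. 1 / n * (\<Sum>j<p n. d n j * (\<Sum>k<p n. (Q n x \<omega> k j)\<^sup>2))"
        and g' = "\<lambda>x n. 1 / n * (\<Sum>j<p n. d n j * T_deriv n x (Inl j))"])
      fix h :: real assume h: "h > 0"
      have e: "(c + 1) * D * (h\<^sup>2 / x ^ 3) = (c + 1) * D / x ^ 3 * h\<^sup>2" by simp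
      have h3: "0 \<le> h\<^sup>2 / x ^ 3" using x by simp
      show "eventually (\<lambda>n. \<bar>1 / n * (\<Sum>j<p n. d n j * Q n (x + h) \<omega> j j) - 1 / n * (\<Sum>j<p n. d n j * Q n x \<omega> j j)
         + h * (1 / n * (\<Sum>j<p n. d n j * (\<Sum>k<p n. (Q n x \<omega> k j)\<^sup>2)))\<bar> \<le> (c + 1) * D / x ^ 3 * h\<^sup>2) sequentially"
        using eventually_size
      proof eventually_elim
        case (elim n)
        show ?case unfolding e[symmetric]
        proof (rule weighted_sum_taylor)
          fix j assume "j < p n"
          then show "\<bar>Q n (x + h) \<omega> j j - Q n x \<omega> j j + h * (\<Sum>k<p n. (Q n x \<omega> k j)\<^sup>2)\<bar> \<le> h\<^sup>2 / x ^ 3"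
            unfolding Q_def using x h by (intro res_taylor) auto
        qed (use elim d h3 D in auto)
      qed
      show "eventually (\<lambda>n. \<bar>1 / n * (\<Sum>j<p n. d n j * T_real n (p n) (\<gamma> n) (x + h) (Inl j))
         - 1 / n * (\<Sum>j<p n. d n j * T_real n (p n) (\<gamma> n) x (Inl j))
         + h * (1 / n * (\<Sum>j<p n. d n j * T_deriv n x (Inl j)))\<bar> \<le> (c + 1) * D / x ^ 3 * h\<^sup>2) sequentially"
        using eventually_size
      proof eventually_elim
        case (elim n)
        show ?case unfolding e[symmetric]
        proof (rule weighted_sum_taylor)
          fix j assume "j < p n"
          then show "\<bar>T_real n (p n) (\<gamma> n) (x + h) (Inl j) - T_real n (p n) (\<gamma> n) x (Inl j) + h * T_deriv n x (Inl j)\<bar> \<le> h\<^sup>2 / x ^ 3"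
            using x h by (intro T_real_taylor) auto
        qed (use elim d h3 D in auto)
      qed
    qed (use elim K in auto)
  qed
qed

lemma trace_limit_columns_derivative:
  assumes x: "x > 0"
  shows "AE \<omega> in M. (\<lambda>n. 1 / n * (\<Sum>i<n. \<Sum>l<n. (Qt n x \<omega> l i)\<^sup>2)
     - 1 / n * (\<Sum>i<n. T_deriv n x (Inr i))) \<longlonglongrightarrow> 0"
proof -
  have "AE \<omega> in M. \<forall>m::nat. (\<lambda>n. 1 / n * (\<Sum>i<n. Qt n (x + 1 / Suc m) \<omega> i i)
     - 1 / n * (\<Sum>i<n. T_real n (p n) (\<gamma> n) (x + 1 / Suc m) (Inr i))) \<longlonglongrightarrow> 0"
    unfolding AE_all_countable
  proof
    fix m :: nat
    have "x + 1 / Suc m > 0" using x by (intro add_pos_pos) auto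
    then show "AE \<omega> in M. (\<lambda>n. 1 / n * (\<Sum>i<n. Qt n (x + 1 / Suc m) \<omega> i i)
     - 1 / n * (\<Sum>i<n. T_real n (p n) (\<gamma> n) (x + 1 / Suc m) (Inr i))) \<longlonglongrightarrow> 0"
      by (rule trace_limit_columns)
  qed
  with trace_limit_columns[OF x] show ?thesis
  proof eventually_elim
    case (elim \<omega>)
    have K: "0 \<le> 1 * 1 / x ^ 3" using x by simp
    show ?case
    proof (rule derivative_convergence[where f = "\<lambda>x n. 1 / n * (\<Sum>i<n. Qt n x \<omega> i i)" and x = x
        and g = "\<lambda>x n. 1 / n * (\<Sum>i<n. T_real n (p n) (\<gamma> n) x (Inr i))" and K = "1 * 1 / x ^ 3"
        and f' = "\<lambda>x n. 1 / n * (\<Sum>i<n. \<Sum>l<n. (Qt n x \<omega> l i)\<^sup>2)"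
        and g' = "\<lambda>x n. 1 / n * (\<Sum>i<n. T_deriv n x (Inr i))"])
      fix h :: real assume h: "h > 0"
      have h3: "0 \<le> h\<^sup>2 / x ^ 3" using x by simp
      show "eventually (\<lambda>n. \<bar>1 / n * (\<Sum>i<n. Qt n (x + h) \<omega> i i) - 1 / n * (\<Sum>i<n. Qt n x \<omega> i i)
         + h * (1 / n * (\<Sum>i<n. \<Sum>l<n. (Qt n x \<omega> l i)\<^sup>2))\<bar> \<le> 1 * 1 / x ^ 3 * h\<^sup>2) sequentially"
        using eventually_size
      proof eventually_elim
        case (elim n)
        have "\<bar>1 / n * (\<Sum>i<n. 1 * Qt n (x + h) \<omega> i i) - 1 / n * (\<Sum>i<n. 1 * Qt n x \<omega> i i)
           + h * (1 / n * (\<Sum>i<n. 1 * (\<Sum>l<n. (Qt n x \<omega> l i)\<^sup>2)))\<bar> \<le> 1 * 1 * (h\<^sup>2 / x ^ 3)"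
        proof (rule weighted_sum_taylor)
          fix i assume "i < n"
          then show "\<bar>Qt n (x + h) \<omega> i i - Qt n x \<omega> i i + h * (\<Sum>l<n. (Qt n x \<omega> l i)\<^sup>2)\<bar> \<le> h\<^sup>2 / x ^ 3"
            unfolding Qt_def using x h by (intro res_taylor) auto
        qed (use elim h3 in auto)
        then show ?case by simp
      qed
      show "eventually (\<lambda>n. \<bar>1 / n * (\<Sum>i<n. T_real n (p n) (\<gamma> n) (x + h) (Inr i))
         - 1 / n * (\<Sum>i<n. T_real n (p n) (\<gamma> n) x (Inr i))
         + h * (1 / n * (\<Sum>i<n. T_deriv n x (Inr i)))\<bar> \<le> 1 * 1 / x ^ 3 * h\<^sup>2) sequentially"
        using eventually_size
      proof eventually_elim
        case (elim n)
        have "\<bar>1 / n * (\<Sum>i<n. 1 * T_real n (p n) (\<gamma> n) (x + h) (Inr i)) - 1 / n * (\<Sum>i<n. 1 * T_real n (p n) (\<gamma> n) x (Inr i))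
           + h * (1 / n * (\<Sum>i<n. 1 * T_deriv n x (Inr i)))\<bar> \<le> 1 * 1 * (h\<^sup>2 / x ^ 3)"
        proof (rule weighted_sum_taylor)
          fix i assume "i < n"
          then show "\<bar>T_real n (p n) (\<gamma> n) (x + h) (Inr i) - T_real n (p n) (\<gamma> n) x (Inr i) + h * T_deriv n x (Inr i)\<bar> \<le> h\<^sup>2 / x ^ 3"
            using x h by (intro T_real_taylor) auto
        qed (use elim h3 in auto)
        then show ?case by simp
      qed
    qed (use elim K in auto)
  qed
qed

lemma det_test_risk_eq:
  "det_test_risk lam \<sigma> \<alpha> n (p n) (\<gamma> n) g = \<sigma>\<^sup>2 + \<sigma>\<^sup>2 * (1 / n * (\<Sum>j<p n. (g j)\<^sup>2 * T_real n (p n) (\<gamma> n) lam (Inl j)))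
     + lam * (lam * \<alpha>\<^sup>2 / p n - \<sigma>\<^sup>2 / n) * (\<Sum>j<p n. (g j)\<^sup>2 * T_deriv n lam (Inl j))"
  unfolding det_test_risk_def T_mat_def T_mat_deriv_def mat_trace_sq_diag_mult T_real_def T_deriv_def
  by (simp add: Re_sum)

lemma det_train_risk_eq:
  "det_train_risk lam \<sigma> \<alpha> n (p n) (\<gamma> n)
     = lam\<^sup>2 * \<alpha>\<^sup>2 / p n * ((\<Sum>i<n. T_real n (p n) (\<gamma> n) lam (Inr i)) - lam * (\<Sum>i<n. T_deriv n lam (Inr i)))
     + lam\<^sup>2 * \<sigma>\<^sup>2 / n * (\<Sum>i<n. T_deriv n lam (Inr i))"
  unfolding det_train_risk_def Tt_mat_def Tt_mat_deriv_def mat_trace_diag_lincomb T_real_def T_deriv_def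
  by (simp add: Re_sum sum_subtractf sum_distrib_left)

lemma inverse_ratio: "(\<lambda>n. real n / real (p n)) \<longlonglongrightarrow> 1 / c"
  using tendsto_divide[OF tendsto_const[of 1] ratio] c by simp

end

lemma power4_le_one_plus_powr:
  fixes x \<delta> :: real
  assumes "\<delta> > 0"
  shows "x ^ 4 \<le> 1 + \<bar>x\<bar> powr (4 + \<delta>)"
proof (cases "\<bar>x\<bar> \<le> 1")
  case True
  have "x ^ 4 = \<bar>x\<bar> ^ 4" by (simp add: power_even_abs)
  also have "\<dots> \<le> 1" using True by (intro power_le_one) auto
  finally show ?thesis using powr_ge_zero[of "\<bar>x\<bar>" "4 + \<delta>"] by linarith
next
  case False
  have "x ^ 4 = \<bar>x\<bar> ^ 4" by (simp add: power_even_abs)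
  also have "\<dots> = \<bar>x\<bar> powr 4" using False by (simp add: powr_numeral)
  also have "\<dots> \<le> \<bar>x\<bar> powr (4 + \<delta>)" using False assms by (intro powr_mono) auto
  finally show ?thesis by simp
qed

theorem theorem3p2:
  fixes M :: "'a measure"
    and p :: "nat \<Rightarrow> nat" and c :: real
    and \<gamma> :: "nat \<Rightarrow> nat \<Rightarrow> nat \<Rightarrow> real" and \<gamma>t :: "nat \<Rightarrow> nat \<Rightarrow> real" and gmax :: real
    and \<nu> :: "real measure" and Z :: "nat \<Rightarrow> nat \<Rightarrow> nat \<Rightarrow> 'a \<Rightarrow> real"
    and zt :: "nat \<Rightarrow> nat \<Rightarrow> 'a \<Rightarrow> real"
    and \<beta> \<epsilon> :: "nat \<Rightarrow> nat \<Rightarrow> 'a \<Rightarrow> real" and \<epsilon>t :: "nat \<Rightarrow> 'a \<Rightarrow> real"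
    and X :: "nat \<Rightarrow> 'a \<Rightarrow> real mat" and \<beta>v \<epsilon>v Y xt :: "nat \<Rightarrow> 'a \<Rightarrow> real vec"
    and yt :: "nat \<Rightarrow> 'a \<Rightarrow> real"
    and \<sigma> \<alpha> \<delta> lam :: real
  assumes "prob_space M"
    and "c > 0" and "(\<lambda>n. real (p n) / real n) \<longlonglongrightarrow> c"
    and "\<sigma>\<^sup>2 > 0" and "\<alpha> > 0" and "\<delta> > 0" and "lam > 0"
    \<comment> \<open>the model\<close>
    and "\<And>n \<omega>. X n \<omega> = design_matrix n (p n) (\<gamma> n) (Z n) \<omega>"
    and "\<And>n \<omega>. \<beta>v n \<omega> = Matrix.vec (p n) (\<lambda>j. \<beta> n j \<omega>)"
    and "\<And>n \<omega>. \<epsilon>v n \<omega> = Matrix.vec n (\<lambda>i. \<epsilon> n i \<omega>)"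
    and "\<And>n \<omega>. Y n \<omega> = X n \<omega> *\<^sub>v \<beta>v n \<omega> + \<epsilon>v n \<omega>"
    and "\<And>n \<omega>. xt n \<omega> = test_point (p n) (\<gamma>t n) (zt n) \<omega>"
    and "\<And>n \<omega>. yt n \<omega> = xt n \<omega> \<bullet> \<beta>v n \<omega> + \<epsilon>t n \<omega>"
    \<comment> \<open>mutual independence\<close>
    and "\<And>n. n \<ge> 1 \<Longrightarrow> indep_sources M n (p n) (\<beta>v n) (X n) (\<epsilon>v n) (xt n) (\<epsilon>t n)"
    \<comment> \<open>entries of the matrices Z: i.i.d., with a law that does not depend on n\<close>
    and "\<And>n. n \<ge> 1 \<Longrightarrow>
           prob_space.indep_vars M (\<lambda>_. borel) (\<lambda>(i, j). Z n i j) ({..<n} \<times> {..<p n})"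
    and "\<And>n i j. n \<ge> 1 \<Longrightarrow> i < n \<Longrightarrow> j < p n \<Longrightarrow> distr M borel (Z n i j) = \<nu>"
    and "\<And>n i j. n \<ge> 1 \<Longrightarrow> i < n \<Longrightarrow> j < p n \<Longrightarrow>
           integrable M (Z n i j) \<and> (\<integral>\<omega>. Z n i j \<omega> \<partial>M) = 0 \<and>
           integrable M (\<lambda>\<omega>. (Z n i j \<omega>)\<^sup>2) \<and> (\<integral>\<omega>. (Z n i j \<omega>)\<^sup>2 \<partial>M) = 1 \<and>
           integrable M (\<lambda>\<omega>. \<bar>Z n i j \<omega>\<bar> powr (4 + \<delta>))"
    \<comment> \<open>entries of the test vectors: i.i.d. for each n\<close>
    and "\<And>n. n \<ge> 1 \<Longrightarrow> prob_space.indep_vars M (\<lambda>_. borel) (zt n) {..<p n}"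
    and "\<And>n j k. n \<ge> 1 \<Longrightarrow> j < p n \<Longrightarrow> k < p n \<Longrightarrow>
           distr M borel (zt n j) = distr M borel (zt n k)"
    and "\<And>n j. n \<ge> 1 \<Longrightarrow> j < p n \<Longrightarrow>
           integrable M (zt n j) \<and> (\<integral>\<omega>. zt n j \<omega> \<partial>M) = 0 \<and>
           integrable M (\<lambda>\<omega>. (zt n j \<omega>)\<^sup>2) \<and> (\<integral>\<omega>. (zt n j \<omega>)\<^sup>2 \<partial>M) = 1 \<and>
           integrable M (\<lambda>\<omega>. \<bar>zt n j \<omega>\<bar> powr (4 + \<delta>))"
    \<comment> \<open>noise: i.i.d. for each n\<close>
    and "\<And>n. n \<ge> 1 \<Longrightarrow> prob_space.indep_vars M (\<lambda>_. borel) (\<epsilon> n) {..<n}"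
    and "\<And>n i k. n \<ge> 1 \<Longrightarrow> i < n \<Longrightarrow> k < n \<Longrightarrow>
           distr M borel (\<epsilon> n i) = distr M borel (\<epsilon> n k)"
    and "\<And>n i. n \<ge> 1 \<Longrightarrow> i < n \<Longrightarrow>
           integrable M (\<epsilon> n i) \<and> (\<integral>\<omega>. \<epsilon> n i \<omega> \<partial>M) = 0 \<and>
           integrable M (\<lambda>\<omega>. (\<epsilon> n i \<omega>)\<^sup>2) \<and> (\<integral>\<omega>. (\<epsilon> n i \<omega>)\<^sup>2 \<partial>M) = \<sigma>\<^sup>2"
    and "\<And>n. n \<ge> 1 \<Longrightarrow>
           integrable M (\<epsilon>t n) \<and> (\<integral>\<omega>. \<epsilon>t n \<omega> \<partial>M) = 0 \<and>
           integrable M (\<lambda>\<omega>. (\<epsilon>t n \<omega>)\<^sup>2) \<and> (\<integral>\<omega>. (\<epsilon>t n \<omega>)\<^sup>2 \<partial>M) = \<sigma>\<^sup>2"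
    \<comment> \<open>random coefficients\<close>
    and "\<And>n j. n \<ge> 1 \<Longrightarrow> j < p n \<Longrightarrow> integrable M (\<beta> n j) \<and> (\<integral>\<omega>. \<beta> n j \<omega> \<partial>M) = 0"
    and "\<And>n j k. n \<ge> 1 \<Longrightarrow> j < p n \<Longrightarrow> k < p n \<Longrightarrow>
           integrable M (\<lambda>\<omega>. \<beta> n j \<omega> * \<beta> n k \<omega>) \<and>
           (\<integral>\<omega>. \<beta> n j \<omega> * \<beta> n k \<omega> \<partial>M) = (if j = k then \<alpha>\<^sup>2 / real (p n) else 0)"
    \<comment> \<open>bounded variance profiles\<close>
    and "gmax > 0"
    and "\<And>n i j. n \<ge> 1 \<Longrightarrow> i < n \<Longrightarrow> j < p n \<Longrightarrow> \<bar>\<gamma> n i j\<bar> < gmax \<and> \<bar>\<gamma>t n j\<bar> < gmax"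
  shows "AE \<omega> in M.
      (\<lambda>n. \<bar>cond_test_risk M lam n (p n) (X n) (Y n) (xt n) (yt n) \<omega>
             - det_test_risk lam \<sigma> \<alpha> n (p n) (\<gamma> n) (\<gamma>t n)\<bar>) \<longlonglongrightarrow> 0 \<and>
      (\<lambda>n. \<bar>cond_train_risk M lam n (p n) (X n) (Y n) \<omega>
             - det_train_risk lam \<sigma> \<alpha> n (p n) (\<gamma> n)\<bar>) \<longlonglongrightarrow> 0"
proof -
  note sigma = assms(4) and lam = assms(7) and X = assms(8) and \<beta>v = assms(9) and \<epsilon>v = assms(10) and Y = assms(11)
    and xt = assms(12) and yt = assms(13) and sources = assms(14) and Z_ind = assms(15) and Z_law = assms(16)
    and Z = assms(17) and zt_ind = assms(18) and zt = assms(20) and \<epsilon>_ind = assms(21) and \<epsilon> = assms(23)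
    and \<epsilon>t = assms(24) and \<beta>1 = assms(25) and \<beta>2 = assms(26) and gmax = assms(28)
  interpret prob_space M by fact
  \<comment> \<open>The law \<open>\<nu>\<close> is common to all entries and all \<open>n\<close>,
    so a single constant bounds the fourth moments of the whole sequence.\<close>
  define m4 where "m4 = (\<integral>z. z ^ 4 \<partial>\<nu>)"
  have Z4: "integrable M (\<lambda>\<omega>. (Z n i j \<omega>) ^ 4) \<and> expectation (\<lambda>\<omega>. (Z n i j \<omega>) ^ 4) = m4"
    if ij: "n \<ge> 1" "i < n" "j < p n" for n i j
  proof
    have m: "Z n i j \<in> borel_measurable M" using Z[OF ij] by (auto intro: borel_measurable_integrable)
    show "integrable M (\<lambda>\<omega>. (Z n i j \<omega>) ^ 4)"
    proof (rule Bochner_Integration.integrable_bound[of _ "\<lambda>\<omega>. 1 + \<bar>Z n i j \<omega>\<bar> powr (4 + \<delta>)"])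
      show "integrable M (\<lambda>\<omega>. 1 + \<bar>Z n i j \<omega>\<bar> powr (4 + \<delta>))" using Z[OF ij] by simp
      show "AE \<omega> in M. norm ((Z n i j \<omega>) ^ 4) \<le> norm (1 + \<bar>Z n i j \<omega>\<bar> powr (4 + \<delta>))"
        using power4_le_one_plus_powr[OF \<open>\<delta> > 0\<close>] by (auto intro!: AE_I2)
    qed (use m in simp)
    show "expectation (\<lambda>\<omega>. (Z n i j \<omega>) ^ 4) = m4"
      unfolding m4_def Z_law[OF ij, symmetric] by (rule integral_distr[symmetric, OF m]) simp
  qed
  interpret S: random_matrix_sequence M p c \<gamma> gmax m4 Z
  proof (intro random_matrix_sequence.intro random_matrix_sequence_axioms.intro prob_space_axioms)
    fix n :: nat assume n: "n \<ge> 1" "p n \<ge> 1"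
    show "random_matrix M (\<lambda>(i, j). Z n i j) n (p n) (\<gamma> n) gmax m4"
    proof (intro random_matrix.intro random_matrix_axioms.intro prob_space_axioms)
      show "\<bar>\<gamma> n i j\<bar> \<le> gmax" if "i < n" "j < p n" for i j using gmax[OF n(1) that] by linarith
    qed (use n Z[OF n(1)] Z4[OF n(1)] Z_ind[OF n(1)] \<open>gmax > 0\<close> in simp_all)
  qed fact+
  have model: "ridge_model M n (p n) (\<gamma> n) (\<gamma>t n) (Z n) (zt n) (\<beta> n) (\<epsilon> n) (\<epsilon>t n) \<sigma> \<alpha> lam" if n: "n \<ge> 1" for n
  proof (intro ridge_model.intro ridge_model_axioms.intro)
    show "indep_sources M n (p n) (\<lambda>\<omega>. Matrix.vec (p n) (\<lambda>j. \<beta> n j \<omega>)) (design_matrix n (p n) (\<gamma> n) (Z n))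
      (\<lambda>\<omega>. Matrix.vec n (\<lambda>i. \<epsilon> n i \<omega>)) (test_point (p n) (\<gamma>t n) (zt n)) (\<epsilon>t n)"
      using sources[OF n] unfolding X[abs_def] \<beta>v[abs_def] \<epsilon>v[abs_def] xt[abs_def] .
    fix j assume j: "j < p n"
    show "integrable M (zt n j) \<and> expectation (zt n j) = 0 \<and>
      integrable M (\<lambda>\<omega>. (zt n j \<omega>)\<^sup>2) \<and> expectation (\<lambda>\<omega>. (zt n j \<omega>)\<^sup>2) = 1"
      using zt[OF n j] by simp
  qed (rule prob_space_axioms n lam zt_ind[OF n] \<epsilon>_ind[OF n] \<epsilon>[OF n] \<epsilon>t[OF n] \<beta>1[OF n] \<beta>2[OF n]; assumption)+
  \<comment> \<open>Each conditional expectation is determined up to a null set that depends on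
    \<open>n\<close>; the countable union of these sets is still null.\<close>
  have test: "AE \<omega> in M. \<forall>n. n \<ge> 1 \<longrightarrow> cond_test_risk M lam n (p n) (X n) (Y n) (xt n) (yt n) \<omega>
      = \<sigma>\<^sup>2 + (\<Sum>j<p n. (\<gamma>t n j)\<^sup>2 * (\<alpha>\<^sup>2 / p n * lam\<^sup>2 * (\<Sum>k<p n. (S.Q n lam \<omega> k j)\<^sup>2)
        + \<sigma>\<^sup>2 / n * (S.Q n lam \<omega> j j - lam * (\<Sum>k<p n. (S.Q n lam \<omega> k j)\<^sup>2))))"
    unfolding AE_all_countable
  proof
    fix n show "AE \<omega> in M. n \<ge> 1 \<longrightarrow> cond_test_risk M lam n (p n) (X n) (Y n) (xt n) (yt n) \<omega>
      = \<sigma>\<^sup>2 + (\<Sum>j<p n. (\<gamma>t n j)\<^sup>2 * (\<alpha>\<^sup>2 / p n * lam\<^sup>2 * (\<Sum>k<p n. (S.Q n lam \<omega> k j)\<^sup>2)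
        + \<sigma>\<^sup>2 / n * (S.Q n lam \<omega> j j - lam * (\<Sum>k<p n. (S.Q n lam \<omega> k j)\<^sup>2))))"
    proof (cases "n \<ge> 1")
      case True
      note m = model[OF True]
      have "X n = design_matrix n (p n) (\<gamma> n) (Z n)" "xt n = test_point (p n) (\<gamma>t n) (zt n)"
        "yt n = (\<lambda>\<omega>. test_point (p n) (\<gamma>t n) (zt n) \<omega> \<bullet> Matrix.vec (p n) (\<lambda>j. \<beta> n j \<omega>) + \<epsilon>t n \<omega>)"
        "Y n = ridge_model.Y n (p n) (\<gamma> n) (Z n) (\<beta> n) (\<epsilon> n)"
        "ridge_model.Q n (p n) (\<gamma> n) (Z n) lam = S.Q n lam"
        by (intro ext; simp only: X xt yt \<beta>v Y \<epsilon>v ridge_model.Y_def[OF m] ridge_model.Q_def[OF m] ridge_model.X_def[OF m, abs_def] S.Q_def S.X_def[abs_def])+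
      then show ?thesis using ridge_model.cond_test_risk_formula[OF m] by simp
    qed simp
  qed
  have train: "AE \<omega> in M. \<forall>n. n \<ge> 1 \<longrightarrow> cond_train_risk M lam n (p n) (X n) (Y n) \<omega>
      = lam\<^sup>2 * \<alpha>\<^sup>2 / p n * (\<Sum>i<n. S.Qt n lam \<omega> i i - lam * (\<Sum>l<n. (S.Qt n lam \<omega> l i)\<^sup>2))
      + lam\<^sup>2 * \<sigma>\<^sup>2 / n * (\<Sum>i<n. \<Sum>l<n. (S.Qt n lam \<omega> l i)\<^sup>2)"
    unfolding AE_all_countable
  proof
    fix n show "AE \<omega> in M. n \<ge> 1 \<longrightarrow> cond_train_risk M lam n (p n) (X n) (Y n) \<omega>
      = lam\<^sup>2 * \<alpha>\<^sup>2 / p n * (\<Sum>i<n. S.Qt n lam \<omega> i i - lam * (\<Sum>l<n. (S.Qt n lam \<omega> l i)\<^sup>2))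
      + lam\<^sup>2 * \<sigma>\<^sup>2 / n * (\<Sum>i<n. \<Sum>l<n. (S.Qt n lam \<omega> l i)\<^sup>2)"
    proof (cases "n \<ge> 1")
      case True
      note m = model[OF True]
      have "X n = design_matrix n (p n) (\<gamma> n) (Z n)" 
        "Y n = ridge_model.Y n (p n) (\<gamma> n) (Z n) (\<beta> n) (\<epsilon> n)"
        "ridge_model.Qt n (p n) (\<gamma> n) (Z n) lam = S.Qt n lam"
        by (intro ext; simp only: X \<beta>v Y \<epsilon>v ridge_model.Y_def[OF m] ridge_model.Qt_def[OF m] ridge_model.X_def[OF m] S.Qt_def S.X_def)+
      then show ?thesis using ridge_model.cond_train_risk_formula[OF m] by simp
    qed simp
  qed
  have w: "0 \<le> (\<gamma>t n j)\<^sup>2 \<and> (\<gamma>t n j)\<^sup>2 \<le> gmax\<^sup>2" if "n \<ge> 1" "j < p n" for n j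
  proof -
    \<comment> \<open>The hypothesis bounds \<open>\<gamma>t n j\<close> jointly with an entry of
      some row; row \<open>0\<close> exists because \<open>n \<ge> 1\<close>.\<close>
    have "\<bar>\<gamma>t n j\<bar> \<le> \<bar>gmax\<bar>" using gmax[OF that(1) _ that(2), of 0] that by auto
    then show ?thesis by (simp add: abs_le_square_iff)
  qed
  have split: "(\<Sum>j<m. d j * (a * s j + b * (q j - l * s j)))
      = a * (\<Sum>j<m. d j * s j) + b * ((\<Sum>j<m. d j * q j) - l * (\<Sum>j<m. d j * s j))"
    for m :: nat and a b l :: real and d s q :: "nat \<Rightarrow> real"
    by (simp add: sum.distrib sum_subtractf sum_distrib_left algebra_simps)
  have G: "gmax\<^sup>2 > 0" using \<open>gmax > 0\<close> by simp
  have rows: "AE \<omega> in M. (\<lambda>n. 1 / n * (\<Sum>j<p n. (\<gamma>t n j)\<^sup>2 * S.Q n lam \<omega> j j)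
      - 1 / n * (\<Sum>j<p n. (\<gamma>t n j)\<^sup>2 * T_real n (p n) (\<gamma> n) lam (Inl j))) \<longlonglongrightarrow> 0"
    by (rule S.weighted_trace_limit_rows[OF lam _ G]) (rule w)
  have rows': "AE \<omega> in M. (\<lambda>n. 1 / n * (\<Sum>j<p n. (\<gamma>t n j)\<^sup>2 * (\<Sum>k<p n. (S.Q n lam \<omega> k j)\<^sup>2))
      - 1 / n * (\<Sum>j<p n. (\<gamma>t n j)\<^sup>2 * S.T_deriv n lam (Inl j))) \<longlonglongrightarrow> 0"
    by (rule S.weighted_trace_limit_derivative[OF lam _ G]) (rule w)
  have "AE \<omega> in M. (\<lambda>n. cond_test_risk M lam n (p n) (X n) (Y n) (xt n) (yt n) \<omega>
             - det_test_risk lam \<sigma> \<alpha> n (p n) (\<gamma> n) (\<gamma>t n)) \<longlonglongrightarrow> 0"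
    using test rows rows'
  proof eventually_elim
    case (elim \<omega>)
    note f = elim(1)
    define u where "u n = 1 / n * (\<Sum>j<p n. (\<gamma>t n j)\<^sup>2 * S.Q n lam \<omega> j j)
      - 1 / n * (\<Sum>j<p n. (\<gamma>t n j)\<^sup>2 * T_real n (p n) (\<gamma> n) lam (Inl j))" for n
    define v where "v n = 1 / n * (\<Sum>j<p n. (\<gamma>t n j)\<^sup>2 * (\<Sum>k<p n. (S.Q n lam \<omega> k j)\<^sup>2))
      - 1 / n * (\<Sum>j<p n. (\<gamma>t n j)\<^sup>2 * S.T_deriv n lam (Inl j))" for n
    \<comment> \<open>The factor \<open>\<alpha>^2 / p n\<close> is written as
      \<open>\<alpha>^2 * (n / p n)\<close> times \<open>1 / n\<close>: the traces appear normalised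
      by \<open>n\<close>, and their coefficients converge because \<open>n / p n\<close> tends to
      \<open>1 / c\<close>.\<close>
    have "(\<lambda>n. \<sigma>\<^sup>2 * u n + lam * (lam * \<alpha>\<^sup>2 * (real n / p n) - \<sigma>\<^sup>2) * v n)
        \<longlonglongrightarrow> \<sigma>\<^sup>2 * 0 + lam * (lam * \<alpha>\<^sup>2 * (1 / c) - \<sigma>\<^sup>2) * 0"
      using elim(2,3) unfolding u_def[symmetric] v_def[symmetric]
      by (intro tendsto_add tendsto_mult tendsto_diff tendsto_const S.inverse_ratio)
    then have "(\<lambda>n. \<sigma>\<^sup>2 * u n + lam * (lam * \<alpha>\<^sup>2 * (real n / p n) - \<sigma>\<^sup>2) * v n) \<longlonglongrightarrow> 0" by simp
    then show ?case
    proof (rule Lim_transform_eventually)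
      show "eventually (\<lambda>n. \<sigma>\<^sup>2 * u n + lam * (lam * \<alpha>\<^sup>2 * (real n / p n) - \<sigma>\<^sup>2) * v n
        = cond_test_risk M lam n (p n) (X n) (Y n) (xt n) (yt n) \<omega>
             - det_test_risk lam \<sigma> \<alpha> n (p n) (\<gamma> n) (\<gamma>t n)) sequentially"
        using S.eventually_size
      proof eventually_elim
        case (elim n)
        define A B A' B' where "A = (\<Sum>j<p n. (\<gamma>t n j)\<^sup>2 * S.Q n lam \<omega> j j)"
          and "B = (\<Sum>j<p n. (\<gamma>t n j)\<^sup>2 * (\<Sum>k<p n. (S.Q n lam \<omega> k j)\<^sup>2))"
          and "A' = (\<Sum>j<p n. (\<gamma>t n j)\<^sup>2 * T_real n (p n) (\<gamma> n) lam (Inl j))"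
          and "B' = (\<Sum>j<p n. (\<gamma>t n j)\<^sup>2 * S.T_deriv n lam (Inl j))"
        have r: "cond_test_risk M lam n (p n) (X n) (Y n) (xt n) (yt n) \<omega>
          = \<sigma>\<^sup>2 + (\<Sum>j<p n. (\<gamma>t n j)\<^sup>2 * (\<alpha>\<^sup>2 / p n * lam\<^sup>2 * (\<Sum>k<p n. (S.Q n lam \<omega> k j)\<^sup>2)
        + \<sigma>\<^sup>2 / n * (S.Q n lam \<omega> j j - lam * (\<Sum>k<p n. (S.Q n lam \<omega> k j)\<^sup>2))))"
          using f elim by blast
        also have "\<dots> = \<sigma>\<^sup>2 + (\<alpha>\<^sup>2 / p n * lam\<^sup>2 * B + \<sigma>\<^sup>2 / n * (A - lam * B))"
          unfolding A_def B_def by (simp only: split)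
        finally have r: "cond_test_risk M lam n (p n) (X n) (Y n) (xt n) (yt n) \<omega> = \<dots>" .
        have "real n \<noteq> 0" "real (p n) \<noteq> 0" using elim by auto
        then show ?case
          unfolding r S.det_test_risk_eq u_def v_def A_def[symmetric] B_def[symmetric] A'_def[symmetric] B'_def[symmetric]
          by (simp add: field_simps power2_eq_square)
      qed
    qed
  qed
  moreover have "AE \<omega> in M. (\<lambda>n. cond_train_risk M lam n (p n) (X n) (Y n) \<omega>
             - det_train_risk lam \<sigma> \<alpha> n (p n) (\<gamma> n)) \<longlonglongrightarrow> 0"
    using train S.trace_limit_columns[OF lam] S.trace_limit_columns_derivative[OF lam]
  proof eventually_elim
    case (elim \<omega>)
    note f = elim(1)
    define u where "u n = 1 / n * (\<Sum>i<n. S.Qt n lam \<omega> i i)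
      - 1 / n * (\<Sum>i<n. T_real n (p n) (\<gamma> n) lam (Inr i))" for n
    define v where "v n = 1 / n * (\<Sum>i<n. \<Sum>l<n. (S.Qt n lam \<omega> l i)\<^sup>2)
      - 1 / n * (\<Sum>i<n. S.T_deriv n lam (Inr i))" for n
    have "(\<lambda>n. lam\<^sup>2 * \<alpha>\<^sup>2 * (real n / p n) * (u n - lam * v n) + lam\<^sup>2 * \<sigma>\<^sup>2 * v n)
        \<longlonglongrightarrow> lam\<^sup>2 * \<alpha>\<^sup>2 * (1 / c) * (0 - lam * 0) + lam\<^sup>2 * \<sigma>\<^sup>2 * 0"
      using elim(2,3) unfolding u_def[symmetric] v_def[symmetric]
      by (intro tendsto_add tendsto_mult tendsto_diff tendsto_const S.inverse_ratio)
    then have "(\<lambda>n. lam\<^sup>2 * \<alpha>\<^sup>2 * (real n / p n) * (u n - lam * v n) + lam\<^sup>2 * \<sigma>\<^sup>2 * v n) \<longlonglongrightarrow> 0" by simp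
    then show ?case
    proof (rule Lim_transform_eventually)
      show "eventually (\<lambda>n. lam\<^sup>2 * \<alpha>\<^sup>2 * (real n / p n) * (u n - lam * v n) + lam\<^sup>2 * \<sigma>\<^sup>2 * v n
        = cond_train_risk M lam n (p n) (X n) (Y n) \<omega> - det_train_risk lam \<sigma> \<alpha> n (p n) (\<gamma> n)) sequentially"
        using S.eventually_size
      proof eventually_elim
        case (elim n)
        define A B A' B' where "A = (\<Sum>i<n. S.Qt n lam \<omega> i i)" and "B = (\<Sum>i<n. \<Sum>l<n. (S.Qt n lam \<omega> l i)\<^sup>2)"
          and "A' = (\<Sum>i<n. T_real n (p n) (\<gamma> n) lam (Inr i))" and "B' = (\<Sum>i<n. S.T_deriv n lam (Inr i))"
        have r: "cond_train_risk M lam n (p n) (X n) (Y n) \<omega>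
          = lam\<^sup>2 * \<alpha>\<^sup>2 / p n * (A - lam * B) + lam\<^sup>2 * \<sigma>\<^sup>2 / n * B"
          using f elim unfolding A_def B_def by (simp add: sum_subtractf sum_distrib_left)
        have "real n \<noteq> 0" "real (p n) \<noteq> 0" using elim by auto
        then show ?case
          unfolding r S.det_train_risk_eq u_def v_def A_def[symmetric] B_def[symmetric] A'_def[symmetric] B'_def[symmetric]
          by (simp add: field_simps power2_eq_square)
      qed
    qed
  qed
  ultimately show ?thesis
    by eventually_elim (auto intro: tendsto_rabs_zero)
qed

end
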